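(* Let $N\ge 2$ and for $\theta_0\in\,]0,\pi/2]$ let $D_{Nd}(R,R')$ denote the relative equilibrium formed of $N$ vortices of vorticity $+1$ at co-latitude $\theta_0$ and longitudes $\frac{2\pi(j-1)}{N}$, and $N$ vortices of vorticity $-1$ at co-latitude $\pi-\theta_0$ and longitudes $\frac{2\pi(j-1)}{N}+\frac{\pi}{N}$, $j=1,\dots,N$. For $\theta_0=\pi/2$ it is the equatorial ring of $2N$ equally spaced vortices of alternating vorticities, denoted $D_{2Nh}(R_e)$, which is a fixed equilibrium. (1) $D_{2d}(R,R')$ relative equilibria are Lyapunov stable for $\theta_0\in[1.14,\pi/2]$ and linearly unstable on the complement of this interval in $]0,\pi/2]$. (2) $D_{3d}(R,R')$ relative equilibria are linearly stable for $\theta_0\in[1.302,1.315]$ and linearly unstable on the complement of this interval in $]0,\pi/2]$. At the upper bound of the interval a Hamiltonian-Hopf bifurcation occurs. (3) For $N\geq 4$, $D_{Nd}(R,R')$ relative equilibria are linearly unstable for all co-latitudes $\theta_0\in\,]0,\pi/2]$. (4) The equatorial fixed equilibria $D_{2Nh}(R_e)$ are linearly unstable for all $N\ge 3$, while $D_{4h}(R_e)$ (the case $N=2$) is Lyapunov stable.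
   Context: Vortices $x_1,\dots,x_M$ on the unit sphere $S^2\subset\mathbb{R}^3$ with vorticities $\lambda_1,\dots,\lambda_M$; phase space $\mathcal{P}=\{(x_1,\dots,x_M)\in (S^2)^M: x_i\ne x_j \text{ if } i\ne j\}$. Equations of motion: $\dot x_i=\sum_{j\ne i}\lambda_j\,\frac{x_j\times x_i}{1-x_i\cdot x_j}$. They are Hamiltonian with $H=\sum_{i<j}\lambda_i\lambda_j\ln\|x_i-x_j\|^2$ and symplectic form $\omega=\sum_i\lambda_i\sin\theta_i\,d\theta_i\wedge d\phi_i$ ($\theta_i$ co-latitude, $\phi_i$ longitude). The centre of vorticity $\Phi(x)=\sum_i\lambda_i x_i\in\mathbb{R}^3$ is conserved. $SO(3)$ acts diagonally on $\mathcal{P}$. $x_e\in\mathcal{P}$ is a relative equilibrium if for every $t$ the solution with $x_e(0)=x_e$ satisfies $x_e(t)=g_t\cdot x_e$ for some $g_t\in SO(3)$; equivalently, with $\mu=\Phi(x_e)$, there is $\xi\in\mathbb{R}^3$ (the angular velocity) such that $x_e$ is a critical point of $H_\xi(x)=H(x)+\langle\Phi(x)-\mu,\xi\rangle$. A fixed equilibrium is a critical point of $H$ ($\xi=0$). $SO(3)_\mu=\{g\in SO(3): g\mu=\mu\}$. Symplectic slice: $\mathcal{G}=T_{x_e}(SO(3)_\mu\cdot x_e)^{\perp}\cap\ker D\Phi(x_e)$. Linearized system in the slice: $L=(\Omega^\flat_{\mathcal{G}})^{-1}d^2H_\xi|_{\mathcal{G}}(x_e)$, where $\Omega^\flat_{\mathcal{G}}$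 is the matrix of $\omega|_{\mathcal{G}}$. "Lyapunov stable" means Lyapunov stable modulo $SO(3)_\mu$: for every $SO(3)_\mu$-invariant open neighbourhood $V$ of $SO(3)_\mu\cdot x_e$ there is an open neighbourhood $U\subseteq V$ of $x_e$ which is invariant under the Hamiltonian evolution. "Linearly unstable": $L$ has an eigenvalue with non-zero real part. "Linearly stable": all eigenvalues of $L$ have zero real part and, in addition, $d^2H_\xi|_{\mathcal{G}}(x_e)$ is not definite (neither positive nor negative definite). Hamiltonian-Hopf bifurcation: as the parameter $\theta_0$ crosses the value, two pairs of non-zero purely imaginary eigenvalues of $L$ collide on the imaginary axis and leave it.
   Formalization: The bounds 1.14, 1.302, 1.315 are read as rounded values of exact thresholds (taken literally the claims fail, e.g. at 1.14 and 1.302), and for N=2 the threshold co-latitude itself is excluded from the Lyapunov stable interval, where stability fails. *)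

theory Defs
  imports "HOL-Analysis.Analysis"
begin

text \<open>A configuration of point vortices is \<open>x :: real^3^'m\<close>, where the finite type \<open>'m\<close>
  indexes the vortices; \<open>\<Gamma> i\<close> is the vorticity of vortex \<open>i\<close>.\<close>

subsection \<open>The point vortex system on the sphere\<close>

definition phase_space :: "(real^3^'m::finite) set" where
  "phase_space = {x. (\<forall>i. norm (x $ i) = 1) \<and> (\<forall>i j. i \<noteq> j \<longrightarrow> x $ i \<noteq> x $ j)}"

definition vortex_field :: "('m::finite \<Rightarrow> real) \<Rightarrow> real^3^'m \<Rightarrow> real^3^'m" where
  "vortex_field \<Gamma> x =
     (\<chi> i. \<Sum>j\<in>UNIV - {i}. (\<Gamma> j / (1 - x $ i \<bullet> x $ j)) *\<^sub>R cross3 (x $ j) (x $ i))"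

definition solution_on :: "('m::finite \<Rightarrow> real) \<Rightarrow> real set \<Rightarrow> (real \<Rightarrow> real^3^'m) \<Rightarrow> bool" where
  "solution_on \<Gamma> I u \<longleftrightarrow>
     (\<forall>t\<in>I. u t \<in> phase_space \<and> (u has_vector_derivative vortex_field \<Gamma> (u t)) (at t within I))"

text \<open>The index type carries no order, so the sum over \<open>i < j\<close> is half the sum over ordered
  pairs of distinct indices.\<close>

definition hamiltonian :: "('m::finite \<Rightarrow> real) \<Rightarrow> real^3^'m \<Rightarrow> real" where
  "hamiltonian \<Gamma> x =
     (\<Sum>i\<in>UNIV. \<Sum>j\<in>UNIV - {i}. \<Gamma> i * \<Gamma> j * ln ((norm (x $ i - x $ j))\<^sup>2)) / 2"

definition centre_of_vorticity :: "('m::finite \<Rightarrow> real) \<Rightarrow> real^3^'m \<Rightarrow> real^3" where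
  "centre_of_vorticity \<Gamma> x = (\<Sum>i\<in>UNIV. \<Gamma> i *\<^sub>R x $ i)"

definition augmented_hamiltonian ::
    "('m::finite \<Rightarrow> real) \<Rightarrow> real^3 \<Rightarrow> real^3 \<Rightarrow> real^3^'m \<Rightarrow> real" where
  "augmented_hamiltonian \<Gamma> \<mu> \<xi> x = hamiltonian \<Gamma> x + (centre_of_vorticity \<Gamma> x - \<mu>) \<bullet> \<xi>"

definition tangent_space :: "real^3^'m::finite \<Rightarrow> (real^3^'m) set" where
  "tangent_space x = {v. \<forall>i. v $ i \<bullet> x $ i = 0}"

text \<open>\<open>sin \<theta> d\<theta> \<and> d\<phi>\<close> is the area form \<open>(v, w) \<mapsto> x \<bullet> (v \<times> w)\<close> of the unit sphere, which also makes
  sense at the poles; see \<open>area_form_spherical\<close> below.\<close>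

definition symplectic_form ::
    "('m::finite \<Rightarrow> real) \<Rightarrow> real^3^'m \<Rightarrow> real^3^'m \<Rightarrow> real^3^'m \<Rightarrow> real" where
  "symplectic_form \<Gamma> x v w = (\<Sum>i\<in>UNIV. \<Gamma> i * (x $ i \<bullet> cross3 (v $ i) (w $ i)))"

definition sphere_point :: "real \<Rightarrow> real \<Rightarrow> real^3" where
  "sphere_point \<theta> \<phi> = vector [sin \<theta> * cos \<phi>, sin \<theta> * sin \<phi>, cos \<theta>]"

lemma area_form_spherical:
  fixes a b c d \<theta> \<phi> :: real
  defines "e\<^sub>1 \<equiv> vector [cos \<theta> * cos \<phi>, cos \<theta> * sin \<phi>, - sin \<theta>] :: real^3"
    and "e\<^sub>2 \<equiv> vector [- sin \<theta> * sin \<phi>, sin \<theta> * cos \<phi>, 0] :: real^3"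
  shows "((\<lambda>t. sphere_point t \<phi>) has_vector_derivative e\<^sub>1) (at \<theta>)"
    and "((\<lambda>t. sphere_point \<theta> t) has_vector_derivative e\<^sub>2) (at \<phi>)"
    and "sphere_point \<theta> \<phi> \<bullet> cross3 (a *\<^sub>R e\<^sub>1 + b *\<^sub>R e\<^sub>2) (c *\<^sub>R e\<^sub>1 + d *\<^sub>R e\<^sub>2)
          = sin \<theta> * (a * d - b * c)"
proof -
  have e1: "e\<^sub>1 = (cos \<theta> * cos \<phi>) *\<^sub>R axis 1 1 + (cos \<theta> * sin \<phi>) *\<^sub>R axis 2 1 + (- sin \<theta>) *\<^sub>R axis 3 1"
    and e2: "e\<^sub>2 = (- sin \<theta> * sin \<phi>) *\<^sub>R axis 1 1 + (sin \<theta> * cos \<phi>) *\<^sub>R axis 2 1"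
    by (simp_all add: e\<^sub>1_def e\<^sub>2_def vec_eq_iff forall_3 axis_def)
  have sp: "sphere_point \<theta> \<phi> =
      (sin \<theta> * cos \<phi>) *\<^sub>R axis 1 1 + (sin \<theta> * sin \<phi>) *\<^sub>R axis 2 1 + cos \<theta> *\<^sub>R axis 3 1" for \<theta> \<phi>
    by (simp add: sphere_point_def vec_eq_iff forall_3 axis_def)
  show "((\<lambda>t. sphere_point t \<phi>) has_vector_derivative e\<^sub>1) (at \<theta>)"
    unfolding sp e1 has_vector_derivative_def
    by (auto intro!: derivative_eq_intros simp: algebra_simps)
  show "((\<lambda>t. sphere_point \<theta> t) has_vector_derivative e\<^sub>2) (at \<phi>)"
    unfolding sp e2 has_vector_derivative_def
    by (auto intro!: derivative_eq_intros simp: algebra_simps)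
  have "vector [s * p, s * q, c'] \<bullet>
      cross3 (a *\<^sub>R vector [c' * p, c' * q, - s] + b *\<^sub>R vector [- s * q, s * p, 0])
             (c *\<^sub>R vector [c' * p, c' * q, - s] + d *\<^sub>R (vector [- s * q, s * p, 0] :: real^3))
      = s * (a * d - b * c) * (s\<^sup>2 + c'\<^sup>2) * (q\<^sup>2 + p\<^sup>2)" for s c' p q :: real
    by (simp add: cross3_def inner_vec_def sum_3)
       (simp add: algebra_simps power2_eq_square)
  from this[of "sin \<theta>" "cos \<phi>" "sin \<phi>" "cos \<theta>"]
  show "sphere_point \<theta> \<phi> \<bullet> cross3 (a *\<^sub>R e\<^sub>1 + b *\<^sub>R e\<^sub>2) (c *\<^sub>R e\<^sub>1 + d *\<^sub>R e\<^sub>2)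
          = sin \<theta> * (a * d - b * c)"
    by (simp add: sphere_point_def e\<^sub>1_def e\<^sub>2_def)
qed

subsection \<open>Critical points and Hessians on the phase space\<close>

text \<open>The map \<open>v \<mapsto> to_spheres (x + v)\<close> on \<open>tangent_space x\<close> is a local parametrization of the phase
  space around \<open>x\<close> (at \<open>v = 0\<close>), whose derivative at \<open>0\<close> is the identity.  Derivatives of
  functions on the phase space are taken in this chart.  The Hessian of a function at a critical
  point does not depend on the chart; \<open>hessian\<close> is only used at critical points.\<close>

definition to_spheres :: "real^3^'m::finite \<Rightarrow> real^3^'m" where
  "to_spheres y = (\<chi> i. y $ i /\<^sub>R norm (y $ i))"

definition critical_point :: "(real^3^'m::finite \<Rightarrow> real) \<Rightarrow> real^3^'m \<Rightarrow> bool" where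
  "critical_point f x \<longleftrightarrow> x \<in> phase_space \<and>
     (\<forall>v\<in>tangent_space x. ((\<lambda>t. f (to_spheres (x + t *\<^sub>R v))) has_real_derivative 0) (at 0))"

definition hessian ::
    "(real^3^'m::finite \<Rightarrow> real) \<Rightarrow> real^3^'m \<Rightarrow> real^3^'m \<Rightarrow> real^3^'m \<Rightarrow> real" where
  "hessian f x v w =
     deriv (\<lambda>s. deriv (\<lambda>t. f (to_spheres (x + s *\<^sub>R v + t *\<^sub>R w))) 0) 0"

subsection \<open>Relative equilibria\<close>

definition SO3 :: "(real^3^3) set" where
  "SO3 = {g. rotation_matrix g}"

definition rotate :: "real^3^3 \<Rightarrow> real^3^'m::finite \<Rightarrow> real^3^'m" where
  "rotate g x = (\<chi> i. g *v x $ i)"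

definition isotropy_group :: "real^3 \<Rightarrow> (real^3^3) set" where
  "isotropy_group \<mu> = {g \<in> SO3. g *v \<mu> = \<mu>}"

definition relative_equilibrium :: "('m::finite \<Rightarrow> real) \<Rightarrow> real^3^'m \<Rightarrow> bool" where
  "relative_equilibrium \<Gamma> x \<longleftrightarrow>
     (\<exists>u. solution_on \<Gamma> UNIV u \<and> u 0 = x \<and> (\<forall>t. \<exists>g\<in>SO3. u t = rotate g x))"

definition angular_velocity :: "('m::finite \<Rightarrow> real) \<Rightarrow> real^3^'m \<Rightarrow> real^3 \<Rightarrow> bool" where
  "angular_velocity \<Gamma> x \<xi> \<longleftrightarrow>
     critical_point (augmented_hamiltonian \<Gamma> (centre_of_vorticity \<Gamma> x) \<xi>) x"

definition fixed_equilibrium :: "('m::finite \<Rightarrow> real) \<Rightarrow> real^3^'m \<Rightarrow> bool" where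
  "fixed_equilibrium \<Gamma> x \<longleftrightarrow> critical_point (hamiltonian \<Gamma>) x"

subsection \<open>Lyapunov stability modulo the isotropy group of the momentum\<close>

text \<open>Solutions with vorticities of both signs need not exist for all times, hence invariance is
  stated for solutions on arbitrary intervals containing \<open>0\<close>.\<close>

definition flow_invariant :: "('m::finite \<Rightarrow> real) \<Rightarrow> (real^3^'m) set \<Rightarrow> bool" where
  "flow_invariant \<Gamma> U \<longleftrightarrow>
     (\<forall>I u. is_interval I \<and> 0 \<in> I \<and> solution_on \<Gamma> I u \<and> u 0 \<in> U \<longrightarrow> (\<forall>t\<in>I. u t \<in> U))"

definition lyapunov_stable :: "('m::finite \<Rightarrow> real) \<Rightarrow> real^3^'m \<Rightarrow> bool" where
  "lyapunov_stable \<Gamma> x \<longleftrightarrow> (let K = isotropy_group (centre_of_vorticity \<Gamma> x) in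
     \<forall>V. openin (top_of_set phase_space) V \<and> (\<forall>g\<in>K. rotate g ` V \<subseteq> V) \<and> (\<lambda>g. rotate g x) ` K \<subseteq> V \<longrightarrow>
       (\<exists>U. openin (top_of_set phase_space) U \<and> x \<in> U \<and> U \<subseteq> V \<and> flow_invariant \<Gamma> U))"

subsection \<open>The symplectic slice and the linearized system\<close>

text \<open>Identifying the Lie algebra of \<open>SO3\<close> with \<open>real^3\<close> through the cross product, the Lie algebra
  of the isotropy group of \<open>\<mu>\<close> is \<open>{\<zeta>. \<zeta> \<times> \<mu> = 0}\<close>; it acts by infinitesimal rotations.\<close>

definition orbit_tangent_space :: "real^3 \<Rightarrow> real^3^'m::finite \<Rightarrow> (real^3^'m) set" where
  "orbit_tangent_space \<mu> x = {(\<chi> i. cross3 \<zeta> (x $ i)) | \<zeta>. cross3 \<zeta> \<mu> = 0}"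

text \<open>The centre of vorticity is linear in \<open>x\<close>, so it is its own derivative.  The orthogonal
  complement is the one in the metric of the product of spheres, i.e. in the inner product of
  the ambient space.\<close>

definition symplectic_slice :: "('m::finite \<Rightarrow> real) \<Rightarrow> real^3^'m \<Rightarrow> (real^3^'m) set" where
  "symplectic_slice \<Gamma> x =
     tangent_space x \<inter> (orbit_tangent_space (centre_of_vorticity \<Gamma> x) x)\<^sup>\<bottom> \<inter>
     {v. centre_of_vorticity \<Gamma> v = 0}"

definition slice_hessian ::
    "('m::finite \<Rightarrow> real) \<Rightarrow> real^3^'m \<Rightarrow> real^3 \<Rightarrow> real^3^'m \<Rightarrow> real^3^'m \<Rightarrow> real" where
  "slice_hessian \<Gamma> x \<xi> = hessian (augmented_hamiltonian \<Gamma> (centre_of_vorticity \<Gamma> x) \<xi>) x"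

text \<open>The operator \<open>L\<close>: applying the inverse of the flat map \<open>u \<mapsto> \<omega>(u, \<cdot>)\<close> of the slice to the
  functional \<open>d\<^sup>2H\<^sub>\<xi>(v, \<cdot>)\<close>.\<close>

definition slice_linearization ::
    "('m::finite \<Rightarrow> real) \<Rightarrow> real^3^'m \<Rightarrow> real^3 \<Rightarrow> real^3^'m \<Rightarrow> real^3^'m" where
  "slice_linearization \<Gamma> x \<xi> v =
     (THE u. u \<in> symplectic_slice \<Gamma> x \<and>
        (\<forall>w\<in>symplectic_slice \<Gamma> x. symplectic_form \<Gamma> x u w = slice_hessian \<Gamma> x \<xi> v w))"

text \<open>Complex eigenvalues of a real operator: \<open>v + \<i> w\<close> is an eigenvector of the complexification,
  with the equation \<open>L (v + \<i> w) = \<sigma> (v + \<i> w)\<close> split into real and imaginary parts.\<close>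

definition complex_eigenvalues :: "('a::real_vector \<Rightarrow> 'a) \<Rightarrow> 'a set \<Rightarrow> complex set" where
  "complex_eigenvalues L S = {\<sigma>. \<exists>v\<in>S. \<exists>w\<in>S. (v \<noteq> 0 \<or> w \<noteq> 0) \<and>
     L v = Re \<sigma> *\<^sub>R v - Im \<sigma> *\<^sub>R w \<and> L w = Im \<sigma> *\<^sub>R v + Re \<sigma> *\<^sub>R w}"

definition slice_eigenvalues :: "('m::finite \<Rightarrow> real) \<Rightarrow> real^3^'m \<Rightarrow> real^3 \<Rightarrow> complex set" where
  "slice_eigenvalues \<Gamma> x \<xi> = complex_eigenvalues (slice_linearization \<Gamma> x \<xi>) (symplectic_slice \<Gamma> x)"

definition definite_on :: "'a::real_vector set \<Rightarrow> ('a \<Rightarrow> 'a \<Rightarrow> real) \<Rightarrow> bool" where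
  "definite_on S B \<longleftrightarrow> (\<forall>v\<in>S - {0}. B v v > 0) \<or> (\<forall>v\<in>S - {0}. B v v < 0)"

definition linearly_unstable :: "('m::finite \<Rightarrow> real) \<Rightarrow> real^3^'m \<Rightarrow> bool" where
  "linearly_unstable \<Gamma> x \<longleftrightarrow>
     (\<exists>\<xi>. angular_velocity \<Gamma> x \<xi> \<and> (\<exists>\<sigma>\<in>slice_eigenvalues \<Gamma> x \<xi>. Re \<sigma> \<noteq> 0))"

definition linearly_stable :: "('m::finite \<Rightarrow> real) \<Rightarrow> real^3^'m \<Rightarrow> bool" where
  "linearly_stable \<Gamma> x \<longleftrightarrow>
     (\<exists>\<xi>. angular_velocity \<Gamma> x \<xi> \<and> (\<forall>\<sigma>\<in>slice_eigenvalues \<Gamma> x \<xi>. Re \<sigma> = 0) \<and>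
        \<not> definite_on (symplectic_slice \<Gamma> x) (slice_hessian \<Gamma> x \<xi>))"

subsection \<open>Hamiltonian-Hopf bifurcation\<close>

text \<open>For a one-parameter family \<open>X\<close> of relative equilibria of the system with vorticities \<open>\<Gamma>\<close>:
  the eigenvalues near \<open>\<plusminus>\<i>\<omega>\<close> are two pairs \<open>\<plusminus>\<sigma>\<^sub>1\<close>, \<open>\<plusminus>\<sigma>\<^sub>2\<close>, continuous in the parameter, which are
  distinct and purely imaginary before \<open>p\<close>, coincide with \<open>\<plusminus>\<i>\<omega> \<noteq> 0\<close> at \<open>p\<close> and are off the
  imaginary axis after \<open>p\<close>.\<close>

definition hamiltonian_hopf_bifurcation ::
    "('m::finite \<Rightarrow> real) \<Rightarrow> (real \<Rightarrow> real^3^'m) \<Rightarrow> real \<Rightarrow> bool" where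
  "hamiltonian_hopf_bifurcation \<Gamma> X p \<longleftrightarrow>
     (\<exists>\<omega> r \<delta> \<xi> \<sigma>\<^sub>1 \<sigma>\<^sub>2. \<omega> > 0 \<and> r > 0 \<and> \<delta> > 0 \<and>
        continuous_on {p - \<delta><..<p + \<delta>} \<sigma>\<^sub>1 \<and> continuous_on {p - \<delta><..<p + \<delta>} \<sigma>\<^sub>2 \<and>
        (\<forall>q\<in>{p - \<delta><..<p + \<delta>}. angular_velocity \<Gamma> (X q) (\<xi> q) \<and>
           slice_eigenvalues \<Gamma> (X q) (\<xi> q) \<inter> (ball (\<i> * of_real \<omega>) r \<union> ball (- \<i> * of_real \<omega>) r)
             = {\<sigma>\<^sub>1 q, - \<sigma>\<^sub>1 q, \<sigma>\<^sub>2 q, - \<sigma>\<^sub>2 q}) \<and>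
        (\<forall>q\<in>{p - \<delta><..<p}. Re (\<sigma>\<^sub>1 q) = 0 \<and> Re (\<sigma>\<^sub>2 q) = 0 \<and>
           \<sigma>\<^sub>1 q \<noteq> \<sigma>\<^sub>2 q \<and> \<sigma>\<^sub>1 q \<noteq> - \<sigma>\<^sub>2 q) \<and>
        \<sigma>\<^sub>1 p = \<i> * of_real \<omega> \<and> \<sigma>\<^sub>2 p = \<i> * of_real \<omega> \<and>
        (\<forall>q\<in>{p<..<p + \<delta>}. Re (\<sigma>\<^sub>1 q) \<noteq> 0 \<and> Re (\<sigma>\<^sub>2 q) \<noteq> 0 \<and>
           \<sigma>\<^sub>1 q \<noteq> \<sigma>\<^sub>2 q \<and> \<sigma>\<^sub>1 q \<noteq> - \<sigma>\<^sub>2 q))"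

subsection \<open>Two staggered rings of opposite vorticities\<close>

text \<open>\<open>2N\<close> vortices, \<open>N = CARD('n)\<close>, indexed by \<open>'n + 'n\<close> (first ring \<open>Inl\<close>, second ring \<open>Inr\<close>); \<open>\<iota>\<close>
  numbers the vortices of each ring by \<open>1, \<dots>, N\<close>.\<close>

definition DNd_vorticity :: "'n::finite + 'n \<Rightarrow> real" where
  "DNd_vorticity = case_sum (\<lambda>_. 1) (\<lambda>_. - 1)"

definition DNd :: "('n::finite \<Rightarrow> nat) \<Rightarrow> real \<Rightarrow> real^3^('n + 'n)" where
  "DNd \<iota> \<theta> = (\<chi> k. case k of
      Inl a \<Rightarrow> sphere_point \<theta> (2 * pi * (real (\<iota> a) - 1) / real CARD('n))
    | Inr a \<Rightarrow> sphere_point (pi - \<theta>) (2 * pi * (real (\<iota> a) - 1) / real CARD('n) + pi / real CARD('n)))"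

end

theory Submission
  imports Defs
begin

text \<open>All four parts follow from the spectrum of the linearized flow, except Lyapunov stability, which
follows from an inequality for the energy.

Write \<open>c\<close> and \<open>s\<close> for the cosine and sine of the co-latitude. At each vortex there is an orthonormal
frame consisting of the position, a meridional vector \<open>E\<close> and a longitudinal vector \<open>F\<close>. A rotation by \<open>\<pi> / N\<close> composed with the
reflection in the equatorial plane permutes the \<open>2N\<close> vortices cyclically and reverses the vorticities, so
displacements whose \<open>E\<close> and \<open>F\<close> coefficients are waves of wave number \<open>k\<close> in the longitude form an
invariant space. On it the Hessian has a meridional coefficient \<open>P k\<close>, a longitudinal coefficient
\<open>- R k\<close> and a coupling \<open>\<beta> k\<close> (\<open>mode_operator\<close>), and the eigenvalues of the
linearized flow are \<open>\<tau> \<plusminus> \<i> \<beta> k\<close> with \<open>\<tau>\<^sup>2 = P k * R k / s^4\<close> (\<open>mode_eigenvalue\<close>). The symplectic slice contains all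
waves with \<open>1 \<le> k \<le> N\<close> and \<open>k \<noteq> N - 1\<close>, so \<open>P k * R k > 0\<close> for one such \<open>k\<close> proves linear instability
(\<open>linearly_unstable_mode\<close>). The sums over vortices in \<open>P\<close> and \<open>R\<close> are evaluated by differentiating a
Poisson kernel summed over the vertices of the opposite ring (\<open>odd_kernel_sum_closed\<close>).

For \<open>k = N\<close> the product has the sign of \<open>- \<epsilon>\<close>, where \<open>\<epsilon> = P N\<close> is elementary. If \<open>\<epsilon> < 0\<close> the rings are
unstable. If \<open>N \<ge> 4\<close> and \<open>\<epsilon> \<ge> 0\<close>, then \<open>c\<close> is so small that both \<open>P k\<close> and \<open>R k\<close> are negative for
\<open>k = \<lfloor>N / 2\<rfloor>\<close> (\<open>linearly_unstable_ge_4\<close>).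

For \<open>N = 2\<close> the condition \<open>\<epsilon> > 0\<close> already gives Lyapunov stability. On the configurations with the same
centre of vorticity the energy is bounded below by a function of the length of the sum of
the four positions, by Cauchy-Schwarz and the inequality between arithmetic and geometric means. The
condition makes this function larger than at zero for all small nonzero lengths, and the equality cases near the rings are their images
under the isotropy group (\<open>lyapunov_stable_2\<close>). An invariant neighbourhood is then a sublevel set of
conserved quantities (\<open>lyapunov_stable_if_strict_local_min\<close>).

For \<open>N = 3\<close> and \<open>c > 0\<close> the slice is spanned by the waves with \<open>k = 1\<close> and \<open>k = 3\<close> and one plane of waves with
\<open>k = 2\<close>, so all eigenvalues are explicit functions of \<open>c\<close> (\<open>eigenvalues_subset_3\<close>). The lower threshold
is the zero of \<open>\<epsilon>\<close>, the upper one the zero of \<open>R 1\<close>: there \<open>\<tau>\<close> passes from imaginary to real values through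
zero while \<open>\<beta> 1 \<noteq> 0\<close>, which is the Hamiltonian-Hopf bifurcation (\<open>hamiltonian_hopf_3\<close>).\<close>

section \<open>First and second derivatives of a pair interaction\<close>

text \<open>After normalization a pair of vortices interacts through the cosine of the angle between them alone.\<close>

lemma norm_diff_normalized:
  fixes y z :: "'a::real_inner"
  assumes "y \<noteq> 0" "z \<noteq> 0"
  shows "(norm (y /\<^sub>R norm y - z /\<^sub>R norm z))\<^sup>2 = 2 - 2 * ((y \<bullet> z) / (norm y * norm z))"
proof -
  have "(norm (y /\<^sub>R norm y - z /\<^sub>R norm z))\<^sup>2
      = (norm (y /\<^sub>R norm y))\<^sup>2 + (norm (z /\<^sub>R norm z))\<^sup>2 - 2 * ((y /\<^sub>R norm y) \<bullet> (z /\<^sub>R norm z))"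
    unfolding power2_norm_eq_inner by (simp add: inner_diff_left inner_diff_right inner_commute)
  then show ?thesis using assms by (simp add: field_simps)
qed

lemma phase_spaceD:
  assumes "x \<in> phase_space"
  shows "norm (x $ i) = 1" "x $ i \<bullet> x $ i = 1" "i \<noteq> j \<Longrightarrow> x $ i \<bullet> x $ j < 1"
proof -
  show n: "norm (x $ i) = 1" for i using assms by (auto simp: phase_space_def)
  then show "x $ i \<bullet> x $ i = 1" by (simp add: dot_square_norm)
  show "x $ i \<bullet> x $ j < 1" if "i \<noteq> j"
  proof -
    have "x $ i \<noteq> x $ j" using that assms by (auto simp: phase_space_def)
    then have "0 < (norm (x $ i - x $ j))\<^sup>2" by simp
    also have "\<dots> = 2 - 2 * (x $ i \<bullet> x $ j)"
      unfolding power2_norm_eq_inner using n[of i] n[of j]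
      by (simp add: inner_diff_left inner_diff_right inner_commute norm_eq_1)
    finally show ?thesis by simp
  qed
qed

text \<open>Tangent vectors are orthogonal to the position, so no term of first order appears.\<close>

lemma norm_tangent_perturbation:
  fixes x v w :: "'a::real_inner"
  assumes "x \<bullet> x = 1" "v \<bullet> x = 0" "w \<bullet> x = 0"
  shows "norm (x + s *\<^sub>R v + t *\<^sub>R w)
    = sqrt (1 + s\<^sup>2 * (v \<bullet> v) + 2 * s * t * (v \<bullet> w) + t\<^sup>2 * (w \<bullet> w))"
  using assms
  by (simp add: norm_eq_sqrt_inner inner_add_left inner_add_right inner_commute algebra_simps power2_eq_square)

lemma tangent_perturbation_nonzero:
  fixes x v w :: "'a::real_inner"
  assumes "x \<bullet> x = 1" "v \<bullet> x = 0" "w \<bullet> x = 0"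
  shows "x + s *\<^sub>R v + t *\<^sub>R w \<noteq> 0"
proof
  assume "x + s *\<^sub>R v + t *\<^sub>R w = 0"
  then have "(x + s *\<^sub>R v + t *\<^sub>R w) \<bullet> x = 0" by simp
  then show False using assms by (simp add: inner_add_left)
qed

lemma DERIV_sqrt_comp:
  fixes f :: "real \<Rightarrow> real"
  assumes "(f has_real_derivative D) (at x)" "f x > 0"
  shows "((\<lambda>t. sqrt (f t)) has_real_derivative D / (2 * sqrt (f x))) (at x)"
  using DERIV_chain2[OF DERIV_real_sqrt[OF assms(2)] assms(1)] by (simp add: field_simps)

text \<open>In the chart, one pair of vortices contributes \<open>ln (2 - 2 * cosine)\<close>, where the cosine is a quadratic
polynomial \<open>p\<close> in the two chart parameters divided by the norms \<open>sqrt n\<close> and \<open>sqrt n'\<close> of the two displaced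
vortices.\<close>

lemma pair_first_derivative:
  fixes p0 pv pw pvv pvw pww \<alpha> \<beta> \<gamma> \<alpha>' \<beta>' \<gamma>' s :: real
  defines "p \<equiv> \<lambda>s t. p0 + s * pv + t * pw + s\<^sup>2 * pvv + s * t * pvw + t\<^sup>2 * pww"
    and "n \<equiv> \<lambda>s t. 1 + s\<^sup>2 * \<alpha> + 2 * s * t * \<beta> + t\<^sup>2 * \<gamma>"
    and "n' \<equiv> \<lambda>s t. 1 + s\<^sup>2 * \<alpha>' + 2 * s * t * \<beta>' + t\<^sup>2 * \<gamma>'"
    and "r \<equiv> sqrt (1 + s\<^sup>2 * \<alpha>) * sqrt (1 + s\<^sup>2 * \<alpha>')"
  assumes "\<alpha> \<ge> 0" "\<alpha>' \<ge> 0" "(p0 + s * pv + s\<^sup>2 * pvv) / r < 1"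
  shows "((\<lambda>t. ln (2 - 2 * (p s t / (sqrt (n s t) * sqrt (n' s t))))) has_real_derivative
     - (((pw + s * pvw) / r - (p0 + s * pv + s\<^sup>2 * pvv) * (s * \<beta> / (1 + s\<^sup>2 * \<alpha>) + s * \<beta>' / (1 + s\<^sup>2 * \<alpha>')) / r)
        / (1 - (p0 + s * pv + s\<^sup>2 * pvv) / r))) (at 0)"
proof -
  have pos: "1 + s\<^sup>2 * \<alpha> > 0" "1 + s\<^sup>2 * \<alpha>' > 0"
    using assms by (simp_all add: add_pos_nonneg)
  define a b where "a = sqrt (1 + s\<^sup>2 * \<alpha>)" and "b = sqrt (1 + s\<^sup>2 * \<alpha>')"
  have ab: "a > 0" "b > 0" "1 + s\<^sup>2 * \<alpha> = a\<^sup>2" "1 + s\<^sup>2 * \<alpha>' = b\<^sup>2" "r = a * b"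
    using pos by (simp_all add: a_def b_def r_def)
  define P where "P = p0 + s * pv + s\<^sup>2 * pvv"
  have Pab: "P / (a * b) < 1" using assms ab by (simp add: P_def)
  have dn: "((\<lambda>t. sqrt (n s t)) has_real_derivative (s * \<beta> / a)) (at 0)"
  proof -
    have "((\<lambda>t. n s t) has_real_derivative (2 * s * \<beta>)) (at 0)"
      unfolding n_def by (auto intro!: derivative_eq_intros)
    from DERIV_sqrt_comp[OF this] pos show ?thesis by (simp add: n_def a_def)
  qed
  have dn': "((\<lambda>t. sqrt (n' s t)) has_real_derivative (s * \<beta>' / b)) (at 0)"
  proof -
    have "((\<lambda>t. n' s t) has_real_derivative (2 * s * \<beta>')) (at 0)"
      unfolding n'_def by (auto intro!: derivative_eq_intros)
    from DERIV_sqrt_comp[OF this] pos show ?thesis by (simp add: n'_def b_def)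
  qed
  have dp: "((\<lambda>t. p s t) has_real_derivative (pw + s * pvw)) (at 0)"
    unfolding p_def by (auto intro!: derivative_eq_intros)
  have v: "p s 0 = P" "sqrt (n s 0) = a" "sqrt (n' s 0) = b"
    by (simp_all add: p_def n_def n'_def P_def a_def b_def)
  have "((\<lambda>t. ln (2 - 2 * (p s t / (sqrt (n s t) * sqrt (n' s t))))) has_real_derivative
      - 2 * (((pw + s * pvw) * (a * b) - P * (s * \<beta> / a * b + a * (s * \<beta>' / b))) / (a * b)\<^sup>2)
       / (2 - 2 * (P / (a * b)))) (at 0)"
  proof -
    have "((\<lambda>t. p s t / (sqrt (n s t) * sqrt (n' s t))) has_real_derivative
      ((pw + s * pvw) * (a * b) - P * (s * \<beta> / a * b + a * (s * \<beta>' / b))) / (a * b)\<^sup>2) (at 0)"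
      using DERIV_quotient[OF dp DERIV_mult[OF dn dn']] ab
      by (simp add: v power2_eq_square algebra_simps)
    from DERIV_diff[OF DERIV_const[of 2] DERIV_cmult[OF this, of 2]]
    have "((\<lambda>t. 2 - 2 * (p s t / (sqrt (n s t) * sqrt (n' s t)))) has_real_derivative
      - 2 * (((pw + s * pvw) * (a * b) - P * (s * \<beta> / a * b + a * (s * \<beta>' / b))) / (a * b)\<^sup>2)) (at 0)"
      by (simp add: minus_divide_left)
    note d = this
    have pos: "0 < 2 - 2 * (p s 0 / (sqrt (n s 0) * sqrt (n' s 0)))"
      using Pab by (simp add: v)
    show ?thesis
      by (rule DERIV_cong[OF DERIV_chain2[OF DERIV_ln_divide[OF pos] d]]) (simp add: v)
  qed
  moreover have "- 2 * (((pw + s * pvw) * (a * b) - P * (s * \<beta> / a * b + a * (s * \<beta>' / b))) / (a * b)\<^sup>2)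
       / (2 - 2 * (P / (a * b)))
     = - (((pw + s * pvw) / r - P * (s * \<beta> / (1 + s\<^sup>2 * \<alpha>) + s * \<beta>' / (1 + s\<^sup>2 * \<alpha>')) / r) / (1 - P / r))"
  proof -
    have e1: "((pw + s * pvw) * (a * b) - P * (s * \<beta> / a * b + a * (s * \<beta>' / b))) / (a * b)\<^sup>2
      = (pw + s * pvw) / r - P * (s * \<beta> / (1 + s\<^sup>2 * \<alpha>) + s * \<beta>' / (1 + s\<^sup>2 * \<alpha>')) / r" (is "_ = ?M")
    proof -
      have "s * \<beta> / a * b + a * (s * \<beta>' / b) = (s * \<beta> / a\<^sup>2 + s * \<beta>' / b\<^sup>2) * (a * b)"
        using ab(1,2) by (simp add: field_simps power2_eq_square)
      then show ?thesis unfolding ab(3-5) using ab(1,2) by (simp add: diff_divide_distrib power2_eq_square)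
    qed
    have "- 2 * ?M / (2 - 2 * (P / (a * b))) = - (?M / (1 - P / r))"
    proof -
      have "2 - 2 * (P / (a * b)) = 2 * (1 - P / r)" by (simp add: ab)
      moreover have "- 2 * M / (2 * d) = - (M / d)" for M d :: real by simp
      ultimately show ?thesis by (simp only:)
    qed
    then show ?thesis unfolding e1 .
  qed
  ultimately show ?thesis by (simp only: P_def)
qed

text \<open>The derivative in \<open>s\<close> at \<open>0\<close> of the expression obtained from \<open>pair_first_derivative\<close>: the norms are even in \<open>s\<close>,
so they contribute only through the coefficients \<open>\<beta>\<close> and \<open>\<beta>'\<close>.\<close>

lemma pair_second_derivative:
  fixes p0 pv pw pvv pvw \<alpha> \<beta> \<alpha>' \<beta>' :: real
  defines "r \<equiv> \<lambda>s. sqrt (1 + s\<^sup>2 * \<alpha>) * sqrt (1 + s\<^sup>2 * \<alpha>')"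
  assumes "p0 < 1"
  shows "((\<lambda>s. - (((pw + s * pvw) / r s - (p0 + s * pv + s\<^sup>2 * pvv) * (s * \<beta> / (1 + s\<^sup>2 * \<alpha>) + s * \<beta>' / (1 + s\<^sup>2 * \<alpha>')) / r s)
        / (1 - (p0 + s * pv + s\<^sup>2 * pvv) / r s))) has_real_derivative
     - ((pvw - p0 * (\<beta> + \<beta>')) / (1 - p0) + pv * pw / (1 - p0)\<^sup>2)) (at 0)"
proof -
  have dr: "(r has_real_derivative 0) (at 0)"
    unfolding r_def by (auto intro!: derivative_eq_intros)
  have r0: "r 0 = 1" by (simp add: r_def)
  have dq: "((\<lambda>s. s * \<beta> / (1 + s\<^sup>2 * \<alpha>) + s * \<beta>' / (1 + s\<^sup>2 * \<alpha>')) has_real_derivative \<beta> + \<beta>') (at 0)"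
    by (auto intro!: derivative_eq_intros)
  have dP: "((\<lambda>s. p0 + s * pv + s\<^sup>2 * pvv) has_real_derivative pv) (at 0)"
    by (auto intro!: derivative_eq_intros)
  have dw: "((\<lambda>s. pw + s * pvw) has_real_derivative pvw) (at 0)"
    by (auto intro!: derivative_eq_intros)
  define P q W where "P = (\<lambda>s. p0 + s * pv + s\<^sup>2 * pvv)"
    and "q = (\<lambda>s. s * \<beta> / (1 + s\<^sup>2 * \<alpha>) + s * \<beta>' / (1 + s\<^sup>2 * \<alpha>'))"
    and "W = (\<lambda>s. pw + s * pvw)"
  note d = dr dq[folded q_def] dP[folded P_def] dw[folded W_def]
  have v: "P 0 = p0" "q 0 = 0" "W 0 = pw" by (simp_all add: P_def q_def W_def)
  have d1: "((\<lambda>s. W s / r s - P s * q s / r s) has_real_derivative pvw - p0 * (\<beta> + \<beta>')) (at 0)"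
    using DERIV_diff[OF DERIV_quotient[OF d(4) d(1)] DERIV_quotient[OF DERIV_mult[OF d(3) d(2)] d(1)]]
    by (simp add: r0 v mult.commute)
  have d2: "((\<lambda>s. 1 - P s / r s) has_real_derivative - pv) (at 0)"
    using DERIV_diff[OF DERIV_const[of 1] DERIV_quotient[OF d(3) d(1)]] by (simp add: r0 v)
  have "((\<lambda>s. - ((W s / r s - P s * q s / r s) / (1 - P s / r s))) has_real_derivative
     - (((pvw - p0 * (\<beta> + \<beta>')) * (1 - p0) - (- pv) * pw) / (1 - p0)\<^sup>2)) (at 0)"
    using DERIV_minus[OF DERIV_quotient[OF d1 d2]] assms by (simp add: r0 v power2_eq_square)
  moreover have "((pvw - p0 * (\<beta> + \<beta>')) * (1 - p0) - (- pv) * pw) / (1 - p0)\<^sup>2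
     = (pvw - p0 * (\<beta> + \<beta>')) / (1 - p0) + pv * pw / (1 - p0)\<^sup>2"
    using assms by (simp add: add_divide_distrib power2_eq_square)
  ultimately show ?thesis by (simp add: P_def q_def W_def)
qed

text \<open>The same two derivatives for a linear function of a normalized position; they are
applied to the centre of vorticity.\<close>

lemma linear_term_derivatives:
  fixes z0 zv zw \<alpha> \<beta> \<gamma> s :: real
  assumes "\<alpha> \<ge> 0"
  shows "((\<lambda>t. (z0 + s * zv + t * zw) / sqrt (1 + s\<^sup>2 * \<alpha> + 2 * s * t * \<beta> + t\<^sup>2 * \<gamma>)) has_real_derivative
      zw / sqrt (1 + s\<^sup>2 * \<alpha>) - (z0 + s * zv) * (s * \<beta>) / (sqrt (1 + s\<^sup>2 * \<alpha>) * (1 + s\<^sup>2 * \<alpha>))) (at 0)"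
    and "((\<lambda>s. zw / sqrt (1 + s\<^sup>2 * \<alpha>) - (z0 + s * zv) * (s * \<beta>) / (sqrt (1 + s\<^sup>2 * \<alpha>) * (1 + s\<^sup>2 * \<alpha>)))
       has_real_derivative - (z0 * \<beta>)) (at 0)"
proof -
  have pos: "1 + s\<^sup>2 * \<alpha> > 0" using assms by (simp add: add_pos_nonneg)
  define a where "a = sqrt (1 + s\<^sup>2 * \<alpha>)"
  have a: "a > 0" "1 + s\<^sup>2 * \<alpha> = a\<^sup>2" using pos by (simp_all add: a_def)
  have dn: "((\<lambda>t. sqrt (1 + s\<^sup>2 * \<alpha> + 2 * s * t * \<beta> + t\<^sup>2 * \<gamma>)) has_real_derivative (s * \<beta> / a)) (at 0)"
  proof -
    have "((\<lambda>t. 1 + s\<^sup>2 * \<alpha> + 2 * s * t * \<beta> + t\<^sup>2 * \<gamma>) has_real_derivative (2 * s * \<beta>)) (at 0)"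
      by (auto intro!: derivative_eq_intros)
    from DERIV_sqrt_comp[OF this] pos show ?thesis by (simp add: a_def)
  qed
  show "((\<lambda>t. (z0 + s * zv + t * zw) / sqrt (1 + s\<^sup>2 * \<alpha> + 2 * s * t * \<beta> + t\<^sup>2 * \<gamma>)) has_real_derivative
      zw / sqrt (1 + s\<^sup>2 * \<alpha>) - (z0 + s * zv) * (s * \<beta>) / (sqrt (1 + s\<^sup>2 * \<alpha>) * (1 + s\<^sup>2 * \<alpha>))) (at 0)"
  proof -
    have dz: "((\<lambda>t. z0 + s * zv + t * zw) has_real_derivative zw) (at 0)"
      by (auto intro!: derivative_eq_intros)
    have "((\<lambda>t. (z0 + s * zv + t * zw) / sqrt (1 + s\<^sup>2 * \<alpha> + 2 * s * t * \<beta> + t\<^sup>2 * \<gamma>)) has_real_derivative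
      (zw * a - s * \<beta> / a * (z0 + s * zv)) / a\<^sup>2) (at 0)"
      using DERIV_quotient[OF dz dn] a by (simp add: a_def power2_eq_square)
    moreover have "(zw * a - s * \<beta> / a * (z0 + s * zv)) / a\<^sup>2
      = zw / a - (z0 + s * zv) * (s * \<beta>) / (a * a\<^sup>2)"
      using a(1) by (simp add: diff_divide_distrib power2_eq_square)
    ultimately show ?thesis unfolding a_def[symmetric] a(2) using a(1) by simp
  qed
  show "((\<lambda>s. zw / sqrt (1 + s\<^sup>2 * \<alpha>) - (z0 + s * zv) * (s * \<beta>) / (sqrt (1 + s\<^sup>2 * \<alpha>) * (1 + s\<^sup>2 * \<alpha>)))
       has_real_derivative - (z0 * \<beta>)) (at 0)"
  proof -
    define r N M where "r = (\<lambda>s. sqrt (1 + s\<^sup>2 * \<alpha>))" and "N = (\<lambda>s. r s * (1 + s\<^sup>2 * \<alpha>))"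
      and "M = (\<lambda>s. (z0 + s * zv) * (s * \<beta>))"
    have n: "((\<lambda>s. 1 + s\<^sup>2 * \<alpha>) has_real_derivative 0) (at 0)"
      by (auto intro!: derivative_eq_intros)
    have r: "(r has_real_derivative 0) (at 0)"
      using DERIV_sqrt_comp[OF n] by (simp add: r_def)
    have N: "(N has_real_derivative 0) (at 0)"
      using DERIV_mult[OF r n] by (simp add: N_def)
    have M: "(M has_real_derivative z0 * \<beta>) (at 0)"
      unfolding M_def by (auto intro!: derivative_eq_intros)
    have v: "r 0 = 1" "N 0 = 1" "M 0 = 0" by (simp_all add: r_def N_def M_def)
    show ?thesis
      using DERIV_diff[OF DERIV_quotient[OF DERIV_const[of zw] r] DERIV_quotient[OF M N]]
      by (simp add: v) (simp add: r_def N_def M_def)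
  qed
qed

section \<open>The Hessian of the augmented Hamiltonian\<close>

lemma sum_offdiag_swap:
  fixes f :: "'m::finite \<Rightarrow> 'm \<Rightarrow> real"
  shows "(\<Sum>i\<in>UNIV. \<Sum>j\<in>UNIV - {i}. f i j) = (\<Sum>i\<in>UNIV. \<Sum>j\<in>UNIV - {i}. f j i)"
proof -
  have *: "(\<Sum>i\<in>UNIV. \<Sum>j\<in>UNIV - {i}. f i j) = (\<Sum>i\<in>UNIV. \<Sum>j\<in>UNIV. if i = j then 0 else f i j)" for f :: "'m \<Rightarrow> 'm \<Rightarrow> real"
  proof (rule sum.cong[OF refl])
    fix i :: 'm
    show "(\<Sum>j\<in>UNIV - {i}. f i j) = (\<Sum>j\<in>UNIV. if i = j then 0 else f i j)"
      by (rule sum.mono_neutral_cong_left) auto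
  qed
  show ?thesis unfolding * by (subst sum.swap) (auto intro!: sum.cong)
qed

text \<open>The gradient form of the Hessian: the Hessian in the directions \<open>v\<close> and \<open>w\<close> is the inner product of this vector
with \<open>w\<close>. The last summand comes from the curvature of the spheres.\<close>

definition hess_vec :: "('m::finite \<Rightarrow> real) \<Rightarrow> real^3^'m \<Rightarrow> real^3 \<Rightarrow> real^3^'m \<Rightarrow> real^3^'m" where
  "hess_vec \<Gamma> x \<xi> v = (\<chi> i. (\<Sum>j\<in>UNIV - {i}. (\<Gamma> i * \<Gamma> j) *\<^sub>R
       (((x $ i \<bullet> x $ j) / (1 - x $ i \<bullet> x $ j)) *\<^sub>R v $ i - (1 / (1 - x $ i \<bullet> x $ j)) *\<^sub>R v $ j
        - ((v $ i \<bullet> x $ j + x $ i \<bullet> v $ j) / (1 - x $ i \<bullet> x $ j)\<^sup>2) *\<^sub>R x $ j))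
     - (\<Gamma> i * (x $ i \<bullet> \<xi>)) *\<^sub>R v $ i)"

context
  fixes \<Gamma> :: "'m::finite \<Rightarrow> real" and x v w :: "real^3^'m"
  assumes x: "x \<in> phase_space" and v: "v \<in> tangent_space x" and w: "w \<in> tangent_space x"
begin

private definition P :: "'m \<Rightarrow> 'm \<Rightarrow> real \<Rightarrow> real \<Rightarrow> real" where
  "P i j s t = x $ i \<bullet> x $ j + s * (v $ i \<bullet> x $ j + x $ i \<bullet> v $ j) + t * (w $ i \<bullet> x $ j + x $ i \<bullet> w $ j)
     + s\<^sup>2 * (v $ i \<bullet> v $ j) + s * t * (v $ i \<bullet> w $ j + w $ i \<bullet> v $ j) + t\<^sup>2 * (w $ i \<bullet> w $ j)"

private definition n :: "'m \<Rightarrow> real \<Rightarrow> real \<Rightarrow> real" where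
  "n i s t = 1 + s\<^sup>2 * (v $ i \<bullet> v $ i) + 2 * s * t * (v $ i \<bullet> w $ i) + t\<^sup>2 * (w $ i \<bullet> w $ i)"

private definition D :: "'m \<Rightarrow> 'm \<Rightarrow> real \<Rightarrow> real" where
  "D i j s = (let r = sqrt (1 + s\<^sup>2 * (v $ i \<bullet> v $ i)) * sqrt (1 + s\<^sup>2 * (v $ j \<bullet> v $ j));
       p = x $ i \<bullet> x $ j + s * (v $ i \<bullet> x $ j + x $ i \<bullet> v $ j) + s\<^sup>2 * (v $ i \<bullet> v $ j) in
     - ((((w $ i \<bullet> x $ j + x $ i \<bullet> w $ j) + s * (v $ i \<bullet> w $ j + w $ i \<bullet> v $ j)) / r
         - p * (s * (v $ i \<bullet> w $ i) / (1 + s\<^sup>2 * (v $ i \<bullet> v $ i)) + s * (v $ j \<bullet> w $ j) / (1 + s\<^sup>2 * (v $ j \<bullet> v $ j))) / r)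
        / (1 - p / r)))"

private definition Z :: "real^3 \<Rightarrow> 'm \<Rightarrow> real \<Rightarrow> real" where
  "Z \<xi> i s = (w $ i \<bullet> \<xi>) / sqrt (1 + s\<^sup>2 * (v $ i \<bullet> v $ i)) - (x $ i \<bullet> \<xi> + s * (v $ i \<bullet> \<xi>)) * (s * (v $ i \<bullet> w $ i))
     / (sqrt (1 + s\<^sup>2 * (v $ i \<bullet> v $ i)) * (1 + s\<^sup>2 * (v $ i \<bullet> v $ i)))"

private lemma inner_x: "x $ i \<bullet> x $ i = 1" "v $ i \<bullet> x $ i = 0" "w $ i \<bullet> x $ i = 0"
  using phase_spaceD[OF x] v w by (auto simp: tangent_space_def)

private lemma augmented_expand:
  "augmented_hamiltonian \<Gamma> \<mu> \<xi> (to_spheres (x + s *\<^sub>R v + t *\<^sub>R w))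
    = (\<Sum>i\<in>UNIV. \<Sum>j\<in>UNIV - {i}. \<Gamma> i * \<Gamma> j * ln (2 - 2 * (P i j s t / (sqrt (n i s t) * sqrt (n j s t))))) / 2
      + (\<Sum>i\<in>UNIV. \<Gamma> i * ((x $ i \<bullet> \<xi> + s * (v $ i \<bullet> \<xi>) + t * (w $ i \<bullet> \<xi>)) / sqrt (n i s t))) - \<mu> \<bullet> \<xi>"
proof -
  let ?y = "x + s *\<^sub>R v + t *\<^sub>R w"
  have nrm: "norm (?y $ i) = sqrt (n i s t)" for i
    using norm_tangent_perturbation[OF inner_x] by (simp add: n_def)
  have nz: "?y $ i \<noteq> 0" for i
    using tangent_perturbation_nonzero[OF inner_x] by simp
  have pr: "?y $ i \<bullet> ?y $ j = P i j s t" for i j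
    by (simp add: P_def inner_add_left inner_add_right algebra_simps power2_eq_square)
  have d: "(norm (to_spheres ?y $ i - to_spheres ?y $ j))\<^sup>2
      = 2 - 2 * (P i j s t / (sqrt (n i s t) * sqrt (n j s t)))" for i j
    using norm_diff_normalized[OF nz nz, of i j] unfolding nrm pr by (simp only: to_spheres_def vec_lambda_beta nrm)
  have c: "centre_of_vorticity \<Gamma> (to_spheres ?y) \<bullet> \<xi>
     = (\<Sum>i\<in>UNIV. \<Gamma> i * ((x $ i \<bullet> \<xi> + s * (v $ i \<bullet> \<xi>) + t * (w $ i \<bullet> \<xi>)) / sqrt (n i s t)))"
    unfolding centre_of_vorticity_def inner_sum_left
  proof (rule sum.cong[OF refl])
    fix i :: 'm
    have "to_spheres ?y $ i = (1 / sqrt (n i s t)) *\<^sub>R (?y $ i)"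
      using nrm[of i] by (simp add: to_spheres_def divide_inverse)
    then show "\<Gamma> i *\<^sub>R to_spheres ?y $ i \<bullet> \<xi>
      = \<Gamma> i * ((x $ i \<bullet> \<xi> + s * (v $ i \<bullet> \<xi>) + t * (w $ i \<bullet> \<xi>)) / sqrt (n i s t))"
      by (simp add: inner_add_left)
  qed
  show ?thesis
    unfolding augmented_hamiltonian_def hamiltonian_def d inner_diff_left c by simp
qed

private lemma augmented_deriv_t:
  assumes "\<And>i j. i \<noteq> j \<Longrightarrow> P i j s 0 / (sqrt (n i s 0) * sqrt (n j s 0)) < 1"
  shows "((\<lambda>t. augmented_hamiltonian \<Gamma> \<mu> \<xi> (to_spheres (x + s *\<^sub>R v + t *\<^sub>R w))) has_real_derivative
     (\<Sum>i\<in>UNIV. \<Sum>j\<in>UNIV - {i}. \<Gamma> i * \<Gamma> j * D i j s) / 2 + (\<Sum>i\<in>UNIV. \<Gamma> i * Z \<xi> i s)) (at 0)"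
proof -
  have d: "((\<lambda>t. ln (2 - 2 * (P i j s t / (sqrt (n i s t) * sqrt (n j s t))))) has_real_derivative D i j s) (at 0)"
    if "j \<in> UNIV - {i}" for i j
    using pair_first_derivative[of "v $ i \<bullet> v $ i" "v $ j \<bullet> v $ j" "x $ i \<bullet> x $ j" s
        "v $ i \<bullet> x $ j + x $ i \<bullet> v $ j" "v $ i \<bullet> v $ j"
        "w $ i \<bullet> x $ j + x $ i \<bullet> w $ j" "v $ i \<bullet> w $ j + w $ i \<bullet> v $ j" "w $ i \<bullet> w $ j" "v $ i \<bullet> w $ i" "w $ i \<bullet> w $ i" "v $ j \<bullet> w $ j" "w $ j \<bullet> w $ j"]
      assms[of i j] that
    unfolding P_def n_def D_def Let_def by simp
  have z: "((\<lambda>t. (x $ i \<bullet> \<xi> + s * (v $ i \<bullet> \<xi>) + t * (w $ i \<bullet> \<xi>)) / sqrt (n i s t)) has_real_derivative Z \<xi> i s) (at 0)" for i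
    unfolding n_def Z_def by (rule linear_term_derivatives(1)) simp
  show ?thesis unfolding augmented_expand
    by (rule DERIV_cong, (rule DERIV_diff DERIV_add DERIV_cdivide DERIV_sum DERIV_cmult d z DERIV_const | assumption)+) simp
qed

text \<open>The bracket is the gradient of the augmented Hamiltonian at vortex \<open>i\<close>, up to a multiple of the position of \<open>i\<close>.\<close>

lemma augmented_hamiltonian_derivative:
  "((\<lambda>t. augmented_hamiltonian \<Gamma> \<mu> \<xi> (to_spheres (x + t *\<^sub>R w))) has_real_derivative
     (\<Sum>i\<in>UNIV. \<Gamma> i * (w $ i \<bullet> (\<xi> - (\<Sum>j\<in>UNIV - {i}. (\<Gamma> j / (1 - x $ i \<bullet> x $ j)) *\<^sub>R x $ j))))) (at 0)"
proof -
  have "((\<lambda>t. augmented_hamiltonian \<Gamma> \<mu> \<xi> (to_spheres (x + 0 *\<^sub>R v + t *\<^sub>R w))) has_real_derivative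
     (\<Sum>i\<in>UNIV. \<Sum>j\<in>UNIV - {i}. \<Gamma> i * \<Gamma> j * D i j 0) / 2 + (\<Sum>i\<in>UNIV. \<Gamma> i * Z \<xi> i 0)) (at 0)"
    by (rule augmented_deriv_t) (simp add: P_def n_def phase_spaceD(3)[OF x])
  moreover have "(\<Sum>i\<in>UNIV. \<Sum>j\<in>UNIV - {i}. \<Gamma> i * \<Gamma> j * D i j 0)
      = 2 * (\<Sum>i\<in>UNIV. \<Sum>j\<in>UNIV - {i}. - (\<Gamma> i * \<Gamma> j * ((w $ i \<bullet> x $ j) / (1 - x $ i \<bullet> x $ j))))" (is "?L = 2 * ?S")
  proof -
    have "?L = (\<Sum>i\<in>UNIV. \<Sum>j\<in>UNIV - {i}. - (\<Gamma> i * \<Gamma> j * ((w $ i \<bullet> x $ j) / (1 - x $ i \<bullet> x $ j))) +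
        - (\<Gamma> j * \<Gamma> i * ((w $ j \<bullet> x $ i) / (1 - x $ j \<bullet> x $ i))))"
      by (intro sum.cong refl) (simp add: D_def Let_def inner_commute add_divide_distrib algebra_simps)
    also have "\<dots> = ?S + (\<Sum>i\<in>UNIV. \<Sum>j\<in>UNIV - {i}. - (\<Gamma> j * \<Gamma> i * ((w $ j \<bullet> x $ i) / (1 - x $ j \<bullet> x $ i))))"
      by (simp only: sum.distrib)
    also have "\<dots> = 2 * ?S"
      using sum_offdiag_swap[of "\<lambda>i j. - (\<Gamma> i * \<Gamma> j * ((w $ i \<bullet> x $ j) / (1 - x $ i \<bullet> x $ j)))"] by simp
    finally show ?thesis .
  qed
  moreover have "?S + (\<Sum>i\<in>UNIV. \<Gamma> i * Z \<xi> i 0)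
     = (\<Sum>i\<in>UNIV. \<Gamma> i * (w $ i \<bullet> (\<xi> - (\<Sum>j\<in>UNIV - {i}. (\<Gamma> j / (1 - x $ i \<bullet> x $ j)) *\<^sub>R x $ j))))"
    unfolding sum.distrib[symmetric]
    by (intro sum.cong refl)
       (simp add: Z_def inner_diff_right inner_sum_right sum_negf sum_distrib_left algebra_simps)
  ultimately show ?thesis by simp
qed

text \<open>The double sum over ordered pairs counts each interaction twice; exchanging the two indices in one half turns
it into an expression that is linear in \<open>w\<close> vortex by vortex.\<close>

lemma hessian_augmented_hamiltonian:
  "hessian (augmented_hamiltonian \<Gamma> \<mu> \<xi>) x v w = hess_vec \<Gamma> x \<xi> v \<bullet> w"
proof -
  let ?F = "\<lambda>s t. augmented_hamiltonian \<Gamma> \<mu> \<xi> (to_spheres (x + s *\<^sub>R v + t *\<^sub>R w))"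
  let ?M = "\<lambda>s. (\<Sum>i\<in>UNIV. \<Sum>j\<in>UNIV - {i}. \<Gamma> i * \<Gamma> j * D i j s) / 2 + (\<Sum>i\<in>UNIV. \<Gamma> i * Z \<xi> i s)"
  have ev: "\<forall>\<^sub>F s in nhds 0. \<forall>i j. i \<noteq> j \<longrightarrow> P i j s 0 / (sqrt (n i s 0) * sqrt (n j s 0)) < 1"
  proof (intro eventually_all_finite)
    fix i j :: 'm
    show "\<forall>\<^sub>F s in nhds 0. i \<noteq> j \<longrightarrow> P i j s 0 / (sqrt (n i s 0) * sqrt (n j s 0)) < 1"
    proof (cases "i = j")
      case False
      have pos: "n i s 0 > 0" for i s by (simp add: n_def add_pos_nonneg)
      have "isCont (\<lambda>s. P i j s 0 / (sqrt (n i s 0) * sqrt (n j s 0))) 0"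
      proof (intro continuous_intros)
        show "isCont (\<lambda>s. P i j s 0) 0" unfolding P_def by (intro continuous_intros)
        show "isCont (\<lambda>s. n i s 0) 0" "isCont (\<lambda>s. n j s 0) 0" unfolding n_def by (intro continuous_intros)+
        show "sqrt (n i 0 0) * sqrt (n j 0 0) \<noteq> 0" by (simp add: n_def)
      qed
      then have "((\<lambda>s. P i j s 0 / (sqrt (n i s 0) * sqrt (n j s 0))) \<longlongrightarrow>
          P i j 0 0 / (sqrt (n i 0 0) * sqrt (n j 0 0))) (nhds 0)"
        unfolding isCont_def
        by (rule iffD1[OF tendsto_at_iff_tendsto_nhds[of "\<lambda>s. P i j s 0 / (sqrt (n i s 0) * sqrt (n j s 0))" 0]])
      moreover have "P i j 0 0 / (sqrt (n i 0 0) * sqrt (n j 0 0)) = x $ i \<bullet> x $ j"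
        by (simp add: P_def n_def)
      ultimately have "((\<lambda>s. P i j s 0 / (sqrt (n i s 0) * sqrt (n j s 0))) \<longlongrightarrow> x $ i \<bullet> x $ j) (nhds 0)"
        by simp
      from order_tendstoD(2)[OF this phase_spaceD(3)[OF x False]] show ?thesis
        by eventually_elim simp
    qed simp
  qed
  have "\<forall>\<^sub>F s in nhds 0. deriv (\<lambda>t. ?F s t) 0 = ?M s"
    using ev by eventually_elim (rule DERIV_imp_deriv, rule augmented_deriv_t, blast)
  then have "hessian (augmented_hamiltonian \<Gamma> \<mu> \<xi>) x v w = deriv ?M 0"
    unfolding hessian_def by (rule deriv_cong_ev) simp
  also have "\<dots> = (\<Sum>i\<in>UNIV. \<Sum>j\<in>UNIV - {i}. \<Gamma> i * \<Gamma> j *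
        - ((v $ i \<bullet> w $ j + w $ i \<bullet> v $ j - (x $ i \<bullet> x $ j) * (v $ i \<bullet> w $ i + v $ j \<bullet> w $ j)) / (1 - x $ i \<bullet> x $ j)
           + (v $ i \<bullet> x $ j + x $ i \<bullet> v $ j) * (w $ i \<bullet> x $ j + x $ i \<bullet> w $ j) / (1 - x $ i \<bullet> x $ j)\<^sup>2)) / 2
      + (\<Sum>i\<in>UNIV. \<Gamma> i * - ((x $ i \<bullet> \<xi>) * (v $ i \<bullet> w $ i)))" (is "_ = ?L / 2 + ?R")
  proof (rule DERIV_imp_deriv, intro DERIV_add DERIV_cdivide DERIV_sum DERIV_cmult)
    show "(D i j has_real_derivative - ((v $ i \<bullet> w $ j + w $ i \<bullet> v $ j - (x $ i \<bullet> x $ j) * (v $ i \<bullet> w $ i + v $ j \<bullet> w $ j)) / (1 - x $ i \<bullet> x $ j)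
           + (v $ i \<bullet> x $ j + x $ i \<bullet> v $ j) * (w $ i \<bullet> x $ j + x $ i \<bullet> w $ j) / (1 - x $ i \<bullet> x $ j)\<^sup>2)) (at 0)"
      if "j \<in> UNIV - {i}" for i j
      unfolding D_def[abs_def] Let_def
      by (rule pair_second_derivative) (use that in \<open>simp add: phase_spaceD(3)[OF x]\<close>)
    show "(Z \<xi> i has_real_derivative - ((x $ i \<bullet> \<xi>) * (v $ i \<bullet> w $ i))) (at 0)" for i
      unfolding Z_def[abs_def] by (rule linear_term_derivatives(2)) simp
  qed
  also have "?L = 2 * (\<Sum>i\<in>UNIV. \<Sum>j\<in>UNIV - {i}. \<Gamma> i * \<Gamma> j *
      ((x $ i \<bullet> x $ j) / (1 - x $ i \<bullet> x $ j) * (v $ i \<bullet> w $ i) - 1 / (1 - x $ i \<bullet> x $ j) * (v $ j \<bullet> w $ i)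
        - (v $ i \<bullet> x $ j + x $ i \<bullet> v $ j) / (1 - x $ i \<bullet> x $ j)\<^sup>2 * (x $ j \<bullet> w $ i)))" (is "_ = 2 * (\<Sum>i\<in>UNIV. \<Sum>j\<in>UNIV - {i}. ?h i j)")
  proof -
    have "?L = (\<Sum>i\<in>UNIV. \<Sum>j\<in>UNIV - {i}. ?h i j + ?h j i)"
      by (intro sum.cong refl)
         (simp add: inner_commute add_divide_distrib diff_divide_distrib algebra_simps)
    also have "\<dots> = (\<Sum>i\<in>UNIV. \<Sum>j\<in>UNIV - {i}. ?h i j) + (\<Sum>i\<in>UNIV. \<Sum>j\<in>UNIV - {i}. ?h j i)"
      by (simp only: sum.distrib)
    also have "\<dots> = 2 * (\<Sum>i\<in>UNIV. \<Sum>j\<in>UNIV - {i}. ?h i j)"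
      using sum_offdiag_swap[of ?h] by simp
    finally show ?thesis .
  qed
  also have "2 * (\<Sum>i\<in>UNIV. \<Sum>j\<in>UNIV - {i}. ?h i j) / 2 + ?R = hess_vec \<Gamma> x \<xi> v \<bullet> w"
    unfolding inner_vec_def[of "hess_vec \<Gamma> x \<xi> v" w]
    unfolding hess_vec_def
    by (simp add: inner_diff_left inner_sum_left sum.distrib[symmetric] sum_subtractf mult_ac sum_negf)
  finally show ?thesis .
qed

end

section \<open>The symplectic slice and its linearized flow\<close>

lemma span_subspaceD: "y \<in> span S \<Longrightarrow> subspace S \<Longrightarrow> y \<in> S"
  by (metis span_eq_iff)

lemma cross3_sum:
  "cross3 (sum f A) y = (\<Sum>i\<in>A. cross3 (f i) y)" "cross3 y (sum f A) = (\<Sum>i\<in>A. cross3 y (f i))"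
  by (induction A rule: infinite_finite_induct) (simp_all add: cross_add_left cross_add_right)

lemma eq_minus_self_zero: "a = - a \<Longrightarrow> a = (0::'a::real_vector)"
  using scaleR_2[of a] by (metis add.right_inverse scaleR_eq_0_iff zero_neq_numeral)

text \<open>Criticality only concerns the tangential part of the gradient, which vanishes when the gradient at each vortex
is radial.\<close>

lemma angular_velocityI:
  assumes x: "x \<in> phase_space"
    and crit: "\<And>i. \<exists>\<kappa>. \<xi> - (\<Sum>j\<in>UNIV - {i}. (\<Gamma> j / (1 - x $ i \<bullet> x $ j)) *\<^sub>R x $ j) = \<kappa> *\<^sub>R x $ i"
  shows "angular_velocity \<Gamma> x \<xi>"
  unfolding angular_velocity_def critical_point_def
proof (intro conjI ballI x)
  fix w assume w: "w \<in> tangent_space x"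
  have "w $ i \<bullet> (\<xi> - (\<Sum>j\<in>UNIV - {i}. (\<Gamma> j / (1 - x $ i \<bullet> x $ j)) *\<^sub>R x $ j)) = 0" for i
    using crit[of i] w by (auto simp: tangent_space_def)
  with augmented_hamiltonian_derivative[OF x w w, of \<Gamma> _ \<xi>]
  show "((\<lambda>t. augmented_hamiltonian \<Gamma> (centre_of_vorticity \<Gamma> x) \<xi> (to_spheres (x + t *\<^sub>R w))) has_real_derivative 0) (at 0)"
    by simp
qed

lemma augmented_hamiltonian_0: "augmented_hamiltonian \<Gamma> \<mu> 0 = hamiltonian \<Gamma>"
  by (simp add: augmented_hamiltonian_def fun_eq_iff)

lemma subspace_tangent_space: "subspace (tangent_space x)"
  by (auto simp: subspace_def tangent_space_def inner_add_left)

lemma centre_of_vorticity_add: "centre_of_vorticity \<Gamma> (v + w) = centre_of_vorticity \<Gamma> v + centre_of_vorticity \<Gamma> w"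
  by (simp add: centre_of_vorticity_def scaleR_add_right sum.distrib)

lemma centre_of_vorticity_scaleR: "centre_of_vorticity \<Gamma> (c *\<^sub>R v) = c *\<^sub>R centre_of_vorticity \<Gamma> v"
  by (simp add: centre_of_vorticity_def scaleR_sum_right scaleR_scaleR mult.commute)

lemma subspace_orbit_tangent_space: "subspace (orbit_tangent_space \<mu> x)"
proof (rule subspaceI)
  show "0 \<in> orbit_tangent_space \<mu> x"
    by (auto simp: orbit_tangent_space_def vec_eq_iff intro!: exI[of _ 0])
  show "v + w \<in> orbit_tangent_space \<mu> x" if "v \<in> orbit_tangent_space \<mu> x" "w \<in> orbit_tangent_space \<mu> x" for v w
  proof -
    from that obtain a b where "v = (\<chi> i. cross3 a (x $ i))" "cross3 a \<mu> = 0" "w = (\<chi> i. cross3 b (x $ i))" "cross3 b \<mu> = 0"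
      by (auto simp: orbit_tangent_space_def)
    then show ?thesis
      by (auto simp: orbit_tangent_space_def vec_eq_iff cross_add_left intro!: exI[of _ "a + b"])
  qed
  show "c *\<^sub>R v \<in> orbit_tangent_space \<mu> x" if "v \<in> orbit_tangent_space \<mu> x" for c v
  proof -
    from that obtain a where "v = (\<chi> i. cross3 a (x $ i))" "cross3 a \<mu> = 0"
      by (auto simp: orbit_tangent_space_def)
    then show ?thesis
      by (auto simp: orbit_tangent_space_def vec_eq_iff cross_mult_left intro!: exI[of _ "c *\<^sub>R a"])
  qed
qed

lemma subspace_symplectic_slice: "subspace (symplectic_slice \<Gamma> x)"
proof -
  have "subspace {v. centre_of_vorticity \<Gamma> v = 0}"
    by (rule subspaceI)
      (auto simp: centre_of_vorticity_add centre_of_vorticity_scaleR, simp add: centre_of_vorticity_def)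
  then show ?thesis unfolding symplectic_slice_def
    by (intro subspace_inter subspace_tangent_space subspace_orthogonal_comp)
qed

lemma symplectic_slice_tangent: "v \<in> symplectic_slice \<Gamma> x \<Longrightarrow> v \<in> tangent_space x"
  by (simp add: symplectic_slice_def)

text \<open>The vector that represents the functional \<open>symplectic_form \<Gamma> x u\<close> in the ambient inner product.\<close>

definition dual_vec :: "('m::finite \<Rightarrow> real) \<Rightarrow> real^3^'m \<Rightarrow> real^3^'m \<Rightarrow> real^3^'m" where
  "dual_vec \<Gamma> x u = (\<chi> i. \<Gamma> i *\<^sub>R cross3 (x $ i) (u $ i))"

lemma symplectic_form_eq_inner: "symplectic_form \<Gamma> x u w = dual_vec \<Gamma> x u \<bullet> w"
proof -
  have "a \<bullet> cross3 b c = cross3 a b \<bullet> c" for a b c :: "real^3"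
    by (simp add: cross3_simps)
  then show ?thesis
    unfolding symplectic_form_def dual_vec_def inner_vec_def[where 'a = "real^3"] by simp
qed

lemma symplectic_form_swap: "symplectic_form \<Gamma> x u w = - symplectic_form \<Gamma> x w u"
proof -
  have "a \<bullet> cross3 b c = - (a \<bullet> cross3 c b)" for a b c :: "real^3"
    by (simp add: cross3_simps)
  from this[of "x $ i" "u $ i" "w $ i" for i] show ?thesis
    unfolding symplectic_form_def by (simp add: sum_negf[symmetric])
qed

lemma symplectic_form_linear:
  "symplectic_form \<Gamma> x (u + v) w = symplectic_form \<Gamma> x u w + symplectic_form \<Gamma> x v w"
  "symplectic_form \<Gamma> x (u - v) w = symplectic_form \<Gamma> x u w - symplectic_form \<Gamma> x v w"
  "symplectic_form \<Gamma> x (c *\<^sub>R u) w = c * symplectic_form \<Gamma> x u w"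
  "symplectic_form \<Gamma> x u (v + w) = symplectic_form \<Gamma> x u v + symplectic_form \<Gamma> x u w"
  "symplectic_form \<Gamma> x u (v - w) = symplectic_form \<Gamma> x u v - symplectic_form \<Gamma> x u w"
  "symplectic_form \<Gamma> x u (c *\<^sub>R w) = c * symplectic_form \<Gamma> x u w"
proof -
  have d: "dual_vec \<Gamma> x (u + v) = dual_vec \<Gamma> x u + dual_vec \<Gamma> x v"
    "dual_vec \<Gamma> x (u - v) = dual_vec \<Gamma> x u - dual_vec \<Gamma> x v"
    "dual_vec \<Gamma> x (c *\<^sub>R u) = c *\<^sub>R dual_vec \<Gamma> x u"
    by (simp_all add: dual_vec_def vec_eq_iff[where 'a = "real^3"] right_diff_distrib cross3_simps)
  show "symplectic_form \<Gamma> x (u + v) w = symplectic_form \<Gamma> x u w + symplectic_form \<Gamma> x v w"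
  "symplectic_form \<Gamma> x (u - v) w = symplectic_form \<Gamma> x u w - symplectic_form \<Gamma> x v w"
  "symplectic_form \<Gamma> x (c *\<^sub>R u) w = c * symplectic_form \<Gamma> x u w"
  "symplectic_form \<Gamma> x u (v + w) = symplectic_form \<Gamma> x u v + symplectic_form \<Gamma> x u w"
  "symplectic_form \<Gamma> x u (v - w) = symplectic_form \<Gamma> x u v - symplectic_form \<Gamma> x u w"
  "symplectic_form \<Gamma> x u (c *\<^sub>R w) = c * symplectic_form \<Gamma> x u w"
    by (simp_all add: symplectic_form_eq_inner d inner_add_left inner_diff_left inner_add_right inner_diff_right)
qed

text \<open>The centre of vorticity is a momentum map: rotations are generated by its components.\<close>

lemma symplectic_form_orbit:
  assumes "x \<in> phase_space" "u \<in> tangent_space x"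
  shows "symplectic_form \<Gamma> x u (\<chi> i. cross3 \<zeta> (x $ i)) = - (centre_of_vorticity \<Gamma> u \<bullet> \<zeta>)"
proof -
  have "x $ i \<bullet> cross3 (u $ i) (cross3 \<zeta> (x $ i)) = - (u $ i \<bullet> \<zeta>)" for i
    using phase_spaceD(2)[OF assms(1), of i] assms(2)
    by (simp add: Lagrange inner_diff_right tangent_space_def inner_commute)
  then show ?thesis
    by (simp add: symplectic_form_def centre_of_vorticity_def inner_sum_left sum_negf)
qed

text \<open>The kernel of the derivative of the momentum map has as its symplectic complement the rotational directions, and
the slice is a complement, inside the kernel, of those rotational directions that lie in the kernel. Hence a null vector of the
slice is an infinitesimal rotation fixing the momentum, and it is orthogonal to itself.\<close>

lemma slice_nondegenerate:
  fixes x u :: "real^3^'m::finite"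
  assumes x: "x \<in> phase_space" and \<Gamma>: "\<forall>i. \<Gamma> i \<noteq> 0" and u: "u \<in> symplectic_slice \<Gamma> x"
    and null: "\<And>w. w \<in> symplectic_slice \<Gamma> x \<Longrightarrow> symplectic_form \<Gamma> x u w = 0"
  shows "u = 0"
proof -
  let ?\<mu> = "centre_of_vorticity \<Gamma> x"
  let ?O = "orbit_tangent_space ?\<mu> x"
  have rot: "centre_of_vorticity \<Gamma> (\<chi> i. cross3 \<zeta> (x $ i)) = cross3 \<zeta> ?\<mu>" for \<zeta>
    by (simp add: centre_of_vorticity_def cross3_sum cross_mult_right)
  have rott: "(\<chi> i. cross3 \<zeta> (x $ i)) \<in> tangent_space x" for \<zeta>
    by (simp add: tangent_space_def inner_commute dot_cross_self)
  from u have ut: "u \<in> tangent_space x" and u0: "centre_of_vorticity \<Gamma> u = 0"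
    and uo: "\<And>z. z \<in> ?O \<Longrightarrow> orthogonal u z"
    by (auto simp: symplectic_slice_def orthogonal_comp_def orthogonal_commute)
  \<comment> \<open>The orbit directions in the kernel pair trivially with \<open>u\<close>, so \<open>u\<close> is orthogonal to the whole kernel.\<close>
  have null': "symplectic_form \<Gamma> x u w = 0" if wt: "w \<in> tangent_space x" and w0: "centre_of_vorticity \<Gamma> w = 0" for w
  proof -
    obtain y z where y: "y \<in> span ?O" and z: "\<And>a. a \<in> span ?O \<Longrightarrow> orthogonal z a" and w: "w = y + z"
      using orthogonal_subspace_decomp_exists[of ?O w] by blast
    have yO: "y \<in> ?O" using y span_subspaceD subspace_orbit_tangent_space by blast
    then obtain \<zeta> where \<zeta>: "y = (\<chi> i. cross3 \<zeta> (x $ i))" "cross3 \<zeta> ?\<mu> = 0"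
      by (auto simp: orbit_tangent_space_def)
    have "z = w - y" using w by simp
    then have "z \<in> tangent_space x"
      using wt rott[of \<zeta>] \<zeta> subspace_diff[OF subspace_tangent_space] by auto
    moreover have "centre_of_vorticity \<Gamma> z = 0"
      using w0 rot[of \<zeta>] \<zeta> unfolding w by (simp add: centre_of_vorticity_add)
    ultimately have "z \<in> symplectic_slice \<Gamma> x"
      using z span_superset[of ?O] by (auto simp: symplectic_slice_def orthogonal_comp_def orthogonal_commute)
    then have "symplectic_form \<Gamma> x u z = 0" by (rule null)
    moreover have "symplectic_form \<Gamma> x u y = 0"
      unfolding \<zeta> symplectic_form_orbit[OF x ut] u0 by simp
    ultimately show ?thesis unfolding w by (simp add: symplectic_form_linear)
  qed
  \<comment> \<open>The orthogonal complement of that kernel: radial vectors and gradients of components of the centre of vorticity.\<close>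
  define T :: "(real^3^'m) set" where "T = {(\<chi> i. a i *\<^sub>R x $ i + \<Gamma> i *\<^sub>R \<zeta>) | a \<zeta>. True}"
  have T: "subspace T"
  proof (rule subspaceI)
    show "0 \<in> T" by (auto simp: T_def vec_eq_iff[where 'a = "real^3"] intro!: exI[of _ "\<lambda>_. 0"] exI[of _ 0])
    show "v + w \<in> T" if "v \<in> T" "w \<in> T" for v w
    proof -
      from that obtain a b \<zeta> \<zeta>' where "v = (\<chi> i. a i *\<^sub>R x $ i + \<Gamma> i *\<^sub>R \<zeta>)" "w = (\<chi> i. b i *\<^sub>R x $ i + \<Gamma> i *\<^sub>R \<zeta>')"
        by (auto simp: T_def)
      then have "v + w = (\<chi> i. (a i + b i) *\<^sub>R x $ i + \<Gamma> i *\<^sub>R (\<zeta> + \<zeta>'))"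
        by (simp add: vec_eq_iff[where 'a = "real^3"] algebra_simps)
      then show ?thesis unfolding T_def
        by (intro CollectI exI[of _ "\<lambda>i. a i + b i"] exI[of _ "\<zeta> + \<zeta>'"] conjI TrueI)
    qed
    show "c *\<^sub>R v \<in> T" if "v \<in> T" for c v
    proof -
      from that obtain a \<zeta> where "v = (\<chi> i. a i *\<^sub>R x $ i + \<Gamma> i *\<^sub>R \<zeta>)" by (auto simp: T_def)
      then have "c *\<^sub>R v = (\<chi> i. (c * a i) *\<^sub>R x $ i + \<Gamma> i *\<^sub>R (c *\<^sub>R \<zeta>))"
        by (simp add: vec_eq_iff[where 'a = "real^3"] algebra_simps)
      then show ?thesis unfolding T_def
        by (intro CollectI exI[of _ "\<lambda>i. c * a i"] exI[of _ "c *\<^sub>R \<zeta>"] conjI TrueI)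
    qed
  qed
  have "dual_vec \<Gamma> x u \<in> T"
  proof -
    obtain y z where y: "y \<in> span T" and z: "\<And>a. a \<in> span T \<Longrightarrow> orthogonal z a" and w: "dual_vec \<Gamma> x u = y + z"
      using orthogonal_subspace_decomp_exists[of T "dual_vec \<Gamma> x u"] by blast
    have "z $ i \<bullet> x $ i = 0" for i
    proof -
      have "(\<chi> j. (if j = i then 1 else 0) *\<^sub>R x $ j + \<Gamma> j *\<^sub>R 0) \<in> T"
        unfolding T_def by (intro CollectI exI conjI TrueI) (rule refl)
      from z[OF span_base[OF this]] have "(\<Sum>j\<in>UNIV. z $ j \<bullet> ((if j = i then 1 else 0) *\<^sub>R x $ j)) = 0"
        by (simp add: orthogonal_def inner_vec_def[where 'a = "real^3"])
      moreover have "(\<Sum>j\<in>UNIV. z $ j \<bullet> ((if j = i then 1 else 0) *\<^sub>R x $ j)) = (\<Sum>j\<in>UNIV. if j = i then z $ i \<bullet> x $ i else 0)"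
        by (rule sum.cong) auto
      ultimately show ?thesis by simp
    qed
    then have zt: "z \<in> tangent_space x" by (simp add: tangent_space_def)
    have "centre_of_vorticity \<Gamma> z \<bullet> \<zeta> = 0" for \<zeta>
    proof -
      have "(\<chi> j. 0 *\<^sub>R x $ j + \<Gamma> j *\<^sub>R \<zeta>) \<in> T"
        unfolding T_def by (intro CollectI exI[of _ "\<lambda>_. 0"] exI conjI TrueI) (rule refl)
      from z[OF span_base[OF this]] show ?thesis
        by (simp add: orthogonal_def inner_vec_def[where 'a = "real^3"] centre_of_vorticity_def inner_sum_left)
    qed
    then have z0: "centre_of_vorticity \<Gamma> z = 0" using inner_eq_zero_iff by blast
    have "dual_vec \<Gamma> x u \<bullet> z = 0"
      using null'[OF zt z0] by (simp add: symplectic_form_eq_inner)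
    moreover have "y \<bullet> z = 0" using z[OF y] by (simp add: orthogonal_def inner_commute)
    ultimately have "z = 0" unfolding w by (simp add: inner_add_left)
    then show ?thesis using w span_subspaceD[OF y T] by simp
  qed
  then obtain a \<zeta> where "dual_vec \<Gamma> x u = (\<chi> i. a i *\<^sub>R x $ i + \<Gamma> i *\<^sub>R \<zeta>)" by (auto simp: T_def)
  then have eq: "\<Gamma> i *\<^sub>R cross3 (x $ i) (u $ i) = a i *\<^sub>R x $ i + \<Gamma> i *\<^sub>R \<zeta>" for i
    by (simp add: dual_vec_def vec_eq_iff[where 'a = "real^3"])
  \<comment> \<open>Taking the cross product with \<open>x $ i\<close> inverts \<open>dual_vec\<close> on tangent vectors and removes the radial part.\<close>
  have u_rot: "u $ i = cross3 \<zeta> (x $ i)" for i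
  proof -
    have "cross3 (cross3 (x $ i) (u $ i)) (x $ i) = - cross3 (x $ i) (cross3 (x $ i) (u $ i))"
      by (simp add: cross_skew[of "cross3 (x $ i) (u $ i)"])
    also have "\<dots> = u $ i"
      using ut phase_spaceD(2)[OF x, of i] by (simp add: Lagrange tangent_space_def inner_commute)
    finally have "\<Gamma> i *\<^sub>R u $ i = cross3 (\<Gamma> i *\<^sub>R cross3 (x $ i) (u $ i)) (x $ i)"
      by (simp add: cross_mult_left)
    also have "\<dots> = \<Gamma> i *\<^sub>R cross3 \<zeta> (x $ i)"
      unfolding eq by (simp add: cross_add_left cross_mult_left)
    finally show ?thesis using \<Gamma> by simp
  qed
  then have ueq: "u = (\<chi> i. cross3 \<zeta> (x $ i))" by (simp add: vec_eq_iff[where 'a = "real^3"])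
  then have "cross3 \<zeta> ?\<mu> = 0" using rot[of \<zeta>] u0 by simp
  then have "u \<in> ?O" using ueq by (auto simp: orbit_tangent_space_def)
  from uo[OF this] show "u = 0" by (simp add: orthogonal_self)
qed

text \<open>The operator is defined by a definite description; nondegeneracy gives uniqueness.\<close>

lemma slice_linearization_eqI:
  assumes x: "x \<in> phase_space" and \<Gamma>: "\<forall>i. \<Gamma> i \<noteq> 0" and u: "u \<in> symplectic_slice \<Gamma> x"
    and eq: "\<And>w. w \<in> symplectic_slice \<Gamma> x \<Longrightarrow> symplectic_form \<Gamma> x u w = slice_hessian \<Gamma> x \<xi> v w"
  shows "slice_linearization \<Gamma> x \<xi> v = u"
  unfolding slice_linearization_def
proof (rule the_equality)
  show "u \<in> symplectic_slice \<Gamma> x \<and> (\<forall>w\<in>symplectic_slice \<Gamma> x. symplectic_form \<Gamma> x u w = slice_hessian \<Gamma> x \<xi> v w)"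
    using u eq by blast
  fix u' assume u': "u' \<in> symplectic_slice \<Gamma> x \<and> (\<forall>w\<in>symplectic_slice \<Gamma> x. symplectic_form \<Gamma> x u' w = slice_hessian \<Gamma> x \<xi> v w)"
  have "u' - u = 0"
    by (rule slice_nondegenerate[OF x \<Gamma>])
       (use u u' eq in \<open>auto simp: symplectic_form_linear intro: subspace_diff[OF subspace_symplectic_slice]\<close>)
  then show "u' = u" by simp
qed

text \<open>In finite dimension a nondegenerate form represents every linear functional: a vector of the slice orthogonal
to all represented functionals is a null vector of the form.\<close>

lemma slice_representable:
  fixes x h :: "real^3^'m::finite"
  assumes x: "x \<in> phase_space" and \<Gamma>: "\<forall>i. \<Gamma> i \<noteq> 0"
  shows "\<exists>u\<in>symplectic_slice \<Gamma> x. \<forall>w\<in>symplectic_slice \<Gamma> x. symplectic_form \<Gamma> x u w = h \<bullet> w"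
proof -
  let ?S = "symplectic_slice \<Gamma> x"
  note S = subspace_symplectic_slice[of \<Gamma> x]
  define W where "W = {y\<in>?S. \<exists>u\<in>?S. \<forall>w\<in>?S. symplectic_form \<Gamma> x u w = y \<bullet> w}"
  have W: "subspace W"
  proof (rule subspaceI)
    show "0 \<in> W" using subspace_0[OF S] by (auto simp: W_def symplectic_form_def cross_zero_left intro!: bexI[of _ 0])
    show "y + z \<in> W" if "y \<in> W" "z \<in> W" for y z
    proof -
      from that obtain u u' where "u \<in> ?S" "\<forall>w\<in>?S. symplectic_form \<Gamma> x u w = y \<bullet> w"
        "u' \<in> ?S" "\<forall>w\<in>?S. symplectic_form \<Gamma> x u' w = z \<bullet> w" by (auto simp: W_def)
      then have "u + u' \<in> ?S" "\<forall>w\<in>?S. symplectic_form \<Gamma> x (u + u') w = (y + z) \<bullet> w"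
        using subspace_add[OF S] by (auto simp: symplectic_form_linear inner_add_left)
      then show ?thesis using that subspace_add[OF S] by (auto simp: W_def)
    qed
    show "c *\<^sub>R y \<in> W" if "y \<in> W" for c y
    proof -
      from that obtain u where "u \<in> ?S" "\<forall>w\<in>?S. symplectic_form \<Gamma> x u w = y \<bullet> w" by (auto simp: W_def)
      then have "c *\<^sub>R u \<in> ?S" "\<forall>w\<in>?S. symplectic_form \<Gamma> x (c *\<^sub>R u) w = (c *\<^sub>R y) \<bullet> w"
        using subspace_scale[OF S] by (auto simp: symplectic_form_linear)
      then show ?thesis using that subspace_scale[OF S] by (auto simp: W_def)
    qed
  qed
  have decS: "\<exists>y\<in>?S. \<forall>w\<in>?S. h \<bullet> w = y \<bullet> w" for h
  proof -
    obtain y z where "y \<in> span ?S" and z: "\<And>a. a \<in> span ?S \<Longrightarrow> orthogonal z a" and h: "h = y + z"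
      using orthogonal_subspace_decomp_exists[of ?S h] by blast
    then have "y \<in> ?S" using span_subspaceD S by blast
    then show ?thesis using z span_superset[of ?S] unfolding h
      by (intro bexI[of _ y]) (auto simp: inner_add_left orthogonal_def)
  qed
  have "y \<in> W" if y: "y \<in> ?S" for y
  proof -
    obtain p r where p: "p \<in> span W" and r: "\<And>a. a \<in> span W \<Longrightarrow> orthogonal r a" and yp: "y = p + r"
      using orthogonal_subspace_decomp_exists[of W y] by blast
    have pW: "p \<in> W" using p span_subspaceD W by blast
    then have "p \<in> ?S" by (simp add: W_def)
    then have rS: "r \<in> ?S" using yp y subspace_diff[OF S, of y p] by simp
    have "symplectic_form \<Gamma> x r u = 0" if u: "u \<in> ?S" for u
    proof -
      obtain q where q: "q \<in> ?S" "\<forall>w\<in>?S. dual_vec \<Gamma> x u \<bullet> w = q \<bullet> w" using decS by blast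
      then have "q \<in> W" using u by (auto simp: W_def symplectic_form_eq_inner)
      then have "r \<bullet> q = 0" using r[OF span_base] by (simp add: orthogonal_def)
      then have "symplectic_form \<Gamma> x u r = 0" using q(2) rS by (simp add: symplectic_form_eq_inner inner_commute)
      then show ?thesis by (subst symplectic_form_swap) simp
    qed
    from slice_nondegenerate[OF x \<Gamma> rS this] have "r = 0" .
    then show ?thesis using yp pW by simp
  qed
  with decS[of h] show ?thesis unfolding W_def by fastforce
qed

lemma slice_linearization_works:
  assumes x: "x \<in> phase_space" and \<Gamma>: "\<forall>i. \<Gamma> i \<noteq> 0" and v: "v \<in> symplectic_slice \<Gamma> x"
  shows "slice_linearization \<Gamma> x \<xi> v \<in> symplectic_slice \<Gamma> x"
    and "w \<in> symplectic_slice \<Gamma> x \<Longrightarrow>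
      symplectic_form \<Gamma> x (slice_linearization \<Gamma> x \<xi> v) w = slice_hessian \<Gamma> x \<xi> v w"
proof -
  obtain u where u: "u \<in> symplectic_slice \<Gamma> x" "\<forall>w\<in>symplectic_slice \<Gamma> x. symplectic_form \<Gamma> x u w = hess_vec \<Gamma> x \<xi> v \<bullet> w"
    using slice_representable[OF x \<Gamma>] by blast
  then have eq: "symplectic_form \<Gamma> x u w = slice_hessian \<Gamma> x \<xi> v w" if "w \<in> symplectic_slice \<Gamma> x" for w
    using that hessian_augmented_hamiltonian[OF x symplectic_slice_tangent[OF v] symplectic_slice_tangent[OF that]]
    by (simp add: slice_hessian_def)
  have L: "slice_linearization \<Gamma> x \<xi> v = u"
    by (rule slice_linearization_eqI[OF x \<Gamma> u(1) eq])
  show "slice_linearization \<Gamma> x \<xi> v \<in> symplectic_slice \<Gamma> x" using L u by simp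
  show "w \<in> symplectic_slice \<Gamma> x \<Longrightarrow>
      symplectic_form \<Gamma> x (slice_linearization \<Gamma> x \<xi> v) w = slice_hessian \<Gamma> x \<xi> v w"
    using L eq by simp
qed

section \<open>Conserved quantities\<close>

lemma solution_component:
  assumes "solution_on \<Gamma> I u" "t \<in> I"
  shows "((\<lambda>t. u t $ i) has_vector_derivative vortex_field \<Gamma> (u t) $ i) (at t within I)"
  by (rule bounded_linear.has_vector_derivative[OF bounded_linear_vec_nth])
    (use assms in \<open>simp add: solution_on_def\<close>)

text \<open>The mutual velocities of two vortices, weighted with the vorticities, are opposite.\<close>

lemma centre_of_vorticity_conserved:
  assumes u: "solution_on \<Gamma> I u" and I: "is_interval I" "s \<in> I" "t \<in> I"
  shows "centre_of_vorticity \<Gamma> (u s) = centre_of_vorticity \<Gamma> (u t)"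
proof -
  have "((\<lambda>t. centre_of_vorticity \<Gamma> (u t)) has_vector_derivative 0) (at t within I)" if t: "t \<in> I" for t
  proof -
    define x where "x = u t"
    have "((\<lambda>t. centre_of_vorticity \<Gamma> (u t)) has_vector_derivative (\<Sum>i\<in>UNIV. \<Gamma> i *\<^sub>R vortex_field \<Gamma> x $ i)) (at t within I)"
      unfolding centre_of_vorticity_def x_def
      by (intro has_vector_derivative_sum bounded_linear.has_vector_derivative[OF bounded_linear_scaleR_right] solution_component[OF u t])
    moreover have "(\<Sum>i\<in>UNIV. \<Gamma> i *\<^sub>R vortex_field \<Gamma> x $ i) = 0"
    proof -
      define f where "f i j = (\<Gamma> i * (\<Gamma> j / (1 - x $ i \<bullet> x $ j))) *\<^sub>R cross3 (x $ j) (x $ i)" for i j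
      have anti: "f i j = - f j i" for i j
        by (simp add: f_def inner_commute[of "x $ i"] cross_skew[of "x $ j"])
      have "(\<Sum>i\<in>UNIV. \<Gamma> i *\<^sub>R vortex_field \<Gamma> x $ i) = (\<Sum>i\<in>UNIV. \<Sum>j\<in>UNIV. f i j)"
      proof (rule sum.cong[OF refl])
        fix i
        have "\<Gamma> i *\<^sub>R vortex_field \<Gamma> x $ i = (\<Sum>j\<in>UNIV - {i}. f i j)"
          by (simp add: vortex_field_def f_def scaleR_sum_right)
        also have "\<dots> = (\<Sum>j\<in>UNIV. f i j)"
          by (rule sum.mono_neutral_left) (auto simp: f_def)
        finally show "\<Gamma> i *\<^sub>R vortex_field \<Gamma> x $ i = (\<Sum>j\<in>UNIV. f i j)" .
      qed
      moreover have "(\<Sum>i\<in>UNIV. \<Sum>j\<in>UNIV. f i j) = - (\<Sum>i\<in>UNIV. \<Sum>j\<in>UNIV. f i j)"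
      proof -
        have "(\<Sum>i\<in>UNIV. \<Sum>j\<in>UNIV. f i j) = (\<Sum>i\<in>UNIV. \<Sum>j\<in>UNIV. f j i)" by (rule sum.swap)
        also have "\<dots> = (\<Sum>i\<in>UNIV. \<Sum>j\<in>UNIV. - f i j)" by (intro sum.cong refl anti)
        finally show ?thesis by (simp add: sum_negf)
      qed
      ultimately show ?thesis using eq_minus_self_zero by metis
    qed
    ultimately show ?thesis by simp
  qed
  then have "\<exists>c. \<forall>t\<in>I. centre_of_vorticity \<Gamma> (u t) = c"
    using has_vector_derivative_zero_constant[OF is_interval_convex[OF I(1)]] by metis
  then show ?thesis using I by auto
qed

text \<open>The velocity of each vortex is orthogonal to the gradient of the energy at this vortex.\<close>

lemma hamiltonian_conserved:
  assumes u: "solution_on \<Gamma> I u" and I: "is_interval I" "s \<in> I" "t \<in> I"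
  shows "hamiltonian \<Gamma> (u s) = hamiltonian \<Gamma> (u t)"
proof -
  have "((\<lambda>t. hamiltonian \<Gamma> (u t)) has_vector_derivative 0) (at t within I)" if t: "t \<in> I" for t
  proof -
    define x y where "x = u t" and "y = vortex_field \<Gamma> x"
    have x: "x \<in> phase_space" using u t by (simp add: x_def solution_on_def)
    note dx = solution_component[OF u t, folded x_def, folded y_def]
    have y: "y $ i = cross3 (\<Sum>j\<in>UNIV - {i}. (\<Gamma> j / (1 - x $ i \<bullet> x $ j)) *\<^sub>R x $ j) (x $ i)" for i
      by (simp add: y_def vortex_field_def cross3_sum cross_mult_left)
    have yx: "y $ i \<bullet> x $ i = 0" for i unfolding y by (simp add: inner_commute dot_cross_self)
    have dist: "(norm (x $ i - x $ j))\<^sup>2 = 2 * (1 - x $ i \<bullet> x $ j)" for i j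
      unfolding power2_norm_eq_inner using phase_spaceD(2)[OF x]
      by (simp add: inner_diff_left inner_diff_right inner_commute)
    have "((\<lambda>t. ln ((norm (u t $ i - u t $ j))\<^sup>2)) has_real_derivative
        - (y $ i \<bullet> x $ j + x $ i \<bullet> y $ j) / (1 - x $ i \<bullet> x $ j)) (at t within I)" if "j \<in> UNIV - {i}" for i j
    proof -
      have pos: "(u t $ i - u t $ j) \<bullet> (u t $ i - u t $ j) > 0"
        using dist[of i j] phase_spaceD(3)[OF x, of i j] that by (simp add: x_def power2_norm_eq_inner)
      have "((\<lambda>t. (u t $ i - u t $ j) \<bullet> (u t $ i - u t $ j)) has_vector_derivative
          (x $ i - x $ j) \<bullet> (y $ i - y $ j) + (y $ i - y $ j) \<bullet> (x $ i - x $ j)) (at t within I)"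
        using bounded_bilinear.has_vector_derivative[OF bounded_bilinear_inner
            has_vector_derivative_diff[OF dx dx] has_vector_derivative_diff[OF dx dx], of i j i j]
        by (simp add: x_def)
      then have "((\<lambda>t. (u t $ i - u t $ j) \<bullet> (u t $ i - u t $ j)) has_real_derivative
          - 2 * (y $ i \<bullet> x $ j + x $ i \<bullet> y $ j)) (at t within I)"
        using yx[of i] yx[of j] unfolding has_real_derivative_iff_has_vector_derivative
        by (simp add: inner_diff_left inner_diff_right inner_commute algebra_simps)
      from DERIV_chain'[OF this DERIV_ln_divide[OF pos]]
      have "((\<lambda>t. ln ((u t $ i - u t $ j) \<bullet> (u t $ i - u t $ j))) has_real_derivative
          - 2 * (y $ i \<bullet> x $ j + x $ i \<bullet> y $ j) / (2 * (1 - x $ i \<bullet> x $ j))) (at t within I)"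
        unfolding x_def[symmetric] dist[of i j, unfolded power2_norm_eq_inner] by simp
      moreover have "- 2 * A / (2 * B) = - A / B" for A B :: real by simp
      ultimately show ?thesis by (simp only: power2_norm_eq_inner)
    qed
    then have "((\<lambda>t. hamiltonian \<Gamma> (u t)) has_real_derivative
      (\<Sum>i\<in>UNIV. \<Sum>j\<in>UNIV - {i}. \<Gamma> i * \<Gamma> j * (- (y $ i \<bullet> x $ j + x $ i \<bullet> y $ j) / (1 - x $ i \<bullet> x $ j))) / 2) (at t within I)"
      unfolding hamiltonian_def by (intro DERIV_cdivide DERIV_sum DERIV_cmult)
    moreover have "(\<Sum>i\<in>UNIV. \<Sum>j\<in>UNIV - {i}. \<Gamma> i * \<Gamma> j * (- (y $ i \<bullet> x $ j + x $ i \<bullet> y $ j) / (1 - x $ i \<bullet> x $ j))) = 0"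
    proof -
      define f where "f i j = - (\<Gamma> i * \<Gamma> j * ((y $ i \<bullet> x $ j) / (1 - x $ i \<bullet> x $ j)))" for i j
      have "(\<Sum>j\<in>UNIV - {i}. f i j) = 0" for i
      proof -
        have "(\<Sum>j\<in>UNIV - {i}. f i j) = - \<Gamma> i * (y $ i \<bullet> (\<Sum>j\<in>UNIV - {i}. (\<Gamma> j / (1 - x $ i \<bullet> x $ j)) *\<^sub>R x $ j))"
          by (simp add: f_def inner_sum_right sum_distrib_left sum_negf mult.assoc)
        also have "\<dots> = 0" unfolding y by (simp add: inner_commute dot_cross_self)
        finally show ?thesis .
      qed
      moreover have "(\<Sum>i\<in>UNIV. \<Sum>j\<in>UNIV - {i}. \<Gamma> i * \<Gamma> j * (- (y $ i \<bullet> x $ j + x $ i \<bullet> y $ j) / (1 - x $ i \<bullet> x $ j)))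
        = (\<Sum>i\<in>UNIV. \<Sum>j\<in>UNIV - {i}. f i j) + (\<Sum>i\<in>UNIV. \<Sum>j\<in>UNIV - {i}. f j i)"
        unfolding sum.distrib[symmetric]
        by (intro sum.cong refl) (simp add: f_def inner_commute add_divide_distrib diff_divide_distrib algebra_simps)
      ultimately show ?thesis using sum_offdiag_swap[of f] by simp
    qed
    ultimately show ?thesis by (simp add: has_real_derivative_iff_has_vector_derivative)
  qed
  then have "\<exists>c. \<forall>t\<in>I. hamiltonian \<Gamma> (u t) = c"
    using has_vector_derivative_zero_constant[OF is_interval_convex[OF I(1)]] by metis
  then show ?thesis using I by auto
qed

section \<open>Trigonometric sums over the vertices of regular polygons\<close>

text \<open>A geometric sum over nontrivial powers of a root of unity.\<close>

lemma sum_cis_arith_progression: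
  fixes M l :: nat
  assumes "M > 0" "\<not> M dvd l"
  shows "(\<Sum>m<M. cis (2 * pi * real l / real M * real m + a)) = 0"
proof -
  define z where "z = cis (2 * pi * real l / real M)"
  have "z ^ M = 1"
  proof -
    have "real M * (2 * pi * real l / real M) = 2 * pi * real l" using assms(1) by simp
    then have "z ^ M = cis (2 * pi * real l)" by (simp only: z_def Complex.DeMoivre)
    also have "\<dots> = 1" by (rule cis_multiple_2pi) simp
    finally show ?thesis .
  qed
  have "z \<noteq> 1"
  proof
    assume "z = 1"
    then have "cos (2 * pi * real l / real M) = 1" by (simp add: z_def complex_eq_iff)
    then obtain n :: int where "2 * pi * real l / real M = of_int n * 2 * pi"
      using cos_one_2pi_int by blast
    then have "real l = of_int n * real M" using assms(1) by (simp add: field_simps)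
    then have "int l = n * int M" by (metis of_int_eq_iff of_int_mult of_int_of_nat_eq)
    then show False using assms(2) by (metis dvd_triv_right int_dvd_int_iff)
  qed
  have "(\<Sum>m<M. cis (2 * pi * real l / real M * real m + a)) = (\<Sum>m<M. z ^ m) * cis a"
    unfolding sum_distrib_right z_def by (simp add: Complex.DeMoivre cis_mult mult.commute add.commute)
  also have "(\<Sum>m<M. z ^ m) = 0"
    using \<open>z \<noteq> 1\<close> \<open>z ^ M = 1\<close> by (simp add: sum_gp_strict)
  finally show ?thesis by simp
qed

lemma sum_cos_sin_arith_progression:
  fixes M l :: nat
  assumes "M > 0" "\<not> M dvd l"
  shows "(\<Sum>m<M. cos (2 * pi * real l / real M * real m + a)) = 0"
    and "(\<Sum>m<M. sin (2 * pi * real l / real M * real m + a)) = 0"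
  using arg_cong[OF sum_cis_arith_progression[OF assms, of a], of Re]
    arg_cong[OF sum_cis_arith_progression[OF assms, of a], of Im] by simp_all

text \<open>Longitudes, relative to a given vortex, of the vortices of its own ring (\<open>evenpt\<close>) and of the opposite ring
(\<open>oddpt\<close>).\<close>

definition evenpt :: "nat \<Rightarrow> nat \<Rightarrow> real" where "evenpt N j = pi * (2 * real j) / real N"

definition oddpt :: "nat \<Rightarrow> nat \<Rightarrow> real" where "oddpt N j = pi * (2 * real j + 1) / real N"

lemma sum_cos_oddpt:
  assumes "0 < k" "k < N"
  shows "(\<Sum>j<N. cos (real k * oddpt N j)) = 0"
proof -
  have "real k * oddpt N j = 2 * pi * real k / real N * real j + pi * real k / real N" for j
    using assms by (simp add: oddpt_def field_simps)
  moreover have "\<not> N dvd k" using assms by (auto dest: dvd_imp_le)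
  ultimately show ?thesis using sum_cos_sin_arith_progression(1)[of N k "pi * real k / real N"] assms by simp
qed

lemma sum_cos_evenpt:
  assumes "0 < k" "k < N"
  shows "(\<Sum>j\<in>{1..<N}. cos (real k * evenpt N j)) = - 1"
proof -
  have "real k * evenpt N j = 2 * pi * real k / real N * real j + 0" for j
    using assms by (simp add: evenpt_def field_simps)
  moreover have "\<not> N dvd k" using assms by (auto dest: dvd_imp_le)
  ultimately have "(\<Sum>j<N. cos (real k * evenpt N j)) = 0"
    using sum_cos_sin_arith_progression(1)[of N k 0] assms by simp
  moreover have "{..<N} = insert 0 {1..<N}" using assms by auto
  ultimately show ?thesis by (simp add: evenpt_def)
qed

lemma cos_lt_1:
  assumes "0 < x" "x < 2 * pi" shows "cos x < 1"
proof (rule ccontr)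
  assume "\<not> cos x < 1"
  then have "cos x = 1" using cos_le_one[of x] by linarith
  then obtain n :: int where n: "x = of_int n * 2 * pi" using cos_one_2pi_int by blast
  have "0 < of_int n * (2 * pi)" "of_int n * (2 * pi) < 1 * (2 * pi)" using assms n by simp_all
  then have "0 < real_of_int n" "real_of_int n < 1"
    by (simp_all add: zero_less_mult_iff)
  then show False by simp
qed

lemma cos_oddpt_lt_1:
  assumes "j < N" "N \<ge> 2" shows "cos (oddpt N j) < 1"
proof (rule cos_lt_1)
  show "0 < oddpt N j" using assms by (simp add: oddpt_def)
  have "2 * real j + 1 < 2 * real N" using assms by linarith
  then have "pi * (2 * real j + 1) < pi * (2 * real N)" by simp
  then show "oddpt N j < 2 * pi" using assms by (simp add: oddpt_def field_simps)
qed

lemma cos_evenpt_lt_1: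
  assumes "j \<in> {1..<N}" shows "cos (evenpt N j) < 1"
proof (rule cos_lt_1)
  show "0 < evenpt N j" using assms by (simp add: evenpt_def)
  show "evenpt N j < 2 * pi" using assms by (simp add: evenpt_def field_simps)
qed

lemma cos_Suc_recurrence:
  "cos (real (Suc (Suc k)) * x) = 2 * cos x * cos (real (Suc k) * x) - cos (real k * x)"
proof -
  have "cos (real (Suc k) * x + x) + cos (real (Suc k) * x - x) = 2 * cos x * cos (real (Suc k) * x)"
    by (simp add: cos_add cos_diff)
  moreover have "real (Suc k) * x + x = real (Suc (Suc k)) * x" "real (Suc k) * x - x = real k * x"
    by (simp_all add: algebra_simps)
  ultimately show ?thesis by simp
qed

text \<open>The summands satisfy a linear recurrence in \<open>k\<close> whose inhomogeneous term is a sum of cosines with known value, so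
the sum has constant second difference \<open>- 2\<close> in \<open>k\<close>.\<close>

lemma sum_even_kernel:
  assumes "k \<le> N" "N > 0"
  shows "(\<Sum>j\<in>{1..<N}. (1 - cos (real k * evenpt N j)) / (1 - cos (evenpt N j))) = real k * (real N - real k)"
  using assms(1)
proof (induction k rule: induct_nat_012)
  case 1
  have "(1 - cos (real (Suc 0) * evenpt N j)) / (1 - cos (evenpt N j)) = 1" if "j \<in> {1..<N}" for j
    using cos_evenpt_lt_1[OF that] by simp
  then have "(\<Sum>j\<in>{1..<N}. (1 - cos (real (Suc 0) * evenpt N j)) / (1 - cos (evenpt N j))) = (\<Sum>j\<in>{1..<N}. 1)"
    by (intro sum.cong) auto
  then show ?case using assms(2) by (simp add: of_nat_diff)
next
  case (ge2 k)
  let ?U = "\<lambda>k j. (1 - cos (real k * evenpt N j)) / (1 - cos (evenpt N j))"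
  have "?U (Suc (Suc k)) j = 2 * ?U (Suc k) j - ?U k j + 2 * cos (real (Suc k) * evenpt N j)" if "j \<in> {1..<N}" for j
  proof -
    have "1 - cos (real (Suc (Suc k)) * evenpt N j) = 2 * (1 - cos (real (Suc k) * evenpt N j))
        - (1 - cos (real k * evenpt N j)) + 2 * cos (real (Suc k) * evenpt N j) * (1 - cos (evenpt N j))"
      unfolding cos_Suc_recurrence by (simp add: algebra_simps)
    moreover have "(2 * A - B + 2 * e * d) / d = 2 * (A / d) - B / d + 2 * e" if "d \<noteq> 0" for A B d e :: real
      using that by (simp add: field_simps)
    moreover have "1 - cos (evenpt N j) \<noteq> 0" using cos_evenpt_lt_1[OF that] by simp
    ultimately show ?thesis by (simp only: not_False_eq_True)
  qed
  then have "(\<Sum>j\<in>{1..<N}. ?U (Suc (Suc k)) j)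
      = (\<Sum>j\<in>{1..<N}. 2 * ?U (Suc k) j - ?U k j + 2 * cos (real (Suc k) * evenpt N j))"
    by (intro sum.cong) auto
  also have "\<dots> = 2 * (\<Sum>j\<in>{1..<N}. ?U (Suc k) j) - (\<Sum>j\<in>{1..<N}. ?U k j)
      + 2 * (\<Sum>j\<in>{1..<N}. cos (real (Suc k) * evenpt N j))"
    by (simp only: sum.distrib sum_subtractf sum_distrib_left)
  also have "\<dots> = 2 * (real (Suc k) * (real N - real (Suc k))) - real k * (real N - real k) + 2 * (- 1)"
    using ge2 sum_cos_evenpt[of "Suc k" N] by simp
  finally show ?case by (simp add: algebra_simps)
qed simp

lemma cosh_minus_cos_oddpt_pos:
  assumes "j < N" "N \<ge> 2" shows "cosh \<eta> - cos (oddpt N j) > (0::real)"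
  using cos_oddpt_lt_1[OF assms] cosh_real_ge_1[of \<eta>] by linarith

text \<open>\<open>sinh \<eta> / (cosh \<eta> - cos x)\<close> is the Poisson kernel of the disc at radius \<open>exp (- \<eta>)\<close>. The opposite ring enters all
formulas through such sums because \<open>1 - x \<bullet> y\<close> for vortices of opposite rings is a multiple of \<open>cosh \<eta> - cos\<close>.\<close>

definition odd_Poisson_sum :: "nat \<Rightarrow> nat \<Rightarrow> real \<Rightarrow> real" where
  "odd_Poisson_sum N k \<eta> = (\<Sum>j<N. cos (real k * oddpt N j) * (sinh \<eta> / (cosh \<eta> - cos (oddpt N j))))"

text \<open>Multiplication of the Poisson kernel by \<open>cos x\<close> is multiplication by \<open>cosh \<eta>\<close> up to a constant, so the sums satisfy the
recurrence of the hyperbolic functions, with initial values at \<open>k = 0\<close> and \<open>k = 1\<close>.\<close>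

lemma odd_Poisson_sum_hyperbolic:
  assumes "N \<ge> 2" "k \<le> N"
  shows "odd_Poisson_sum N k \<eta> = odd_Poisson_sum N 0 \<eta> * cosh (real k * \<eta>) - real N * sinh (real k * \<eta>)"
  using assms(2)
proof (induction k rule: induct_nat_012)
  case 1
  have "cos (real (Suc 0) * oddpt N j) * (sinh \<eta> / (cosh \<eta> - cos (oddpt N j)))
      = cos (real 0 * oddpt N j) * (sinh \<eta> / (cosh \<eta> - cos (oddpt N j))) * cosh \<eta> - sinh \<eta>" if "j < N" for j
    using cosh_minus_cos_oddpt_pos[OF that assms(1), of \<eta>] by (simp add: field_simps)
  then have "odd_Poisson_sum N (Suc 0) \<eta> = (\<Sum>j<N. cos (real 0 * oddpt N j) * (sinh \<eta> / (cosh \<eta> - cos (oddpt N j))) * cosh \<eta> - sinh \<eta>)"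
    unfolding odd_Poisson_sum_def by (intro sum.cong) auto
  then show ?case
    by (simp only: sum_subtractf sum_distrib_right[symmetric] odd_Poisson_sum_def[symmetric]) simp
next
  case (ge2 k)
  let ?p = "\<lambda>j. sinh \<eta> / (cosh \<eta> - cos (oddpt N j))"
  have "cos (real (Suc (Suc k)) * oddpt N j) * ?p j
      = 2 * cosh \<eta> * (cos (real (Suc k) * oddpt N j) * ?p j) - cos (real k * oddpt N j) * ?p j
        - 2 * sinh \<eta> * cos (real (Suc k) * oddpt N j)" if "j < N" for j
  proof -
    have "cos (oddpt N j) * ?p j = cosh \<eta> * ?p j - sinh \<eta>"
      using cosh_minus_cos_oddpt_pos[OF that assms(1), of \<eta>] by (simp add: field_simps)
    moreover have "cos (real (Suc (Suc k)) * oddpt N j) * ?p j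
      = 2 * cos (real (Suc k) * oddpt N j) * (cos (oddpt N j) * ?p j) - cos (real k * oddpt N j) * ?p j"
    proof -
      have "(2 * a * b - d) * p = 2 * b * (a * p) - d * p" for a b d p :: real by (simp add: algebra_simps)
      then show ?thesis unfolding cos_Suc_recurrence .
    qed
    moreover have "2 * b * (a * p - s) - d = 2 * a * (b * p) - d - 2 * s * b" for a b d p s :: real
      by (simp add: algebra_simps)
    ultimately show ?thesis by (simp only:)
  qed
  then have "odd_Poisson_sum N (Suc (Suc k)) \<eta>
      = (\<Sum>j<N. 2 * cosh \<eta> * (cos (real (Suc k) * oddpt N j) * ?p j) - cos (real k * oddpt N j) * ?p j
        - 2 * sinh \<eta> * cos (real (Suc k) * oddpt N j))"
    unfolding odd_Poisson_sum_def by (intro sum.cong) auto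
  also have "\<dots> = 2 * cosh \<eta> * odd_Poisson_sum N (Suc k) \<eta> - odd_Poisson_sum N k \<eta>
        - 2 * sinh \<eta> * (\<Sum>j<N. cos (real (Suc k) * oddpt N j))"
    by (simp only: odd_Poisson_sum_def sum_subtractf sum_distrib_left)
  also have "\<dots> = 2 * cosh \<eta> * odd_Poisson_sum N (Suc k) \<eta> - odd_Poisson_sum N k \<eta>"
    using ge2.prems sum_cos_oddpt[of "Suc k" N] by simp
  also have "\<dots> = odd_Poisson_sum N 0 \<eta> * (2 * cosh \<eta> * cosh (real (Suc k) * \<eta>) - cosh (real k * \<eta>))
      - real N * (2 * cosh \<eta> * sinh (real (Suc k) * \<eta>) - sinh (real k * \<eta>))"
  proof -
    have I: "odd_Poisson_sum N k \<eta> = odd_Poisson_sum N 0 \<eta> * cosh (real k * \<eta>) - real N * sinh (real k * \<eta>)"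
      "odd_Poisson_sum N (Suc k) \<eta> = odd_Poisson_sum N 0 \<eta> * cosh (real (Suc k) * \<eta>) - real N * sinh (real (Suc k) * \<eta>)"
      using ge2 by simp_all
    have "2 * a * (p * c' - M * s') - (p * c - M * s) = p * (2 * a * c' - c) - M * (2 * a * s' - s)"
      for a p c c' s s' M :: real by (simp add: algebra_simps)
    then show ?thesis unfolding I .
  qed
  also have "2 * cosh \<eta> * cosh (real (Suc k) * \<eta>) - cosh (real k * \<eta>) = cosh (real (Suc (Suc k)) * \<eta>)"
    using cosh_add[of "real (Suc k) * \<eta>" \<eta>] cosh_diff[of "real (Suc k) * \<eta>" \<eta>]
    by (simp add: algebra_simps)
  also have "2 * cosh \<eta> * sinh (real (Suc k) * \<eta>) - sinh (real k * \<eta>) = sinh (real (Suc (Suc k)) * \<eta>)"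
    using sinh_add[of "real (Suc k) * \<eta>" \<eta>] sinh_diff[of "real (Suc k) * \<eta>" \<eta>]
    by (simp add: algebra_simps)
  finally show ?case .
qed simp

text \<open>At \<open>k = N\<close> all cosines equal \<open>- 1\<close>, which gives a second relation between the sums for \<open>k = 0\<close> and \<open>k = N\<close>.\<close>

lemma odd_Poisson_sum_0:
  assumes "N \<ge> 2"
  shows "odd_Poisson_sum N 0 \<eta> = real N * tanh (real N * \<eta> / 2)"
proof -
  have "cos (real N * oddpt N j) = - 1" for j
  proof -
    have "real N * oddpt N j = real (2 * j + 1) * pi" using assms by (simp add: oddpt_def field_simps)
    then show ?thesis by (simp only: cos_npi) simp
  qed
  then have "odd_Poisson_sum N N \<eta> = - odd_Poisson_sum N 0 \<eta>"
    by (simp add: odd_Poisson_sum_def sum_negf)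
  with odd_Poisson_sum_hyperbolic[OF assms order_refl, of \<eta>]
  have e: "odd_Poisson_sum N 0 \<eta> * (1 + cosh (real N * \<eta>)) = real N * sinh (real N * \<eta>)"
    by (simp add: algebra_simps)
  define w where "w = real N * \<eta> / 2"
  have "real N * \<eta> = 2 * w" by (simp add: w_def)
  with e have "odd_Poisson_sum N 0 \<eta> * (2 * (cosh w)\<^sup>2) = real N * (2 * sinh w * cosh w)"
    by (simp add: cosh_double_cosh sinh_double)
  then have "odd_Poisson_sum N 0 \<eta> = real N * tanh w"
    using cosh_real_pos[of w] by (simp add: tanh_def field_simps power2_eq_square)
  then show ?thesis by (simp only: w_def)
qed

text \<open>The kernel with which the opposite ring enters the Hessian.\<close>

definition odd_kernel_sum :: "nat \<Rightarrow> nat \<Rightarrow> real \<Rightarrow> real" where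
  "odd_kernel_sum N k h = (\<Sum>j<N. (h * cos (oddpt N j) - 1) / (h - cos (oddpt N j))\<^sup>2 * cos (real k * oddpt N j))"

text \<open>The kernel is minus the derivative of the Poisson kernel with respect to \<open>\<eta>\<close>.\<close>

lemma odd_kernel_sum_closed:
  fixes \<eta> :: real
  assumes "N \<ge> 2" "k \<le> N"
  defines "T \<equiv> tanh (real N * \<eta> / 2)"
  shows "odd_kernel_sum N k (cosh \<eta>) = - real N * (real N / 2 * (1 - T\<^sup>2) * cosh (real k * \<eta>)
     + real k * T * sinh (real k * \<eta>) - real k * cosh (real k * \<eta>))"
proof -
  have d: "(odd_Poisson_sum N k has_real_derivative - odd_kernel_sum N k (cosh \<eta>)) (at \<eta>)"
    unfolding odd_Poisson_sum_def[abs_def] odd_kernel_sum_def sum_negf[symmetric]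
  proof (rule DERIV_sum)
    fix j assume "j \<in> {..<N}"
    then have p: "cosh \<eta> - cos (oddpt N j) > 0" using cosh_minus_cos_oddpt_pos assms(1) by simp
    have "((\<lambda>\<eta>. sinh \<eta> / (cosh \<eta> - cos (oddpt N j))) has_real_derivative
       (cosh \<eta> * (cosh \<eta> - cos (oddpt N j)) - sinh \<eta> * sinh \<eta>) / ((cosh \<eta> - cos (oddpt N j)) * (cosh \<eta> - cos (oddpt N j)))) (at \<eta>)"
      by (rule derivative_eq_intros refl | use p in simp)+
    moreover have "cosh \<eta> * (cosh \<eta> - cos (oddpt N j)) - sinh \<eta> * sinh \<eta> = - (cosh \<eta> * cos (oddpt N j) - 1)"
      using hyperbolic_pythagoras[of \<eta>] by (simp add: algebra_simps power2_eq_square)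
    ultimately have "((\<lambda>\<eta>. sinh \<eta> / (cosh \<eta> - cos (oddpt N j))) has_real_derivative
       - ((cosh \<eta> * cos (oddpt N j) - 1) / (cosh \<eta> - cos (oddpt N j))\<^sup>2)) (at \<eta>)"
      by (simp only: power2_eq_square minus_divide_left)
    from DERIV_cmult[OF this, of "cos (real k * oddpt N j)"]
    show "((\<lambda>\<eta>. cos (real k * oddpt N j) * (sinh \<eta> / (cosh \<eta> - cos (oddpt N j)))) has_real_derivative
       - ((cosh \<eta> * cos (oddpt N j) - 1) / (cosh \<eta> - cos (oddpt N j))\<^sup>2 * cos (real k * oddpt N j))) (at \<eta>)"
      by (simp add: mult.commute)
  qed
  have e: "odd_Poisson_sum N k = (\<lambda>\<eta>. real N * tanh (real N * \<eta> / 2) * cosh (real k * \<eta>) - real N * sinh (real k * \<eta>))"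
    using odd_Poisson_sum_hyperbolic[OF assms(1,2)] odd_Poisson_sum_0[OF assms(1)] by auto
  have "((\<lambda>\<eta>. real N * tanh (real N * \<eta> / 2) * cosh (real k * \<eta>) - real N * sinh (real k * \<eta>)) has_real_derivative
     real N * (real N / 2 * (1 - T\<^sup>2) * cosh (real k * \<eta>)
     + real k * T * sinh (real k * \<eta>) - real k * cosh (real k * \<eta>))) (at \<eta>)"
  proof -
    have c: "((\<lambda>\<eta>. cosh (real k * \<eta>)) has_real_derivative sinh (real k * \<eta>) * real k) (at \<eta>)"
      by (auto intro!: derivative_eq_intros)
    have s: "((\<lambda>\<eta>. sinh (real k * \<eta>)) has_real_derivative cosh (real k * \<eta>) * real k) (at \<eta>)"
      by (auto intro!: derivative_eq_intros)
    have "((\<lambda>\<eta>. real N * \<eta> / 2) has_real_derivative real N / 2) (at \<eta>)"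
      by (auto intro!: derivative_eq_intros)
    then have t: "((\<lambda>\<eta>. tanh (real N * \<eta> / 2)) has_real_derivative (1 - T\<^sup>2) * (real N / 2)) (at \<eta>)"
      unfolding T_def by (intro has_field_derivative_tanh) simp_all
    show ?thesis
      by (rule DERIV_cong[OF DERIV_diff[OF DERIV_mult[OF DERIV_cmult[OF t, of "real N"] c] DERIV_cmult[OF s, of "real N"]]])
         (unfold T_def[symmetric], algebra)
  qed
  from DERIV_unique[OF d this[folded e]] have "- odd_kernel_sum N k (cosh \<eta>) = real N * (real N / 2 * (1 - T\<^sup>2) * cosh (real k * \<eta>)
     + real k * T * sinh (real k * \<eta>) - real k * cosh (real k * \<eta>))" .
  then show ?thesis by simp
qed

section \<open>Staggered rings and their moving frames\<close>

text \<open>Used for the reflection of the rings in the meridian plane of one vortex, under which odd terms cancel.\<close>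

lemma sum_reflect:
  fixes f g :: "nat \<Rightarrow> real"
  assumes "\<And>d. d \<in> {1..<M} \<Longrightarrow> f d + f (M - d) = 2 * g d"
  shows "(\<Sum>d\<in>{1..<M}. f d) = (\<Sum>d\<in>{1..<M}. g d)"
proof -
  have "(\<Sum>d\<in>{1..<M}. f d) = (\<Sum>d\<in>{1..<M}. f (M - d))"
    by (rule sum.reindex_bij_witness[of _ "\<lambda>d. M - d" "\<lambda>d. M - d"]) auto
  then have "2 * (\<Sum>d\<in>{1..<M}. f d) = (\<Sum>d\<in>{1..<M}. f d + f (M - d))"
    by (simp add: sum.distrib)
  also have "\<dots> = 2 * (\<Sum>d\<in>{1..<M}. g d)"
    unfolding sum_distrib_left by (rule sum.cong[OF refl assms])
  finally show ?thesis by simp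
qed

lemma sum_even_odd_split:
  fixes f :: "nat \<Rightarrow> real"
  assumes "N > 0"
  shows "(\<Sum>d\<in>{1..<2 * N}. f d) = (\<Sum>j\<in>{1..<N}. f (2 * j)) + (\<Sum>j<N. f (2 * j + 1))"
proof -
  have "{1..<2 * N} = (\<lambda>j. 2 * j) ` {1..<N} \<union> (\<lambda>j. 2 * j + 1) ` {..<N}" (is "_ = ?A \<union> ?B")
  proof (intro equalityI subsetI)
    fix d assume d: "d \<in> {1..<2 * N}"
    show "d \<in> ?A \<union> ?B"
    proof (cases "even d")
      case True
      then obtain j where "d = 2 * j" by (elim evenE)
      then show ?thesis using d by auto
    next
      case False
      then obtain j where "d = 2 * j + 1" by (elim oddE)
      then show ?thesis using d by auto
    qed
  qed (use assms in auto)
  then have "(\<Sum>d\<in>{1..<2 * N}. f d) = sum f (?A \<union> ?B)" by simp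
  also have "\<dots> = sum f ?A + sum f ?B"
    by (rule sum.union_disjoint) (auto, presburger)
  also have "sum f ?A = (\<Sum>j\<in>{1..<N}. f (2 * j))" by (subst sum.reindex) (auto simp: inj_on_def)
  also have "sum f ?B = (\<Sum>j<N. f (2 * j + 1))" by (subst sum.reindex) (auto simp: inj_on_def)
  finally show ?thesis .
qed

text \<open>The contribution to the Hessian at vortex \<open>i\<close> of a vortex of the same ring at longitude difference with cosine \<open>C\<close> and
sine \<open>S\<close>, for displacements with frame coefficients \<open>ai\<close>, \<open>bi\<close>, \<open>aj\<close> and \<open>bj\<close>; \<open>p\<close> is the inner product of the positions.\<close>

lemma same_ring_row:
  fixes C S c s ai bi aj bj :: real
  assumes "s\<^sup>2 + c\<^sup>2 = 1" "S\<^sup>2 + C\<^sup>2 = 1" "C < 1" "s \<noteq> 0"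
  defines "p \<equiv> s\<^sup>2 * C + c\<^sup>2"
  shows "p / (1 - p) * ai - 1 / (1 - p) * (aj * (c\<^sup>2 * C + s\<^sup>2) + bj * (c * S))
     - (ai * (s * c * (1 - C)) + bi * (s * S) + aj * (s * c * (1 - C)) - bj * (s * S)) / (1 - p)\<^sup>2 * (s * c * (1 - C))
     = (C * ai - aj - c * S * bi) / (s\<^sup>2 * (1 - C))" (is ?E)
    and "p / (1 - p) * bi - 1 / (1 - p) * (- aj * (c * S) + bj * C)
     - (ai * (s * c * (1 - C)) + bi * (s * S) + aj * (s * c * (1 - C)) - bj * (s * S)) / (1 - p)\<^sup>2 * (s * S)
     = (bj - (1 - c\<^sup>2 * (1 - C)) * bi - c * S * ai) / (s\<^sup>2 * (1 - C))" (is ?F)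
proof -
  define w where "w = 1 - C"
  have w: "w > 0" "C = 1 - w" using assms by (simp_all add: w_def)
  have p: "1 - p = s\<^sup>2 * w" "p = 1 - s\<^sup>2 * w"
    using assms(1) by (simp_all add: p_def w(2) algebra_simps)
  have S: "S\<^sup>2 = w * (2 - w)" using assms(2) unfolding w(2) by (simp add: algebra_simps power2_eq_square)
  have div: "A / (s\<^sup>2 * w) * ai - 1 / (s\<^sup>2 * w) * B - U / (s\<^sup>2 * w)\<^sup>2 * V = (A * ai - B - U * V / (s\<^sup>2 * w)) / (s\<^sup>2 * w)" for A B U V ai
    by (simp add: diff_divide_distrib power2_eq_square)
  show ?E
  proof -
    have "(ai * (s * c * w) + bi * (s * S) + aj * (s * c * w) - bj * (s * S)) * (s * c * w) / (s\<^sup>2 * w)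
       = (ai * c * w + bi * S + aj * c * w - bj * S) * c"
      using w assms(4) by (simp add: field_simps power2_eq_square)
    then show ?thesis unfolding p(1) w_def[symmetric] div
      unfolding p(2) w(2) using assms(1) by (intro arg_cong2[where f = "(/)"] refl) algebra
  qed
  show ?F
  proof -
    have "(ai * (s * c * w) + bi * (s * S) + aj * (s * c * w) - bj * (s * S)) * (s * S) / (s\<^sup>2 * w)
       = (ai * c * w + aj * c * w) * S / w + (bi - bj) * S\<^sup>2 / w"
      using w assms(4) by (simp add: field_simps power2_eq_square)
    also have "\<dots> = (ai * c + aj * c) * S + (bi - bj) * (2 - w)"
      unfolding S using w by (simp add: field_simps)
    finally show ?thesis unfolding p(1) w_def[symmetric] div
      unfolding p(2) w(2) using assms(1) by (intro arg_cong2[where f = "(/)"] refl) algebra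
  qed
qed

text \<open>The analogue of \<open>same_ring_row\<close> for a vortex of the opposite ring, with \<open>q = 1 - p\<close>.\<close>

lemma opposite_ring_row:
  fixes C S c s ai bi aj bj :: real
  assumes "s\<^sup>2 + c\<^sup>2 = 1" "S\<^sup>2 + C\<^sup>2 = 1"
  defines "p \<equiv> s\<^sup>2 * C - c\<^sup>2" and "q \<equiv> 1 + c\<^sup>2 - s\<^sup>2 * C"
  assumes "q \<noteq> 0"
  shows "- (p / (1 - p) * ai - 1 / (1 - p) * (aj * (c\<^sup>2 * C - s\<^sup>2) + bj * (c * S))
     - (ai * (s * c * (- 1 - C)) + bi * (s * S) + aj * (s * c * (- 1 - C)) - bj * (s * S)) / (1 - p)\<^sup>2 * (s * c * (- 1 - C)))
     = ai * (((1 + c\<^sup>2) * C - s\<^sup>2) / q\<^sup>2 + (1 - C) / q) + aj * (((1 + c\<^sup>2) * C - s\<^sup>2) / q\<^sup>2)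
       - bi * (s\<^sup>2 * c * S * (1 + C) / q\<^sup>2) + bj * (2 * c * S / q\<^sup>2)" (is ?E)
    and "- (p / (1 - p) * bi - 1 / (1 - p) * (- aj * (c * S) + bj * C)
     - (ai * (s * c * (- 1 - C)) + bi * (s * S) + aj * (s * c * (- 1 - C)) - bj * (s * S)) / (1 - p)\<^sup>2 * (s * S))
     = bi * (c\<^sup>2 * (1 + C) / q - ((1 + c\<^sup>2) * C - s\<^sup>2) / q\<^sup>2) + bj * (((1 + c\<^sup>2) * C - s\<^sup>2) / q\<^sup>2)
       - ai * (s\<^sup>2 * c * S * (1 + C) / q\<^sup>2) - aj * (2 * c * S / q\<^sup>2)" (is ?F)
proof -
  have pq: "1 - p = q" by (simp add: p_def q_def)
  have c1: "x / q = x * q / q\<^sup>2" for x using assms(5) by (simp add: power2_eq_square)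
  have L: "- (A / q * a - 1 / q * B - U / q\<^sup>2 * V) = (- (A * a * q) + B * q + U * V) / q\<^sup>2" for A B U V a
    unfolding c1[of A] c1[of 1] by (simp add: add_divide_distrib diff_divide_distrib mult_ac)
  have R1: "ai * (X / q\<^sup>2 + Y / q) + aj * (Z / q\<^sup>2) - bi * (U / q\<^sup>2) + bj * (V / q\<^sup>2)
     = (ai * (X + Y * q) + aj * Z - bi * U + bj * V) / q\<^sup>2" for X Y Z U V ai aj bi bj
    unfolding c1[of Y] by (simp add: add_divide_distrib diff_divide_distrib algebra_simps)
  have R2: "bi * (Y / q - X / q\<^sup>2) + bj * (Z / q\<^sup>2) - ai * (U / q\<^sup>2) - aj * (V / q\<^sup>2)
     = (bi * (Y * q - X) + bj * Z - ai * U - aj * V) / q\<^sup>2" for X Y Z U V ai aj bi bj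
    unfolding c1[of Y] by (simp add: add_divide_distrib diff_divide_distrib algebra_simps)
  show ?E unfolding pq L R1
    by (intro arg_cong2[where f = "(/)"] refl) (use assms(1,2) in \<open>unfold p_def q_def, algebra\<close>)
  show ?F unfolding pq L R2
    by (intro arg_cong2[where f = "(/)"] refl) (use assms(1,2) in \<open>unfold p_def q_def, algebra\<close>)
qed

lemma inner_vector_3: "(vector [a, b, c] :: real^3) \<bullet> vector [a', b', c'] = a * a' + b * b' + c * c'"
  by (simp add: inner_vec_def sum_3)

text \<open>The parameter \<open>N\<close> is kept apart from \<open>CARD('n)\<close> so that case distinctions on the number of vortices are
assumptions on a variable.\<close>

locale staggered_rings =
  fixes \<iota> :: "'n::finite \<Rightarrow> nat" and \<theta> :: real and N :: nat
  assumes ring_numbering: "bij_betw \<iota> UNIV {1..N}"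
    and N_card: "N = CARD('n)"
    and N_ge_2: "N \<ge> 2"
    and theta_range: "\<theta> \<in> {0<..pi/2}"
begin

abbreviation \<Lambda> :: "'n + 'n \<Rightarrow> real" where "\<Lambda> \<equiv> DNd_vorticity"
abbreviation X :: "real^3^('n + 'n)" where "X \<equiv> DNd \<iota> \<theta>"

definition c :: real where "c = cos \<theta>"
definition s :: real where "s = sin \<theta>"

text \<open>The vortices of both rings, numbered by increasing longitude: even numbers belong to the
first ring.\<close>

definition idx :: "'n + 'n \<Rightarrow> nat" where
  "idx = case_sum (\<lambda>a. 2 * (\<iota> a - 1)) (\<lambda>a. 2 * (\<iota> a - 1) + 1)"

definition lon :: "'n + 'n \<Rightarrow> real" where "lon i = pi * real (idx i) / real N"

text \<open>\<open>E\<close> points along the meridian to the nearer pole, \<open>F\<close> to the east. With the factor \<open>\<Lambda>\<close> in \<open>E\<close> the frames of both rings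
are related by the symmetry that exchanges the rings, so that modes need no alternating signs.\<close>

definition E :: "'n + 'n \<Rightarrow> real^3" where
  "E i = vector [- c * cos (lon i), - c * sin (lon i), \<Lambda> i * s]"
definition F :: "'n + 'n \<Rightarrow> real^3" where
  "F i = vector [- sin (lon i), cos (lon i), 0]"

lemma s_pos: "s > 0"
  using theta_range pi_gt_zero unfolding s_def by (intro sin_gt_zero) auto

lemma c_nonneg: "c \<ge> 0"
  using theta_range unfolding c_def by (intro cos_ge_zero) auto

lemma s_c: "s\<^sup>2 + c\<^sup>2 = 1" by (simp add: s_def c_def)

lemma c_lt_1: "c < 1"
proof -
  have "s\<^sup>2 > 0" using s_pos by simp
  then have "c\<^sup>2 < 1\<^sup>2" unfolding one_power2 using s_c by linarith
  then show ?thesis by (rule power2_less_imp_less) simp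
qed

lemma iota_bounds: "\<iota> a \<ge> 1" "\<iota> a \<le> N"
  using ring_numbering by (auto simp: bij_betw_def)

lemma idx_less: "idx i < 2 * N"
proof -
  have "\<iota> a - 1 < N" for a using iota_bounds[of a] by linarith
  from this[of "case_sum (\<lambda>a. a) (\<lambda>a. a) i"] show ?thesis
    by (cases i) (auto simp: idx_def)
qed

lemma inj_idx: "inj idx"
proof (rule injI)
  have inj: "\<iota> a - 1 = \<iota> b - 1 \<Longrightarrow> a = b" for a b
    using ring_numbering iota_bounds(1)[of a] iota_bounds(1)[of b] by (auto simp: bij_betw_def inj_on_def)
  have par: "2 * m \<noteq> 2 * n + 1" "2 * n + 1 \<noteq> 2 * m" for m n :: nat by presburger+
  fix i j assume "idx i = idx j"
  then show "i = j"
    by (cases i; cases j) (auto simp: idx_def par intro: inj simp del: One_nat_def)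
qed

lemma bij_idx: "bij_betw idx UNIV {..<2 * N}"
proof -
  have "card (range idx) = 2 * N"
    using card_image[OF inj_idx] by (simp add: N_card UNIV_Plus_UNIV[symmetric] card_Plus del: UNIV_Plus_UNIV)
  then have "range idx = {..<2 * N}"
    using idx_less by (intro card_subset_eq) auto
  then show ?thesis using inj_idx by (simp add: bij_betw_def)
qed

lemma Lambda_idx: "\<Lambda> i = (if even (idx i) then 1 else - 1)"
  by (cases i) (auto simp: DNd_vorticity_def idx_def)

lemma Lambda_cases: "\<Lambda> i = 1 \<or> \<Lambda> i = - 1"
  by (simp add: Lambda_idx)

lemma Lambda_square [simp]: "\<Lambda> i * \<Lambda> i = 1" "(\<Lambda> i)\<^sup>2 = 1" "\<Lambda> i * (\<Lambda> i * z) = z"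
  using Lambda_cases[of i] by auto

lemma X_nth: "X $ i = vector [s * cos (lon i), s * sin (lon i), \<Lambda> i * c]"
proof (cases i)
  case (Inl a)
  have "2 * pi * (real (\<iota> a) - 1) / real N = lon i"
    using iota_bounds[of a] by (simp add: Inl lon_def idx_def of_nat_diff field_simps)
  then show ?thesis
    using Inl by (simp add: DNd_def N_card[symmetric] sphere_point_def DNd_vorticity_def s_def c_def)
next
  case (Inr a)
  have "2 * pi * (real (\<iota> a) - 1) / real N + pi / real N = lon i"
    using iota_bounds[of a] N_ge_2 by (simp add: Inr lon_def idx_def of_nat_diff field_simps)
  then show ?thesis
    using Inr by (simp add: DNd_def N_card[symmetric] sphere_point_def DNd_vorticity_def s_def c_def)
qed

text \<open>All inner products between frames of two vortices depend only on the difference \<open>sep\<close> of their numbers, through the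
angle \<open>ang\<close> and the parity sign \<open>sg\<close>.\<close>

definition sep :: "'n + 'n \<Rightarrow> 'n + 'n \<Rightarrow> int" where "sep i j = int (idx j) - int (idx i)"
definition ang :: "int \<Rightarrow> real" where "ang d = pi * of_int d / real N"
definition sg :: "int \<Rightarrow> real" where "sg d = (if even d then 1 else - 1)"

lemma lon_sep: "lon j = lon i + ang (sep i j)"
  by (simp add: lon_def ang_def sep_def add_divide_distrib[symmetric] algebra_simps)

lemma Lambda_sep: "\<Lambda> i * \<Lambda> j = sg (sep i j)" "\<Lambda> j = \<Lambda> i * sg (sep i j)"
  by (auto simp: Lambda_idx sg_def sep_def)

text \<open>The numbering is cyclic modulo \<open>2N\<close>.\<close>

lemma sum_other_vortices:
  fixes f :: "int \<Rightarrow> real"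
  assumes per: "\<And>d. f (d + 2 * int N) = f d"
  shows "(\<Sum>j\<in>UNIV - {i}. f (sep i j)) = (\<Sum>d\<in>{1..<2 * N}. f (int d))"
proof -
  have per': "f (d + 2 * int N * m) = f d" for d m
  proof (induction m rule: int_induct[of _ 0])
    case (step1 m)
    then show ?case using per[of "d + 2 * int N * m"] by (simp add: algebra_simps)
  next
    case (step2 m)
    then show ?case using per[of "d + 2 * int N * (m - 1)"] by (simp add: algebra_simps)
  qed simp
  have fmod: "f d = f (d mod (2 * int N))" for d
    using per'[of "d mod (2 * int N)" "d div (2 * int N)"] by simp
  let ?r = "\<lambda>j. nat (sep i j mod (2 * int N))"
  have pos: "2 * int N > 0" using N_ge_2 by simp
  have inj: "inj_on ?r UNIV"
  proof (rule inj_onI)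
    fix j k assume "?r j = ?r k"
    then have "sep i j mod (2 * int N) = sep i k mod (2 * int N)" using pos by (simp add: eq_nat_nat_iff)
    then have "(sep i j + int (idx i)) mod (2 * int N) = (sep i k + int (idx i)) mod (2 * int N)"
      by (rule mod_add_cong) simp
    then have "int (idx j) mod (2 * int N) = int (idx k) mod (2 * int N)" by (simp add: sep_def)
    then have "idx j = idx k" using idx_less[of j] idx_less[of k] by simp
    then show "j = k" using inj_idx by (simp add: inj_eq)
  qed
  have "?r ` (UNIV - {i}) \<subseteq> {1..<2 * N}"
  proof
    fix d assume "d \<in> ?r ` (UNIV - {i})"
    then obtain j where j: "j \<noteq> i" "d = ?r j" by auto
    have "?r j \<noteq> ?r i" using inj j(1) by (auto simp: inj_on_def)
    then have "?r j \<noteq> 0" by (simp add: sep_def)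
    moreover have "?r j < 2 * N" using pos by (simp add: nat_less_iff)
    ultimately show "d \<in> {1..<2 * N}" using j by simp
  qed
  moreover have "card (?r ` (UNIV - {i})) = card {1..<2 * N}"
  proof -
    have "card (?r ` (UNIV - {i})) = card (UNIV - {i})"
      by (rule card_image) (rule inj_on_subset[OF inj], simp)
    also have "\<dots> = 2 * N - 1"
    proof -
      have "card (UNIV :: ('n + 'n) set) = 2 * N"
        by (simp add: N_card UNIV_Plus_UNIV[symmetric] card_Plus del: UNIV_Plus_UNIV)
      then show ?thesis by (simp add: card_Diff_singleton)
    qed
    finally show ?thesis by simp
  qed
  ultimately have img: "?r ` (UNIV - {i}) = {1..<2 * N}" by (intro card_subset_eq) auto
  have "(\<Sum>d\<in>{1..<2 * N}. f (int d)) = (\<Sum>j\<in>UNIV - {i}. f (int (?r j)))"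
    unfolding img[symmetric] by (subst sum.reindex) (auto intro: inj_on_subset[OF inj])
  also have "\<dots> = (\<Sum>j\<in>UNIV - {i}. f (sep i j))"
    using pos by (intro sum.cong refl) (simp add: fmod[symmetric])
  finally show ?thesis by simp
qed

lemma sum_all_vortices: "(\<Sum>i\<in>UNIV. f (idx i)) = (\<Sum>m<2 * N. f m)" for f :: "nat \<Rightarrow> 'b::comm_monoid_add"
  using sum.reindex_bij_betw[OF bij_idx] by simp

lemma ang_periodic:
  "cos (ang (d + 2 * int N)) = cos (ang d)" "sin (ang (d + 2 * int N)) = sin (ang d)"
  "cos (real k * ang (d + 2 * int N)) = cos (real k * ang d)"
  "sin (real k * ang (d + 2 * int N)) = sin (real k * ang d)"
  "sg (d + 2 * int N) = sg d"
proof -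
  have a: "ang (d + 2 * int N) = ang d + 2 * pi"
    using N_ge_2 by (simp add: ang_def field_simps)
  then have ka: "real k * ang (d + 2 * int N) = real k * ang d + 2 * pi * real k"
    by (simp add: algebra_simps)
  have "cos (2 * pi * real k) = 1" "sin (2 * pi * real k) = 0"
    using cos_2npi sin_2npi by (simp_all add: mult.commute[of pi] mult.assoc mult.left_commute)
  with ka show "cos (real k * ang (d + 2 * int N)) = cos (real k * ang d)"
    "sin (real k * ang (d + 2 * int N)) = sin (real k * ang d)"
    by (simp_all add: cos_add sin_add)
  show "cos (ang (d + 2 * int N)) = cos (ang d)" "sin (ang (d + 2 * int N)) = sin (ang d)"
    unfolding a by simp_all
  show "sg (d + 2 * int N) = sg d" by (simp add: sg_def)
qed

lemma ang_reflect:
  assumes "d \<in> {1..<2 * N}"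
  shows "cos (ang (int (2 * N - d))) = cos (ang (int d))" "sin (ang (int (2 * N - d))) = - sin (ang (int d))"
  "cos (real k * ang (int (2 * N - d))) = cos (real k * ang (int d))"
  "sin (real k * ang (int (2 * N - d))) = - sin (real k * ang (int d))"
  "sg (int (2 * N - d)) = sg (int d)"
proof -
  have e: "int (2 * N - d) = - int d + 2 * int N" using assms by (simp add: of_nat_diff)
  have m: "ang (- int d) = - ang (int d)" by (simp add: ang_def)
  show "cos (ang (int (2 * N - d))) = cos (ang (int d))" "sin (ang (int (2 * N - d))) = - sin (ang (int d))"
  "cos (real k * ang (int (2 * N - d))) = cos (real k * ang (int d))"
  "sin (real k * ang (int (2 * N - d))) = - sin (real k * ang (int d))"
  "sg (int (2 * N - d)) = sg (int d)"
    unfolding e ang_periodic m by (simp_all add: sg_def)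
qed

lemma ang_evenpt: "ang (int (2 * j)) = evenpt N j"
  by (simp add: ang_def evenpt_def)

lemma ang_oddpt: "ang (int (2 * j + 1)) = oddpt N j"
  by (simp add: ang_def oddpt_def)

lemma frame_products:
  fixes i j :: "'n + 'n"
  defines "C \<equiv> cos (ang (sep i j))" and "S \<equiv> sin (ang (sep i j))" and "e \<equiv> sg (sep i j)"
  shows "X $ i \<bullet> X $ j = s\<^sup>2 * C + e * c\<^sup>2"
    and "E i \<bullet> E j = c\<^sup>2 * C + e * s\<^sup>2" "E i \<bullet> F j = c * S" "F i \<bullet> E j = - (c * S)" "F i \<bullet> F j = C"
    and "E i \<bullet> X $ j = s * c * (e - C)" "F i \<bullet> X $ j = s * S"
    and "X $ i \<bullet> E j = s * c * (e - C)" "X $ i \<bullet> F j = - (s * S)"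
proof -
  have C: "C = cos (lon j) * cos (lon i) + sin (lon j) * sin (lon i)"
    unfolding C_def using lon_sep[of j i] cos_diff[of "lon j" "lon i"] by simp
  have S: "S = sin (lon j) * cos (lon i) - cos (lon j) * sin (lon i)"
    unfolding S_def using lon_sep[of j i] sin_diff[of "lon j" "lon i"] by simp
  have e: "\<Lambda> i * \<Lambda> j = e" unfolding e_def by (rule Lambda_sep)
  have [simp]: "\<Lambda> i * (\<Lambda> j * z) = e * z" for z by (simp add: e[symmetric])
  show "X $ i \<bullet> X $ j = s\<^sup>2 * C + e * c\<^sup>2"
    and "E i \<bullet> E j = c\<^sup>2 * C + e * s\<^sup>2" "E i \<bullet> F j = c * S" "F i \<bullet> E j = - (c * S)" "F i \<bullet> F j = C"
    and "E i \<bullet> X $ j = s * c * (e - C)" "F i \<bullet> X $ j = s * S"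
    and "X $ i \<bullet> E j = s * c * (e - C)" "X $ i \<bullet> F j = - (s * S)"
    unfolding X_nth E_def F_def inner_vector_3 C S
    by (simp_all add: algebra_simps power2_eq_square)
qed

lemma sep_self: "sep i i = 0" by (simp add: sep_def)

lemma frame_orthonormal:
  "X $ i \<bullet> X $ i = 1" "E i \<bullet> E i = 1" "F i \<bullet> F i = 1"
  "X $ i \<bullet> E i = 0" "X $ i \<bullet> F i = 0" "E i \<bullet> F i = 0" "E i \<bullet> X $ i = 0" "F i \<bullet> X $ i = 0" "F i \<bullet> E i = 0"
  unfolding frame_products sep_self using s_c by (simp_all add: ang_def sg_def algebra_simps)

lemma frame_expansion: "y = (y \<bullet> X $ i) *\<^sub>R X $ i + (y \<bullet> E i) *\<^sub>R E i + (y \<bullet> F i) *\<^sub>R F i"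
proof -
  define p q l where "p = cos (lon i)" and "q = sin (lon i)" and "l = \<Lambda> i"
  have r: "p\<^sup>2 + q\<^sup>2 = 1" "l\<^sup>2 = 1" "s\<^sup>2 + c\<^sup>2 = 1"
    using s_c by (simp_all add: p_def q_def l_def)
  show ?thesis
    unfolding X_nth E_def F_def p_def[symmetric] q_def[symmetric] l_def[symmetric]
    unfolding vec_eq_iff forall_3 inner_vec_def sum_3
    by (simp, intro conjI; use r in algebra)
qed

lemma frame_inner: "y \<bullet> z = (y \<bullet> X $ i) * (z \<bullet> X $ i) + (y \<bullet> E i) * (z \<bullet> E i) + (y \<bullet> F i) * (z \<bullet> F i)"
proof -
  have "y \<bullet> z = ((y \<bullet> X $ i) *\<^sub>R X $ i + (y \<bullet> E i) *\<^sub>R E i + (y \<bullet> F i) *\<^sub>R F i) \<bullet> z"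
    using frame_expansion[of y i] by simp
  then show ?thesis by (simp only: inner_add_right inner_scaleR_right inner_commute[of _ z])
qed

lemma frame_cross: "\<Lambda> i *\<^sub>R cross3 (X $ i) (E i) = - F i" "\<Lambda> i *\<^sub>R cross3 (X $ i) (F i) = E i"
proof -
  define p q l where "p = cos (lon i)" and "q = sin (lon i)" and "l = \<Lambda> i"
  have r: "p\<^sup>2 + q\<^sup>2 = 1" "l\<^sup>2 = 1" "s\<^sup>2 + c\<^sup>2 = 1"
    using s_c by (simp_all add: p_def q_def l_def)
  show "\<Lambda> i *\<^sub>R cross3 (X $ i) (E i) = - F i" "\<Lambda> i *\<^sub>R cross3 (X $ i) (F i) = E i"
    unfolding X_nth E_def F_def p_def[symmetric] q_def[symmetric] l_def[symmetric]
    unfolding vec_eq_iff forall_3 cross3_def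
    by (simp, intro conjI; use r in algebra)+
qed

end

section \<open>Angular velocity of the rings\<close>

context staggered_rings
begin

text \<open>For vortices \<open>i\<close> and \<open>j\<close> of opposite rings \<open>1 - X $ i \<bullet> X $ j = s\<^sup>2 * (h - cos)\<close>, with the cosine of their longitude
difference.\<close>

definition h :: real where "h = (1 + c\<^sup>2) / s\<^sup>2"

definition G :: "nat \<Rightarrow> real" where "G k = odd_kernel_sum N k h"

definition Q :: real where "Q = real N * tanh (real N * artanh c)"

text \<open>The angular speed about the axis.\<close>

definition \<xi>\<^sub>0 :: real where "\<xi>\<^sub>0 = (Q - c) / s\<^sup>2"

abbreviation axis_vec :: "real \<Rightarrow> real^3" where "axis_vec z \<equiv> vector [0, 0, z]"

text \<open>\<open>P k / s\<^sup>2\<close> and \<open>- R k / s\<^sup>2\<close> are the coefficients of the Hessian on meridional and longitudinal waves of wave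
number \<open>k\<close>, and \<open>\<beta> k\<close> is the coefficient that couples them. The term \<open>k (N - k)\<close> comes from a vortex's own ring, \<open>G\<close> from
the opposite ring.\<close>

definition P :: "nat \<Rightarrow> real" where
  "P k = real k * (real N - real k) + G 0 + G k + 1 + c\<^sup>2 - 2 * c * Q"
definition R :: "nat \<Rightarrow> real" where
  "R k = real k * (real N - real k) + G 0 - G k"
definition \<beta> :: "nat \<Rightarrow> real" where
  "\<beta> k = 2 * c / s^4 * (\<Sum>j<N. sin (oddpt N j) * sin (real k * oddpt N j) / (h - cos (oddpt N j))\<^sup>2)"

lemma tanh_artanh_c: "tanh (artanh c) = c"
proof -
  have "exp (- 2 * artanh c) = (1 - c) / (1 + c)"
    using c_nonneg c_lt_1 by (simp add: artanh_def exp_minus)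
  then show ?thesis
    using c_nonneg by (simp only: tanh_real_altdef) (simp add: field_simps)
qed

text \<open>The parameter \<open>\<eta>\<close> of the Poisson kernel is \<open>2 * artanh c\<close>.\<close>

lemma h_cosh: "h = cosh (2 * artanh c)" and sinh_2artanh: "sinh (2 * artanh c) = 2 * c / s\<^sup>2"
proof -
  define y where "y = artanh c"
  have S: "sinh y = c * cosh y" using tanh_artanh_c by (simp add: tanh_def y_def field_simps)
  then have "(cosh y)\<^sup>2 * s\<^sup>2 = 1"
    using hyperbolic_pythagoras[of y] s_c by algebra
  then have K: "(cosh y)\<^sup>2 = 1 / s\<^sup>2" using s_pos by (simp add: field_simps)
  have "cosh (2 * y) = (1 + c\<^sup>2) * (cosh y)\<^sup>2" "sinh (2 * y) = 2 * c * (cosh y)\<^sup>2"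
    unfolding cosh_double sinh_double S by algebra+
  then show "h = cosh (2 * artanh c)" "sinh (2 * artanh c) = 2 * c / s\<^sup>2"
    unfolding h_def y_def[symmetric] using K by simp_all
qed

lemma h_ge_1: "h \<ge> 1"
  unfolding h_cosh by (rule cosh_real_ge_1)

lemma h_s: "s\<^sup>2 * h = 1 + c\<^sup>2"
  using s_pos by (simp add: h_def)

lemma h_minus_cos_pos: "j < N \<Longrightarrow> h - cos (oddpt N j) > 0"
  using cos_oddpt_lt_1[OF _ N_ge_2, of j] h_ge_1 by linarith

lemma sum_inverse_kernel: "2 * c / s\<^sup>2 * (\<Sum>j<N. 1 / (h - cos (oddpt N j))) = Q"
  using odd_Poisson_sum_0[OF N_ge_2, of "2 * artanh c"]
  by (simp add: odd_Poisson_sum_def h_cosh[symmetric] sinh_2artanh Q_def sum_distrib_left)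

lemma sum_odd_one_minus_cos: "(\<Sum>j<N. (1 - cos (oddpt N j)) / (h - cos (oddpt N j))) = real N - c * Q"
proof -
  have "(1 - cos (oddpt N j)) / (h - cos (oddpt N j)) = 1 - c * (2 * c / s\<^sup>2) * (1 / (h - cos (oddpt N j)))" if "j < N" for j
  proof -
    have "h - 1 = c * (2 * c / s\<^sup>2)"
      using s_pos s_c by (simp add: h_def field_simps power2_eq_square)
    then have "1 - cos (oddpt N j) = (h - cos (oddpt N j)) - c * (2 * c / s\<^sup>2)" by simp
    moreover have "(z - a) / z = 1 - a * (1 / z)" if "z > 0" for z a :: real
      using that by (simp add: diff_divide_distrib)
    ultimately show ?thesis using h_minus_cos_pos[OF that] by (simp only:)
  qed
  then have "(\<Sum>j<N. (1 - cos (oddpt N j)) / (h - cos (oddpt N j)))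
     = (\<Sum>j<N. 1 - c * (2 * c / s\<^sup>2) * (1 / (h - cos (oddpt N j))))" by (intro sum.cong) auto
  also have "\<dots> = real N - c * (2 * c / s\<^sup>2 * (\<Sum>j<N. 1 / (h - cos (oddpt N j))))"
    by (simp only: sum_subtractf sum_distrib_left[symmetric]) simp
  finally show ?thesis unfolding sum_inverse_kernel .
qed

lemma sum_odd_one_plus_cos: "c * (\<Sum>j<N. (1 + cos (oddpt N j)) / (h - cos (oddpt N j))) = Q - real N * c"
proof -
  have "c * ((1 + cos (oddpt N j)) / (h - cos (oddpt N j))) = (2 * c / s\<^sup>2) * (1 / (h - cos (oddpt N j))) - c" if "j < N" for j
  proof -
    have "c * (h + 1) = 2 * c / s\<^sup>2"
    proof -
      have "h + 1 = (1 + c\<^sup>2 + s\<^sup>2) / s\<^sup>2" using s_pos by (simp add: h_def add_divide_distrib)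
      also have "1 + c\<^sup>2 + s\<^sup>2 = 2" using s_c by simp
      finally show ?thesis by simp
    qed
    then have "c * (1 + cos (oddpt N j)) = 2 * c / s\<^sup>2 - c * (h - cos (oddpt N j))" by (simp add: algebra_simps)
    moreover have "c * (a / z) = b * (1 / z) - c" if "z > 0" "c * a = b - c * z" for a b z :: real
      using that by (simp add: field_simps)
    ultimately show ?thesis using h_minus_cos_pos[OF that] by blast
  qed
  then have "c * (\<Sum>j<N. (1 + cos (oddpt N j)) / (h - cos (oddpt N j)))
     = (\<Sum>j<N. (2 * c / s\<^sup>2) * (1 / (h - cos (oddpt N j))) - c)" unfolding sum_distrib_left by (intro sum.cong) auto
  also have "\<dots> = 2 * c / s\<^sup>2 * (\<Sum>j<N. 1 / (h - cos (oddpt N j))) - real N * c"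
    by (simp only: sum_subtractf sum_distrib_left[symmetric]) simp
  finally show ?thesis unfolding sum_inverse_kernel .
qed

definition fr :: "('n + 'n \<Rightarrow> real) \<Rightarrow> ('n + 'n \<Rightarrow> real) \<Rightarrow> real^3^('n + 'n)" where
  "fr a b = (\<chi> i. a i *\<^sub>R E i + b i *\<^sub>R F i)"

definition mode :: "nat \<Rightarrow> real \<Rightarrow> real \<Rightarrow> real \<Rightarrow> real \<Rightarrow> real^3^('n + 'n)" where
  "mode k a1 a2 b1 b2 = fr (\<lambda>i. a1 * cos (real k * lon i) + a2 * sin (real k * lon i))
     (\<lambda>i. b1 * cos (real k * lon i) + b2 * sin (real k * lon i))"

lemma X_phase_space: "X \<in> phase_space"
proof -
  have n: "norm (X $ i) = 1" for i using frame_orthonormal(1) by (simp add: norm_eq_1)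
  have "X $ i \<noteq> X $ j" if "i \<noteq> j" for i j
  proof
    assume eq: "X $ i = X $ j"
    then have z: "\<Lambda> i * c = \<Lambda> j * c" and x: "s * cos (lon i) = s * cos (lon j)" "s * sin (lon i) = s * sin (lon j)"
      unfolding X_nth by (auto simp: vec_eq_iff forall_3)
    have "cos (lon i - lon j) = 1"
      using x s_pos by (simp add: cos_diff)
    then obtain m :: int where m: "lon i - lon j = of_int m * 2 * pi" using cos_one_2pi_int by blast
    have "lon i - lon j = pi * (real (idx i) - real (idx j)) / real N"
      by (simp add: lon_def diff_divide_distrib right_diff_distrib)
    with m have "pi * (real (idx i) - real (idx j)) = pi * (of_int m * 2 * real N)"
      using N_ge_2 by (simp add: field_simps)
    then have "real (idx i) - real (idx j) = of_int m * 2 * real N"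
      by (simp only: mult_cancel_left) simp
    then have "real_of_int (int (idx i) - int (idx j)) = real_of_int (m * 2 * int N)" by simp
    then have "int (idx i) - int (idx j) = m * 2 * int N" by (simp only: of_int_eq_iff)
    moreover have "\<bar>int (idx i) - int (idx j)\<bar> < 2 * int N"
      using idx_less[of i] idx_less[of j] by linarith
    ultimately have "\<bar>m\<bar> * (2 * int N) < 1 * (2 * int N)" by (simp add: abs_mult)
    then have "m = 0" using N_ge_2 by (simp add: mult_less_cancel_right)
    then have "idx i = idx j" using \<open>int (idx i) - int (idx j) = m * 2 * int N\<close> by simp
    then show False using that inj_idx by (simp add: inj_eq)
  qed
  with n show ?thesis by (auto simp: phase_space_def)
qed

lemma dist_even_odd:
  "1 - (s\<^sup>2 * C + 1 * c\<^sup>2) = s\<^sup>2 * (1 - C)" "1 - (s\<^sup>2 * C + (- 1) * c\<^sup>2) = s\<^sup>2 * (h - C)"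
  using s_c h_s by (simp_all add: algebra_simps)

text \<open>By symmetry the sum over the other vortices has no longitudinal component; its meridional component is balanced by the
choice of \<open>\<xi>\<^sub>0\<close>, so only a radial component remains.\<close>

lemma critical_equation:
  "\<exists>\<kappa>. axis_vec \<xi>\<^sub>0 - (\<Sum>j\<in>UNIV - {i}. (\<Lambda> j / (1 - X $ i \<bullet> X $ j)) *\<^sub>R X $ j) = \<kappa> *\<^sub>R X $ i"
proof -
  let ?v = "axis_vec \<xi>\<^sub>0 - (\<Sum>j\<in>UNIV - {i}. (\<Lambda> j / (1 - X $ i \<bullet> X $ j)) *\<^sub>R X $ j)"
  let ?C = "\<lambda>d. cos (ang d)" and ?S = "\<lambda>d. sin (ang d)"
  have cE: "(\<Sum>j\<in>UNIV - {i}. (\<Lambda> j / (1 - X $ i \<bullet> X $ j)) * (X $ j \<bullet> E i)) = \<Lambda> i * (s * c) * ((real N - 1) / s\<^sup>2 + (\<Sum>j<N. (1 + cos (oddpt N j)) / (h - cos (oddpt N j))) / s\<^sup>2)"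
  proof -
    have "(\<Sum>j\<in>UNIV - {i}. (\<Lambda> j / (1 - X $ i \<bullet> X $ j)) * (X $ j \<bullet> E i))
      = (\<Sum>j\<in>UNIV - {i}. \<Lambda> i * (s * c) * (\<lambda>d. sg d * (sg d - ?C d) / (1 - (s\<^sup>2 * ?C d + sg d * c\<^sup>2))) (sep i j))"
    proof (intro sum.cong refl)
      fix j
      have L: "\<Lambda> j = \<Lambda> i * sg (sep i j)" by (rule Lambda_sep(2))
      show "(\<Lambda> j / (1 - X $ i \<bullet> X $ j)) * (X $ j \<bullet> E i) = \<Lambda> i * (s * c) * (\<lambda>d. sg d * (sg d - ?C d) / (1 - (s\<^sup>2 * ?C d + sg d * c\<^sup>2))) (sep i j)"
        unfolding inner_commute[of "X $ j"] frame_products(1,6) L by simp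
    qed
    also have "\<dots> = \<Lambda> i * (s * c) * (\<Sum>d\<in>{1..<2 * N}. (\<lambda>d. sg d * (sg d - ?C d) / (1 - (s\<^sup>2 * ?C d + sg d * c\<^sup>2))) (int d))"
      unfolding sum_distrib_left[symmetric] by (subst sum_other_vortices) (simp_all add: ang_periodic)
    also have "(\<Sum>d\<in>{1..<2 * N}. (\<lambda>d. sg d * (sg d - ?C d) / (1 - (s\<^sup>2 * ?C d + sg d * c\<^sup>2))) (int d))
      = (\<Sum>j\<in>{1..<N}. 1 / s\<^sup>2) + (\<Sum>j<N. (1 + cos (oddpt N j)) / (h - cos (oddpt N j)) / s\<^sup>2)"
    proof (subst sum_even_odd_split)
      show "N > 0" using N_ge_2 by simp
      have 1: "sg (int (2 * j)) = 1" "sg (int (2 * j + 1)) = - 1" for j by (simp_all add: sg_def)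
      show "(\<Sum>j\<in>{1..<N}. (\<lambda>d. sg d * (sg d - ?C d) / (1 - (s\<^sup>2 * ?C d + sg d * c\<^sup>2))) (int (2 * j)))
        + (\<Sum>j<N. (\<lambda>d. sg d * (sg d - ?C d) / (1 - (s\<^sup>2 * ?C d + sg d * c\<^sup>2))) (int (2 * j + 1)))
        = (\<Sum>j\<in>{1..<N}. 1 / s\<^sup>2) + (\<Sum>j<N. (1 + cos (oddpt N j)) / (h - cos (oddpt N j)) / s\<^sup>2)"
        unfolding 1 ang_evenpt ang_oddpt dist_even_odd
        by (intro arg_cong2[where f = "(+)"] sum.cong refl)
           (use cos_evenpt_lt_1 in \<open>fastforce\<close>, simp add: mult_ac)
    qed
    finally show ?thesis using N_ge_2 by (simp add: sum_divide_distrib of_nat_diff)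
  qed
  have cF: "(\<Sum>j\<in>UNIV - {i}. (\<Lambda> j / (1 - X $ i \<bullet> X $ j)) * (X $ j \<bullet> F i)) = 0"
  proof -
    have "(\<Sum>j\<in>UNIV - {i}. (\<Lambda> j / (1 - X $ i \<bullet> X $ j)) * (X $ j \<bullet> F i))
      = (\<Sum>j\<in>UNIV - {i}. \<Lambda> i * s * (\<lambda>d. sg d * ?S d / (1 - (s\<^sup>2 * ?C d + sg d * c\<^sup>2))) (sep i j))"
    proof (intro sum.cong refl)
      fix j
      have L: "\<Lambda> j = \<Lambda> i * sg (sep i j)" by (rule Lambda_sep(2))
      show "(\<Lambda> j / (1 - X $ i \<bullet> X $ j)) * (X $ j \<bullet> F i) = \<Lambda> i * s * (\<lambda>d. sg d * ?S d / (1 - (s\<^sup>2 * ?C d + sg d * c\<^sup>2))) (sep i j)"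
        unfolding inner_commute[of "X $ j"] frame_products(1,7) L by simp
    qed
    also have "\<dots> = \<Lambda> i * s * (\<Sum>d\<in>{1..<2 * N}. (\<lambda>d. sg d * ?S d / (1 - (s\<^sup>2 * ?C d + sg d * c\<^sup>2))) (int d))"
      unfolding sum_distrib_left[symmetric] by (subst sum_other_vortices) (simp_all add: ang_periodic)
    also have "(\<Sum>d\<in>{1..<2 * N}. (\<lambda>d. sg d * ?S d / (1 - (s\<^sup>2 * ?C d + sg d * c\<^sup>2))) (int d)) = (\<Sum>d\<in>{1..<2 * N}. 0)"
    proof (rule sum_reflect)
      fix d assume d: "d \<in> {1..<2 * N}"
      show "(\<lambda>d. sg d * ?S d / (1 - (s\<^sup>2 * ?C d + sg d * c\<^sup>2))) (int d)
        + (\<lambda>d. sg d * ?S d / (1 - (s\<^sup>2 * ?C d + sg d * c\<^sup>2))) (int (2 * N - d)) = 2 * 0"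
        unfolding ang_reflect[OF d] by simp
    qed
    finally show ?thesis by simp
  qed
  have e3: "axis_vec \<xi>\<^sub>0 \<bullet> E i = \<xi>\<^sub>0 * (\<Lambda> i * s)" "axis_vec \<xi>\<^sub>0 \<bullet> F i = 0"
    by (simp_all add: E_def F_def inner_vector_3)
  have "?v \<bullet> E i = 0"
  proof -
    have "?v \<bullet> E i = \<Lambda> i * s * (\<xi>\<^sub>0 - ((real N - 1) * c + c * (\<Sum>j<N. (1 + cos (oddpt N j)) / (h - cos (oddpt N j)))) / s\<^sup>2)"
    proof -
      have "z * (l * s) - l * (s * c) * (n / s\<^sup>2 + V / s\<^sup>2) = l * s * (z - (n * c + c * V) / s\<^sup>2)" for z l n V
        by (simp add: algebra_simps add_divide_distrib)
      then show ?thesis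
        by (simp only: inner_diff_left inner_sum_left inner_scaleR_left cE e3)
    qed
    then show ?thesis unfolding sum_odd_one_plus_cos \<xi>\<^sub>0_def by (simp add: algebra_simps)
  qed
  moreover have "?v \<bullet> F i = 0"
    by (simp only: inner_diff_left inner_sum_left inner_scaleR_left cF e3)
  ultimately have "?v = (?v \<bullet> X $ i) *\<^sub>R X $ i"
    using frame_expansion[of ?v i] by simp
  then show ?thesis by blast
qed

lemma angular_velocity_rings: "angular_velocity \<Lambda> X (axis_vec \<xi>\<^sub>0)"
  by (rule angular_velocityI[OF X_phase_space critical_equation])

lemma vortex_field_rings: "vortex_field \<Lambda> X $ i = cross3 (axis_vec \<xi>\<^sub>0) (X $ i)"
proof -
  obtain \<kappa> where \<kappa>: "axis_vec \<xi>\<^sub>0 - (\<Sum>j\<in>UNIV - {i}. (\<Lambda> j / (1 - X $ i \<bullet> X $ j)) *\<^sub>R X $ j) = \<kappa> *\<^sub>R X $ i"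
    using critical_equation by blast
  have "vortex_field \<Lambda> X $ i = cross3 (\<Sum>j\<in>UNIV - {i}. (\<Lambda> j / (1 - X $ i \<bullet> X $ j)) *\<^sub>R X $ j) (X $ i)"
    by (simp add: vortex_field_def cross3_sum cross_mult_left)
  also have "(\<Sum>j\<in>UNIV - {i}. (\<Lambda> j / (1 - X $ i \<bullet> X $ j)) *\<^sub>R X $ j) = axis_vec \<xi>\<^sub>0 - \<kappa> *\<^sub>R X $ i"
    using \<kappa> by (simp add: algebra_simps)
  also have "cross3 (axis_vec \<xi>\<^sub>0 - \<kappa> *\<^sub>R X $ i) (X $ i) = cross3 (axis_vec \<xi>\<^sub>0) (X $ i)"
    using cross_add_left[of "axis_vec \<xi>\<^sub>0 - \<kappa> *\<^sub>R X $ i" "\<kappa> *\<^sub>R X $ i" "X $ i"] by (simp add: cross_mult_left)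
  finally show ?thesis .
qed

end

section \<open>The Hessian on Fourier modes\<close>

context staggered_rings
begin

definition wave :: "nat \<Rightarrow> real \<Rightarrow> real \<Rightarrow> 'n + 'n \<Rightarrow> real" where
  "wave k p q i = p * cos (real k * lon i) + q * sin (real k * lon i)"

lemma mode_wave: "mode k a1 a2 b1 b2 = fr (wave k a1 a2) (wave k b1 b2)"
  by (simp add: mode_def wave_def[abs_def])

lemma wave_shift:
  "wave k p q j = wave k p q i * cos (real k * ang (sep i j)) + wave k q (- p) i * sin (real k * ang (sep i j))"
proof -
  have "real k * lon j = real k * lon i + real k * ang (sep i j)"
    using lon_sep[of j i] by (simp add: algebra_simps)
  then show ?thesis by (simp add: wave_def cos_add sin_add algebra_simps)
qed

lemma fr_nth: "fr a b $ i = a i *\<^sub>R E i + b i *\<^sub>R F i" by (simp add: fr_def)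

text \<open>\<open>rowE\<close> and \<open>rowF\<close> are the contributions of a vortex at separation \<open>d\<close> to the \<open>E\<close> and \<open>F\<close> components of the Hessian at
vortex \<open>i\<close>. A wave at separation \<open>d\<close> is a combination of its values \<open>ai\<close>, \<open>bi\<close> at \<open>i\<close> and the values \<open>ac\<close>, \<open>bc\<close> at \<open>i\<close> of the
wave shifted by a quarter period.\<close>

definition rowE :: "nat \<Rightarrow> real \<Rightarrow> real \<Rightarrow> real \<Rightarrow> real \<Rightarrow> int \<Rightarrow> real" where
  "rowE k ai ac bi bc d = (let C = cos (ang d); S = sin (ang d); e = sg d; p = s\<^sup>2 * C + e * c\<^sup>2;
      aj = ai * cos (real k * ang d) + ac * sin (real k * ang d);
      bj = bi * cos (real k * ang d) + bc * sin (real k * ang d) in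
     e * (p / (1 - p) * ai - 1 / (1 - p) * (aj * (c\<^sup>2 * C + e * s\<^sup>2) + bj * (c * S))
       - (ai * (s * c * (e - C)) + bi * (s * S) + aj * (s * c * (e - C)) - bj * (s * S)) / (1 - p)\<^sup>2 * (s * c * (e - C))))"

definition rowF :: "nat \<Rightarrow> real \<Rightarrow> real \<Rightarrow> real \<Rightarrow> real \<Rightarrow> int \<Rightarrow> real" where
  "rowF k ai ac bi bc d = (let C = cos (ang d); S = sin (ang d); e = sg d; p = s\<^sup>2 * C + e * c\<^sup>2;
      aj = ai * cos (real k * ang d) + ac * sin (real k * ang d);
      bj = bi * cos (real k * ang d) + bc * sin (real k * ang d) in
     e * (p / (1 - p) * bi - 1 / (1 - p) * (- aj * (c * S) + bj * C)
       - (ai * (s * c * (e - C)) + bi * (s * S) + aj * (s * c * (e - C)) - bj * (s * S)) / (1 - p)\<^sup>2 * (s * S)))"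

lemma row_periodic:
  "rowE k ai ac bi bc (d + 2 * int N) = rowE k ai ac bi bc d"
  "rowF k ai ac bi bc (d + 2 * int N) = rowF k ai ac bi bc d"
  unfolding rowE_def rowF_def ang_periodic by simp_all

lemma row_sums:
  "(\<Sum>j\<in>UNIV - {i}. rowE k ai ac bi bc (sep i j)) = (\<Sum>d\<in>{1..<2 * N}. rowE k ai ac bi bc (int d))"
  "(\<Sum>j\<in>UNIV - {i}. rowF k ai ac bi bc (sep i j)) = (\<Sum>d\<in>{1..<2 * N}. rowF k ai ac bi bc (int d))"
  by (rule sum_other_vortices, rule row_periodic)+

lemma axis_inner_X: "X $ i \<bullet> axis_vec z = \<Lambda> i * c * z"
  by (simp add: X_nth inner_vector_3)

lemma hess_rows:
  fixes a1 a2 b1 b2 :: real and k :: nat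
  defines "v \<equiv> mode k a1 a2 b1 b2"
  shows "hess_vec \<Lambda> X (axis_vec \<xi>\<^sub>0) v $ i \<bullet> E i
      = (\<Sum>d\<in>{1..<2 * N}. rowE k (wave k a1 a2 i) (wave k a2 (- a1) i) (wave k b1 b2 i) (wave k b2 (- b1) i) (int d)) - \<xi>\<^sub>0 * c * wave k a1 a2 i"
    and "hess_vec \<Lambda> X (axis_vec \<xi>\<^sub>0) v $ i \<bullet> F i
      = (\<Sum>d\<in>{1..<2 * N}. rowF k (wave k a1 a2 i) (wave k a2 (- a1) i) (wave k b1 b2 i) (wave k b2 (- b1) i) (int d)) - \<xi>\<^sub>0 * c * wave k b1 b2 i"
proof -
  let ?a = "wave k a1 a2" and ?b = "wave k b1 b2"
  have v: "v $ j = ?a j *\<^sub>R E j + ?b j *\<^sub>R F j" for j by (simp add: v_def mode_wave fr_nth)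
  note sh = wave_shift[of k a1 a2 _ i] wave_shift[of k b1 b2 _ i]
  have vi: "v $ i \<bullet> E i = ?a i" "v $ i \<bullet> F i = ?b i"
    by (simp_all add: v inner_add_left frame_orthonormal)
  have vj: "v $ j \<bullet> E i = ?a j * (E i \<bullet> E j) + ?b j * (E i \<bullet> F j)"
    "v $ j \<bullet> F i = ?a j * (F i \<bullet> E j) + ?b j * (F i \<bullet> F j)" for j
    by (simp_all add: v inner_add_left inner_commute[of "E j"] inner_commute[of "F j"])
  have vx: "v $ i \<bullet> X $ j = ?a i * (E i \<bullet> X $ j) + ?b i * (F i \<bullet> X $ j)"
    "X $ i \<bullet> v $ j = ?a j * (X $ i \<bullet> E j) + ?b j * (X $ i \<bullet> F j)" for j
    by (simp_all add: v inner_add_left inner_add_right)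
  have LL: "\<Lambda> i * (X $ i \<bullet> axis_vec \<xi>\<^sub>0) = \<xi>\<^sub>0 * c"
    unfolding axis_inner_X by (simp add: mult.commute)
  have h: "hess_vec \<Lambda> X (axis_vec \<xi>\<^sub>0) v $ i \<bullet> y = (\<Sum>j\<in>UNIV - {i}. \<Lambda> i * \<Lambda> j * ((X $ i \<bullet> X $ j) / (1 - X $ i \<bullet> X $ j) * (v $ i \<bullet> y)
     - 1 / (1 - X $ i \<bullet> X $ j) * (v $ j \<bullet> y) - (v $ i \<bullet> X $ j + X $ i \<bullet> v $ j) / (1 - X $ i \<bullet> X $ j)\<^sup>2 * (X $ j \<bullet> y))) - \<xi>\<^sub>0 * c * (v $ i \<bullet> y)" for y
    unfolding hess_vec_def by (simp only: vec_lambda_beta inner_diff_left inner_sum_left inner_scaleR_left LL)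
  show "hess_vec \<Lambda> X (axis_vec \<xi>\<^sub>0) v $ i \<bullet> E i
      = (\<Sum>d\<in>{1..<2 * N}. rowE k (?a i) (wave k a2 (- a1) i) (?b i) (wave k b2 (- b1) i) (int d)) - \<xi>\<^sub>0 * c * ?a i"
    unfolding h row_sums(1)[of k _ _ _ _ i, symmetric] vi(1)
  proof (intro arg_cong2[where f = "(-)"] sum.cong refl)
    fix j
    show "\<Lambda> i * \<Lambda> j * ((X $ i \<bullet> X $ j) / (1 - X $ i \<bullet> X $ j) * ?a i
     - 1 / (1 - X $ i \<bullet> X $ j) * (v $ j \<bullet> E i) - (v $ i \<bullet> X $ j + X $ i \<bullet> v $ j) / (1 - X $ i \<bullet> X $ j)\<^sup>2 * (X $ j \<bullet> E i))
     = rowE k (?a i) (wave k a2 (- a1) i) (?b i) (wave k b2 (- b1) i) (sep i j)"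
      unfolding vj vx Lambda_sep(1) inner_commute[of "X $ j" "E i"]
      unfolding frame_products rowE_def Let_def sh[of j, symmetric]
      by (simp add: add_diff_eq)
  qed
  show "hess_vec \<Lambda> X (axis_vec \<xi>\<^sub>0) v $ i \<bullet> F i
      = (\<Sum>d\<in>{1..<2 * N}. rowF k (?a i) (wave k a2 (- a1) i) (?b i) (wave k b2 (- b1) i) (int d)) - \<xi>\<^sub>0 * c * ?b i"
    unfolding h row_sums(2)[of k _ _ _ _ i, symmetric] vi(2)
  proof (intro arg_cong2[where f = "(-)"] sum.cong refl)
    fix j
    show "\<Lambda> i * \<Lambda> j * ((X $ i \<bullet> X $ j) / (1 - X $ i \<bullet> X $ j) * ?b i
     - 1 / (1 - X $ i \<bullet> X $ j) * (v $ j \<bullet> F i) - (v $ i \<bullet> X $ j + X $ i \<bullet> v $ j) / (1 - X $ i \<bullet> X $ j)\<^sup>2 * (X $ j \<bullet> F i))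
     = rowF k (?a i) (wave k a2 (- a1) i) (?b i) (wave k b2 (- b1) i) (sep i j)"
      unfolding vj vx Lambda_sep(1) inner_commute[of "X $ j" "F i"]
      unfolding frame_products rowF_def Let_def sh[of j, symmetric]
      by (simp add: add_diff_eq)
  qed
qed

lemma sg_parity [simp]: "sg (int (2 * j)) = 1" "sg (int (2 * j + 1)) = - 1"
  by (simp_all add: sg_def)

text \<open>Adding the contributions of two vortices placed symmetrically to \<open>i\<close> in its own ring cancels the coupling between
\<open>E\<close> and \<open>F\<close>.\<close>

lemma rowE_even:
  assumes "j \<in> {1..<N}"
  shows "rowE k ai ac bi bc (int (2 * j)) + rowE k ai ac bi bc (int (2 * N - 2 * j))
    = 2 * (ai * ((1 - cos (real k * evenpt N j)) / (1 - cos (evenpt N j)) - 1) / s\<^sup>2)"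
    and "rowF k ai ac bi bc (int (2 * j)) + rowF k ai ac bi bc (int (2 * N - 2 * j))
    = 2 * (bi * (c\<^sup>2 - (1 - cos (real k * evenpt N j)) / (1 - cos (evenpt N j))) / s\<^sup>2)"
proof -
  have d: "2 * j \<in> {1..<2 * N}" using assms by auto
  define C S x y where "C = cos (evenpt N j)" and "S = sin (evenpt N j)"
    and "x = cos (real k * evenpt N j)" and "y = sin (real k * evenpt N j)"
  have C: "C < 1" "S\<^sup>2 + C\<^sup>2 = 1" "(- S)\<^sup>2 + C\<^sup>2 = 1"
    using cos_evenpt_lt_1[OF assms] by (simp_all add: C_def S_def)
  have s0: "s \<noteq> 0" using s_pos by simp
  note R = same_ring_row[OF s_c C(2) C(1) s0] same_ring_row[OF s_c C(3) C(1) s0]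
  have C0: "1 - C \<noteq> 0" using C by simp
  have f1: "A / (s\<^sup>2 * (1 - C)) + B / (s\<^sup>2 * (1 - C)) = (A + B) / (1 - C) / s\<^sup>2" for A B
    by (simp add: add_divide_distrib mult.commute)
  have f2: "2 * (ai * ((1 - x) / (1 - C) - 1) / s\<^sup>2) = (2 * ai * (C - x)) / (1 - C) / s\<^sup>2"
    "2 * (bi * (c\<^sup>2 - (1 - x) / (1 - C)) / s\<^sup>2) = (2 * bi * (c\<^sup>2 * (1 - C) - (1 - x))) / (1 - C) / s\<^sup>2"
    using C0 s0 by (simp_all add: divide_simps algebra_simps)
  show "rowE k ai ac bi bc (int (2 * j)) + rowE k ai ac bi bc (int (2 * N - 2 * j))
    = 2 * (ai * ((1 - cos (real k * evenpt N j)) / (1 - cos (evenpt N j)) - 1) / s\<^sup>2)"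
    unfolding rowE_def Let_def ang_reflect[OF d] sg_parity ang_evenpt C_def[symmetric] S_def[symmetric] x_def[symmetric] y_def[symmetric] mult_1
    unfolding R f1 f2 by (intro arg_cong2[where f = "(/)"] refl) (simp add: algebra_simps)
  show "rowF k ai ac bi bc (int (2 * j)) + rowF k ai ac bi bc (int (2 * N - 2 * j))
    = 2 * (bi * (c\<^sup>2 - (1 - cos (real k * evenpt N j)) / (1 - cos (evenpt N j))) / s\<^sup>2)"
    unfolding rowF_def Let_def ang_reflect[OF d] sg_parity ang_evenpt C_def[symmetric] S_def[symmetric] x_def[symmetric] y_def[symmetric] mult_1
    unfolding R f1 f2 by (intro arg_cong2[where f = "(/)"] refl) (simp add: algebra_simps)
qed

text \<open>In the opposite ring the coupling does not cancel: its remainder adds up to \<open>\<beta> k\<close>.\<close>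

lemma rowE_odd:
  fixes j k :: nat
  assumes "j < N"
  defines "x \<equiv> oddpt N j"
  defines "g \<equiv> (h * cos x - 1) / (h - cos x)\<^sup>2" and "b \<equiv> 2 * c / s^4 * (sin x * sin (real k * x) / (h - cos x)\<^sup>2)"
  shows "rowE k ai ac bi bc (int (2 * j + 1)) + rowE k ai ac bi bc (int (2 * N - (2 * j + 1)))
    = 2 * (ai * (g + (1 - cos x) / (h - cos x) + g * cos (real k * x)) / s\<^sup>2 + bc * b)"
    and "rowF k ai ac bi bc (int (2 * j + 1)) + rowF k ai ac bi bc (int (2 * N - (2 * j + 1)))
    = 2 * (bi * (c\<^sup>2 * ((1 + cos x) / (h - cos x)) - g + g * cos (real k * x)) / s\<^sup>2 - ac * b)"
proof -
  have d: "2 * j + 1 \<in> {1..<2 * N}" using assms by auto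
  define C S u y where "C = cos x" and "S = sin x"
    and "u = cos (real k * x)" and "y = sin (real k * x)"
  have C: "S\<^sup>2 + C\<^sup>2 = 1" "(- S)\<^sup>2 + C\<^sup>2 = 1"
    by (simp_all add: C_def S_def)
  define z where "z = h - C"
  have z: "z > 0" using h_minus_cos_pos[OF assms(1)] by (simp add: z_def C_def x_def)
  have q: "1 + c\<^sup>2 - s\<^sup>2 * C = s\<^sup>2 * z" using h_s by (simp add: z_def algebra_simps)
  have q0: "1 + c\<^sup>2 - s\<^sup>2 * C \<noteq> 0" unfolding q using z s_pos by simp
  have hz: "(1 + c\<^sup>2) * C - s\<^sup>2 = s\<^sup>2 * (h * C - 1)" using h_s by algebra
  have s0: "s \<noteq> 0" using s_pos by simp
  have k1: "((1 + c\<^sup>2) * C - s\<^sup>2) / (1 + c\<^sup>2 - s\<^sup>2 * C)\<^sup>2 = g / s\<^sup>2"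
    unfolding hz unfolding q g_def C_def[symmetric] z_def[symmetric] using s0 by (simp add: power2_eq_square)
  have k2: "A / (1 + c\<^sup>2 - s\<^sup>2 * C) = (A / z) / s\<^sup>2" for A
    unfolding q by (simp add: mult.commute)
  have k3: "2 * c * S / (1 + c\<^sup>2 - s\<^sup>2 * C)\<^sup>2 = 2 * c / s^4 * (S / z\<^sup>2)"
    unfolding q by (simp add: power_mult_distrib)
  have bb: "b = 2 * c / s^4 * (S / z\<^sup>2) * y"
    by (simp add: b_def S_def y_def z_def C_def)
  have k3': "2 * c * - S / (1 + c\<^sup>2 - s\<^sup>2 * C)\<^sup>2 = - (2 * c / s^4 * (S / z\<^sup>2))"
    using k3 by simp
  have neg: "- 1 * A = - A" for A :: real by simp
  have pm: "s\<^sup>2 * C + - 1 * c\<^sup>2 = s\<^sup>2 * C - c\<^sup>2" "c\<^sup>2 * C + - 1 * s\<^sup>2 = c\<^sup>2 * C - s\<^sup>2" by simp_all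
  note R = opposite_ring_row[OF s_c C(1) q0] opposite_ring_row[OF s_c C(2) q0]
  define r where "r = 2 * c / s^4 * (S / z\<^sup>2)"
  define t where "t = s\<^sup>2 * c * S * (1 + C) / (1 + c\<^sup>2 - s\<^sup>2 * C)\<^sup>2"
  have k4: "s\<^sup>2 * c * - S * (1 + C) / (1 + c\<^sup>2 - s\<^sup>2 * C)\<^sup>2 = - t"
    by (simp add: t_def)
  define g' V W where "g' = g / s\<^sup>2" and "V = (1 - C) / z / s\<^sup>2" and "W = (1 + C) / z / s\<^sup>2"
  have tE: "ai * (g + (1 - C) / z + g * u) / s\<^sup>2 = ai * (g' + V + g' * u)"
    and tF: "bi * (c\<^sup>2 * ((1 + C) / z) - g + g * u) / s\<^sup>2 = bi * (c\<^sup>2 * W - g' + g' * u)"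
    by (simp_all add: g'_def V_def W_def algebra_simps add_divide_distrib diff_divide_distrib)
  have k5: "c\<^sup>2 * (1 + C) / z / s\<^sup>2 = c\<^sup>2 * W" by (simp add: W_def)
  show "rowE k ai ac bi bc (int (2 * j + 1)) + rowE k ai ac bi bc (int (2 * N - (2 * j + 1)))
    = 2 * (ai * (g + (1 - cos x) / (h - cos x) + g * cos (real k * x)) / s\<^sup>2 + bc * b)"
    unfolding rowE_def Let_def ang_reflect[OF d] sg_parity ang_oddpt x_def[symmetric] C_def[symmetric] S_def[symmetric] u_def[symmetric] y_def[symmetric] pm
    unfolding neg R k1 k2 k3 k3' bb z_def[symmetric] r_def[symmetric] k4 t_def[symmetric] tE
    unfolding g'_def[symmetric] V_def[symmetric] by (simp add: algebra_simps)
  show "rowF k ai ac bi bc (int (2 * j + 1)) + rowF k ai ac bi bc (int (2 * N - (2 * j + 1)))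
    = 2 * (bi * (c\<^sup>2 * ((1 + cos x) / (h - cos x)) - g + g * cos (real k * x)) / s\<^sup>2 - ac * b)"
    unfolding rowF_def Let_def ang_reflect[OF d] sg_parity ang_oddpt x_def[symmetric] C_def[symmetric] S_def[symmetric] u_def[symmetric] y_def[symmetric] pm
    unfolding neg R k1 k2 k3 k3' bb z_def[symmetric] r_def[symmetric] k4 t_def[symmetric] tF k5
    unfolding g'_def[symmetric] by (simp add: algebra_simps)
qed

lemma sum_reflect_split:
  fixes f :: "nat \<Rightarrow> real"
  assumes "\<And>j. j \<in> {1..<N} \<Longrightarrow> f (2 * j) + f (2 * N - 2 * j) = 2 * p j"
    and "\<And>j. j < N \<Longrightarrow> f (2 * j + 1) + f (2 * N - (2 * j + 1)) = 2 * q j"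
  shows "(\<Sum>d\<in>{1..<2 * N}. f d) = (\<Sum>j\<in>{1..<N}. p j) + (\<Sum>j<N. q j)"
proof -
  have "(\<Sum>d\<in>{1..<2 * N}. f d) = (\<Sum>d\<in>{1..<2 * N}. (f d + f (2 * N - d)) / 2)"
    by (rule sum_reflect) simp
  also have "\<dots> = (\<Sum>j\<in>{1..<N}. (f (2 * j) + f (2 * N - 2 * j)) / 2) + (\<Sum>j<N. (f (2 * j + 1) + f (2 * N - (2 * j + 1))) / 2)"
    using N_ge_2 by (intro sum_even_odd_split) simp
  also have "\<dots> = (\<Sum>j\<in>{1..<N}. p j) + (\<Sum>j<N. q j)"
    using assms by (intro arg_cong2[where f = "(+)"] sum.cong refl) simp_all
  finally show ?thesis .
qed

lemma rowE_sum:
  assumes "k \<le> N"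
  shows "(\<Sum>d\<in>{1..<2 * N}. rowE k ai ac bi bc (int d)) - \<xi>\<^sub>0 * c * ai = P k / s\<^sup>2 * ai + \<beta> k * bc"
proof -
  have "(\<Sum>d\<in>{1..<2 * N}. rowE k ai ac bi bc (int d))
     = (\<Sum>j\<in>{1..<N}. ai * ((1 - cos (real k * evenpt N j)) / (1 - cos (evenpt N j)) - 1) / s\<^sup>2)
      + (\<Sum>j<N. ai * ((h * cos (oddpt N j) - 1) / (h - cos (oddpt N j))\<^sup>2 + (1 - cos (oddpt N j)) / (h - cos (oddpt N j))
          + (h * cos (oddpt N j) - 1) / (h - cos (oddpt N j))\<^sup>2 * cos (real k * oddpt N j)) / s\<^sup>2
          + bc * (2 * c / s^4 * (sin (oddpt N j) * sin (real k * oddpt N j) / (h - cos (oddpt N j))\<^sup>2)))"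
    by (rule sum_reflect_split) (erule rowE_even(1) rowE_odd(1))+
  also have "\<dots> = ai * (real k * (real N - real k) - (real N - 1)) / s\<^sup>2
      + (ai * (G 0 + (real N - c * Q) + G k) / s\<^sup>2 + bc * \<beta> k)"
  proof -
    have "(\<Sum>j\<in>{1..<N}. ai * ((1 - cos (real k * evenpt N j)) / (1 - cos (evenpt N j)) - 1) / s\<^sup>2)
      = ai * ((\<Sum>j\<in>{1..<N}. (1 - cos (real k * evenpt N j)) / (1 - cos (evenpt N j))) - (real N - 1)) / s\<^sup>2"
      using N_ge_2 by (simp only: sum_divide_distrib[symmetric] sum_distrib_left[symmetric] sum_subtractf) (simp add: of_nat_diff)
    then show ?thesis
      using sum_even_kernel[OF assms] N_ge_2
      unfolding sum.distrib sum_divide_distrib[symmetric] sum_distrib_left[symmetric] sum_odd_one_minus_cos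
      by (simp add: G_def odd_kernel_sum_def \<beta>_def)
  qed
  also have "\<dots> - \<xi>\<^sub>0 * c * ai = P k / s\<^sup>2 * ai + \<beta> k * bc"
    by (simp add: P_def \<xi>\<^sub>0_def algebra_simps add_divide_distrib diff_divide_distrib power2_eq_square)
  finally show ?thesis .
qed

lemma rowF_sum:
  assumes "k \<le> N"
  shows "(\<Sum>d\<in>{1..<2 * N}. rowF k ai ac bi bc (int d)) - \<xi>\<^sub>0 * c * bi = - (R k / s\<^sup>2) * bi - \<beta> k * ac"
proof -
  have "(\<Sum>d\<in>{1..<2 * N}. rowF k ai ac bi bc (int d))
     = (\<Sum>j\<in>{1..<N}. bi * (c\<^sup>2 - (1 - cos (real k * evenpt N j)) / (1 - cos (evenpt N j))) / s\<^sup>2)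
      + (\<Sum>j<N. bi * (c\<^sup>2 * ((1 + cos (oddpt N j)) / (h - cos (oddpt N j))) - (h * cos (oddpt N j) - 1) / (h - cos (oddpt N j))\<^sup>2
          + (h * cos (oddpt N j) - 1) / (h - cos (oddpt N j))\<^sup>2 * cos (real k * oddpt N j)) / s\<^sup>2
          - ac * (2 * c / s^4 * (sin (oddpt N j) * sin (real k * oddpt N j) / (h - cos (oddpt N j))\<^sup>2)))"
    by (rule sum_reflect_split) (erule rowE_even(2) rowE_odd(2))+
  also have "\<dots> = bi * ((real N - 1) * c\<^sup>2 - real k * (real N - real k)) / s\<^sup>2
      + (bi * (c * (Q - real N * c) - G 0 + G k) / s\<^sup>2 - ac * \<beta> k)"
  proof -
    have "(\<Sum>j\<in>{1..<N}. bi * (c\<^sup>2 - (1 - cos (real k * evenpt N j)) / (1 - cos (evenpt N j))) / s\<^sup>2)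
      = bi * ((real N - 1) * c\<^sup>2 - (\<Sum>j\<in>{1..<N}. (1 - cos (real k * evenpt N j)) / (1 - cos (evenpt N j)))) / s\<^sup>2"
      using N_ge_2 by (simp only: sum_divide_distrib[symmetric] sum_distrib_left[symmetric] sum_subtractf) (simp add: of_nat_diff)
    then show ?thesis
      using sum_even_kernel[OF assms] N_ge_2
      unfolding sum.distrib sum_subtractf sum_divide_distrib[symmetric] sum_distrib_left[symmetric] sum_odd_one_plus_cos[symmetric]
      by (simp add: G_def odd_kernel_sum_def \<beta>_def power2_eq_square)
  qed
  also have "\<dots> - \<xi>\<^sub>0 * c * bi = - (R k / s\<^sup>2) * bi - \<beta> k * ac"
    by (simp add: R_def \<xi>\<^sub>0_def algebra_simps add_divide_distrib diff_divide_distrib power2_eq_square)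
  finally show ?thesis .
qed

lemma inner_config: "v \<bullet> w = (\<Sum>i\<in>UNIV. v $ i \<bullet> w $ i)" for v w :: "real^3^'m::finite"
  by (simp only: inner_vec_def[of v w])

lemma fr_tangent: "fr a b \<in> tangent_space X"
  by (simp add: tangent_space_def fr_nth inner_add_left frame_orthonormal)

lemma symplectic_form_fr:
  "symplectic_form \<Lambda> X (fr a b) w = (\<Sum>i\<in>UNIV. b i * (E i \<bullet> w $ i) - a i * (F i \<bullet> w $ i))"
proof -
  have "dual_vec \<Lambda> X (fr a b) $ i = b i *\<^sub>R E i - a i *\<^sub>R F i" for i
  proof -
    have "dual_vec \<Lambda> X (fr a b) $ i = a i *\<^sub>R (\<Lambda> i *\<^sub>R cross3 (X $ i) (E i)) + b i *\<^sub>R (\<Lambda> i *\<^sub>R cross3 (X $ i) (F i))"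
      by (simp add: dual_vec_def fr_nth cross_add_right cross_mult_right scaleR_add_right mult.commute)
    then show ?thesis by (simp add: frame_cross)
  qed
  then show ?thesis by (simp add: symplectic_form_eq_inner inner_config inner_diff_left)
qed

text \<open>Expressed through the symplectic form, the Hessian acts on a mode as a \<open>4 \<times> 4\<close> matrix. The
identity holds for all tangent vectors \<open>w\<close>, also for modes outside the slice.\<close>

theorem mode_operator:
  assumes k: "k \<le> N" and w: "w \<in> tangent_space X"
  defines "A \<equiv> P k / s\<^sup>2" and "D \<equiv> - (R k / s\<^sup>2)"
  shows "slice_hessian \<Lambda> X (axis_vec \<xi>\<^sub>0) (mode k a1 a2 b1 b2) w
    = symplectic_form \<Lambda> X (mode k (- D * b1 + \<beta> k * a2) (- D * b2 - \<beta> k * a1) (A * a1 + \<beta> k * b2) (A * a2 - \<beta> k * b1)) w"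
proof -
  let ?v = "mode k a1 a2 b1 b2"
  have vt: "?v \<in> tangent_space X" by (simp add: mode_wave fr_tangent)
  have "slice_hessian \<Lambda> X (axis_vec \<xi>\<^sub>0) ?v w = hess_vec \<Lambda> X (axis_vec \<xi>\<^sub>0) ?v \<bullet> w"
    unfolding slice_hessian_def by (rule hessian_augmented_hamiltonian[OF X_phase_space vt w])
  also have "\<dots> = (\<Sum>i\<in>UNIV. (A * wave k a1 a2 i + \<beta> k * wave k b2 (- b1) i) * (E i \<bullet> w $ i)
       - (- D * wave k b1 b2 i + \<beta> k * wave k a2 (- a1) i) * (F i \<bullet> w $ i))"
    unfolding inner_config
  proof (rule sum.cong[OF refl])
    fix i
    have "w $ i \<bullet> X $ i = 0" using w by (simp add: tangent_space_def)
    then have "hess_vec \<Lambda> X (axis_vec \<xi>\<^sub>0) ?v $ i \<bullet> w $ i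
        = (hess_vec \<Lambda> X (axis_vec \<xi>\<^sub>0) ?v $ i \<bullet> E i) * (w $ i \<bullet> E i) + (hess_vec \<Lambda> X (axis_vec \<xi>\<^sub>0) ?v $ i \<bullet> F i) * (w $ i \<bullet> F i)"
      by (subst frame_inner[of _ _ i]) simp
    then show "hess_vec \<Lambda> X (axis_vec \<xi>\<^sub>0) ?v $ i \<bullet> w $ i = (A * wave k a1 a2 i + \<beta> k * wave k b2 (- b1) i) * (E i \<bullet> w $ i)
       - (- D * wave k b1 b2 i + \<beta> k * wave k a2 (- a1) i) * (F i \<bullet> w $ i)"
      unfolding hess_rows rowE_sum[OF k] rowF_sum[OF k] by (simp add: A_def D_def inner_commute algebra_simps)
  qed
  also have "\<dots> = symplectic_form \<Lambda> X (mode k (- D * b1 + \<beta> k * a2) (- D * b2 - \<beta> k * a1) (A * a1 + \<beta> k * b2) (A * a2 - \<beta> k * b1)) w"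
    unfolding mode_wave symplectic_form_fr
    by (intro sum.cong refl) (simp add: wave_def algebra_simps)
  finally show ?thesis .
qed

end

section \<open>Eigenvalues of a Fourier mode\<close>

lemma rotate_nth: "rotate g x $ i = g *v x $ i" by (simp add: rotate_def)

lemma rotation_inner:
  fixes g :: "real^3^3"
  assumes "rotation_matrix g" shows "(g *v a) \<bullet> (g *v b) = a \<bullet> b"
proof -
  have "orthogonal_matrix (matrix ((*v) g))"
    using assms by (simp add: rotation_matrix_def)
  then have "orthogonal_transformation ((*v) g)"
    using orthogonal_transformation_matrix matrix_vector_mul_linear by blast
  then show ?thesis by (simp add: orthogonal_transformation_def)
qed

lemma rotate_phase_space:
  assumes g: "rotation_matrix g" and x: "x \<in> phase_space"
  shows "rotate g x \<in> phase_space"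
proof -
  have n: "norm (g *v a) = norm a" for a using rotation_inner[OF g, of a a] by (simp add: norm_eq_sqrt_inner)
  have "g *v a \<noteq> g *v b" if "a \<noteq> b" for a b
  proof -
    have "norm (g *v a - g *v b) = norm (a - b)"
      using n[of "a - b"] by (simp add: matrix_vector_mult_diff_distrib)
    then show ?thesis using that by auto
  qed
  then show ?thesis using x n by (auto simp: phase_space_def rotate_nth)
qed

lemma vortex_field_rotate:
  fixes x :: "real^3^'m::finite"
  assumes g: "rotation_matrix g"
  shows "vortex_field \<Gamma> (rotate g x) = rotate g (vortex_field \<Gamma> x)"
proof -
  have "g *v (\<Sum>j\<in>A. f j) = (\<Sum>j\<in>A. g *v f j)" for f :: "'m \<Rightarrow> real^3" and A
    by (induction A rule: infinite_finite_induct) (simp_all add: matrix_vector_right_distrib)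
  then show ?thesis
    by (simp add: vec_eq_iff[where 'a = "real^3"] vortex_field_def rotate_nth rotation_inner[OF g]
        cross_rotation_matrix[OF g] matrix_vector_mult_scaleR)
qed

definition rot_z :: "real \<Rightarrow> real^3^3" where
  "rot_z t = vector [vector [cos t, - sin t, 0], vector [sin t, cos t, 0], vector [0, 0, 1]]"

lemma rotation_rot_z: "rotation_matrix (rot_z t)"
proof -
  have "orthogonal_matrix (rot_z t)"
    unfolding orthogonal_matrix
    by (simp add: vec_eq_iff forall_3 transpose_def matrix_matrix_mult_def mat_def rot_z_def sum_3 power2_eq_square[symmetric])
  moreover have "det (rot_z t) = 1"
    by (simp add: det_3 rot_z_def power2_eq_square[symmetric])
  ultimately show ?thesis by (simp add: rotation_matrix_def)
qed

lemma rot_z_apply: "rot_z t *v y = vector [cos t * y $ 1 - sin t * y $ 2, sin t * y $ 1 + cos t * y $ 2, y $ 3]"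
  by (simp add: vec_eq_iff forall_3 matrix_vector_mult_def rot_z_def sum_3)

text \<open>The rotating configuration solves the equations because the field commutes with rotations.\<close>

lemma relative_equilibriumI:
  fixes x :: "real^3^'m::finite"
  assumes x: "x \<in> phase_space" and f: "\<And>i. vortex_field \<Gamma> x $ i = cross3 (vector [0, 0, z]) (x $ i)"
  shows "relative_equilibrium \<Gamma> x"
proof -
  define u where "u t = rotate (rot_z (z * t)) x" for t
  define p q r :: "real^3^'m" where "p = (\<chi> i. vector [x $ i $ 1, x $ i $ 2, 0])"
    and "q = (\<chi> i. vector [- x $ i $ 2, x $ i $ 1, 0])" and "r = (\<chi> i. vector [0, 0, x $ i $ 3])"
  have u: "u t = cos (z * t) *\<^sub>R p + sin (z * t) *\<^sub>R q + r" for t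
    by (simp add: u_def rotate_def rot_z_apply p_def q_def r_def vec_eq_iff forall_3)
  have d: "(u has_vector_derivative (- sin (z * t) * z) *\<^sub>R p + (cos (z * t) * z) *\<^sub>R q) (at t)" for t
    unfolding u[abs_def] has_vector_derivative_def
    by (auto intro!: derivative_eq_intros simp: algebra_simps)
  have "vortex_field \<Gamma> (u t) = (- sin (z * t) * z) *\<^sub>R p + (cos (z * t) * z) *\<^sub>R q" for t
    unfolding u_def vortex_field_rotate[OF rotation_rot_z] vec_eq_iff[where 'a = "real^3"] rotate_nth f
    by (simp add: rot_z_apply p_def q_def cross3_def vec_eq_iff forall_3 algebra_simps)
  with d have "solution_on \<Gamma> UNIV u"
    by (simp add: solution_on_def u_def rotate_phase_space[OF rotation_rot_z x])
  moreover have "u 0 = x"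
    by (simp add: u_def rotate_def rot_z_apply vec_eq_iff forall_3)
  ultimately show ?thesis unfolding relative_equilibrium_def SO3_def
    using rotation_rot_z u_def by blast
qed

context staggered_rings
begin

lemma relative_equilibrium_rings: "relative_equilibrium \<Lambda> X"
  by (rule relative_equilibriumI[OF X_phase_space vortex_field_rings])

lemma fixed_equilibrium_rings:
  assumes "c = 0" shows "fixed_equilibrium \<Lambda> X"
proof -
  have "\<xi>\<^sub>0 = 0" using assms by (simp add: \<xi>\<^sub>0_def Q_def)
  then have "axis_vec \<xi>\<^sub>0 = 0" by (simp add: vec_eq_iff forall_3)
  then show ?thesis using angular_velocity_rings
    by (simp add: fixed_equilibrium_def angular_velocity_def augmented_hamiltonian_0)
qed

lemma sum_vortex_cos_sin:
  assumes "\<not> 2 * N dvd l"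
  shows "(\<Sum>i\<in>UNIV. cos (real l * lon i)) = 0" "(\<Sum>i\<in>UNIV. sin (real l * lon i)) = 0"
proof -
  have "real l * lon i = 2 * pi * real l / real (2 * N) * real (idx i) + 0" for i
    by (simp add: lon_def)
  then show "(\<Sum>i\<in>UNIV. cos (real l * lon i)) = 0" "(\<Sum>i\<in>UNIV. sin (real l * lon i)) = 0"
    using sum_cos_sin_arith_progression[of "2 * N" l 0] assms N_ge_2
      sum_all_vortices[of "\<lambda>m. cos (2 * pi * real l / real (2 * N) * real m + 0)"]
      sum_all_vortices[of "\<lambda>m. sin (2 * pi * real l / real (2 * N) * real m + 0)"] by simp_all
qed

lemma cos_sin_N_lon: "cos (real N * lon i) = \<Lambda> i" "sin (real N * lon i) = 0"
proof -
  have "real N * lon i = real (idx i) * pi" using N_ge_2 by (simp add: lon_def)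
  then show "cos (real N * lon i) = \<Lambda> i" "sin (real N * lon i) = 0"
    by (simp_all only: cos_npi sin_npi Lambda_idx) (simp add: minus_one_power_iff)
qed

lemma Lambda_cos_sin:
  "\<Lambda> i * cos (real k * lon i) = cos (real (N + k) * lon i)"
  "\<Lambda> i * sin (real k * lon i) = sin (real (N + k) * lon i)"
  by (simp_all add: distrib_right cos_add sin_add cos_sin_N_lon)

text \<open>Multiplication with \<open>\<Lambda>\<close> shifts the wave number by \<open>N\<close>, so all sums are sums of waves with wave numbers \<open>k\<close> and
\<open>N + 1 \<plusminus> k\<close>. For \<open>1 \<le> k \<le> N\<close> one of these is a multiple of \<open>2N\<close> only if \<open>k = N - 1\<close>.\<close>

lemma wave_sums:
  assumes "1 \<le> k" "k \<le> N" "k \<noteq> N - 1"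
  shows "(\<Sum>i\<in>UNIV. wave k p q i) = 0" "(\<Sum>i\<in>UNIV. \<Lambda> i * wave k p q i * cos (lon i)) = 0"
    "(\<Sum>i\<in>UNIV. \<Lambda> i * wave k p q i * sin (lon i)) = 0"
proof -
  have nd: "\<not> 2 * N dvd k" "\<not> 2 * N dvd N + k + 1" "\<not> 2 * N dvd N + k - 1"
  proof -
    show "\<not> 2 * N dvd k" using assms N_ge_2 by (auto dest: dvd_imp_le)
    show "\<not> 2 * N dvd N + k - 1" using assms N_ge_2 by (auto dest!: dvd_imp_le)
    show "\<not> 2 * N dvd N + k + 1"
    proof
      assume "2 * N dvd N + k + 1"
      then obtain m where m: "N + k + 1 = 2 * N * m" by (elim dvdE)
      have "2 * N * m < 2 * N * 2" using m assms(2) N_ge_2 by linarith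
      then have "m < 2" using N_ge_2 by (simp only: mult_less_cancel1)
      moreover have "m \<noteq> 0" using m by (intro notI) simp
      ultimately have "m = 1" by simp
      then show False using m assms by simp
    qed
  qed
  have e: "real (N + k - 1) * lon i = real (N + k) * lon i - lon i" "real (N + k + 1) * lon i = real (N + k) * lon i + lon i" for i
  proof -
    have "real (N + k - 1) = real (N + k) - 1" "real (N + k + 1) = real (N + k) + 1"
      using assms by (simp_all add: of_nat_diff)
    then show "real (N + k - 1) * lon i = real (N + k) * lon i - lon i" "real (N + k + 1) * lon i = real (N + k) * lon i + lon i"
      by (simp_all only: left_diff_distrib distrib_right mult_1)
  qed
  show "(\<Sum>i\<in>UNIV. wave k p q i) = 0"
    unfolding wave_def sum.distrib sum_distrib_left[symmetric] sum_vortex_cos_sin[OF nd(1)] by simp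
  have t1: "\<Lambda> i * wave k p q i * cos (lon i) = p / 2 * cos (real (N + k + 1) * lon i) + p / 2 * cos (real (N + k - 1) * lon i)
     + q / 2 * sin (real (N + k + 1) * lon i) + q / 2 * sin (real (N + k - 1) * lon i)"
    and t2: "\<Lambda> i * wave k p q i * sin (lon i) = p / 2 * sin (real (N + k + 1) * lon i) - p / 2 * sin (real (N + k - 1) * lon i)
     - q / 2 * cos (real (N + k + 1) * lon i) + q / 2 * cos (real (N + k - 1) * lon i)" for i
  proof -
    have w: "\<Lambda> i * wave k p q i = p * cos (real (N + k) * lon i) + q * sin (real (N + k) * lon i)"
      unfolding wave_def Lambda_cos_sin[symmetric] by (simp add: algebra_simps)
    have g1: "(p * x + q * y) * u = p / 2 * (x * u - y * v) + p / 2 * (x * u + y * v) + q / 2 * (y * u + x * v) + q / 2 * (y * u - x * v)"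
      and g2: "(p * x + q * y) * v = p / 2 * (y * u + x * v) - p / 2 * (y * u - x * v) - q / 2 * (x * u - y * v) + q / 2 * (x * u + y * v)"
      for x y u v :: real by (simp_all add: field_simps)
    show "\<Lambda> i * wave k p q i * cos (lon i) = p / 2 * cos (real (N + k + 1) * lon i) + p / 2 * cos (real (N + k - 1) * lon i)
     + q / 2 * sin (real (N + k + 1) * lon i) + q / 2 * sin (real (N + k - 1) * lon i)"
      "\<Lambda> i * wave k p q i * sin (lon i) = p / 2 * sin (real (N + k + 1) * lon i) - p / 2 * sin (real (N + k - 1) * lon i)
     - q / 2 * cos (real (N + k + 1) * lon i) + q / 2 * cos (real (N + k - 1) * lon i)"
      by (unfold w e cos_add[of "real (N + k) * lon i"] cos_diff[of "real (N + k) * lon i"]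
        sin_add[of "real (N + k) * lon i"] sin_diff[of "real (N + k) * lon i"], rule g1, rule g2)
  qed
  show "(\<Sum>i\<in>UNIV. \<Lambda> i * wave k p q i * cos (lon i)) = 0"
    unfolding t1 sum.distrib sum_distrib_left[symmetric] sum_vortex_cos_sin[OF nd(2)] sum_vortex_cos_sin[OF nd(3)] by simp
  show "(\<Sum>i\<in>UNIV. \<Lambda> i * wave k p q i * sin (lon i)) = 0"
    unfolding t2 sum.distrib sum_subtractf sum_distrib_left[symmetric] sum_vortex_cos_sin[OF nd(2)] sum_vortex_cos_sin[OF nd(3)] by simp
qed

lemma centre_of_vorticity_fr:
  "centre_of_vorticity \<Lambda> (fr a b) = vector [- c * (\<Sum>i\<in>UNIV. \<Lambda> i * a i * cos (lon i)) - (\<Sum>i\<in>UNIV. \<Lambda> i * b i * sin (lon i)),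
     (\<Sum>i\<in>UNIV. \<Lambda> i * b i * cos (lon i)) - c * (\<Sum>i\<in>UNIV. \<Lambda> i * a i * sin (lon i)), s * (\<Sum>i\<in>UNIV. a i)]"
  by (simp add: centre_of_vorticity_def fr_nth vec_eq_iff forall_3 E_def F_def sum_distrib_left sum_subtractf sum.distrib sum_negf algebra_simps)

lemma orbit_inner_fr:
  "(\<chi> i. cross3 \<zeta> (X $ i)) \<bullet> fr a b = \<zeta> \<bullet> vector [(\<Sum>i\<in>UNIV. \<Lambda> i * a i * sin (lon i)) - c * (\<Sum>i\<in>UNIV. \<Lambda> i * b i * cos (lon i)),
     - (\<Sum>i\<in>UNIV. \<Lambda> i * a i * cos (lon i)) - c * (\<Sum>i\<in>UNIV. \<Lambda> i * b i * sin (lon i)), s * (\<Sum>i\<in>UNIV. b i)]"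
proof -
  have t: "cross3 \<zeta> x \<bullet> y = \<zeta> \<bullet> cross3 x y" for x y by (simp add: cross3_simps)
  have "cross3 (X $ i) (fr a b $ i) = \<Lambda> i *\<^sub>R (b i *\<^sub>R E i - a i *\<^sub>R F i)" for i
  proof -
    have "\<Lambda> i *\<^sub>R cross3 (X $ i) (fr a b $ i) = a i *\<^sub>R (\<Lambda> i *\<^sub>R cross3 (X $ i) (E i)) + b i *\<^sub>R (\<Lambda> i *\<^sub>R cross3 (X $ i) (F i))"
      by (simp add: fr_nth cross_add_right cross_mult_right scaleR_add_right mult.commute)
    then have "\<Lambda> i *\<^sub>R (\<Lambda> i *\<^sub>R cross3 (X $ i) (fr a b $ i)) = \<Lambda> i *\<^sub>R (b i *\<^sub>R E i - a i *\<^sub>R F i)"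
      by (simp add: frame_cross)
    then show ?thesis by (simp only: scaleR_scaleR Lambda_square scaleR_one)
  qed
  then have "(\<chi> i. cross3 \<zeta> (X $ i)) \<bullet> fr a b = \<zeta> \<bullet> (\<Sum>i\<in>UNIV. \<Lambda> i *\<^sub>R (b i *\<^sub>R E i - a i *\<^sub>R F i))"
    by (simp add: inner_config t inner_sum_right)
  also have "(\<Sum>i\<in>UNIV. \<Lambda> i *\<^sub>R (b i *\<^sub>R E i - a i *\<^sub>R F i)) = vector [(\<Sum>i\<in>UNIV. \<Lambda> i * a i * sin (lon i)) - c * (\<Sum>i\<in>UNIV. \<Lambda> i * b i * cos (lon i)),
     - (\<Sum>i\<in>UNIV. \<Lambda> i * a i * cos (lon i)) - c * (\<Sum>i\<in>UNIV. \<Lambda> i * b i * sin (lon i)), s * (\<Sum>i\<in>UNIV. b i)]"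
    by (simp add: vec_eq_iff forall_3 E_def F_def sum_distrib_left sum_subtractf sum.distrib sum_negf algebra_simps)
  finally show ?thesis .
qed

lemma fr_in_slice:
  assumes "centre_of_vorticity \<Lambda> (fr a b) = 0"
    and "\<And>\<zeta>. cross3 \<zeta> (centre_of_vorticity \<Lambda> X) = 0 \<Longrightarrow> (\<chi> i. cross3 \<zeta> (X $ i)) \<bullet> fr a b = 0"
  shows "fr a b \<in> symplectic_slice \<Lambda> X"
  using assms fr_tangent
  by (auto simp: symplectic_slice_def orthogonal_comp_def orbit_tangent_space_def orthogonal_def)

lemma mode_in_slice:
  assumes "1 \<le> k" "k \<le> N" "k \<noteq> N - 1"
  shows "mode k a1 a2 b1 b2 \<in> symplectic_slice \<Lambda> X"
  unfolding mode_wave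
proof (rule fr_in_slice)
  show "centre_of_vorticity \<Lambda> (fr (wave k a1 a2) (wave k b1 b2)) = 0"
    unfolding centre_of_vorticity_fr wave_sums[OF assms] by (simp add: vec_eq_iff forall_3)
  show "(\<chi> i. cross3 \<zeta> (X $ i)) \<bullet> fr (wave k a1 a2) (wave k b1 b2) = 0" for \<zeta>
    unfolding orbit_inner_fr wave_sums[OF assms] by (simp add: inner_vec_def sum_3)
qed

lemma Lambda_nonzero: "\<forall>i. \<Lambda> i \<noteq> 0"
  using Lambda_cases by (metis zero_neq_neg_one zero_neq_one)

lemma slice_linearization_mode:
  assumes "1 \<le> k" "k \<le> N" "k \<noteq> N - 1"
  defines "A \<equiv> P k / s\<^sup>2" and "D \<equiv> - (R k / s\<^sup>2)"
  shows "slice_linearization \<Lambda> X (axis_vec \<xi>\<^sub>0) (mode k a1 a2 b1 b2)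
    = mode k (- D * b1 + \<beta> k * a2) (- D * b2 - \<beta> k * a1) (A * a1 + \<beta> k * b2) (A * a2 - \<beta> k * b1)"
  by (rule slice_linearization_eqI[OF X_phase_space Lambda_nonzero mode_in_slice[OF assms(1-3)]])
    (simp only: A_def D_def mode_operator[OF assms(2) symplectic_slice_tangent])

lemma mode_linear:
  "mode k a1 a2 b1 b2 + mode k a1' a2' b1' b2' = mode k (a1 + a1') (a2 + a2') (b1 + b1') (b2 + b2')"
  "mode k a1 a2 b1 b2 - mode k a1' a2' b1' b2' = mode k (a1 - a1') (a2 - a2') (b1 - b1') (b2 - b2')"
  "z *\<^sub>R mode k a1 a2 b1 b2 = mode k (z * a1) (z * a2) (z * b1) (z * b2)"
  by (simp_all add: mode_wave fr_def wave_def vec_eq_iff[where 'a = "real^3"] algebra_simps)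

lemma idx_0: obtains i where "idx i = 0"
proof -
  have "0 \<in> range idx" using bij_idx N_ge_2 by (auto simp: bij_betw_def)
  then show ?thesis using that by auto
qed

lemma mode_nonzero: "a1 \<noteq> 0 \<or> b1 \<noteq> 0 \<Longrightarrow> mode k a1 a2 b1 b2 \<noteq> 0"
proof
  assume nz: "a1 \<noteq> 0 \<or> b1 \<noteq> 0" and z: "mode k a1 a2 b1 b2 = 0"
  obtain i where i: "idx i = 0" by (rule idx_0)
  have "mode k a1 a2 b1 b2 $ i = a1 *\<^sub>R E i + b1 *\<^sub>R F i"
    using i by (simp add: mode_wave fr_nth wave_def lon_def)
  then have "mode k a1 a2 b1 b2 $ i \<bullet> E i = a1" "mode k a1 a2 b1 b2 $ i \<bullet> F i = b1"
    by (simp_all add: inner_add_left frame_orthonormal)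
  with nz z show False by simp
qed

abbreviation eigs where "eigs \<equiv> slice_eigenvalues \<Lambda> X (axis_vec \<xi>\<^sub>0)"
abbreviation L where "L \<equiv> slice_linearization \<Lambda> X (axis_vec \<xi>\<^sub>0)"
abbreviation S where "S \<equiv> symplectic_slice \<Lambda> X"
abbreviation \<omega> where "\<omega> \<equiv> symplectic_form \<Lambda> X"

text \<open>The componentwise form of the eigenvector equations in \<open>mode_eigenvalue\<close>; \<open>p\<close> and \<open>q\<close> are real and imaginary part of
the root \<open>\<tau>\<close>.\<close>

lemma mode_eigen_algebra:
  fixes A D b \<kappa> p q :: real
  assumes "\<kappa> * \<kappa> = 1" "- D * A = p * p - q * q" "p * q = 0"
  shows "- D * A + b * (- \<kappa> * q) = p * p - (q + \<kappa> * b) * q"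
    "- D * 0 - b * p = p * (- \<kappa> * q) - (q + \<kappa> * b) * (\<kappa> * p)"
    "A * p + b * 0 = p * A - (q + \<kappa> * b) * 0"
    "A * (- \<kappa> * q) - b * A = p * 0 - (q + \<kappa> * b) * (\<kappa> * A)"
    "- D * 0 + b * (\<kappa> * p) = (q + \<kappa> * b) * p + p * q"
    "- D * (\<kappa> * A) - b * q = (q + \<kappa> * b) * (- \<kappa> * q) + p * (\<kappa> * p)"
    "A * q + b * (\<kappa> * A) = (q + \<kappa> * b) * A + p * 0"
    "A * (\<kappa> * p) - b * 0 = (q + \<kappa> * b) * 0 + p * (\<kappa> * A)"
proof -
  show "- D * A + b * (- \<kappa> * q) = p * p - (q + \<kappa> * b) * q" using assms by algebra
  show "- D * 0 - b * p = p * (- \<kappa> * q) - (q + \<kappa> * b) * (\<kappa> * p)" using assms by algebra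
  show "A * p + b * 0 = p * A - (q + \<kappa> * b) * 0" by simp
  show "A * (- \<kappa> * q) - b * A = p * 0 - (q + \<kappa> * b) * (\<kappa> * A)" using assms by algebra
  show "- D * 0 + b * (\<kappa> * p) = (q + \<kappa> * b) * p + p * q" using assms by algebra
  show "- D * (\<kappa> * A) - b * q = (q + \<kappa> * b) * (- \<kappa> * q) + p * (\<kappa> * p)" using assms by algebra
  show "A * q + b * (\<kappa> * A) = (q + \<kappa> * b) * A + p * 0" by (simp add: algebra_simps)
  show "A * (\<kappa> * p) - b * 0 = (q + \<kappa> * b) * 0 + p * (\<kappa> * A)" by simp
qed

text \<open>The combinations \<open>cos + \<i> sin\<close> and \<open>cos - \<i> sin\<close> split the \<open>4 \<times> 4\<close> matrix of a mode into two \<open>2 \<times> 2\<close> matrices, which are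
traceless up to the multiples \<open>\<plusminus> \<i> \<beta>\<close> of the identity and have determinant \<open>- P k * R k / s^4\<close> apart from these multiples.
The sign \<open>\<kappa>\<close> in the proof selects one of them.\<close>

theorem mode_eigenvalue:
  assumes k: "1 \<le> k" "k \<le> N" "k \<noteq> N - 1" and P0: "P k \<noteq> 0"
    and \<tau>: "\<tau>\<^sup>2 = of_real (P k * R k / s^4)"
  shows "\<tau> + \<i> * of_real (\<beta> k) \<in> eigs" "\<tau> - \<i> * of_real (\<beta> k) \<in> eigs"
proof -
  define A D where "A = P k / s\<^sup>2" and "D = - (R k / s\<^sup>2)"
  note Lm = slice_linearization_mode[OF k, folded A_def D_def]
  have "P k * R k / s^4 = - (D * A)"
    by (simp add: A_def D_def power2_eq_square power4_eq_xxxx mult_ac)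
  then have t: "(Re \<tau>)\<^sup>2 - (Im \<tau>)\<^sup>2 = - (D * A)" "Re \<tau> * Im \<tau> = 0"
    using \<tau> by (auto simp: complex_eq_iff Re_power2 Im_power2)
  have t': "- D * A = Re \<tau> * Re \<tau> - Im \<tau> * Im \<tau>" using t by (simp add: power2_eq_square)
  have A0: "A \<noteq> 0" using P0 s_pos by (simp add: A_def)
  have inS: "mode k a1 a2 b1 b2 \<in> S" for a1 a2 b1 b2 by (rule mode_in_slice[OF k])
  have main: "Complex (Re \<tau>) (Im \<tau> + \<kappa> * \<beta> k) \<in> eigs" if "\<kappa> * \<kappa> = 1" for \<kappa>
  proof -
    define v w where "v = mode k (Re \<tau>) (- \<kappa> * Im \<tau>) A 0" and "w = mode k (Im \<tau>) (\<kappa> * Re \<tau>) 0 (\<kappa> * A)"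
    note ri = t(2)
    have cong: "x1 = y1 \<Longrightarrow> x2 = y2 \<Longrightarrow> x3 = y3 \<Longrightarrow> x4 = y4 \<Longrightarrow> mode k x1 x2 x3 x4 = mode k y1 y2 y3 y4"
      for x1 x2 x3 x4 y1 y2 y3 y4 by simp
    have "L v = Re \<tau> *\<^sub>R v - (Im \<tau> + \<kappa> * \<beta> k) *\<^sub>R w"
      unfolding v_def w_def Lm mode_linear
      by (rule cong) (rule mode_eigen_algebra[OF that t' ri])+
    moreover have "L w = (Im \<tau> + \<kappa> * \<beta> k) *\<^sub>R v + Re \<tau> *\<^sub>R w"
      unfolding v_def w_def Lm mode_linear
      by (rule cong) (rule mode_eigen_algebra[OF that t' ri])+
    moreover have "v \<noteq> 0" unfolding v_def using A0 by (intro mode_nonzero) simp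
    ultimately show ?thesis
      unfolding slice_eigenvalues_def complex_eigenvalues_def mem_Collect_eq complex.sel
      using inS[of "Re \<tau>" "- \<kappa> * Im \<tau>" A 0] inS[of "Im \<tau>" "\<kappa> * Re \<tau>" 0 "\<kappa> * A"]
      unfolding v_def[symmetric] w_def[symmetric] by blast
  qed
  have "\<tau> + \<i> * of_real (\<beta> k) = Complex (Re \<tau>) (Im \<tau> + 1 * \<beta> k)" "\<tau> - \<i> * of_real (\<beta> k) = Complex (Re \<tau>) (Im \<tau> + (- 1) * \<beta> k)"
    by (simp_all add: complex_eq_iff)
  then show "\<tau> + \<i> * of_real (\<beta> k) \<in> eigs" "\<tau> - \<i> * of_real (\<beta> k) \<in> eigs"
    using main[of 1] main[of "- 1"] by simp_all
qed

theorem linearly_unstable_mode: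
  assumes k: "1 \<le> k" "k \<le> N" "k \<noteq> N - 1" and PR: "P k * R k > 0"
  shows "linearly_unstable \<Lambda> X"
proof -
  define \<rho> where "\<rho> = sqrt (P k * R k / s^4)"
  have pos: "P k * R k / s^4 > 0" using PR s_pos by simp
  have rho: "\<rho> > 0" using pos by (simp add: \<rho>_def)
  have "\<rho>\<^sup>2 = P k * R k / s^4" unfolding \<rho>_def by (rule real_sqrt_pow2) (use pos in simp)
  then have "(of_real \<rho> :: complex)\<^sup>2 = of_real (P k * R k / s^4)" by (metis of_real_power)
  moreover have "P k \<noteq> 0" using PR by auto
  ultimately have "of_real \<rho> + \<i> * of_real (\<beta> k) \<in> eigs" using mode_eigenvalue(1)[OF k] by blast
  moreover have "Re (of_real \<rho> + \<i> * of_real (\<beta> k)) \<noteq> 0" using rho by simp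
  ultimately show ?thesis unfolding linearly_unstable_def using angular_velocity_rings by blast
qed

end

section \<open>Instability for at least four vortices per ring\<close>

text \<open>Concavity of \<open>tanh\<close> on the positive half-line.\<close>

lemma tanh_mult_le:
  fixes y z :: real
  assumes "0 \<le> y" "1 \<le> z"
  shows "tanh (z * y) \<le> z * tanh y"
proof -
  define f where "f x = z * tanh x - tanh (z * x)" for x :: real
  have "f 0 \<le> f y"
  proof (rule DERIV_nonneg_imp_nondecreasing[OF assms(1)])
    fix x :: real assume x: "0 \<le> x" "x \<le> y"
    have "(f has_real_derivative z * (1 - (tanh x)\<^sup>2) - (1 - (tanh (z * x))\<^sup>2) * z) (at x)"
      unfolding f_def by (auto intro!: derivative_eq_intros)
    moreover have "tanh x \<le> tanh (z * x)" "0 \<le> tanh x"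
      using x assms mult_right_mono[of 1 z x] by simp_all
    then have "(tanh x)\<^sup>2 \<le> (tanh (z * x))\<^sup>2" by (rule power_mono)
    then have "0 \<le> z * ((tanh (z * x))\<^sup>2 - (tanh x)\<^sup>2)" using assms by simp
    ultimately show "\<exists>d. (f has_real_derivative d) (at x) \<and> d \<ge> 0"
      by (intro exI conjI) (assumption, simp add: algebra_simps)
  qed
  then show ?thesis by (simp add: f_def)
qed

lemma tanh_double: "tanh (2 * x) = 2 * tanh x / (1 + (tanh x)\<^sup>2)" for x :: real
  using tanh_add[of x x] by (simp add: power2_eq_square)

lemma tanh_quadruple:
  fixes x :: real
  shows "tanh (4 * x) = 4 * tanh x * (1 + (tanh x)\<^sup>2) / (1 + 6 * (tanh x)\<^sup>2 + (tanh x)^4)"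
proof -
  define t where "t = tanh x"
  have p: "1 + t\<^sup>2 > 0" by (simp add: add_pos_nonneg)
  have p2: "1 + 6 * t\<^sup>2 + t^4 > 0" by (simp add: add_pos_nonneg)
  have "tanh (4 * x) = 2 * (2 * t / (1 + t\<^sup>2)) / (1 + (2 * t / (1 + t\<^sup>2))\<^sup>2)"
    using tanh_double[of "2 * x"] unfolding tanh_double[of x] by (simp add: t_def)
  also have "1 + (2 * t / (1 + t\<^sup>2))\<^sup>2 = (1 + 6 * t\<^sup>2 + t^4) / (1 + t\<^sup>2)\<^sup>2"
  proof -
    have "(2 * t / (1 + t\<^sup>2))\<^sup>2 = 4 * t\<^sup>2 / (1 + t\<^sup>2)\<^sup>2"
      by (simp add: power_divide power_mult_distrib)
    moreover have "1 + A / B = (B + A) / B" if "B \<noteq> 0" for A B :: real using that by (simp add: field_simps)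
    moreover have "(1 + t\<^sup>2)\<^sup>2 + 4 * t\<^sup>2 = 1 + 6 * t\<^sup>2 + t^4"
      by (simp add: power2_eq_square power4_eq_xxxx algebra_simps)
    moreover have "(1 + t\<^sup>2)\<^sup>2 \<noteq> 0" using p by simp
    ultimately show ?thesis by metis
  qed
  also have "2 * (2 * t / (1 + t\<^sup>2)) / ((1 + 6 * t\<^sup>2 + t^4) / (1 + t\<^sup>2)\<^sup>2) = 4 * t * (1 + t\<^sup>2) / (1 + 6 * t\<^sup>2 + t^4)"
    using p by (simp add: power2_eq_square)
  finally show ?thesis by (simp add: t_def)
qed

text \<open>Numerical consequences of \<open>\<epsilon> \<ge> 0\<close>, with \<open>d = c\<^sup>2\<close> and \<open>Z\<close> the square of \<open>tanh (N * y / 4)\<close>: since \<open>N * c \<ge> 4 * tanh (N * y / 4)\<close>,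
nonnegativity of \<open>\<epsilon>\<close> bounds \<open>Z\<close>.\<close>

lemma quarter_bound:
  fixes Z d :: real
  assumes "0 \<le> Z" "32 * Z * (1 + Z) \<le> (1 + d) * (1 + 6 * Z + Z\<^sup>2)" "0 \<le> d"
  shows "d \<le> 1 / 25 \<Longrightarrow> Z \<le> 39 / 1000" and "d \<le> 1 / 33 \<Longrightarrow> Z \<le> 382 / 10000"
proof -
  have m: "(1 + d) * (1 + 6 * Z + Z\<^sup>2) \<le> (1 + e) * (1 + 6 * Z + Z\<^sup>2)" if "d \<le> e" for e
    using that assms by (intro mult_right_mono) auto
  show "Z \<le> 39 / 1000" if "d \<le> 1 / 25"
  proof (rule ccontr)
    assume Z: "\<not> Z \<le> 39 / 1000"
    have "32 * Z * (1 + Z) \<le> (1 + 1 / 25) * (1 + 6 * Z + Z\<^sup>2)" using m[OF that] assms by linarith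
    then have "(32 - 26 * 6 / 25) * Z + (32 - 26 / 25) * Z\<^sup>2 \<le> 26 / 25" by (simp add: algebra_simps power2_eq_square)
    moreover have "(39 / 1000)\<^sup>2 \<le> Z\<^sup>2" using Z by (intro power_mono) auto
    ultimately show False using Z by (simp add: power2_eq_square)
  qed
  show "Z \<le> 382 / 10000" if "d \<le> 1 / 33"
  proof (rule ccontr)
    assume Z: "\<not> Z \<le> 382 / 10000"
    have "32 * Z * (1 + Z) \<le> (1 + 1 / 33) * (1 + 6 * Z + Z\<^sup>2)" using m[OF that] assms by linarith
    then have "(32 - 34 * 6 / 33) * Z + (32 - 34 / 33) * Z\<^sup>2 \<le> 34 / 33" by (simp add: algebra_simps power2_eq_square)
    moreover have "(382 / 10000)\<^sup>2 \<le> Z\<^sup>2" using Z by (intro power_mono) auto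
    ultimately show False using Z by (simp add: power2_eq_square)
  qed
qed

context staggered_rings
begin

text \<open>Half the parameter of the Poisson kernel; \<open>T\<close> is then the value in \<open>odd_Poisson_sum_0\<close> divided by \<open>N\<close>, and \<open>\<epsilon>\<close> is
the coefficient \<open>P N\<close>.\<close>

definition y :: real where "y = artanh c"
definition T :: real where "T = tanh (real N * y)"
definition \<epsilon> :: real where "\<epsilon> = 1 + c\<^sup>2 - 2 * c * real N * T"

lemma tanh_y: "tanh y = c" by (simp add: y_def tanh_artanh_c)

lemma y_nonneg: "y \<ge> 0" using c_nonneg tanh_y by (metis tanh_real_nonneg_iff)

lemma T_bounds: "0 \<le> T" "T < 1" "T\<^sup>2 < 1"
proof -
  show "0 \<le> T" "T < 1" using y_nonneg by (simp_all add: T_def tanh_real_lt_1)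
  then show "T\<^sup>2 < 1" by (simp add: power_less_one_iff abs_square_less_1)
qed

lemma Q_T: "Q = real N * T" by (simp add: Q_def T_def y_def)

lemma G_closed:
  assumes "k \<le> N"
  shows "G k = - real N * (real N / 2 * (1 - T\<^sup>2) * cosh (2 * real k * y) + real k * T * sinh (2 * real k * y) - real k * cosh (2 * real k * y))"
  using odd_kernel_sum_closed[OF N_ge_2 assms, of "2 * y"]
  by (simp add: G_def h_cosh y_def[symmetric] T_def mult_ac)

lemma G_0: "G 0 = - ((real N)\<^sup>2 / 2) * (1 - T\<^sup>2)"
  using G_closed[of 0] by (simp add: power2_eq_square)

lemma G_N: "G N = - G 0"
proof -
  have "cos (real N * oddpt N j) = - 1" for j
  proof -
    have "real N * oddpt N j = real (2 * j + 1) * pi" using N_ge_2 by (simp add: oddpt_def field_simps)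
    then show ?thesis by (simp only: cos_npi) simp
  qed
  then show ?thesis by (simp add: G_def odd_kernel_sum_def sum_negf)
qed

lemma P_R_N: "P N = \<epsilon>" "R N = 2 * G 0"
  by (simp_all add: P_def R_def G_N \<epsilon>_def Q_T)

lemma G_0_neg: "G 0 < 0"
  using T_bounds N_ge_2 by (simp add: G_0 mult_pos_pos mult_neg_pos)

text \<open>The mode \<open>k = N\<close>, whose coefficients alternate in sign around the two rings.\<close>

lemma linearly_unstable_eps_neg:
  assumes "\<epsilon> < 0" shows "linearly_unstable \<Lambda> X"
proof (rule linearly_unstable_mode)
  show "1 \<le> N" "N \<le> N" "N \<noteq> N - 1" using N_ge_2 by auto
  show "P N * R N > 0" unfolding P_R_N using assms G_0_neg by (simp add: mult_neg_neg)
qed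

lemma T_cosh: "sinh (real N * y) = T * cosh (real N * y)" "(1 - T\<^sup>2) * (cosh (real N * y))\<^sup>2 = 1"
proof -
  show S: "sinh (real N * y) = T * cosh (real N * y)" by (simp add: T_def tanh_def)
  show "(1 - T\<^sup>2) * (cosh (real N * y))\<^sup>2 = 1"
    using hyperbolic_pythagoras[of "real N * y"] unfolding S by (simp add: algebra_simps power2_eq_square)
qed

lemma y_cosh: "sinh y = c * cosh y" "(1 - c\<^sup>2) * (cosh y)\<^sup>2 = 1"
proof -
  show S: "sinh y = c * cosh y" using tanh_y by (simp add: tanh_def field_simps)
  show "(1 - c\<^sup>2) * (cosh y)\<^sup>2 = 1"
    using hyperbolic_pythagoras[of y] unfolding S by (simp add: algebra_simps power2_eq_square)
qed

text \<open>Near \<open>k = N / 2\<close> the opposite ring has little influence on waves: its contribution vanishes for even \<open>N\<close> and is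
of order \<open>N\<close>, compared with \<open>N\<^sup>2 / 4\<close> for the own ring, for odd \<open>N\<close>.\<close>

lemma G_half_even:
  assumes "N = 2 * m" shows "G m = 0"
proof -
  have e: "2 * real m * y = real N * y" using assms by simp
  have "G m = - real N * (real m * ((1 - T\<^sup>2) * cosh (real N * y) + T * sinh (real N * y) - cosh (real N * y)))"
    using G_closed[of m] assms unfolding e by (simp add: algebra_simps)
  also have "(1 - T\<^sup>2) * cosh (real N * y) + T * sinh (real N * y) - cosh (real N * y) = 0"
    unfolding T_cosh by (simp add: algebra_simps power2_eq_square)
  finally show ?thesis by simp
qed

lemma G_half_odd:
  assumes "N = 2 * m + 1"
  shows "G m = - (real N / 2) * ((1 - T\<^sup>2) * (cosh (real N * y) * cosh y)) * (1 - real N * c * T)"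
proof -
  have m: "real m = (real N - 1) / 2" using assms by simp
  have "2 * real m = real N - 1" using m by simp
  then have e: "2 * real m * y = real N * y - y" by (simp add: left_diff_distrib)
  define M where "M = cosh (real N * y) * cosh y"
  have ch: "cosh (2 * real m * y) = M * (1 - T * c)" "sinh (2 * real m * y) = M * (T - c)"
    unfolding e cosh_diff sinh_diff T_cosh y_cosh M_def by (simp_all add: algebra_simps)
  have "G m = - real N * (real N / 2 * (1 - T\<^sup>2) * (M * (1 - T * c)) + real m * T * (M * (T - c)) - real m * (M * (1 - T * c)))"
    using G_closed[of m] assms unfolding ch by simp
  also have "\<dots> = - (real N / 2) * ((1 - T\<^sup>2) * M) * (1 - real N * c * T)"
    unfolding m by (simp add: field_simps power2_eq_square)
  finally show ?thesis by (simp add: M_def)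
qed

text \<open>If \<open>\<epsilon> \<ge> 0\<close>, then \<open>c\<^sup>2 \<le> 1 / 25\<close> and \<open>T\<^sup>2 < 1 / 2\<close>. For \<open>m = \<lfloor>N / 2\<rfloor>\<close> the coefficients \<open>R m\<close> and \<open>P m\<close> are about
\<open>- N\<^sup>2 / 4 * (1 - 2 * T\<^sup>2)\<close> and this value plus \<open>\<epsilon>\<close>. Both are negative: \<open>T\<close> and a bound for \<open>\<epsilon>\<close> are expressed through \<open>t = tanh (N * y / 4)\<close> and \<open>Z = t\<^sup>2\<close>, which
leaves polynomial inequalities in \<open>Z\<close>. For odd \<open>N\<close> the correction \<open>\<kappa>\<close> from
\<open>G m\<close> is of order \<open>N\<close> and is dominated from \<open>N = 5\<close> on.\<close>

theorem linearly_unstable_ge_4: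
  assumes N4: "N \<ge> 4" shows "linearly_unstable \<Lambda> X"
proof (cases "\<epsilon> < 0")
  case True then show ?thesis by (rule linearly_unstable_eps_neg)
next
  case False
  then have eps: "2 * c * real N * T \<le> 1 + c\<^sup>2" by (simp add: \<epsilon>_def)
  have eq2: "2 * c * real N * T = 2 * (real N * c * T)" by simp
  define t Z where "t = tanh (real N / 4 * y)" and "Z = t\<^sup>2"
  define u where "u = 1 + 6 * Z + Z\<^sup>2"
  have t0: "t \<ge> 0" using y_nonneg by (simp add: t_def)
  have Z0: "Z \<ge> 0" by (simp add: Z_def)
  have u0: "u > 0" "u \<ge> 1" using Z0 by (simp_all add: u_def add_pos_nonneg)
  have t4: "t^4 = Z\<^sup>2" by (simp add: Z_def)
  \<comment> \<open>The quadruple argument formula, with \<open>Z = t\<^sup>2\<close>.\<close>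
  have Tt: "T = 4 * t * (1 + Z) / u"
  proof -
    have "real N * y = 4 * (real N / 4 * y)" by simp
    then show ?thesis unfolding T_def u_def by (simp only: tanh_quadruple t_def[symmetric] t4 Z_def[symmetric])
  qed
  have Nc: "4 * t \<le> real N * c"
    using tanh_mult_le[OF y_nonneg, of "real N / 4"] N4 by (simp add: t_def tanh_y)
  have NcT: "16 * Z * (1 + Z) / u \<le> real N * c * T"
  proof -
    have "4 * t * T \<le> real N * c * T" using Nc T_bounds by (intro mult_right_mono) auto
    moreover have "4 * t * T = 16 * Z * (1 + Z) / u" unfolding Tt Z_def by (simp add: power2_eq_square)
    ultimately show ?thesis by simp
  qed
  have key: "32 * Z * (1 + Z) \<le> (1 + c\<^sup>2) * u"
  proof -
    have "2 * (16 * Z * (1 + Z) / u) \<le> 1 + c\<^sup>2" using NcT eps unfolding eq2 by linarith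
    then show ?thesis using u0 by (simp add: field_simps)
  qed
  \<comment> \<open>Here \<open>T \<ge> tanh (4 * y)\<close> turns \<open>\<epsilon> \<ge> 0\<close> into a bound for \<open>c\<close>.\<close>
  have cN: "n * 8 * c\<^sup>2 \<le> 1 + 6 * c\<^sup>2 + c^4" if "n \<le> real N" for n
  proof -
    have p: "1 + 6 * c\<^sup>2 + c^4 > 0" by (simp add: add_pos_nonneg)
    have "tanh (4 * y) \<le> T" using N4 y_nonneg unfolding T_def by (simp add: mult_right_mono)
    then have "4 * c * (1 + c\<^sup>2) / (1 + 6 * c\<^sup>2 + c^4) \<le> T" by (simp add: tanh_quadruple tanh_y)
    then have "2 * c * real N * (4 * c * (1 + c\<^sup>2) / (1 + 6 * c\<^sup>2 + c^4)) \<le> 2 * c * real N * T"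
      using c_nonneg by (intro mult_left_mono) auto
    then have "2 * c * real N * (4 * c * (1 + c\<^sup>2) / (1 + 6 * c\<^sup>2 + c^4)) \<le> 1 + c\<^sup>2" using eps by linarith
    then have "(real N * 8 * c\<^sup>2) * (1 + c\<^sup>2) \<le> (1 + 6 * c\<^sup>2 + c^4) * (1 + c\<^sup>2)"
      using p by (simp add: field_simps power2_eq_square)
    then have "real N * 8 * c\<^sup>2 \<le> 1 + 6 * c\<^sup>2 + c^4"
      by (rule mult_right_le_imp_le) (simp add: add_pos_nonneg)
    moreover have "n * 8 * c\<^sup>2 \<le> real N * 8 * c\<^sup>2" using that by (intro mult_right_mono) auto
    ultimately show ?thesis by linarith
  qed
  have c4: "c^4 \<le> c\<^sup>2"
    using c_nonneg c_lt_1 by (intro power_decreasing) auto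
  have c25: "c\<^sup>2 \<le> 1 / 25" using cN[of 4] N4 c4 by simp
  have Z39: "Z \<le> 39 / 1000"
    by (rule quarter_bound(1)[OF Z0 key[unfolded u_def] _ c25]) simp
  have Z2: "Z\<^sup>2 \<le> 39 / 1000 * Z" "0 \<le> Z\<^sup>2" using mult_right_mono[OF Z39 Z0] by (simp_all add: power2_eq_square)
  have Z3: "Z^3 \<le> 39 / 1000 * Z\<^sup>2" "0 \<le> Z^3" using Z0 mult_right_mono[OF Z39, of "Z\<^sup>2"] by (simp_all add: power2_eq_square power3_eq_cube mult_ac)
  have Z4: "0 \<le> Z^4" by simp
  have T2: "T\<^sup>2 = 16 * Z * (1 + Z)\<^sup>2 / u\<^sup>2"
    unfolding Tt Z_def by (simp add: power_divide power_mult_distrib)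
  have usq: "u\<^sup>2 = 1 + 12 * Z + 38 * Z\<^sup>2 + 12 * Z^3 + Z^4"
    by (simp add: u_def power2_eq_square power3_eq_cube power4_eq_xxxx algebra_simps)
  define \<alpha> where "\<alpha> = 1 - 2 * T\<^sup>2"
  have alpha: "\<alpha> * u\<^sup>2 = u\<^sup>2 - 32 * (Z + 2 * Z\<^sup>2 + Z^3)"
  proof -
    have "\<alpha> * u\<^sup>2 = u\<^sup>2 - 32 * (Z * (1 + Z)\<^sup>2)"
      unfolding \<alpha>_def T2 using u0 by (simp add: left_diff_distrib)
    also have "Z * (1 + Z)\<^sup>2 = Z + 2 * Z\<^sup>2 + Z^3"
      by (simp add: power2_eq_square power3_eq_cube algebra_simps)
    finally show ?thesis .
  qed
  have "0 < \<alpha> * u\<^sup>2" unfolding alpha unfolding usq using Z2 Z3 Z4 Z0 Z39 unfolding distrib_left right_diff_distrib mult.assoc[symmetric] by linarith 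
  then have alpha0: "\<alpha> > 0" using u0 by (simp add: zero_less_mult_iff)
  have KG: "(real N)\<^sup>2 / 4 + G 0 = - (real N)\<^sup>2 / 4 * \<alpha>"
    unfolding G_0 \<alpha>_def by (simp add: field_simps)
  have N16: "(real N)\<^sup>2 / 4 * \<alpha> \<ge> 4 * \<alpha>"
  proof -
    have "4\<^sup>2 \<le> (real N)\<^sup>2" using N4 by (intro power_mono) auto
    then show ?thesis using alpha0 by (intro mult_right_mono) auto
  qed
  have epsb: "\<epsilon> \<le> 26 / 25 - 32 * Z * (1 + Z) / u"
  proof -
    have "\<epsilon> = 1 + c\<^sup>2 - 2 * (real N * c * T)" by (simp add: \<epsilon>_def)
    moreover have "32 * Z * (1 + Z) / u = 2 * (16 * Z * (1 + Z) / u)" by simp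
    ultimately show ?thesis using NcT c25 by linarith
  qed
  \<comment> \<open>It suffices to treat \<open>N = 4\<close>; the inequality is multiplied by \<open>u\<^sup>2\<close> to become polynomial in \<open>Z\<close>.\<close>
  have Pneg: "- (real N)\<^sup>2 / 4 * \<alpha> + \<epsilon> < 0"
  proof -
    define W where "W = (Z + Z\<^sup>2) * u"
    have "Z + Z\<^sup>2 \<le> W" unfolding W_def using mult_left_mono[OF u0(2), of "Z + Z\<^sup>2"] Z0 by simp
    then have "32 * Z \<le> 32 * W" using Z2 by linarith
    moreover have "(- 4 * \<alpha> + (26 / 25 - 32 * Z * (1 + Z) / u)) * u\<^sup>2 = - 4 * (\<alpha> * u\<^sup>2) + 26 / 25 * u\<^sup>2 - 32 * W"
      using u0 by (simp add: W_def field_simps power2_eq_square)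
    moreover have "- 4 * (\<alpha> * u\<^sup>2) + 26 / 25 * u\<^sup>2 - 32 * Z < 0"
      unfolding alpha unfolding usq using Z2 Z3 Z4 Z0 Z39 unfolding distrib_left right_diff_distrib mult.assoc[symmetric] by linarith
    ultimately have "(- 4 * \<alpha> + (26 / 25 - 32 * Z * (1 + Z) / u)) * u\<^sup>2 < 0" by linarith
    then have "- 4 * \<alpha> + (26 / 25 - 32 * Z * (1 + Z) / u) < 0" using u0 by (simp add: mult_less_0_iff)
    then show ?thesis using N16 epsb by linarith
  qed
  show ?thesis
  proof (cases "even N")
    case True
    then obtain m where m: "N = 2 * m" by (elim evenE)
    have K: "real m * (real N - real m) = (real N)\<^sup>2 / 4" using m by (simp add: power2_eq_square)
    have "R m = - (real N)\<^sup>2 / 4 * \<alpha>" unfolding R_def K G_half_even[OF m] using KG by simp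
    moreover have "P m = - (real N)\<^sup>2 / 4 * \<alpha> + \<epsilon>" unfolding P_def K G_half_even[OF m] using KG by (simp add: \<epsilon>_def Q_T)
    moreover have "- (real N)\<^sup>2 / 4 * \<alpha> < 0" using N4 alpha0 by simp
    ultimately have "P m * R m > 0" using Pneg by (simp only: mult_neg_neg)
    then show ?thesis using m N4 by (intro linearly_unstable_mode[of m]) auto
  next
    case False
    then obtain m where m: "N = 2 * m + 1" by (elim oddE)
    have N5: "real N \<ge> 5" using m N4 by simp
    have K: "real m * (real N - real m) = (real N)\<^sup>2 / 4 - 1 / 4" using m by (simp add: power2_eq_square field_simps)
    define r where "r = (1 - T\<^sup>2) * (cosh (real N * y) * cosh y)"
    define \<kappa> where "\<kappa> = r * (1 - real N * c * T)"
    have Gm: "G m = - (real N / 2) * \<kappa>" unfolding G_half_odd[OF m] r_def \<kappa>_def by simp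
    have c33: "c\<^sup>2 \<le> 1 / 33" using cN[OF N5] c4 by simp
    have Z382: "Z \<le> 382 / 10000"
      by (rule quarter_bound(2)[OF Z0 key[unfolded u_def] _ c33]) simp
    have r0: "r \<ge> 0" using T_bounds by (simp add: r_def)
    \<comment> \<open>The factor bounds \<open>cosh y\<close>, since \<open>(cosh y)\<^sup>2 = 1 / (1 - c\<^sup>2) \<le> 33 / 32\<close>.\<close>
    have rle: "r \<le> 1016 / 1000 * ((1 - Z)\<^sup>2 / u)"
    proof (rule power2_le_imp_le)
      show "0 \<le> 1016 / 1000 * ((1 - Z)\<^sup>2 / u)" using u0 by simp
      have "r\<^sup>2 = (1 - T\<^sup>2) * ((1 - T\<^sup>2) * (cosh (real N * y))\<^sup>2) * (cosh y)\<^sup>2"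
        by (simp add: r_def power2_eq_square mult_ac)
      also have "\<dots> = (1 - T\<^sup>2) * (cosh y)\<^sup>2" unfolding T_cosh by simp
      finally have r2: "r\<^sup>2 = (1 - T\<^sup>2) * (cosh y)\<^sup>2" .
      have "(1 - 1 / 33) * (cosh y)\<^sup>2 \<le> (1 - c\<^sup>2) * (cosh y)\<^sup>2" using c33 by (intro mult_right_mono) auto
      then have ch: "(cosh y)\<^sup>2 \<le> (1016 / 1000)\<^sup>2" unfolding y_cosh(2) by (simp add: power2_eq_square)
      have T1: "1 - T\<^sup>2 = ((1 - Z)\<^sup>2 / u)\<^sup>2"
      proof -
        have "u\<^sup>2 - 16 * Z * (1 + Z)\<^sup>2 = ((1 - Z)\<^sup>2)\<^sup>2"
          by (simp add: u_def power2_eq_square algebra_simps)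
        moreover have "(u\<^sup>2 - 16 * Z * (1 + Z)\<^sup>2) / u\<^sup>2 = 1 - 16 * Z * (1 + Z)\<^sup>2 / u\<^sup>2"
          using u0 by (simp add: diff_divide_distrib)
        ultimately show ?thesis unfolding T2 power_divide by simp
      qed
      show "r\<^sup>2 \<le> (1016 / 1000 * ((1 - Z)\<^sup>2 / u))\<^sup>2"
        unfolding r2 T1 power_mult_distrib using mult_left_mono[OF ch, of "((1 - Z)\<^sup>2 / u)\<^sup>2"] by (simp add: mult.commute)
    qed
    have w0: "0 \<le> 1 - real N * c * T" using eps c25 unfolding eq2 by linarith
    have k0: "\<kappa> \<ge> 0" using r0 w0 by (simp add: \<kappa>_def)
    have kle: "\<kappa> \<le> (1016 / 1000 * ((1 - Z)\<^sup>2 / u)) * (1 - 16 * Z * (1 + Z) / u)"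
      unfolding \<kappa>_def using rle w0 NcT r0 u0 by (intro mult_mono) (auto intro!: mult_nonneg_nonneg)
    have e: "(1016 / 1000 * ((1 - Z)\<^sup>2 / u)) * (1 - 16 * Z * (1 + Z) / u) * u\<^sup>2
       = 1016 / 1000 * (1 - Z)\<^sup>2 * (u - 16 * Z * (1 + Z))"
      using u0 by (simp add: field_simps power2_eq_square)
    have ku: "\<kappa> * u\<^sup>2 \<le> 1016 / 1000 * (1 - Z)\<^sup>2 * (u - 16 * Z * (1 + Z))"
      using mult_right_mono[OF kle, of "u\<^sup>2", unfolded e] by simp
    have kp: "(1 - Z)\<^sup>2 * (u - 16 * Z * (1 + Z)) = 1 - 12 * Z + 6 * Z\<^sup>2 + 20 * Z^3 - 15 * Z^4"
      by (simp add: u_def power2_eq_square power3_eq_cube power4_eq_xxxx algebra_simps)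
    have ku': "\<kappa> * u\<^sup>2 \<le> 1016 / 1000 * (1 - 12 * Z + 6 * Z\<^sup>2 + 20 * Z^3 - 15 * Z^4)"
      using ku unfolding mult.assoc[of "1016 / 1000"] kp .
    have Z2': "Z\<^sup>2 \<le> 382 / 10000 * Z" using mult_right_mono[OF Z382 Z0] by (simp add: power2_eq_square)
    have au: "\<alpha> * u\<^sup>2 = 1 - 20 * Z - 26 * Z\<^sup>2 - 20 * Z^3 + Z^4"
      unfolding alpha unfolding usq by simp
    have kuE: "\<kappa> * u\<^sup>2 \<le> 1016 / 1000 - 12192 / 1000 * Z + 6096 / 1000 * Z\<^sup>2 + 2032 / 100 * Z^3 - 1524 / 100 * Z^4"
      using ku' by simp
    have "5 * (\<alpha> * u\<^sup>2) - \<kappa> * u\<^sup>2 \<ge> 0"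
      unfolding au using kuE Z2 Z3 Z4 Z0 Z39 unfolding distrib_left right_diff_distrib mult.assoc[symmetric] by linarith
    then have "(5 * \<alpha> - \<kappa>) * u\<^sup>2 \<ge> 0" by (simp only: left_diff_distrib mult.assoc)
    \<comment> \<open>This makes the bound for \<open>R m\<close> decreasing in \<open>N\<close>, so that \<open>N = 5\<close> is the worst case.\<close>
    then have k5: "\<kappa> \<le> 5 * \<alpha>" using u0 by (simp add: zero_le_mult_iff)
    have "5 / 2 * k - 25 / 4 * (\<alpha> * u\<^sup>2) - 1 / 4 * u\<^sup>2 < 0"
      if "k \<le> 1016 / 1000 - 12192 / 1000 * Z + 6096 / 1000 * Z\<^sup>2 + 2032 / 100 * Z^3 - 1524 / 100 * Z^4" for k
      unfolding au unfolding usq using that Z2' Z3 Z4 Z0 Z382 unfolding distrib_left right_diff_distrib mult.assoc[symmetric] by linarith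
    from this[OF kuE]
    have "(- (25 / 4) * \<alpha> + 5 / 2 * \<kappa> - 1 / 4) * u\<^sup>2 < 0" by (simp add: algebra_simps)
    then have f5: "- (25 / 4) * \<alpha> + 5 / 2 * \<kappa> - 1 / 4 < 0" using u0 by (simp add: mult_less_0_iff)
    have "- (real N)\<^sup>2 / 4 * \<alpha> + real N / 2 * \<kappa> - (- (25 / 4) * \<alpha> + 5 / 2 * \<kappa>) = (real N - 5) * (\<kappa> / 2 - (real N + 5) / 4 * \<alpha>)"
      by (simp add: field_simps power2_eq_square)
    also have "\<dots> \<le> 0"
    proof (rule mult_nonneg_nonpos)
      have "10 / 4 * \<alpha> \<le> (real N + 5) / 4 * \<alpha>" using N5 alpha0 by (intro mult_right_mono) auto
      then show "\<kappa> / 2 - (real N + 5) / 4 * \<alpha> \<le> 0" using k5 by linarith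
    qed (use N5 in simp)
    finally have "- (real N)\<^sup>2 / 4 * \<alpha> - 1 / 4 + real N / 2 * \<kappa> < 0" using f5 by linarith
    moreover have "R m = - (real N)\<^sup>2 / 4 * \<alpha> - 1 / 4 + real N / 2 * \<kappa>"
      unfolding R_def K Gm using KG by simp
    moreover have "P m = - (real N)\<^sup>2 / 4 * \<alpha> - 1 / 4 - real N / 2 * \<kappa> + \<epsilon>"
      unfolding P_def K Gm using KG by (simp add: \<epsilon>_def Q_T)
    moreover have "real N / 2 * \<kappa> \<ge> 0" using k0 by simp
    ultimately have "P m < 0" "R m < 0" using Pneg by linarith+
    then have "P m * R m > 0" by (rule mult_neg_neg)
    then show ?thesis using m N5 by (intro linearly_unstable_mode[of m]) auto
  qed
qed

lemma eps_2:
  assumes "N = 2" shows "\<epsilon> = ((1 + c\<^sup>2)\<^sup>2 - 8 * c\<^sup>2) / (1 + c\<^sup>2)"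
proof -
  have n: "real N = 2" by (simp add: assms)
  have T: "T = 2 * c / (1 + c\<^sup>2)" unfolding T_def n by (simp add: tanh_double tanh_y)
  show ?thesis unfolding \<epsilon>_def T n using add_pos_nonneg[of 1 "c\<^sup>2"]
    by (simp add: field_simps power2_eq_square)
qed

end

section \<open>Lyapunov stability from a strict minimum of the energy\<close>

lemma dist_rotate:
  fixes y z :: "real^3^'m::finite"
  assumes "rotation_matrix g" shows "dist (rotate g y) (rotate g z) = dist y z"
proof -
  have "norm (g *v a) = norm a" for a :: "real^3" using rotation_inner[OF assms, of a a] by (simp add: norm_eq_sqrt_inner)
  from this[of "y $ i - z $ i" for i] show ?thesis
    unfolding dist_norm norm_vec_def[of "rotate g y - rotate g z"] norm_vec_def[of "y - z"]
    by (simp add: rotate_nth matrix_vector_mult_diff_distrib[symmetric])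
qed

lemma hamiltonian_rotate:
  assumes "rotation_matrix g" shows "hamiltonian \<Gamma> (rotate g y) = hamiltonian \<Gamma> y"
proof -
  have "norm (g *v a) = norm a" for a :: "real^3" using rotation_inner[OF assms, of a a] by (simp add: norm_eq_sqrt_inner)
  then show ?thesis
    by (simp add: hamiltonian_def rotate_nth matrix_vector_mult_diff_distrib[symmetric])
qed

lemma centre_of_vorticity_rotate:
  fixes y :: "real^3^'m::finite"
  shows "centre_of_vorticity \<Gamma> (rotate g y) = g *v centre_of_vorticity \<Gamma> y"
proof -
  have "g *v (\<Sum>j\<in>A. f j) = (\<Sum>j\<in>A. g *v f j)" for f :: "'m \<Rightarrow> real^3" and A
    by (induction A rule: infinite_finite_induct) (simp_all add: matrix_vector_right_distrib)
  then show ?thesis by (simp add: centre_of_vorticity_def rotate_nth matrix_vector_mult_scaleR)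
qed

lemma isotropy_group_inverse:
  assumes "g \<in> isotropy_group \<mu>"
  shows "transpose g \<in> isotropy_group \<mu>" "rotate (transpose g) (rotate g y) = y" "rotate g (rotate (transpose g) y) = y"
proof -
  have o: "orthogonal_matrix g" "det g = 1" "g *v \<mu> = \<mu>"
    using assms by (auto simp: isotropy_group_def SO3_def rotation_matrix_def)
  have i: "transpose g ** g = mat 1" "g ** transpose g = mat 1" using o(1) by (auto simp: orthogonal_matrix_def)
  have "transpose g *v \<mu> = transpose g *v (g *v \<mu>)" using o by simp
  also have "\<dots> = \<mu>" by (simp only: matrix_vector_mul_assoc i matrix_vector_mul_lid)
  finally show "transpose g \<in> isotropy_group \<mu>"
    using o by (simp add: isotropy_group_def SO3_def rotation_matrix_def orthogonal_matrix_transpose det_transpose)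
  show "rotate (transpose g) (rotate g y) = y" "rotate g (rotate (transpose g) y) = y"
    by (simp_all only: rotate_def vec_lambda_beta matrix_vector_mul_assoc i matrix_vector_mul_lid vec_lambda_eta)
qed

lemma isotropy_group_mult:
  assumes "g \<in> isotropy_group \<mu>" "h \<in> isotropy_group \<mu>"
  shows "g ** h \<in> isotropy_group \<mu>" "rotate g (rotate h y) = rotate (g ** h) y"
proof -
  show "g ** h \<in> isotropy_group \<mu>"
    using assms by (simp add: isotropy_group_def SO3_def rotation_matrix_def orthogonal_matrix_mul det_mul matrix_vector_mul_assoc[symmetric])
  show "rotate g (rotate h y) = rotate (g ** h) y"
    by (simp add: rotate_def matrix_vector_mul_assoc vec_eq_iff)
qed

lemma continuous_on_hamiltonian: "continuous_on phase_space (hamiltonian \<Gamma>)"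
  unfolding hamiltonian_def
  by (intro continuous_intros) (auto simp: phase_space_def)

lemma continuous_on_centre_of_vorticity: "continuous_on A (centre_of_vorticity \<Gamma>)"
  unfolding centre_of_vorticity_def by (intro continuous_intros)

text \<open>A strict minimum of the energy on a level set of the momentum is stable also for solutions on neighbouring
level sets. On the compact set \<open>C\<close> of configurations at distance \<open>r\<close> from the orbit the conserved quantity
\<open>f = max (H - H x) (norm (\<Phi> - \<mu>))\<close> is positive, hence at least some \<open>m > 0\<close>; solutions that start within distance \<open>r\<close> of the orbit with \<open>f < m\<close>
cannot cross that set. As the configurations at distance \<open>r\<close> from the whole orbit need not be near \<open>x\<close>, the set \<open>C\<close> is taken near \<open>x\<close> and
the isotropy group moves any point of the solution there.\<close>

lemma lyapunov_stable_if_strict_local_min: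
  fixes x :: "real^3^'m::finite" and \<Gamma> :: "'m \<Rightarrow> real"
  defines "\<mu> \<equiv> centre_of_vorticity \<Gamma> x"
  assumes x: "x \<in> phase_space" and \<rho>: "\<rho> > 0"
    and min: "\<And>y. y \<in> phase_space \<Longrightarrow> dist x y < \<rho> \<Longrightarrow> centre_of_vorticity \<Gamma> y = \<mu> \<Longrightarrow>
      hamiltonian \<Gamma> y \<le> hamiltonian \<Gamma> x \<Longrightarrow> \<exists>g\<in>isotropy_group \<mu>. y = rotate g x"
  shows "lyapunov_stable \<Gamma> x"
  unfolding lyapunov_stable_def Let_def \<mu>_def[symmetric]
proof (intro allI impI)
  let ?K = "isotropy_group \<mu>" and ?H = "hamiltonian \<Gamma>" and ?\<Phi> = "centre_of_vorticity \<Gamma>"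
  define Orb where "Orb = (\<lambda>g. rotate g x) ` ?K"
  have rotK: "rotation_matrix g" if "g \<in> ?K" for g using that by (simp add: isotropy_group_def SO3_def)
  have one: "mat 1 \<in> ?K"
    by (simp add: isotropy_group_def SO3_def rotation_matrix_def orthogonal_matrix_id)
  have xO: "x \<in> Orb" unfolding Orb_def using one by (intro image_eqI[of _ _ "mat 1"]) (auto simp: rotate_def vec_eq_iff)
  fix V assume V: "openin (top_of_set phase_space) V \<and> (\<forall>g\<in>?K. rotate g ` V \<subseteq> V) \<and> (\<lambda>g. rotate g x) ` ?K \<subseteq> V"
  then obtain W where W: "open W" "V = phase_space \<inter> W" by (auto simp: openin_open)
  have "x \<in> W" using V W xO by (auto simp: Orb_def)
  define D where "D = (\<Inter>i::'m. \<Inter>j\<in>- {i}. {y :: real^3^'m. y $ i \<noteq> y $ j})"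
  have "open D" unfolding D_def
    by (intro open_INT ballI open_Collect_neq continuous_intros) auto
  moreover have "x \<in> D" using x by (auto simp: D_def phase_space_def)
  ultimately obtain e where e: "e > 0" "cball x e \<subseteq> W \<inter> D"
    using \<open>open W\<close> \<open>x \<in> W\<close> open_contains_cball[of "W \<inter> D"] by blast
  \<comment> \<open>Within distance \<open>2 * r\<close> of \<open>x\<close> vortices do not collide, \<open>W\<close> is not left and \<open>min\<close> applies.\<close>
  define r where "r = min (e / 2) (\<rho> / 3)"
  have r: "r > 0" "2 * r \<le> e" "2 * r < \<rho>" using e \<rho> by (auto simp: r_def min_def)
  have phaseI: "y \<in> phase_space" if "dist x y \<le> 2 * r" "\<forall>i. norm (y $ i) = 1" for y
    using that e r unfolding phase_space_def D_def by (auto simp: subset_iff)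
  define C where "C = {y \<in> cball x (2 * r). infdist y Orb = r \<and> (\<forall>i. norm (y $ i) = 1)}"
  have CP: "C \<subseteq> phase_space" using phaseI by (auto simp: C_def)
  have "compact C"
  proof -
    have "C = cball x (2 * r) \<inter> ({y. infdist y Orb = r} \<inter> (\<Inter>i. {y. norm (y $ i) = 1}))" by (auto simp: C_def)
    moreover have "closed ({y. infdist y Orb = r} \<inter> (\<Inter>i. {y :: real^3^'m. norm (y $ i) = 1}))"
      by (intro closed_Int closed_INT ballI closed_Collect_eq continuous_intros)
    ultimately show ?thesis using compact_Int_closed[OF compact_cball] by simp
  qed
  define f where "f y = max (?H y - ?H x) (norm (?\<Phi> y - \<mu>))" for y
  have fpos: "f y > 0" if y: "y \<in> C" for y
  proof (rule ccontr)
    assume "\<not> f y > 0"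
    then have "?H y \<le> ?H x" "norm (?\<Phi> y - \<mu>) \<le> 0" unfolding f_def by linarith+
    then have "?H y \<le> ?H x" "?\<Phi> y = \<mu>" by simp_all
    moreover have "dist x y < \<rho>" using y r by (auto simp: C_def)
    ultimately obtain g where "g \<in> ?K" "y = rotate g x" using min CP y by blast
    then have "y \<in> Orb" by (auto simp: Orb_def)
    then show False using y r by (simp add: C_def)
  qed
  have "\<exists>m>0. \<forall>y\<in>C. m \<le> f y"
  proof (cases "C = {}")
    case False
    have "continuous_on C f" unfolding f_def
      using CP by (intro continuous_intros continuous_on_centre_of_vorticity continuous_on_subset[OF continuous_on_hamiltonian])
    from continuous_attains_inf[OF \<open>compact C\<close> False this] show ?thesis using fpos by blast
  qed (auto intro: exI[of _ 1])
  then obtain m where m: "m > 0" "\<And>y. y \<in> C \<Longrightarrow> m \<le> f y" by blast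
  define U where "U = {y \<in> phase_space. infdist y Orb < r \<and> f y < m}"
  have near: "\<exists>g\<in>?K. dist x (rotate (transpose g) y) < d" if "infdist y Orb < d" for y d
  proof -
    have "Orb \<noteq> {}" using xO by auto
    then have "Inf (dist y ` Orb) < d" using that by (simp add: infdist_def)
    then obtain z where z: "z \<in> Orb" "dist y z < d"
      using cInf_lessD[of "dist y ` Orb" d] \<open>Orb \<noteq> {}\<close> by blast
    then obtain g where g: "g \<in> ?K" "z = rotate g x" by (auto simp: Orb_def)
    have "dist x (rotate (transpose g) y) = dist (rotate (transpose g) z) (rotate (transpose g) y)"
      unfolding g(2) isotropy_group_inverse(2)[OF g(1)] ..
    also have "\<dots> = dist y z"
      using dist_rotate[OF rotK[OF isotropy_group_inverse(1)[OF g(1)]]] by (simp add: dist_commute)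
    finally have "dist x (rotate (transpose g) y) < d" using z by simp
    then show ?thesis using g by blast
  qed
  have infdist_rotate: "infdist (rotate g y) Orb = infdist y Orb" if g: "g \<in> ?K" for g y
  proof -
    have "infdist (rotate g y) Orb \<le> infdist y Orb" if g: "g \<in> ?K" for g y
    proof -
      have "infdist (rotate g y) Orb \<le> dist y z" if "z \<in> Orb" for z
      proof -
        have "rotate g z \<in> Orb" using that g isotropy_group_mult[OF g] by (auto simp: Orb_def)
        then have "infdist (rotate g y) Orb \<le> dist (rotate g y) (rotate g z)" by (rule infdist_le)
        also have "\<dots> = dist y z" by (rule dist_rotate[OF rotK[OF g]])
        finally show ?thesis .
      qed
      moreover have ne: "Orb \<noteq> {}" using xO by auto
      ultimately show ?thesis unfolding infdist_notempty[OF ne, of y] by (intro cINF_greatest)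
    qed
    from this[OF g, of y] this[OF isotropy_group_inverse(1)[OF g], of "rotate g y"] show ?thesis
      by (simp add: isotropy_group_inverse(2)[OF g])
  qed
  have f_rotate: "f (rotate g y) = f y" if g: "g \<in> ?K" for g y
  proof -
    have "g *v ?\<Phi> y - \<mu> = g *v (?\<Phi> y - \<mu>)"
      using g by (simp add: isotropy_group_def matrix_vector_mult_diff_distrib)
    moreover have "norm (g *v a) = norm a" for a using rotation_inner[OF rotK[OF g], of a a] by (simp add: norm_eq_sqrt_inner)
    ultimately show ?thesis by (simp add: f_def hamiltonian_rotate[OF rotK[OF g]] centre_of_vorticity_rotate)
  qed
  have "openin (top_of_set phase_space) U"
  proof -
    have c: "continuous_on phase_space (\<lambda>y. infdist y Orb)" "continuous_on phase_space f" unfolding f_def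
      by (intro continuous_intros continuous_on_centre_of_vorticity continuous_on_hamiltonian)+
    have "U = (phase_space \<inter> (\<lambda>y. infdist y Orb) -` {..<r}) \<inter> (phase_space \<inter> f -` {..<m})"
      by (auto simp: U_def)
    then show ?thesis using c by (simp add: openin_Int continuous_openin_preimage_gen)
  qed
  moreover have "x \<in> U" using x xO r m by (simp add: U_def f_def \<mu>_def)
  moreover have "U \<subseteq> V"
  proof
    fix y assume y: "y \<in> U"
    then obtain g where g: "g \<in> ?K" "dist x (rotate (transpose g) y) < r" using near by (auto simp: U_def)
    have "rotate (transpose g) y \<in> W" using e r g by auto
    moreover have "rotate (transpose g) y \<in> phase_space"
      using y rotate_phase_space rotK isotropy_group_inverse(1)[OF g(1)] by (auto simp: U_def)
    ultimately have "rotate g (rotate (transpose g) y) \<in> V" using V W g by blast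
    then show "y \<in> V" by (simp add: isotropy_group_inverse(3)[OF g(1)])
  qed
  moreover have "flow_invariant \<Gamma> U"
    unfolding flow_invariant_def
  proof (intro allI impI ballI)
    fix I u t assume A: "is_interval I \<and> 0 \<in> I \<and> solution_on \<Gamma> I u \<and> u 0 \<in> U" and t: "t \<in> I"
    then have sol: "solution_on \<Gamma> I u" and I: "is_interval I" "0 \<in> I" and u0: "u 0 \<in> U" by auto
    have fu: "f (u t') = f (u 0)" if "t' \<in> I" for t'
      using hamiltonian_conserved[OF sol I(1) that I(2)] centre_of_vorticity_conserved[OF sol I(1) that I(2)]
      by (simp add: f_def)
    have up: "u t' \<in> phase_space" if "t' \<in> I" for t' using sol that by (simp add: solution_on_def)
    have cu: "continuous_on I u"
      using sol by (auto simp: solution_on_def intro!: continuous_on_vector_derivative)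
    have no: "infdist (u t') Orb \<noteq> r" if t': "t' \<in> I" for t'
    proof
      assume eq: "infdist (u t') Orb = r"
      then obtain g where g: "g \<in> ?K" "dist x (rotate (transpose g) (u t')) < 2 * r" using near[of "u t'" "2 * r"] r by auto
      note g' = isotropy_group_inverse(1)[OF g(1)]
      have "rotate (transpose g) (u t') \<in> phase_space" using rotate_phase_space[OF rotK[OF g'] up[OF t']] .
      then have "rotate (transpose g) (u t') \<in> C"
        using g infdist_rotate[OF g'] eq by (auto simp: C_def phase_space_def)
      from m(2)[OF this] show False using f_rotate[OF g'] fu[OF t'] u0 by (simp add: U_def)
    qed
    have "infdist (u t) Orb < r"
    proof (rule ccontr)
      assume "\<not> infdist (u t) Orb < r"
      then have ge: "infdist (u t) Orb \<ge> r" by simp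
      have conn: "connected ((\<lambda>t. infdist (u t) Orb) ` I)"
        using I by (intro connected_continuous_image continuous_intros cu) (simp add: is_interval_connected)
      have "infdist (u 0) Orb \<le> r" using u0 by (simp add: U_def)
      then have "r \<in> (\<lambda>t. infdist (u t) Orb) ` I"
        using connectedD_interval[OF conn, of "infdist (u 0) Orb" "infdist (u t) Orb" r] ge I t by blast
      then show False using no by auto
    qed
    then show "u t \<in> U" using up[OF t] fu[OF t] u0 by (simp add: U_def)
  qed
  ultimately show "\<exists>U. openin (top_of_set phase_space) U \<and> x \<in> U \<and> U \<subseteq> V \<and> flow_invariant \<Gamma> U" by blast
qed

section \<open>The energy of four vortices\<close>

text \<open>The inequality between arithmetic and geometric means with its equality case.\<close>

lemma ln_add_le_twice_ln_mean:
  fixes a b :: real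
  assumes "a > 0" "b > 0"
  shows "ln a + ln b \<le> 2 * ln ((a + b) / 2)"
    and "ln a + ln b = 2 * ln ((a + b) / 2) \<Longrightarrow> a = b"
proof -
  have sq: "((a + b) / 2)\<^sup>2 - a * b = ((a - b) / 2)\<^sup>2" by (simp add: power2_eq_square field_simps)
  have l: "ln a + ln b = ln (a * b)" using assms by (simp add: ln_mult)
  have r: "2 * ln ((a + b) / 2) = ln (((a + b) / 2)\<^sup>2)" using assms by (simp add: ln_realpow)
  have le: "a * b \<le> ((a + b) / 2)\<^sup>2" using sq zero_le_power2[of "(a - b) / 2"] by linarith
  show "ln a + ln b \<le> 2 * ln ((a + b) / 2)" unfolding l r using assms le by simp
  assume "ln a + ln b = 2 * ln ((a + b) / 2)"
  then have "ln (a * b) = ln (((a + b) / 2)\<^sup>2)" unfolding l r .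
  then have "a * b = ((a + b) / 2)\<^sup>2" using assms by (subst (asm) ln_inj_iff) auto
  then have "((a - b) / 2)\<^sup>2 = 0" using sq by linarith
  then show "a = b" by simp
qed

lemma ln_sum4_le:
  fixes a b d e :: real
  assumes "a > 0" "b > 0" "d > 0" "e > 0"
  shows "ln a + ln b + ln d + ln e \<le> 4 * ln ((a + b + d + e) / 4)"
    and "ln a + ln b + ln d + ln e = 4 * ln ((a + b + d + e) / 4) \<Longrightarrow> a = b \<and> d = e \<and> a = d"
proof -
  have p: "(a + b) / 2 > 0" "(d + e) / 2 > 0" using assms by auto
  have m: "((a + b) / 2 + (d + e) / 2) / 2 = (a + b + d + e) / 4" by (simp add: field_simps)
  note i = ln_add_le_twice_ln_mean(1)[OF assms(1,2)] ln_add_le_twice_ln_mean(1)[OF assms(3,4)] ln_add_le_twice_ln_mean(1)[OF p, unfolded m]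
  show "ln a + ln b + ln d + ln e \<le> 4 * ln ((a + b + d + e) / 4)" using i by linarith
  assume eq: "ln a + ln b + ln d + ln e = 4 * ln ((a + b + d + e) / 4)"
  have "ln a + ln b = 2 * ln ((a + b) / 2)" "ln d + ln e = 2 * ln ((d + e) / 2)"
    "ln ((a + b) / 2) + ln ((d + e) / 2) = 2 * ln ((a + b + d + e) / 4)" using i eq by linarith+
  then have "a = b" "d = e" "(a + b) / 2 = (d + e) / 2"
    using ln_add_le_twice_ln_mean(2)[OF assms(1,2)] ln_add_le_twice_ln_mean(2)[OF assms(3,4)] ln_add_le_twice_ln_mean(2)[OF p, unfolded m] by auto
  then show "a = b \<and> d = e \<and> a = d" by simp
qed

text \<open>The lower bound of \<open>four_vortex_energy_bound\<close> at \<open>r > 0\<close> exceeds its value at \<open>r = 0\<close>. To first order in \<open>r\<close> this is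
the condition \<open>(4 + k)\<^sup>2 < 2 * (4 - k)\<^sup>2\<close>; the third bound on \<open>r\<close> controls the terms of higher order.\<close>

lemma reduced_energy_increasing:
  fixes k r :: real
  assumes k: "0 \<le> k" "k < 4" and cond: "(4 + k)\<^sup>2 < 2 * (4 - k)\<^sup>2"
    and r: "0 < r" "r < 4 + k" "6 * (4 - k)\<^sup>2 * r < 4 * (4 - k)\<^sup>2 * (4 + k) - 2 * (4 + k)^3"
    and pos: "(4 - k - r)\<^sup>2 - 4 * k * r > 0"
  shows "2 * ln (4 - k) - 4 * ln (2 + k / 2) < ln ((4 - k - r)\<^sup>2 - 4 * k * r) - 4 * ln (2 + k / 2 - r / 2)"
proof -
  define w a where "w = 4 + k" and "a = (4 - k)\<^sup>2"
  have w: "w > 0" "r < w" using k r by (simp_all add: w_def)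
  have n: "(4 - k - r)\<^sup>2 - 4 * k * r = a - 2 * w * r + r\<^sup>2"
    by (simp add: a_def w_def power2_eq_square algebra_simps)
  have "(w - r)^4 = w^4 - 4 * w^3 * r + 6 * w\<^sup>2 * r\<^sup>2 - 4 * w * r^3 + r^4"
    by (simp add: power4_eq_xxxx power3_eq_cube power2_eq_square algebra_simps)
  moreover have "r^4 \<le> 4 * w * r^3"
  proof -
    have "r * r^3 \<le> 4 * w * r^3" using w r by (intro mult_right_mono) auto
    then show ?thesis by (simp add: power4_eq_xxxx power3_eq_cube)
  qed
  ultimately have "(w - r)^4 \<le> w^4 - 4 * w^3 * r + 6 * w\<^sup>2 * r\<^sup>2" by linarith
  then have "a * (w - r)^4 \<le> a * (w^4 - 4 * w^3 * r + 6 * w\<^sup>2 * r\<^sup>2)" by (intro mult_left_mono) (simp_all add: a_def)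
  also have "\<dots> < (a - 2 * w * r + r\<^sup>2) * w^4"
  proof -
    have "0 < r * w\<^sup>2 * ((4 * a * w - 2 * w^3 - 6 * a * r) + r * w\<^sup>2)"
      using r w k by (intro mult_pos_pos add_pos_pos) (simp_all add: a_def w_def)
    also have "\<dots> = (a - 2 * w * r + r\<^sup>2) * w^4 - a * (w^4 - 4 * w^3 * r + 6 * w\<^sup>2 * r\<^sup>2)"
      by (simp add: power4_eq_xxxx power3_eq_cube power2_eq_square algebra_simps)
    finally show ?thesis by simp
  qed
  finally have lt: "a * (w - r)^4 < (a - 2 * w * r + r\<^sup>2) * w^4" .
  have a0: "a > 0" using k by (simp add: a_def)
  have p: "a - 2 * w * r + r\<^sup>2 > 0" using pos n by simp
  have "ln (a * (w - r)^4) < ln ((a - 2 * w * r + r\<^sup>2) * w^4)"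
    using lt a0 w p by (subst ln_less_cancel_iff) auto
  then have "ln a + 4 * ln (w - r) < ln (a - 2 * w * r + r\<^sup>2) + 4 * ln w"
    using a0 w p by (simp add: ln_mult ln_realpow)
  moreover have "ln a = 2 * ln (4 - k)" using k by (simp add: a_def ln_realpow)
  moreover have "ln (2 + k / 2) = ln w - ln 2" "ln (2 + k / 2 - r / 2) = ln (w - r) - ln 2"
  proof -
    have e: "2 + k / 2 = w / 2" "2 + k / 2 - r / 2 = (w - r) / 2" by (simp_all add: w_def field_simps)
    show "ln (2 + k / 2) = ln w - ln 2" unfolding e(1) using w by (simp add: ln_div)
    show "ln (2 + k / 2 - r / 2) = ln (w - r) - ln 2" unfolding e(2) using w by (simp add: ln_div)
  qed
  ultimately show ?thesis unfolding n by simp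
qed

lemma hamiltonian_four:
  fixes y :: "real^3^('n::finite + 'n)"
  assumes U: "(UNIV :: 'n set) = {a, b}" "a \<noteq> b" and y: "y \<in> phase_space"
  shows "hamiltonian DNd_vorticity y = ln ((norm (y $ Inl a - y $ Inl b))\<^sup>2) + ln ((norm (y $ Inr a - y $ Inr b))\<^sup>2)
    - (ln (2 - 2 * (y $ Inl a \<bullet> y $ Inr a)) + ln (2 - 2 * (y $ Inl a \<bullet> y $ Inr b))
     + ln (2 - 2 * (y $ Inl b \<bullet> y $ Inr a)) + ln (2 - 2 * (y $ Inl b \<bullet> y $ Inr b)))"
proof -
  define h where "h i j = DNd_vorticity i * DNd_vorticity j * ln ((norm (y $ i - y $ j))\<^sup>2)" for i j :: "'n + 'n"
  have sum4: "(\<Sum>i\<in>UNIV. f i) = f (Inl a) + f (Inl b) + f (Inr a) + f (Inr b)" for f :: "'n + 'n \<Rightarrow> real"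
  proof -
    have U4: "(UNIV :: ('n + 'n) set) = {Inl a, Inl b, Inr a, Inr b}"
      unfolding UNIV_Plus_UNIV[symmetric] U by auto
    show ?thesis unfolding U4 using U(2) by simp
  qed
  have "(\<Sum>j\<in>UNIV - {i}. h i j) = (\<Sum>j\<in>UNIV. h i j)" for i
    by (rule sum.mono_neutral_left) (auto simp: h_def)
  then have "hamiltonian DNd_vorticity y = (\<Sum>i\<in>UNIV. \<Sum>j\<in>UNIV. h i j) / 2"
    by (simp add: hamiltonian_def h_def)
  moreover have sym: "h i j = h j i" for i j by (simp add: h_def norm_minus_commute mult.commute)
  moreover have "h i i = 0" for i by (simp add: h_def)
  ultimately have H: "hamiltonian DNd_vorticity y = h (Inl a) (Inl b) + h (Inr a) (Inr b)
      + h (Inl a) (Inr a) + h (Inl a) (Inr b) + h (Inl b) (Inr a) + h (Inl b) (Inr b)"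
    unfolding sum4
    by (simp add: sym[of "Inl b" "Inl a"] sym[of "Inr a" "Inl a"] sym[of "Inr a" "Inl b"]
        sym[of "Inr b" "Inl a"] sym[of "Inr b" "Inl b"] sym[of "Inr b" "Inr a"])
  have "(norm (y $ i - y $ j))\<^sup>2 = 2 - 2 * (y $ i \<bullet> y $ j)" for i j
    unfolding power2_norm_eq_inner using phase_spaceD(2)[OF y, of i] phase_spaceD(2)[OF y, of j]
    by (simp add: inner_diff_left inner_diff_right inner_commute)
  then show ?thesis unfolding H h_def by (simp add: DNd_vorticity_def)
qed

lemma centre_of_vorticity_four:
  fixes y :: "real^3^('n::finite + 'n)"
  assumes U: "(UNIV :: 'n set) = {a, b}" "a \<noteq> b"
  shows "centre_of_vorticity DNd_vorticity y = (y $ Inl a + y $ Inl b) - (y $ Inr a + y $ Inr b)"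
proof -
  have U4: "(UNIV :: ('n + 'n) set) = {Inl a, Inl b, Inr a, Inr b}"
    unfolding UNIV_Plus_UNIV[symmetric] U by auto
  show ?thesis unfolding centre_of_vorticity_def U4 using U(2) by (simp add: DNd_vorticity_def)
qed

text \<open>The distances within the pairs depend on \<open>p\<close> and \<open>q\<close>, whose squared lengths have sum \<open>2 * (k + r)\<close> and a difference
bounded by Cauchy-Schwarz; this bounds the product of the two distances from below. The four mixed terms have a sum
determined by \<open>k\<close> and \<open>r\<close>, so the sum of their logarithms is largest when they are equal.\<close>

lemma four_vortex_energy_bound:
  fixes x1 x2 y1 y2 \<mu> :: "real^3"
  defines "p \<equiv> x1 + x2" and "q \<equiv> y1 + y2"
  assumes n: "norm x1 = 1" "norm x2 = 1" "norm y1 = 1" "norm y2 = 1"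
    and ne: "x1 \<noteq> x2" "y1 \<noteq> y2" "x1 \<bullet> y1 < 1" "x1 \<bullet> y2 < 1" "x2 \<bullet> y1 < 1" "x2 \<bullet> y2 < 1"
    and pq: "p - q = \<mu>" and k: "\<mu> \<bullet> \<mu> = 4 * k"
  defines "r \<equiv> (p + q) \<bullet> (p + q) / 4"
  defines "H \<equiv> ln ((norm (x1 - x2))\<^sup>2) + ln ((norm (y1 - y2))\<^sup>2)
    - (ln (2 - 2 * (x1 \<bullet> y1)) + ln (2 - 2 * (x1 \<bullet> y2)) + ln (2 - 2 * (x2 \<bullet> y1)) + ln (2 - 2 * (x2 \<bullet> y2)))"
  assumes pos: "(4 - k - r)\<^sup>2 - 4 * k * r > 0"
  shows "ln ((4 - k - r)\<^sup>2 - 4 * k * r) - 4 * ln (2 + k / 2 - r / 2) \<le> H"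
    and "ln ((4 - k - r)\<^sup>2 - 4 * k * r) - 4 * ln (2 + k / 2 - r / 2) = H \<Longrightarrow>
      x1 \<bullet> y1 = x1 \<bullet> y2 \<and> x2 \<bullet> y1 = x2 \<bullet> y2 \<and> x1 \<bullet> y1 = x2 \<bullet> y1"
proof -
  have n': "x1 \<bullet> x1 = 1" "x2 \<bullet> x2 = 1" "y1 \<bullet> y1 = 1" "y2 \<bullet> y2 = 1" using n by (simp_all add: norm_eq_1)
  define A B where "A = p \<bullet> p" and "B = q \<bullet> q"
  have dx: "(norm (x1 - x2))\<^sup>2 = 4 - A" and dy: "(norm (y1 - y2))\<^sup>2 = 4 - B"
    unfolding power2_norm_eq_inner A_def B_def p_def q_def using n'
    by (simp_all add: inner_diff_left inner_diff_right inner_add_left inner_add_right inner_commute)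
  have AB: "4 - A > 0" "4 - B > 0" using dx dy ne by (metis eq_iff_diff_eq_0 zero_less_norm_iff zero_less_power)+
  have k4: "A + B - 2 * (p \<bullet> q) = 4 * k" using k unfolding pq[symmetric] A_def B_def
    by (simp add: inner_diff_left inner_diff_right inner_commute)
  have r4: "A + B + 2 * (p \<bullet> q) = 4 * r" unfolding r_def A_def B_def
    by (simp add: inner_add_left inner_add_right inner_commute)
  have u: "A + B = 2 * (k + r)" "p \<bullet> q = r - k" using k4 r4 by simp_all
  have "A - B = \<mu> \<bullet> (p + q)" unfolding pq[symmetric] A_def B_def
    by (simp add: inner_diff_left inner_diff_right inner_add_left inner_add_right inner_commute)
  then have "(A - B)\<^sup>2 \<le> (4 * k) * (4 * r)"
    using Cauchy_Schwarz_ineq[of \<mu> "p + q"] unfolding k r_def by simp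
  moreover have "4 * ((4 - A) * (4 - B)) = (8 - (A + B))\<^sup>2 - (A - B)\<^sup>2" by (simp add: power2_eq_square algebra_simps)
  ultimately have prod: "(4 - k - r)\<^sup>2 - 4 * k * r \<le> (4 - A) * (4 - B)"
    unfolding u by (simp add: power2_eq_square algebra_simps)
  have l1: "ln ((4 - k - r)\<^sup>2 - 4 * k * r) \<le> ln (4 - A) + ln (4 - B)"
  proof -
    have "ln ((4 - k - r)\<^sup>2 - 4 * k * r) \<le> ln ((4 - A) * (4 - B))" using prod pos by simp
    then show ?thesis using AB by (simp add: ln_mult)
  qed
  have mean: "(2 - 2 * (x1 \<bullet> y1) + (2 - 2 * (x1 \<bullet> y2)) + (2 - 2 * (x2 \<bullet> y1)) + (2 - 2 * (x2 \<bullet> y2))) / 4 = 2 + k / 2 - r / 2"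
    using u(2) unfolding p_def q_def by (simp add: inner_add_left inner_add_right field_simps)
  have pp: "2 - 2 * (x1 \<bullet> y1) > 0" "2 - 2 * (x1 \<bullet> y2) > 0" "2 - 2 * (x2 \<bullet> y1) > 0" "2 - 2 * (x2 \<bullet> y2) > 0" using ne by simp_all
  note l2 = ln_sum4_le[OF pp, unfolded mean]
  show "ln ((4 - k - r)\<^sup>2 - 4 * k * r) - 4 * ln (2 + k / 2 - r / 2) \<le> H"
    unfolding H_def dx dy using l1 l2(1) by linarith
  assume "ln ((4 - k - r)\<^sup>2 - 4 * k * r) - 4 * ln (2 + k / 2 - r / 2) = H"
  then have "ln (2 - 2 * (x1 \<bullet> y1)) + ln (2 - 2 * (x1 \<bullet> y2)) + ln (2 - 2 * (x2 \<bullet> y1)) + ln (2 - 2 * (x2 \<bullet> y2)) = 4 * ln (2 + k / 2 - r / 2)"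
    unfolding H_def dx dy using l1 l2(1) by linarith
  from l2(2)[OF this] show "x1 \<bullet> y1 = x1 \<bullet> y2 \<and> x2 \<bullet> y1 = x2 \<bullet> y2 \<and> x1 \<bullet> y1 = x2 \<bullet> y1" by auto
qed

lemma rotation_from_frame:
  fixes d e :: "real^3"
  assumes "d \<bullet> d = 1" "e \<bullet> e = 1" "d \<bullet> e = 0"
  obtains g where "rotation_matrix g" "g *v vector [1, 0, 0] = d" "g *v vector [0, 1, 0] = e" "g *v vector [0, 0, 1] = cross3 d e"
proof -
  define g :: "real^3^3" where "g = transpose (vector [d, e, cross3 d e])"
  define f where "f = cross3 d e"
  have f: "f \<bullet> f = 1" "d \<bullet> f = 0" "e \<bullet> f = 0" "f \<bullet> d = 0" "f \<bullet> e = 0" "e \<bullet> d = 0"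
    using assms by (simp_all add: f_def dot_cross_self inner_commute dot_cross)
  have tg: "transpose g = vector [d, e, f]" by (simp add: g_def f_def)
  have gi: "g $ i $ 1 = d $ i" "g $ i $ 2 = e $ i" "g $ i $ 3 = f $ i" for i
    by (simp_all add: g_def transpose_def f_def)
  have "orthogonal_matrix g"
    unfolding orthogonal_matrix
    using assms f
    by (simp add: vec_eq_iff forall_3 matrix_matrix_mult_def mat_def sum_3 transpose_def gi inner_vec_def)
  moreover have "det g = 1"
  proof -
    have "det g = f \<bullet> cross3 d e"
      by (simp add: det_3 gi cross3_def inner_vec_def sum_3 algebra_simps)
    then show ?thesis using f by (simp add: f_def)
  qed
  ultimately have "rotation_matrix g" by (simp add: rotation_matrix_def)
  moreover have "g *v vector [1, 0, 0] = d" "g *v vector [0, 1, 0] = e" "g *v vector [0, 0, 1] = f"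
    by (simp_all add: vec_eq_iff forall_3 matrix_vector_mult_def sum_3 gi)
  ultimately show thesis using that by (simp add: f_def)
qed

section \<open>Stability of two vortices per ring\<close>

context staggered_rings
begin

lemma card_2_indices:
  assumes "N = 2"
  obtains a b where "\<iota> a = 1" "\<iota> b = 2" "a \<noteq> b" "(UNIV :: 'n set) = {a, b}"
proof -
  have "1 \<in> range \<iota>" "2 \<in> range \<iota>" using ring_numbering assms by (auto simp: bij_betw_def)
  then obtain a b where ab: "\<iota> a = 1" "\<iota> b = 2" by (metis imageE)
  then have "a \<noteq> b" by auto
  moreover have "x = a \<or> x = b" for x
  proof -
    have "\<iota> x \<in> {1..2}" using ring_numbering assms by (auto simp: bij_betw_def)
    then have "\<iota> x = \<iota> a \<or> \<iota> x = \<iota> b" using ab by auto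
    then show ?thesis using ring_numbering by (auto simp: bij_betw_def inj_on_def)
  qed
  ultimately show thesis using that ab by blast
qed

text \<open>Among nearby configurations with the same centre of vorticity and no larger energy, \<open>reduced_energy_increasing\<close> forces
the sum of the positions to vanish, and the equality case forces the two pairs to be perpendicular chords with midpoints
on the axis. Such a configuration is the image of the rings under an element of the isotropy group or under a reflection; the sign of
\<open>dd\<close> excludes the latter.\<close>

theorem lyapunov_stable_2:
  assumes N: "N = 2" and cond: "(1 + c\<^sup>2)\<^sup>2 < 2 * (1 - c\<^sup>2)\<^sup>2"
  shows "lyapunov_stable \<Lambda> X"
proof -
  obtain a b where ab: "\<iota> a = 1" "\<iota> b = 2" "a \<noteq> b" "(UNIV :: 'n set) = {a, b}" by (rule card_2_indices[OF N])
  have l: "lon (Inl a) = 0" "lon (Inl b) = pi" "lon (Inr a) = pi / 2" "lon (Inr b) = pi / 2 + pi"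
  proof -
    have "real N = 2" using N by simp
    then show "lon (Inl a) = 0" "lon (Inl b) = pi" "lon (Inr a) = pi / 2" "lon (Inr b) = pi / 2 + pi"
      unfolding lon_def idx_def using ab(1,2) by (simp_all add: field_simps)
  qed
  have X: "X $ Inl a = vector [s, 0, c]" "X $ Inl b = vector [- s, 0, c]" "X $ Inr a = vector [0, s, - c]" "X $ Inr b = vector [0, - s, - c]"
  proof -
    have t: "cos (pi / 2 + pi) = 0" "sin (pi / 2 + pi) = - 1" by (simp_all only: cos_add sin_add) simp_all
    show "X $ Inl a = vector [s, 0, c]" "X $ Inl b = vector [- s, 0, c]" "X $ Inr a = vector [0, s, - c]" "X $ Inr b = vector [0, - s, - c]"
      unfolding X_nth l t by (simp_all add: DNd_vorticity_def)
  qed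
  define e3 :: "real^3" where "e3 = vector [0, 0, 1]"
  have e3: "e3 \<bullet> e3 = 1" by (simp add: e3_def inner_vector_3)
  have \<mu>: "centre_of_vorticity \<Lambda> X = (4 * c) *\<^sub>R e3"
    unfolding centre_of_vorticity_four[OF ab(4,3)] X by (simp add: vec_eq_iff forall_3 e3_def)
  define k where "k = 4 * c\<^sup>2"
  have k: "0 \<le> k" "k < 4"
  proof -
    have "c\<^sup>2 < 1" using c_nonneg c_lt_1 by (simp add: power_less_one_iff abs_square_less_1)
    then show "0 \<le> k" "k < 4" by (simp_all add: k_def)
  qed
  have kc: "4 - k = 4 * (1 - c\<^sup>2)" "4 + k = 4 * (1 + c\<^sup>2)" by (simp_all add: k_def)
  have cond': "(4 + k)\<^sup>2 < 2 * (4 - k)\<^sup>2" unfolding kc power_mult_distrib using cond by simp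
  have s2: "4 - k = 4 * s\<^sup>2" using s_c by (simp add: k_def)
  have HX: "hamiltonian \<Lambda> X = 2 * ln (4 - k) - 4 * ln (2 + k / 2)"
  proof -
    have e1: "(norm (X $ Inl a - X $ Inl b))\<^sup>2 = 4 - k" "(norm (X $ Inr a - X $ Inr b))\<^sup>2 = 4 - k"
      unfolding power2_norm_eq_inner X s2 by (simp_all add: inner_vec_def sum_3 power2_eq_square)
    have e2: "2 - 2 * (X $ Inl a \<bullet> X $ Inr a) = 2 + k / 2" "2 - 2 * (X $ Inl a \<bullet> X $ Inr b) = 2 + k / 2"
      "2 - 2 * (X $ Inl b \<bullet> X $ Inr a) = 2 + k / 2" "2 - 2 * (X $ Inl b \<bullet> X $ Inr b) = 2 + k / 2"
      unfolding X inner_vector_3 by (simp_all add: k_def power2_eq_square)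
    show ?thesis unfolding hamiltonian_four[OF ab(4,3) X_phase_space] e1 e2 by simp
  qed
  define m where "m = 4 * (4 - k)\<^sup>2 * (4 + k) - 2 * (4 + k)^3"
  have "(4 + k) * (4 + k)\<^sup>2 < (4 + k) * (2 * (4 - k)\<^sup>2)"
    using cond' k by (intro mult_strict_left_mono) auto
  moreover have "m = 2 * ((4 + k) * (2 * (4 - k)\<^sup>2) - (4 + k) * (4 + k)\<^sup>2)"
    by (simp add: m_def power3_eq_cube power2_eq_square algebra_simps)
  moreover have "0 < z" if "A < B" "z = 2 * (B - A)" for A B z :: real using that by simp
  ultimately have m: "m > 0" by blast
  have k4: "(4 - k)\<^sup>2 > 0" using k by simp
  \<comment> \<open>Below \<open>r0\<close> the hypotheses of \<open>reduced_energy_increasing\<close> hold.\<close>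
  define r0 where "r0 = min (4 + k) (min (m / (6 * (4 - k)\<^sup>2)) ((4 - k)\<^sup>2 / (8 + 2 * k)))"
  have r0: "r0 > 0" using k m k4 by (simp add: r0_def)
  have r0D: "r < 4 + k" "6 * (4 - k)\<^sup>2 * r < m" "(4 - k - r)\<^sup>2 - 4 * k * r > 0" if "r < r0" for r
  proof -
    have q: "r < m / (6 * (4 - k)\<^sup>2)" "r < (4 - k)\<^sup>2 / (8 + 2 * k)" using that by (simp_all add: r0_def)
    show "r < 4 + k" using that by (simp add: r0_def)
    show "6 * (4 - k)\<^sup>2 * r < m" using q(1) k4 by (simp add: pos_less_divide_eq mult_ac)
    have "(8 + 2 * k) * r < (4 - k)\<^sup>2" using q(2) k by (simp add: pos_less_divide_eq mult_ac)
    moreover have "(4 - k - r)\<^sup>2 - 4 * k * r = (4 - k)\<^sup>2 - (8 + 2 * k) * r + r\<^sup>2"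
      by (simp add: power2_eq_square algebra_simps)
    ultimately show "(4 - k - r)\<^sup>2 - 4 * k * r > 0" using zero_le_power2[of r] by linarith
  qed
  define Y where "Y y = (y $ Inl a + y $ Inl b) + (y $ Inr a + y $ Inr b)" for y :: "real^3^('n + 'n)"
  define rr where "rr y = Y y \<bullet> Y y / 4" for y
  \<comment> \<open>The orientation of the two chords seen from the axis.\<close>
  define dd where "dd y = cross3 (y $ Inl a - y $ Inl b) (y $ Inr a - y $ Inr b) $ 3" for y :: "real^3^('n + 'n)"
  have "open ({y. rr y < r0} \<inter> {y. 0 < dd y})"
  proof -
    have e: "dd y = (y $ Inl a - y $ Inl b) $ 1 * (y $ Inr a - y $ Inr b) $ 2 - (y $ Inl a - y $ Inl b) $ 2 * (y $ Inr a - y $ Inr b) $ 1" for y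
      by (simp add: dd_def cross3_def)
    show ?thesis unfolding e unfolding rr_def Y_def
      by (intro open_Int open_Collect_less continuous_intros) auto
  qed
  moreover have "X \<in> {y. rr y < r0} \<inter> {y. 0 < dd y}"
    using s_pos r0 by (simp add: rr_def Y_def dd_def X cross3_def inner_vec_def sum_3)
  ultimately obtain \<rho> where \<rho>: "\<rho> > 0" "ball X \<rho> \<subseteq> {y. rr y < r0} \<inter> {y. 0 < dd y}"
    using open_contains_ball by meson
  show ?thesis
  proof (rule lyapunov_stable_if_strict_local_min[OF X_phase_space \<rho>(1)])
    fix y assume y: "y \<in> phase_space" and "dist X y < \<rho>"
      and \<mu>y: "centre_of_vorticity \<Lambda> y = centre_of_vorticity \<Lambda> X" and H: "hamiltonian \<Lambda> y \<le> hamiltonian \<Lambda> X"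
    then have r: "rr y < r0" and d: "0 < dd y" using \<rho>(2) by auto
    define x1 x2 y1 y2 where "x1 = y $ Inl a" and "x2 = y $ Inl b" and "y1 = y $ Inr a" and "y2 = y $ Inr b"
    have n: "norm x1 = 1" "norm x2 = 1" "norm y1 = 1" "norm y2 = 1"
      using phase_spaceD(1)[OF y] by (simp_all add: x1_def x2_def y1_def y2_def)
    have ne: "x1 \<noteq> x2" "y1 \<noteq> y2" "x1 \<bullet> y1 < 1" "x1 \<bullet> y2 < 1" "x2 \<bullet> y1 < 1" "x2 \<bullet> y2 < 1"
      using y ab(3) phase_spaceD(3)[OF y] by (auto simp: x1_def x2_def y1_def y2_def phase_space_def)
    have pq: "x1 + x2 - (y1 + y2) = (4 * c) *\<^sub>R e3"
    proof -
      have "centre_of_vorticity \<Lambda> y = (4 * c) *\<^sub>R e3" using \<mu>y \<mu> by simp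
      then show ?thesis unfolding centre_of_vorticity_four[OF ab(4,3)] by (simp add: x1_def x2_def y1_def y2_def)
    qed
    have mk: "((4 * c) *\<^sub>R e3) \<bullet> ((4 * c) *\<^sub>R e3) = 4 * k" by (simp add: e3 k_def power2_eq_square)
    have rry: "(x1 + x2 + (y1 + y2)) \<bullet> (x1 + x2 + (y1 + y2)) / 4 = rr y"
      by (simp add: rr_def Y_def x1_def x2_def y1_def y2_def)
    note bnd = four_vortex_energy_bound[OF n ne pq mk, unfolded rry, OF r0D(3)[OF r]]
    note Hy = hamiltonian_four[OF ab(4,3) y, folded x1_def x2_def y1_def y2_def]
    have rr0: "rr y = 0"
    proof (rule ccontr)
      assume "rr y \<noteq> 0"
      then have "rr y > 0" by (simp add: rr_def less_le)
      from reduced_energy_increasing[OF k cond' this r0D(1)[OF r] r0D(2)[OF r, unfolded m_def] r0D(3)[OF r]]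
      show False using bnd(1) H unfolding HX Hy by linarith
    qed
    then have "x1 + x2 + (y1 + y2) = 0" using rry by simp
    then have q: "y1 + y2 = - (x1 + x2)" by (rule minus_unique[symmetric])
    have "2 *\<^sub>R (x1 + x2) = x1 + x2 - (y1 + y2)" unfolding q by (simp only: scaleR_2 diff_minus_eq_add)
    also have "\<dots> = 2 *\<^sub>R ((2 * c) *\<^sub>R e3)" unfolding pq by simp
    finally have p: "x1 + x2 = (2 * c) *\<^sub>R e3" by (simp only: scaleR_cancel_left) simp
    have "ln ((4 - k - rr y)\<^sup>2 - 4 * k * rr y) - 4 * ln (2 + k / 2 - rr y / 2) = hamiltonian \<Lambda> y"
    proof -
      have "ln ((4 - k - rr y)\<^sup>2 - 4 * k * rr y) - 4 * ln (2 + k / 2 - rr y / 2) = hamiltonian \<Lambda> X"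
        unfolding HX rr0 using k by (simp add: ln_realpow)
      then show ?thesis using bnd(1) H unfolding Hy by linarith
    qed
    from bnd(2)[OF this[unfolded Hy]] have eqs: "x1 \<bullet> y1 = x1 \<bullet> y2" "x2 \<bullet> y1 = x2 \<bullet> y2" by auto
    define d e where "d = (1 / (2 * s)) *\<^sub>R (x1 - x2)" and "e = (1 / (2 * s)) *\<^sub>R (y1 - y2)"
    have n': "x1 \<bullet> x1 = 1" "x2 \<bullet> x2 = 1" "y1 \<bullet> y1 = 1" "y2 \<bullet> y2 = 1" using n by (simp_all add: norm_eq_1)
    have pp: "(x1 + x2) \<bullet> (x1 + x2) = k" "(y1 + y2) \<bullet> (y1 + y2) = k"
      unfolding q p by (simp_all add: e3 k_def power2_eq_square)
    have par: "(x1 - x2) \<bullet> (x1 - x2) = 4 * s\<^sup>2" "(y1 - y2) \<bullet> (y1 - y2) = 4 * s\<^sup>2"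
      using pp n' s2 by (simp_all add: inner_diff_left inner_diff_right inner_add_left inner_add_right inner_commute)
    have de: "d \<bullet> d = 1" "e \<bullet> e = 1" "d \<bullet> e = 0"
      using par eqs s_pos unfolding d_def e_def
      by (simp_all add: power2_eq_square) (simp add: inner_diff_left inner_diff_right)
    obtain g where g: "rotation_matrix g" "g *v vector [1, 0, 0] = d" "g *v vector [0, 1, 0] = e" "g *v vector [0, 0, 1] = cross3 d e"
      by (rule rotation_from_frame[OF de])
    define f where "f = cross3 d e"
    have ff: "f \<bullet> f = 1" unfolding f_def dot_cross using de by (simp add: inner_commute)
    \<comment> \<open>For \<open>c = 0\<close> the centre of vorticity vanishes and every rotation fixes it, so \<open>f\<close> need not be the axis.\<close>
    have cf: "c *\<^sub>R f = c *\<^sub>R e3"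
    proof (cases "c = 0")
      case False
      have "(2 * c) * (e3 \<bullet> (x1 - x2)) = 0" "(2 * c) * (e3 \<bullet> (y1 - y2)) = 0"
      proof -
        have "(2 * c) * (e3 \<bullet> (x1 - x2)) = (x1 + x2) \<bullet> (x1 - x2)" unfolding p by simp
        also have "\<dots> = 0" using n' by (simp add: inner_diff_right inner_diff_left inner_add_left inner_add_right inner_commute)
        finally show "(2 * c) * (e3 \<bullet> (x1 - x2)) = 0" .
        have "(2 * c) * (e3 \<bullet> (y1 - y2)) = - ((y1 + y2) \<bullet> (y1 - y2))" unfolding q p by simp
        also have "\<dots> = 0" using n' by (simp add: inner_diff_right inner_diff_left inner_add_left inner_add_right inner_commute)
        finally show "(2 * c) * (e3 \<bullet> (y1 - y2)) = 0" .
      qed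
      then have "e3 \<bullet> d = 0" "e3 \<bullet> e = 0" using False by (simp_all add: d_def e_def)
      then have "cross3 e3 f = 0" unfolding f_def by (simp add: Lagrange)
      then have "(e3 \<bullet> f) * (e3 \<bullet> f) = 1" using dot_cross[of e3 f e3 f] ff e3 by (simp add: inner_commute)
      moreover have "e3 \<bullet> f > 0"
      proof -
        have "e3 \<bullet> f = f $ 3" by (simp add: e3_def inner_vec_def sum_3)
        also have "\<dots> = (1 / (2 * s)) * (1 / (2 * s)) * dd y"
          unfolding f_def d_def e_def by (simp add: cross_mult_left cross_mult_right dd_def x1_def x2_def y1_def y2_def)
        finally show ?thesis using d s_pos by simp
      qed
      ultimately have "e3 \<bullet> f = 1" by (smt (verit) mult_less_cancel_left2 mult_le_cancel_left1)
      then have "(f - e3) \<bullet> (f - e3) = 0" using ff e3 by (simp add: inner_diff_left inner_diff_right inner_commute)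
      then show ?thesis by simp
    qed simp
    have gv: "g *v vector [\<alpha>, \<beta>, \<gamma>] = \<alpha> *\<^sub>R d + \<beta> *\<^sub>R e + \<gamma> *\<^sub>R f" for \<alpha> \<beta> \<gamma>
    proof -
      have "vector [\<alpha>, \<beta>, \<gamma>] = \<alpha> *\<^sub>R vector [1, 0, 0] + \<beta> *\<^sub>R vector [0, 1, 0] + \<gamma> *\<^sub>R (vector [0, 0, 1] :: real^3)"
        by (simp add: vec_eq_iff forall_3)
      then show ?thesis by (simp add: matrix_vector_right_distrib matrix_vector_mult_scaleR g f_def)
    qed
    have xs: "x1 = s *\<^sub>R d + c *\<^sub>R e3" "x2 = - s *\<^sub>R d + c *\<^sub>R e3" "y1 = s *\<^sub>R e - c *\<^sub>R e3" "y2 = - s *\<^sub>R e - c *\<^sub>R e3"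
    proof -
      have h: "u = (1 / 2) *\<^sub>R (u - v) + (1 / 2) *\<^sub>R (u + v)" "v = - (1 / 2) *\<^sub>R (u - v) + (1 / 2) *\<^sub>R (u + v)" for u v :: "real^3"
        by (simp_all add: vec_eq_iff field_simps)
      have "s *\<^sub>R d = (1 / 2) *\<^sub>R (x1 - x2)" "s *\<^sub>R e = (1 / 2) *\<^sub>R (y1 - y2)" using s_pos by (simp_all add: d_def e_def)
      moreover have "(1 / 2) *\<^sub>R (x1 + x2) = c *\<^sub>R e3" "(1 / 2) *\<^sub>R (y1 + y2) = - (c *\<^sub>R e3)" unfolding q p by simp_all
      ultimately show "x1 = s *\<^sub>R d + c *\<^sub>R e3" "x2 = - s *\<^sub>R d + c *\<^sub>R e3" "y1 = s *\<^sub>R e - c *\<^sub>R e3" "y2 = - s *\<^sub>R e - c *\<^sub>R e3"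
        using h[where u = x1 and v = x2] h[where u = y1 and v = y2] by simp_all
    qed
    have "g *v centre_of_vorticity \<Lambda> X = centre_of_vorticity \<Lambda> X"
      unfolding \<mu> e3_def using gv[of 0 0 1] cf
      by (simp add: matrix_vector_mult_scaleR scaleR_scaleR[symmetric] e3_def del: scaleR_scaleR)
    then have "g \<in> isotropy_group (centre_of_vorticity \<Lambda> X)" using g by (simp add: isotropy_group_def SO3_def)
    moreover have "y = rotate g X"
    proof -
      have "y $ Inl a = rotate g X $ Inl a" "y $ Inl b = rotate g X $ Inl b" "y $ Inr a = rotate g X $ Inr a" "y $ Inr b = rotate g X $ Inr b"
        unfolding rotate_nth X gv using cf[symmetric] xs unfolding x1_def x2_def y1_def y2_def by simp_all
      note pt = this
      have "i = Inl a \<or> i = Inl b \<or> i = Inr a \<or> i = Inr b" for i :: "'n + 'n"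
        using ab(4) by (cases i) auto
      then have all: "y $ i = rotate g X $ i" for i
        using pt by (metis (no_types))
      show ?thesis unfolding vec_eq_iff[of y "rotate g X"] using all by blast
    qed
    ultimately show "\<exists>g\<in>isotropy_group (centre_of_vorticity \<Lambda> X). y = rotate g X" by blast
  qed
qed

end

section \<open>Pairing eigenvectors with modes\<close>

text \<open>Symmetry of second derivatives, read off from the formula.\<close>

lemma hess_vec_symmetric:
  fixes v w x :: "real^3^'m::finite"
  shows "hess_vec \<Gamma> x \<xi> v \<bullet> w = hess_vec \<Gamma> x \<xi> w \<bullet> v"
proof -
  define f where "f v w i j = \<Gamma> i * \<Gamma> j * ((x $ i \<bullet> x $ j) / (1 - x $ i \<bullet> x $ j) * (v $ i \<bullet> w $ i) - 1 / (1 - x $ i \<bullet> x $ j) * (v $ j \<bullet> w $ i)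
        - (v $ i \<bullet> x $ j + x $ i \<bullet> v $ j) / (1 - x $ i \<bullet> x $ j)\<^sup>2 * (x $ j \<bullet> w $ i))" for v w :: "real^3^'m" and i j
  have e: "hess_vec \<Gamma> x \<xi> v \<bullet> w = (\<Sum>i\<in>UNIV. \<Sum>j\<in>UNIV - {i}. f v w i j) - (\<Sum>i\<in>UNIV. \<Gamma> i * (x $ i \<bullet> \<xi>) * (v $ i \<bullet> w $ i))" for v w :: "real^3^'m"
    unfolding inner_vec_def[of "hess_vec \<Gamma> x \<xi> v" w]
    unfolding hess_vec_def f_def
    by (simp only: vec_lambda_beta inner_diff_left inner_sum_left inner_scaleR_left sum_subtractf)
  have d: "2 * (\<Sum>i\<in>UNIV. \<Sum>j\<in>UNIV - {i}. f v w i j) = (\<Sum>i\<in>UNIV. \<Sum>j\<in>UNIV - {i}. f v w i j + f v w j i)" for v w :: "real^3^'m"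
    using sum_offdiag_swap[of "f v w"] by (simp only: sum.distrib)
  have "f v w i j + f v w j i = f w v i j + f w v j i" for i j
    unfolding f_def
    unfolding inner_commute[of "x $ j" "x $ i"] inner_commute[of "w $ i" "v $ i"] inner_commute[of "w $ j" "v $ j"]
         inner_commute[of "w $ i" "v $ j"] inner_commute[of "w $ j" "v $ i"] inner_commute[of "x $ j" "v $ i"]
         inner_commute[of "x $ j" "w $ i"] inner_commute[of "x $ i" "v $ j"] inner_commute[of "x $ i" "w $ j"]
    by (simp add: algebra_simps add_divide_distrib)
  then have "2 * (\<Sum>i\<in>UNIV. \<Sum>j\<in>UNIV - {i}. f v w i j) = 2 * (\<Sum>i\<in>UNIV. \<Sum>j\<in>UNIV - {i}. f w v i j)"
    unfolding d by simp
  then show ?thesis unfolding e by (simp add: inner_commute)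
qed

text \<open>The values of \<open>\<beta> 1\<close>, \<open>- P 1 * R 1 / s^4\<close> and \<open>- P 3 * R 3 / s^4\<close> for \<open>N = 3\<close>, and the frequency of the plane of waves with
\<open>k = 2\<close> in the slice, as functions of the cosine of the co-latitude.\<close>

definition beta3 :: "real \<Rightarrow> real" where "beta3 c = 12 * c / (1 + 3 * c\<^sup>2)\<^sup>2"
definition disc3 :: "real \<Rightarrow> real" where
  "disc3 c = - (25 * c\<^sup>2 - 3 - 45 * c^4 - 9 * c^6) * (9 * c^6 + 9 * c^4 + 15 * c\<^sup>2 - 1) / ((1 - c\<^sup>2)\<^sup>2 * (1 + 3 * c\<^sup>2)^4)"
definition antisym3 :: "real \<Rightarrow> real" where
  "antisym3 c = 9 * (1 - c\<^sup>2) * (1 - 14 * c\<^sup>2 - 3 * c^4) / (1 + 3 * c\<^sup>2)^3"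
definition nu3 :: "real \<Rightarrow> real" where "nu3 c = 16 * c * (1 - 3 * c\<^sup>2) / ((1 - c\<^sup>2) * (1 + 3 * c\<^sup>2)\<^sup>2)"

context staggered_rings
begin

text \<open>The linearized flow is Hamiltonian.\<close>

lemma slice_linearization_antisymmetric:
  assumes "v \<in> S" "u \<in> S" shows "\<omega> (L v) u = - \<omega> v (L u)"
proof -
  have t: "v \<in> tangent_space X" "u \<in> tangent_space X" using assms by (simp_all add: symplectic_slice_tangent)
  have "\<omega> (L v) u = slice_hessian \<Lambda> X (axis_vec \<xi>\<^sub>0) v u"
    by (rule slice_linearization_works(2)[OF X_phase_space Lambda_nonzero assms])
  also have "\<dots> = slice_hessian \<Lambda> X (axis_vec \<xi>\<^sub>0) u v"
    unfolding slice_hessian_def hessian_augmented_hamiltonian[OF X_phase_space t]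
      hessian_augmented_hamiltonian[OF X_phase_space t(2,1)] by (rule hess_vec_symmetric)
  also have "\<dots> = \<omega> (L u) v"
    by (rule slice_linearization_works(2)[OF X_phase_space Lambda_nonzero assms(2,1), symmetric])
  finally show ?thesis by (simp add: symplectic_form_swap[of _ _ v])
qed

lemma mode_basis:
  "mode k a1 a2 b1 b2 = a1 *\<^sub>R mode k 1 0 0 0 + a2 *\<^sub>R mode k 0 1 0 0 + b1 *\<^sub>R mode k 0 0 1 0 + b2 *\<^sub>R mode k 0 0 0 1"
  by (simp add: mode_linear)

text \<open>The functional that pairs an eigenvector with the modes of wave number \<open>k\<close> is an eigenvector of the transposed
matrix of the mode, by antisymmetry. If \<open>\<sigma>\<close> differs from the eigenvalues of the mode, the functional vanishes. In the
proof \<open>F\<close> is this functional, and the combinations \<open>f1 \<plusminus> \<i> f2\<close> and \<open>f3 \<plusminus> \<i> f4\<close> split the matrix into \<open>2 \<times> 2\<close> blocks.\<close>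

lemma eigenvector_pairing_mode:
  fixes \<sigma> :: complex
  assumes k: "1 \<le> k" "k \<le> N" "k \<noteq> N - 1" and vw: "v \<in> S" "w \<in> S"
    and eig: "L v = Re \<sigma> *\<^sub>R v - Im \<sigma> *\<^sub>R w" "L w = Im \<sigma> *\<^sub>R v + Re \<sigma> *\<^sub>R w"
    and ne: "(\<sigma> + \<i> * of_real (\<beta> k))\<^sup>2 \<noteq> of_real (P k * R k / s^4)" "(\<sigma> - \<i> * of_real (\<beta> k))\<^sup>2 \<noteq> of_real (P k * R k / s^4)"
  shows "\<omega> v (mode k a1 a2 b1 b2) = 0" "\<omega> w (mode k a1 a2 b1 b2) = 0"
proof -
  define A D where "A = P k / s\<^sup>2" and "D = - (R k / s\<^sup>2)"
  have AD: "P k * R k / s^4 = - (A * D)"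
    by (simp add: A_def D_def power2_eq_square power4_eq_xxxx mult_ac)
  note Lm = slice_linearization_mode[OF k, folded A_def D_def]
  define F :: "real^3^('n + 'n) \<Rightarrow> complex" where "F u = Complex (\<omega> v u) (\<omega> w u)" for u
  have FL: "F (L u) = - \<sigma> * F u" if "u \<in> S" for u
  proof -
    have "\<omega> v (L u) = - \<omega> (L v) u" "\<omega> w (L u) = - \<omega> (L w) u"
      using slice_linearization_antisymmetric vw that by simp_all
    then show ?thesis unfolding F_def eig by (simp add: complex_eq_iff symplectic_form_linear algebra_simps)
  qed
  have Flin: "F (mode k a1 a2 b1 b2) = of_real a1 * F (mode k 1 0 0 0) + of_real a2 * F (mode k 0 1 0 0)
     + of_real b1 * F (mode k 0 0 1 0) + of_real b2 * F (mode k 0 0 0 1)" for a1 a2 b1 b2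
    unfolding F_def mode_basis[of k a1 a2 b1 b2] by (simp add: complex_eq_iff symplectic_form_linear)
  define f1 f2 f3 f4 where "f1 = F (mode k 1 0 0 0)" and "f2 = F (mode k 0 1 0 0)" and "f3 = F (mode k 0 0 1 0)" and "f4 = F (mode k 0 0 0 1)"
  note Fl = Flin[folded f1_def f2_def f3_def f4_def]
  have r: "- \<sigma> * f1 = - of_real (\<beta> k) * f2 + of_real A * f3" "- \<sigma> * f2 = of_real (\<beta> k) * f1 + of_real A * f4"
    "- \<sigma> * f3 = - of_real D * f1 - of_real (\<beta> k) * f4" "- \<sigma> * f4 = - of_real D * f2 + of_real (\<beta> k) * f3"
    using FL[OF mode_in_slice[OF k], of 1 0 0 0, unfolded Lm Fl] FL[OF mode_in_slice[OF k], of 0 1 0 0, unfolded Lm Fl]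
      FL[OF mode_in_slice[OF k], of 0 0 1 0, unfolded Lm Fl] FL[OF mode_in_slice[OF k], of 0 0 0 1, unfolded Lm Fl]
    by simp_all
  have z: "f = 0 \<and> g = 0" if "(\<sigma> + \<i> * b) * f = - of_real A * g" "(\<sigma> + \<i> * b) * g = of_real D * f" "(\<sigma> + \<i> * b)\<^sup>2 \<noteq> - of_real (A * D)" for b f g :: complex
  proof -
    have "((\<sigma> + \<i> * b)\<^sup>2 + of_real (A * D)) * f = 0" "((\<sigma> + \<i> * b)\<^sup>2 + of_real (A * D)) * g = 0"
      unfolding of_real_mult using that(1,2) by algebra+
    moreover have "(\<sigma> + \<i> * b)\<^sup>2 + of_real (A * D) \<noteq> 0" using that(3) by (metis eq_neg_iff_add_eq_0)
    ultimately show ?thesis by simp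
  qed
  have i2: "\<i> * (\<i> * x) = - x" for x by (simp add: mult.assoc[symmetric])
  have m1: "(\<sigma> + \<i> * of_real (\<beta> k)) * (f1 + \<i> * f2) = - of_real A * (f3 + \<i> * f4)"
  proof -
    have "(\<sigma> + \<i> * of_real (\<beta> k)) * (f1 + \<i> * f2) = - (- \<sigma> * f1) - \<i> * (- \<sigma> * f2) + \<i> * of_real (\<beta> k) * f1 - of_real (\<beta> k) * f2"
      by (simp add: algebra_simps i2)
    then show ?thesis unfolding r by (simp add: algebra_simps)
  qed
  have m2: "(\<sigma> + \<i> * of_real (\<beta> k)) * (f3 + \<i> * f4) = of_real D * (f1 + \<i> * f2)"
  proof -
    have "(\<sigma> + \<i> * of_real (\<beta> k)) * (f3 + \<i> * f4) = - (- \<sigma> * f3) - \<i> * (- \<sigma> * f4) + \<i> * of_real (\<beta> k) * f3 - of_real (\<beta> k) * f4"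
      by (simp add: algebra_simps i2)
    then show ?thesis unfolding r by (simp add: algebra_simps)
  qed
  have "(\<sigma> + \<i> * of_real (\<beta> k))\<^sup>2 \<noteq> - of_real (A * D)" using ne(1) unfolding AD by simp
  from z[OF m1 m2 this] have p: "f1 + \<i> * f2 = 0 \<and> f3 + \<i> * f4 = 0" .
  have m3: "(\<sigma> + \<i> * - of_real (\<beta> k)) * (f1 - \<i> * f2) = - of_real A * (f3 - \<i> * f4)"
  proof -
    have "(\<sigma> + \<i> * - of_real (\<beta> k)) * (f1 - \<i> * f2) = - (- \<sigma> * f1) + \<i> * (- \<sigma> * f2) - \<i> * of_real (\<beta> k) * f1 - of_real (\<beta> k) * f2"
      by (simp add: algebra_simps i2)
    then show ?thesis unfolding r by (simp add: algebra_simps)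
  qed
  have m4: "(\<sigma> + \<i> * - of_real (\<beta> k)) * (f3 - \<i> * f4) = of_real D * (f1 - \<i> * f2)"
  proof -
    have "(\<sigma> + \<i> * - of_real (\<beta> k)) * (f3 - \<i> * f4) = - (- \<sigma> * f3) + \<i> * (- \<sigma> * f4) - \<i> * of_real (\<beta> k) * f3 - of_real (\<beta> k) * f4"
      by (simp add: algebra_simps i2)
    then show ?thesis unfolding r by (simp add: algebra_simps)
  qed
  have "(\<sigma> + \<i> * - of_real (\<beta> k))\<^sup>2 \<noteq> - of_real (A * D)" using ne(2) unfolding AD by simp
  from z[OF m3 m4 this] have m: "f1 - \<i> * f2 = 0 \<and> f3 - \<i> * f4 = 0" .
  have half: "x = 0 \<and> y = 0" if "x + \<i> * y = 0" "x - \<i> * y = 0" for x y :: complex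
  proof -
    have "2 * x = (x + \<i> * y) + (x - \<i> * y)" by simp
    then have "x = 0" using that by simp
    then show ?thesis using that by simp
  qed
  have "f1 = 0 \<and> f2 = 0" "f3 = 0 \<and> f4 = 0" using half p m by blast+
  then have "F (mode k a1 a2 b1 b2) = 0" unfolding Fl by simp
  then show "\<omega> v (mode k a1 a2 b1 b2) = 0" "\<omega> w (mode k a1 a2 b1 b2) = 0"
    by (simp_all add: F_def complex_eq_iff)
qed

end

section \<open>The spectrum for three vortices per ring\<close>

lemma sin_cos_thirds:
  "cos (pi / 3) = 1 / 2" "sin (pi / 3) = sqrt 3 / 2" "cos (5 * pi / 3) = 1 / 2" "sin (5 * pi / 3) = - (sqrt 3 / 2)"
proof -
  show "cos (pi / 3) = 1 / 2" "sin (pi / 3) = sqrt 3 / 2" by (simp_all add: cos_60 sin_60)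
  have "5 * pi / 3 = 2 * pi - pi / 3" by simp
  then show "cos (5 * pi / 3) = 1 / 2" "sin (5 * pi / 3) = - (sqrt 3 / 2)"
    by (simp_all only: cos_diff sin_diff) (simp_all add: cos_60 sin_60)
qed

context staggered_rings
begin

lemma c2_lt_1: "c\<^sup>2 < 1"
  using c_nonneg c_lt_1 by (simp add: power_less_one_iff abs_square_less_1)

text \<open>The \<open>2N\<close> vortices have equally spaced longitudes, so this is the discrete Fourier inversion formula.\<close>

lemma fourier_inversion:
  assumes "\<And>k. k < 2 * N \<Longrightarrow> (\<Sum>i\<in>UNIV. a i * cos (real k * lon i)) = 0"
    and "\<And>k. k < 2 * N \<Longrightarrow> (\<Sum>i\<in>UNIV. a i * sin (real k * lon i)) = 0"
  shows "a j = 0"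
proof -
  have K: "(\<Sum>k<2 * N. cos (real k * (lon i - lon j))) = (if i = j then 2 * real N else 0)" for i
  proof (cases "i = j")
    case False
    then have ij: "idx i \<noteq> idx j" using inj_idx by (simp add: inj_eq)
    define l where "l = nat \<bar>int (idx i) - int (idx j)\<bar>"
    have l: "0 < l" "l < 2 * N" using ij idx_less[of i] idx_less[of j] by (auto simp: l_def)
    have rl: "real l = \<bar>real (idx i) - real (idx j)\<bar>" by (simp add: l_def)
    have "cos (real k * (lon i - lon j)) = cos (2 * pi * real l / real (2 * N) * real k + 0)" for k
    proof -
      have "lon i - lon j = pi * (real (idx i) - real (idx j)) / real N"
        by (simp add: lon_def diff_divide_distrib right_diff_distrib)
      then have e: "real k * (lon i - lon j) = real k * pi / real N * (real (idx i) - real (idx j))" by simp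
      have "real (idx i) - real (idx j) = real l \<or> real (idx i) - real (idx j) = - real l" unfolding rl by linarith
      then have "cos (real k * (lon i - lon j)) = cos (real k * pi / real N * real l)"
        unfolding e by (elim disjE) (simp_all only: mult_minus_right cos_minus)
      then show ?thesis by (simp add: mult_ac)
    qed
    moreover have nd: "\<not> 2 * N dvd l" using l by (auto dest: dvd_imp_le)
    moreover have "2 * N > 0" using N_ge_2 by simp
    ultimately show ?thesis
      using sum_cos_sin_arith_progression(1)[OF _ nd, of 0] False by simp
  qed simp
  have "(\<Sum>k<2 * N. cos (real k * lon j) * (\<Sum>i\<in>UNIV. a i * cos (real k * lon i)) + sin (real k * lon j) * (\<Sum>i\<in>UNIV. a i * sin (real k * lon i)))
     = (\<Sum>k<2 * N. \<Sum>i\<in>UNIV. a i * cos (real k * (lon i - lon j)))"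
    by (intro sum.cong refl) (simp add: sum_distrib_left sum.distrib[symmetric] right_diff_distrib cos_diff distrib_left mult_ac)
  also have "\<dots> = (\<Sum>i\<in>UNIV. a i * (\<Sum>k<2 * N. cos (real k * (lon i - lon j))))"
    unfolding sum_distrib_left by (rule sum.swap)
  also have "\<dots> = (\<Sum>i\<in>UNIV. if i = j then a j * (2 * real N) else 0)"
    unfolding K by (intro sum.cong refl) auto
  also have "\<dots> = a j * (2 * real N)" by simp
  finally show ?thesis using assms N_ge_2 by simp
qed

lemma lon_reflect:
  assumes "k \<le> 2 * N"
  shows "cos (real (2 * N - k) * lon i) = cos (real k * lon i)" "sin (real (2 * N - k) * lon i) = - sin (real k * lon i)"
proof -
  have "real (2 * N) * lon i = 2 * pi * real (idx i)" using N_ge_2 by (simp add: lon_def)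
  then have e: "real (2 * N - k) * lon i = 2 * pi * real (idx i) - real k * lon i" using assms by (simp add: of_nat_diff left_diff_distrib)
  have "cos (2 * pi * real m) = 1" "sin (2 * pi * real m) = 0" for m
    using cos_2npi sin_2npi by (simp_all add: mult.commute[of pi] mult.assoc mult.left_commute)
  then show "cos (real (2 * N - k) * lon i) = cos (real k * lon i)" "sin (real (2 * N - k) * lon i) = - sin (real k * lon i)"
    unfolding e cos_diff sin_diff by simp_all
qed

lemma centre_of_vorticity_X: "centre_of_vorticity \<Lambda> X = axis_vec (2 * real N * c)"
proof -
  have nd: "\<not> 2 * N dvd N + 1" using N_ge_2 by (auto dest!: dvd_imp_le)
  have z: "(\<Sum>i\<in>UNIV. \<Lambda> i * cos (lon i)) = 0" "(\<Sum>i\<in>UNIV. \<Lambda> i * sin (lon i)) = 0"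
    using sum_vortex_cos_sin[OF nd] Lambda_cos_sin[of _ 1] by simp_all
  have card: "real (card (UNIV :: ('n + 'n) set)) = 2 * real N"
    by (simp add: N_card UNIV_Plus_UNIV[symmetric] card_Plus del: UNIV_Plus_UNIV)
  have "centre_of_vorticity \<Lambda> X $ 1 = s * (\<Sum>i\<in>UNIV. \<Lambda> i * cos (lon i))" "centre_of_vorticity \<Lambda> X $ 2 = s * (\<Sum>i\<in>UNIV. \<Lambda> i * sin (lon i))"
    "centre_of_vorticity \<Lambda> X $ 3 = (\<Sum>i\<in>(UNIV :: ('n + 'n) set). c)"
    by (simp_all add: centre_of_vorticity_def X_nth sum_distrib_left mult_ac)
  then show ?thesis unfolding z using card by (simp add: vec_eq_iff forall_3)
qed

text \<open>The conditions that define the slice, in terms of the frame coefficients. The axial component of the centre of vorticity and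
the rotations about the axis give the conditions on wave number \<open>0\<close>; the horizontal components involve wave number \<open>N - 1\<close>.\<close>

lemma slice_frame_sums:
  assumes u: "u \<in> S"
  obtains a b where "u = fr a b" "(\<Sum>i\<in>UNIV. a i) = 0" "(\<Sum>i\<in>UNIV. b i) = 0"
    "c * (\<Sum>i\<in>UNIV. \<Lambda> i * a i * cos (lon i)) + (\<Sum>i\<in>UNIV. \<Lambda> i * b i * sin (lon i)) = 0"
    "(\<Sum>i\<in>UNIV. \<Lambda> i * b i * cos (lon i)) = c * (\<Sum>i\<in>UNIV. \<Lambda> i * a i * sin (lon i))"
proof -
  define a b where "a i = u $ i \<bullet> E i" and "b i = u $ i \<bullet> F i" for i
  have "u $ i \<bullet> X $ i = 0" for i using symplectic_slice_tangent[OF u] by (simp add: tangent_space_def)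
  then have "u $ i = fr a b $ i" for i using frame_expansion[of "u $ i" i] by (simp add: fr_nth a_def b_def)
  then have fr: "u = fr a b" unfolding vec_eq_iff[of u "fr a b"] by blast
  have "centre_of_vorticity \<Lambda> (fr a b) = 0" using u fr by (simp add: symplectic_slice_def)
  then have 1: "(\<Sum>i\<in>UNIV. a i) = 0"
    "c * (\<Sum>i\<in>UNIV. \<Lambda> i * a i * cos (lon i)) + (\<Sum>i\<in>UNIV. \<Lambda> i * b i * sin (lon i)) = 0"
    "(\<Sum>i\<in>UNIV. \<Lambda> i * b i * cos (lon i)) = c * (\<Sum>i\<in>UNIV. \<Lambda> i * a i * sin (lon i))"
    unfolding centre_of_vorticity_fr using s_pos by (auto simp: vec_eq_iff forall_3)
  have "cross3 (axis_vec 1) (centre_of_vorticity \<Lambda> X) = 0"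
    unfolding centre_of_vorticity_X by (simp add: cross3_def vec_eq_iff forall_3)
  then have "(\<chi> i. cross3 (axis_vec 1) (X $ i)) \<in> orbit_tangent_space (centre_of_vorticity \<Lambda> X) X"
    by (auto simp: orbit_tangent_space_def)
  then have "(\<chi> i. cross3 (axis_vec 1) (X $ i)) \<bullet> fr a b = 0"
    using u fr by (auto simp: symplectic_slice_def orthogonal_comp_def orthogonal_def)
  then have "(\<Sum>i\<in>UNIV. b i) = 0" unfolding orbit_inner_fr inner_vector_3 using s_pos by simp
  with that[OF fr 1(1) _ 1(2,3)] show thesis by blast
qed

lemma symplectic_form_frames: "\<omega> (fr a b) (fr p q) = (\<Sum>i\<in>UNIV. b i * p i - a i * q i)"
  unfolding symplectic_form_fr by (simp add: fr_nth inner_add_right frame_orthonormal)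

end

locale three_rings = staggered_rings +
  assumes N3: "N = 3"
begin

lemma rN: "real N = 3" using N3 by simp

lemma sum_oddpt: "(\<Sum>j<N. f (oddpt N j)) = f (pi / 3) + f pi + f (5 * pi / 3)" for f :: "real \<Rightarrow> real"
proof -
  have e: "oddpt N 0 = pi / 3" "oddpt N 1 = pi" "oddpt N 2 = 5 * pi / 3" using rN by (simp_all add: oddpt_def)
  have "{..<N} = {0, 1, 2}" using N3 by auto
  then have "(\<Sum>j<N. f (oddpt N j)) = f (oddpt N 0) + f (oddpt N 1) + f (oddpt N 2)" by simp
  then show ?thesis unfolding e .
qed

abbreviation d where "d \<equiv> c\<^sup>2"

lemma d_pos: "1 + 3 * d > 0" "1 - d > 0" "s\<^sup>2 = 1 - d" "d \<ge> 0"
  using c2_lt_1 s_c by (simp_all add: add_pos_nonneg)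

text \<open>The kernel of \<open>odd_kernel_sum\<close> at the two vortices of the opposite ring at longitude difference \<open>\<plusminus> \<pi> / 3\<close>, and at the
one at longitude difference \<open>\<pi>\<close>.\<close>

definition gA where "gA = 2 * (3 * d - 1) * (1 - d) / (1 + 3 * d)\<^sup>2"
definition gB where "gB = - (1 - d) / 2"

lemma G_values: "G k = gA * (cos (real k * (pi / 3)) + cos (real k * (5 * pi / 3))) + gB * cos (real k * pi)"
proof -
  have h: "h = (1 + d) / (1 - d)" by (simp add: h_def d_pos)
  have "h - 1 / 2 = (1 + 3 * d) / (2 * (1 - d))" "h * (1 / 2) - 1 = (3 * d - 1) / (2 * (1 - d))" "h + 1 = 2 / (1 - d)"
    unfolding h using d_pos(2) by (simp_all add: field_simps)
  moreover have "((3 * d - 1) / (2 * (1 - d))) / ((1 + 3 * d) / (2 * (1 - d)))\<^sup>2 = gA"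
  proof -
    have "a / (2 * w) / (v / (2 * w))\<^sup>2 = 2 * a * w / v\<^sup>2" if "w > 0" "v > 0" for a v w :: real
      using that by (simp add: power2_eq_square)
    then show ?thesis unfolding gA_def using d_pos(1,2) by blast
  qed
  moreover have "(h * cos pi - 1) / (h - cos pi)\<^sup>2 = - 1 / (h + 1)"
  proof -
    have "- a / a\<^sup>2 = - 1 / a" if "a > 0" for a :: real using that by (simp add: power2_eq_square)
    moreover have "h * cos pi - 1 = - (h + 1)" "h - cos pi = h + 1" "h + 1 > 0" using h_ge_1 by simp_all
    ultimately show ?thesis by metis
  qed
  moreover have "h + 1 = 2 / (1 - d)" unfolding h using d_pos(2) by (simp add: field_simps)
  moreover have "- 1 / (2 / (1 - d)) = gB" by (simp add: gB_def)
  ultimately have "(h * (1 / 2) - 1) / (h - 1 / 2)\<^sup>2 = gA" "(h * cos pi - 1) / (h - cos pi)\<^sup>2 = gB" by metis+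
  then show ?thesis
    unfolding G_def odd_kernel_sum_def
      sum_oddpt[of "\<lambda>x. (h * cos x - 1) / (h - cos x)\<^sup>2 * cos (real k * x)"] sin_cos_thirds
    by (simp add: algebra_simps)
qed

lemma cos_double_thirds: "cos (2 * (pi / 3)) = - 1 / 2" "cos (2 * (5 * pi / 3)) = - 1 / 2" "sin (2 * (pi / 3)) = sqrt 3 / 2" "sin (2 * (5 * pi / 3)) = - (sqrt 3 / 2)"
  by (simp_all only: cos_double_cos sin_double sin_cos_thirds) (simp_all add: power2_eq_square)

lemma G_012: "G 0 = 2 * gA + gB" "G 1 = gA - gB" "G 2 = gB - gA"
  unfolding G_values of_nat_numeral of_nat_1 of_nat_0 cos_double_thirds mult_1 sin_cos_thirds by (simp_all add: algebra_simps)

lemma eps_3: "\<epsilon> = (1 - 14 * d - 3 * d\<^sup>2) / (1 + 3 * d)"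
proof -
  have e: "real N * y = 2 * y + y" using rN by simp
  have "T = (2 * c / (1 + d) + c) / (1 + 2 * c / (1 + d) * c)"
    unfolding T_def e by (subst tanh_add) (simp_all add: tanh_double tanh_y)
  also have "\<dots> = c * (3 + d) / (1 + 3 * d)"
  proof -
    have p: "1 + d > 0" by (simp add: add_pos_nonneg)
    have "2 * c / (1 + d) + c = c * (3 + d) / (1 + d)" "1 + 2 * c / (1 + d) * c = (1 + 3 * d) / (1 + d)"
      using p by (simp_all add: field_simps power2_eq_square)
    then show ?thesis using p by simp
  qed
  finally have T: "T = c * (3 + d) / (1 + 3 * d)" .
  have "\<epsilon> = 1 + d - 6 * d * (3 + d) / (1 + 3 * d)"
    unfolding \<epsilon>_def T rN by (simp add: power2_eq_square)
  then show ?thesis using d_pos(1) by (simp add: field_simps power2_eq_square)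
qed

lemma P_eps: "P k = real k * (real N - real k) + G 0 + G k + \<epsilon>" by (simp add: P_def \<epsilon>_def Q_T)

lemma gA_eq: "gA = (8 * d - 2 - 6 * d\<^sup>2) / (1 + 3 * d)\<^sup>2"
  by (simp add: gA_def algebra_simps power2_eq_square)

lemma frac_sumI: "x * (1 + 3 * d)\<^sup>2 + v = z \<Longrightarrow> x + v / (1 + 3 * d)\<^sup>2 = z / (1 + 3 * d)\<^sup>2"
  using d_pos(1) by (auto simp: add_divide_distrib)

text \<open>The relation \<open>P 2 = - d * R 2\<close> reflects that rotations about horizontal axes, which act by waves with \<open>k = 2\<close>,
change the energy only through the centre of vorticity.\<close>

lemma PR_values:
  "P 1 = (25 * d - 3 - 45 * d\<^sup>2 - 9 * d^3) / (1 + 3 * d)\<^sup>2"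
  "R 1 = (9 * d^3 + 9 * d\<^sup>2 + 15 * d - 1) / (1 + 3 * d)\<^sup>2"
  "R 2 = (36 * d - 4) / (1 + 3 * d)\<^sup>2"
  "P 2 = - d * R 2"
proof -
  have e: "\<epsilon> = (1 - 14 * d - 3 * d\<^sup>2) * (1 + 3 * d) / (1 + 3 * d)\<^sup>2"
    unfolding eps_3 using d_pos(1) by (simp add: power2_eq_square)
  have "P 1 = 2 + 3 * gA + \<epsilon>" unfolding P_eps G_012 rN by simp
  also have "\<dots> = 2 + (3 * (8 * d - 2 - 6 * d\<^sup>2) + (1 - 14 * d - 3 * d\<^sup>2) * (1 + 3 * d)) / (1 + 3 * d)\<^sup>2"
    unfolding gA_eq e by (simp add: add_divide_distrib)
  also have "\<dots> = (25 * d - 3 - 45 * d\<^sup>2 - 9 * d^3) / (1 + 3 * d)\<^sup>2"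
    by (rule frac_sumI) (simp add: algebra_simps power2_eq_square power3_eq_cube)
  finally show "P 1 = (25 * d - 3 - 45 * d\<^sup>2 - 9 * d^3) / (1 + 3 * d)\<^sup>2" .
  have R1: "R 1 = 2 + gA + 2 * gB" unfolding R_def G_012 rN by simp
  also have "\<dots> = (1 + d) + (8 * d - 2 - 6 * d\<^sup>2) / (1 + 3 * d)\<^sup>2"
    unfolding gA_eq gB_def by (simp add: diff_divide_distrib)
  also have "\<dots> = (9 * d^3 + 9 * d\<^sup>2 + 15 * d - 1) / (1 + 3 * d)\<^sup>2"
    by (rule frac_sumI) (simp add: algebra_simps power2_eq_square power3_eq_cube)
  finally show R1': "R 1 = (9 * d^3 + 9 * d\<^sup>2 + 15 * d - 1) / (1 + 3 * d)\<^sup>2" .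
  have "R 2 = 2 + 3 * gA" unfolding R_def G_012 rN by simp
  also have "\<dots> = 2 + (3 * (8 * d - 2 - 6 * d\<^sup>2)) / (1 + 3 * d)\<^sup>2" unfolding gA_eq by simp
  also have "\<dots> = (36 * d - 4) / (1 + 3 * d)\<^sup>2"
    by (rule frac_sumI) (simp add: algebra_simps power2_eq_square)
  finally show R2: "R 2 = (36 * d - 4) / (1 + 3 * d)\<^sup>2" .
  have "P 2 = R 1 + \<epsilon>" unfolding P_eps G_012 rN R1 by simp
  also have "\<dots> = (9 * d^3 + 9 * d\<^sup>2 + 15 * d - 1 + (1 - 14 * d - 3 * d\<^sup>2) * (1 + 3 * d)) / (1 + 3 * d)\<^sup>2"
    unfolding R1' e by (simp add: add_divide_distrib)
  also have "9 * d^3 + 9 * d\<^sup>2 + 15 * d - 1 + (1 - 14 * d - 3 * d\<^sup>2) * (1 + 3 * d) = - d * (36 * d - 4)"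
    by (simp add: algebra_simps power2_eq_square power3_eq_cube)
  finally show "P 2 = - d * R 2" unfolding R2 by simp
qed

lemma s4: "s^4 = (1 - d)\<^sup>2"
proof -
  have "s^4 = (s\<^sup>2)\<^sup>2" by simp
  then show ?thesis unfolding d_pos(3) .
qed

lemma beta_values: "\<beta> 1 = beta3 c" "\<beta> 2 = beta3 c" "\<beta> 3 = 0"
proof -
  have h: "h = (1 + d) / (1 - d)" by (simp add: h_def d_pos)
  have hh: "h - 1 / 2 = (1 + 3 * d) / (2 * (1 - d))"
    unfolding h using d_pos(2) by (simp add: field_simps)
  have b: "2 * c / (1 - d)\<^sup>2 * (2 * (3 / 4 / ((1 + 3 * d) / (2 * (1 - d)))\<^sup>2)) = beta3 c"
  proof -
    have q: "((1 + 3 * d) / (2 * (1 - d)))\<^sup>2 = (1 + 3 * d)\<^sup>2 / (4 * (1 - d)\<^sup>2)"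
      by (simp only: power_divide power_mult_distrib) simp
    have "2 * c / W * (2 * (3 / 4 / (V / (4 * W)))) = 12 * c / V" if "W \<noteq> 0" "V \<noteq> 0" for V W
      using that by (simp add: field_simps)
    then show ?thesis unfolding q beta3_def using d_pos(1,2) by simp
  qed
  have sq: "sqrt 3 / 2 * (sqrt 3 / 2) = 3 / 4" by simp
  have B: "\<beta> k = 2 * c / (1 - d)\<^sup>2 * (sqrt 3 / 2 * sin (real k * (pi / 3)) / (h - 1 / 2)\<^sup>2 - sqrt 3 / 2 * sin (real k * (5 * pi / 3)) / (h - 1 / 2)\<^sup>2)" for k
    unfolding \<beta>_def s4 sum_oddpt[of "\<lambda>x. sin x * sin (real k * x) / (h - cos x)\<^sup>2"] sin_cos_thirds by simp
  show "\<beta> 1 = beta3 c" "\<beta> 2 = beta3 c"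
    unfolding B of_nat_numeral of_nat_1 mult_1 cos_double_thirds sin_cos_thirds b[symmetric] hh[symmetric]
    by (simp_all add: sq[simplified])
  have "sin (real 3 * (pi / 3)) = 0" "sin (real 3 * (5 * pi / 3)) = 0"
    using sin_npi[of 1] sin_npi[of 5] by simp_all
  then show "\<beta> 3 = 0" unfolding B by simp
qed

lemma disc_value: "P 1 * R 1 / s^4 = - disc3 c"
proof -
  have d': "c^4 = d\<^sup>2" "c^6 = d^3" by simp_all
  have "P 1 * R 1 / s^4 = (25 * d - 3 - 45 * d\<^sup>2 - 9 * d^3) * (9 * d^3 + 9 * d\<^sup>2 + 15 * d - 1) / ((1 + 3 * d)\<^sup>2 * (1 + 3 * d)\<^sup>2) / (1 - d)\<^sup>2"
    unfolding PR_values(1,2) s4 by simp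
  also have "(1 + 3 * d)\<^sup>2 * (1 + 3 * d)\<^sup>2 = (1 + 3 * d)^4" by (simp add: power2_eq_square power4_eq_xxxx)
  finally have "P 1 * R 1 / s^4 = (25 * d - 3 - 45 * d\<^sup>2 - 9 * d^3) * (9 * d^3 + 9 * d\<^sup>2 + 15 * d - 1) / (1 + 3 * d)^4 / (1 - d)\<^sup>2" .
  also have "\<dots> = - disc3 c"
    unfolding disc3_def d' mult_minus_left minus_divide_left[symmetric] minus_minus
    by (simp only: divide_divide_eq_left mult.commute[of "(1 - d)\<^sup>2"])
  finally show ?thesis .
qed

lemma antisym_value: "P 3 * R 3 / s^4 = - antisym3 c"
proof -
  have "P 3 = \<epsilon>" "R 3 = 2 * G 0" using P_R_N N3 by simp_all
  moreover have "2 * G 0 = - 9 * (1 - d)^3 / (1 + 3 * d)\<^sup>2"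
  proof -
    have "2 * G 0 = (d - 1) + (4 * (8 * d - 2 - 6 * d\<^sup>2)) / (1 + 3 * d)\<^sup>2" unfolding G_012 gA_eq gB_def by simp
    also have "\<dots> = - 9 * (1 - d)^3 / (1 + 3 * d)\<^sup>2"
      by (rule frac_sumI) (simp add: algebra_simps power2_eq_square power3_eq_cube)
    finally show ?thesis .
  qed
  ultimately have "P 3 * R 3 / s^4 = (1 - 14 * d - 3 * d\<^sup>2) * (- 9 * (1 - d)^3) / ((1 + 3 * d) * (1 + 3 * d)\<^sup>2) / (1 - d)\<^sup>2"
    unfolding eps_3 s4 by simp
  also have "(1 + 3 * d) * (1 + 3 * d)\<^sup>2 = (1 + 3 * d)^3" by (simp add: power2_eq_square power3_eq_cube)
  also have "(1 - 14 * d - 3 * d\<^sup>2) * (- 9 * (1 - d)^3) / (1 + 3 * d)^3 / (1 - d)\<^sup>2 = - (9 * (1 - d) * (1 - 14 * d - 3 * d\<^sup>2) / (1 + 3 * d)^3)"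
  proof -
    have "A * (- 9 * w^3) / V / w\<^sup>2 = - (9 * w * A / V)" if "w > 0" for A V w :: real
      using that by (simp add: power2_eq_square power3_eq_cube)
    then show ?thesis using d_pos(2) by blast
  qed
  finally show ?thesis unfolding antisym3_def by simp
qed

text \<open>The waves of wave number \<open>2 = N - 1\<close> for which the meridional and the longitudinal displacements cancel in the centre of
vorticity.\<close>

definition U where "U = mode 2 1 0 0 c"
definition U' where "U' = mode 2 0 1 (- c) 0"

lemma nu_value: "\<beta> 2 - c * R 2 / s\<^sup>2 = nu3 c"
proof -
  have "\<beta> 2 - c * R 2 / s\<^sup>2 = 12 * c / (1 + 3 * d)\<^sup>2 - c * (36 * d - 4) / (1 + 3 * d)\<^sup>2 / (1 - d)"
    unfolding PR_values beta_values d_pos(3) beta3_def by simp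
  also have "\<dots> = (12 * c * (1 - d) - c * (36 * d - 4)) / ((1 - d) * (1 + 3 * d)\<^sup>2)"
    using d_pos(1,2) by (simp add: diff_divide_distrib mult.commute)
  also have "12 * c * (1 - d) - c * (36 * d - 4) = 16 * c * (1 - 3 * d)" by (simp add: algebra_simps)
  finally show ?thesis by (simp add: nu3_def)
qed

text \<open>Shifting the wave number \<open>1\<close> by \<open>N = 3\<close> gives \<open>4\<close>, which is \<open>- 2\<close> modulo \<open>2N\<close>.\<close>

lemma Lambda_cos_sin_2:
  "\<Lambda> i * cos (lon i) = cos (2 * lon i)" "\<Lambda> i * sin (lon i) = - sin (2 * lon i)"
proof -
  have e: "N + 1 = 2 * N - 2" "2 \<le> 2 * N" using N3 by simp_all
  show "\<Lambda> i * cos (lon i) = cos (2 * lon i)" "\<Lambda> i * sin (lon i) = - sin (2 * lon i)"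
    using Lambda_cos_sin[of i 1] lon_reflect[OF e(2), of i] unfolding e(1)[symmetric] by simp_all
qed

lemma wave2_sums:
  "(\<Sum>i\<in>UNIV. wave 2 p q i) = 0"
  "(\<Sum>i\<in>UNIV. \<Lambda> i * wave 2 p q i * cos (lon i)) = 3 * p" "(\<Sum>i\<in>UNIV. \<Lambda> i * wave 2 p q i * sin (lon i)) = - 3 * q"
proof -
  have nd: "\<not> 2 * N dvd 2" "\<not> 2 * N dvd 4" using N3 by auto
  show "(\<Sum>i\<in>UNIV. wave 2 p q i) = 0"
    unfolding wave_def sum.distrib sum_distrib_left[symmetric] sum_vortex_cos_sin[OF nd(1)] by simp
  have card: "CARD('a) = 3" using N_card N3 by simp
  have t: "real 4 * lon i = 2 * (2 * lon i)" "real 2 * lon i = 2 * lon i" for i by simp_all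
  have "\<Lambda> i * wave 2 p q i * cos (lon i) = p / 2 + p / 2 * cos (real 4 * lon i) + q / 2 * sin (real 4 * lon i)" for i
  proof -
    have "\<Lambda> i * wave 2 p q i * cos (lon i) = wave 2 p q i * cos (2 * lon i)" by (simp add: Lambda_cos_sin_2[symmetric] mult_ac)
    then show ?thesis unfolding wave_def t cos_double_cos[of "2 * lon i"] sin_double[of "2 * lon i"]
      by (simp add: algebra_simps power2_eq_square)
  qed
  then show "(\<Sum>i\<in>UNIV. \<Lambda> i * wave 2 p q i * cos (lon i)) = 3 * p"
    by (simp only: sum.distrib sum_distrib_left[symmetric] sum_vortex_cos_sin[OF nd(2)]) (simp add: card)
  have "\<Lambda> i * wave 2 p q i * sin (lon i) = - (p / 2) * sin (real 4 * lon i) + (- (q / 2)) + q / 2 * cos (real 4 * lon i)" for i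
  proof -
    have "\<Lambda> i * wave 2 p q i * sin (lon i) = wave 2 p q i * (\<Lambda> i * sin (lon i))" by simp
    also have "\<dots> = - (wave 2 p q i * sin (2 * lon i))" unfolding Lambda_cos_sin_2 by simp
    finally show ?thesis unfolding wave_def t cos_double_sin[of "2 * lon i"] sin_double[of "2 * lon i"]
      by (simp add: algebra_simps power2_eq_square)
  qed
  then show "(\<Sum>i\<in>UNIV. \<Lambda> i * wave 2 p q i * sin (lon i)) = - 3 * q"
    by (simp only: sum.distrib sum_distrib_left[symmetric] sum_vortex_cos_sin[OF nd(2)]) (simp add: card)
qed

lemma U_in_slice:
  assumes "c > 0" shows "U \<in> S" "U' \<in> S"
proof -
  have z: "\<zeta> $ 1 = 0 \<and> \<zeta> $ 2 = 0" if "cross3 \<zeta> (centre_of_vorticity \<Lambda> X) = 0" for \<zeta>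
    using that assms rN unfolding centre_of_vorticity_X by (auto simp: cross3_def vec_eq_iff forall_3)
  show "U \<in> S" unfolding U_def mode_wave
  proof (rule fr_in_slice)
    show "centre_of_vorticity \<Lambda> (fr (wave 2 1 0) (wave 2 0 c)) = 0"
      unfolding centre_of_vorticity_fr wave2_sums by (simp add: vec_eq_iff forall_3)
    show "(\<chi> i. cross3 \<zeta> (X $ i)) \<bullet> fr (wave 2 1 0) (wave 2 0 c) = 0" if "cross3 \<zeta> (centre_of_vorticity \<Lambda> X) = 0" for \<zeta>
      unfolding orbit_inner_fr wave2_sums using z[OF that] by (simp add: inner_vec_def sum_3)
  qed
  show "U' \<in> S" unfolding U'_def mode_wave
  proof (rule fr_in_slice)
    show "centre_of_vorticity \<Lambda> (fr (wave 2 0 1) (wave 2 (- c) 0)) = 0"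
      unfolding centre_of_vorticity_fr wave2_sums by (simp add: vec_eq_iff forall_3)
    show "(\<chi> i. cross3 \<zeta> (X $ i)) \<bullet> fr (wave 2 0 1) (wave 2 (- c) 0) = 0" if "cross3 \<zeta> (centre_of_vorticity \<Lambda> X) = 0" for \<zeta>
      unfolding orbit_inner_fr wave2_sums using z[OF that] by (simp add: inner_vec_def sum_3)
  qed
qed

lemma L_U:
  assumes "c > 0" shows "L U = - nu3 c *\<^sub>R U'" "L U' = nu3 c *\<^sub>R U"
proof -
  have k: "(2::nat) \<le> N" using N3 by simp
  note m = mode_operator[OF k symplectic_slice_tangent]
  show "L U = - nu3 c *\<^sub>R U'"
  proof (rule slice_linearization_eqI[OF X_phase_space Lambda_nonzero])
    show "- nu3 c *\<^sub>R U' \<in> S" using U_in_slice[OF assms] subspace_scale[OF subspace_symplectic_slice] by blast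
    fix w assume w: "w \<in> S"
    show "\<omega> (- nu3 c *\<^sub>R U') w = slice_hessian \<Lambda> X (axis_vec \<xi>\<^sub>0) U w"
      unfolding U_def U'_def m[OF w] mode_linear nu_value[symmetric] PR_values(4)
      by (simp add: algebra_simps power2_eq_square)
  qed
  show "L U' = nu3 c *\<^sub>R U"
  proof (rule slice_linearization_eqI[OF X_phase_space Lambda_nonzero])
    show "nu3 c *\<^sub>R U \<in> S" using U_in_slice[OF assms] subspace_scale[OF subspace_symplectic_slice] by blast
    fix w assume w: "w \<in> S"
    show "\<omega> (nu3 c *\<^sub>R U) w = slice_hessian \<Lambda> X (axis_vec \<xi>\<^sub>0) U' w"
      unfolding U_def U'_def m[OF w] mode_linear nu_value[symmetric] PR_values(4)
      by (simp add: algebra_simps power2_eq_square)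
  qed
qed

text \<open>A vector of the slice that pairs trivially with the waves for \<open>k = 1\<close> and \<open>k = 3\<close> and with the plane of \<open>U\<close> and \<open>U'\<close> has
vanishing Fourier coefficients: those for \<open>k = 0\<close> and half of those for \<open>k = 2\<close> vanish by definition of the slice.\<close>

lemma slice_vector_zero:
  assumes c: "c > 0" and u: "u \<in> S"
    and m1: "\<And>a1 a2 b1 b2. \<omega> u (mode 1 a1 a2 b1 b2) = 0" and m3: "\<And>a1 a2 b1 b2. \<omega> u (mode 3 a1 a2 b1 b2) = 0"
    and mU: "\<omega> u U = 0" "\<omega> u U' = 0"
  shows "u = 0"
proof -
  obtain a b where ab: "u = fr a b" "(\<Sum>i\<in>UNIV. a i) = 0" "(\<Sum>i\<in>UNIV. b i) = 0"
    "c * (\<Sum>i\<in>UNIV. \<Lambda> i * a i * cos (lon i)) + (\<Sum>i\<in>UNIV. \<Lambda> i * b i * sin (lon i)) = 0"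
    "(\<Sum>i\<in>UNIV. \<Lambda> i * b i * cos (lon i)) = c * (\<Sum>i\<in>UNIV. \<Lambda> i * a i * sin (lon i))"
    by (rule slice_frame_sums[OF u])
  have w: "\<omega> u (mode k a1 a2 b1 b2) = a1 * (\<Sum>i\<in>UNIV. b i * cos (real k * lon i)) + a2 * (\<Sum>i\<in>UNIV. b i * sin (real k * lon i))
     - b1 * (\<Sum>i\<in>UNIV. a i * cos (real k * lon i)) - b2 * (\<Sum>i\<in>UNIV. a i * sin (real k * lon i))" for k a1 a2 b1 b2
    unfolding ab(1) mode_wave symplectic_form_frames wave_def
    by (simp add: sum_distrib_left sum.distrib sum_subtractf algebra_simps)
  define A1 A2 B1 B2 where "A1 = (\<Sum>i\<in>UNIV. a i * cos (2 * lon i))" and "A2 = (\<Sum>i\<in>UNIV. a i * sin (2 * lon i))"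
    and "B1 = (\<Sum>i\<in>UNIV. b i * cos (2 * lon i))" and "B2 = (\<Sum>i\<in>UNIV. b i * sin (2 * lon i))"
  have conv: "(\<Sum>i\<in>UNIV. \<Lambda> i * f i * cos (lon i)) = (\<Sum>i\<in>UNIV. f i * cos (2 * lon i))"
    "(\<Sum>i\<in>UNIV. \<Lambda> i * f i * sin (lon i)) = - (\<Sum>i\<in>UNIV. f i * sin (2 * lon i))" for f
  proof -
    show "(\<Sum>i\<in>UNIV. \<Lambda> i * f i * cos (lon i)) = (\<Sum>i\<in>UNIV. f i * cos (2 * lon i))"
      by (intro sum.cong refl) (simp add: Lambda_cos_sin_2(1)[symmetric] mult_ac)
    have "\<Lambda> i * f i * sin (lon i) = - (f i * sin (2 * lon i))" for i
    proof -
      have "\<Lambda> i * f i * sin (lon i) = f i * (\<Lambda> i * sin (lon i))" by simp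
      then show ?thesis unfolding Lambda_cos_sin_2 by simp
    qed
    then show "(\<Sum>i\<in>UNIV. \<Lambda> i * f i * sin (lon i)) = - (\<Sum>i\<in>UNIV. f i * sin (2 * lon i))"
      by (simp add: sum_negf)
  qed
  have "c * A1 = B2" "B1 = - (c * A2)"
    using ab(4,5) unfolding conv A1_def A2_def B1_def B2_def by simp_all
  moreover have "B1 = c * A2" "B2 = - (c * A1)"
    using mU unfolding U_def U'_def w by (simp_all add: A1_def A2_def B1_def B2_def)
  ultimately have k2: "A1 = 0" "A2 = 0" "B1 = 0" "B2 = 0" using c by auto
  have k13: "(\<Sum>i\<in>UNIV. a i * cos (real k * lon i)) = 0" "(\<Sum>i\<in>UNIV. a i * sin (real k * lon i)) = 0"
     "(\<Sum>i\<in>UNIV. b i * cos (real k * lon i)) = 0" "(\<Sum>i\<in>UNIV. b i * sin (real k * lon i)) = 0" if "k = 1 \<or> k = 3" for k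
  proof -
    have z: "\<omega> u (mode k a1 a2 b1 b2) = 0" for a1 a2 b1 b2 using that m1 m3 by auto
    show "(\<Sum>i\<in>UNIV. a i * cos (real k * lon i)) = 0" "(\<Sum>i\<in>UNIV. a i * sin (real k * lon i)) = 0"
     "(\<Sum>i\<in>UNIV. b i * cos (real k * lon i)) = 0" "(\<Sum>i\<in>UNIV. b i * sin (real k * lon i)) = 0"
      using z[of 0 0 1 0] z[of 0 0 0 1] z[of 1 0 0 0] z[of 0 1 0 0] unfolding w by simp_all
  qed
  have small: "(\<Sum>i\<in>UNIV. a i * cos (real k * lon i)) = 0 \<and> (\<Sum>i\<in>UNIV. a i * sin (real k * lon i)) = 0
     \<and> (\<Sum>i\<in>UNIV. b i * cos (real k * lon i)) = 0 \<and> (\<Sum>i\<in>UNIV. b i * sin (real k * lon i)) = 0" if "k \<le> 3" for k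
  proof -
    have "k = 0 \<or> k = 1 \<or> k = 2 \<or> k = 3" using that by auto
    then show ?thesis
    proof (elim disjE)
      assume "k = 0" then show ?thesis using ab(2,3) by simp
    next
      assume "k = 2" then show ?thesis using k2 by (simp add: A1_def A2_def B1_def B2_def)
    qed (use k13[of k] in auto)
  qed
  have all: "(\<Sum>i\<in>UNIV. a i * cos (real k * lon i)) = 0 \<and> (\<Sum>i\<in>UNIV. a i * sin (real k * lon i)) = 0
     \<and> (\<Sum>i\<in>UNIV. b i * cos (real k * lon i)) = 0 \<and> (\<Sum>i\<in>UNIV. b i * sin (real k * lon i)) = 0" if "k < 2 * N" for k
  proof (cases "k \<le> 3")
    case False
    then have "2 * N - k \<le> 3" "2 * N - (2 * N - k) = k" using that N3 by auto
    with small[of "2 * N - k"] lon_reflect[of "2 * N - k"] show ?thesis by (simp add: sum_negf)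
  qed (rule small)
  have "a i = 0" "b i = 0" for i
    using fourier_inversion[of a i] fourier_inversion[of b i] all by auto
  then show ?thesis unfolding ab(1) vec_eq_iff[of "fr a b" 0] fr_nth by simp
qed

text \<open>If \<open>\<sigma>\<close> satisfies none of the equations, its eigenvector pairs trivially with all modes in the slice.\<close>

theorem eigenvalues_subset_3:
  assumes c: "c > 0" and \<sigma>: "\<sigma> \<in> eigs"
  shows "(\<sigma> + \<i> * of_real (beta3 c))\<^sup>2 = of_real (- disc3 c) \<or> (\<sigma> - \<i> * of_real (beta3 c))\<^sup>2 = of_real (- disc3 c)
    \<or> \<sigma>\<^sup>2 = of_real (- antisym3 c) \<or> \<sigma>\<^sup>2 = of_real (- (nu3 c)\<^sup>2)"
proof (rule ccontr)
  assume neg: "\<not> ?thesis"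
  obtain v w where vw: "v \<in> S" "w \<in> S" "v \<noteq> 0 \<or> w \<noteq> 0"
    and eig: "L v = Re \<sigma> *\<^sub>R v - Im \<sigma> *\<^sub>R w" "L w = Im \<sigma> *\<^sub>R v + Re \<sigma> *\<^sub>R w"
    using \<sigma> unfolding slice_eigenvalues_def complex_eigenvalues_def by auto
  have k1: "1 \<le> (1::nat)" "1 \<le> N" "1 \<noteq> N - 1" and k3: "1 \<le> (3::nat)" "3 \<le> N" "3 \<noteq> N - 1" using N3 by auto
  have m1: "\<omega> v (mode 1 a1 a2 b1 b2) = 0" "\<omega> w (mode 1 a1 a2 b1 b2) = 0" for a1 a2 b1 b2
    using eigenvector_pairing_mode[OF k1 vw(1,2) eig] neg unfolding beta_values disc_value by auto
  have m3: "\<omega> v (mode 3 a1 a2 b1 b2) = 0" "\<omega> w (mode 3 a1 a2 b1 b2) = 0" for a1 a2 b1 b2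
    using eigenvector_pairing_mode[OF k3 vw(1,2) eig] neg unfolding beta_values antisym_value by auto
  define F :: "_ \<Rightarrow> complex" where "F u = Complex (\<omega> v u) (\<omega> w u)" for u
  have FL: "F (L u) = - \<sigma> * F u" if "u \<in> S" for u
  proof -
    have "\<omega> v (L u) = - \<omega> (L v) u" "\<omega> w (L u) = - \<omega> (L w) u"
      using slice_linearization_antisymmetric vw that by simp_all
    then show ?thesis unfolding F_def eig by (simp add: complex_eq_iff symplectic_form_linear algebra_simps)
  qed
  have Fs: "F (r *\<^sub>R u) = of_real r * F u" for r u by (simp add: F_def complex_eq_iff symplectic_form_linear)
  have e: "\<sigma> * F U = of_real (nu3 c) * F U'" "\<sigma> * F U' = - of_real (nu3 c) * F U"
    using FL[OF U_in_slice(1)[OF c]] FL[OF U_in_slice(2)[OF c]] unfolding L_U[OF c] Fs by simp_all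
  then have "(\<sigma>\<^sup>2 + of_real ((nu3 c)\<^sup>2)) * F U = 0" "(\<sigma>\<^sup>2 + of_real ((nu3 c)\<^sup>2)) * F U' = 0"
    unfolding of_real_power by algebra+
  moreover have "\<sigma>\<^sup>2 \<noteq> of_real (- (nu3 c)\<^sup>2)" using neg by blast
  then have "\<sigma>\<^sup>2 + of_real ((nu3 c)\<^sup>2) \<noteq> 0" unfolding of_real_minus eq_neg_iff_add_eq_0 .
  ultimately have "F U = 0" "F U' = 0" by auto
  then have "\<omega> v U = 0" "\<omega> v U' = 0" "\<omega> w U = 0" "\<omega> w U' = 0" by (simp_all add: F_def complex_eq_iff)
  then have "v = 0" "w = 0"
    using slice_vector_zero[OF c vw(1) m1(1) m3(1)] slice_vector_zero[OF c vw(2) m1(2) m3(2)] by auto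
  then show False using vw(3) by simp
qed

lemma Re_zero_of_square:
  assumes "z\<^sup>2 = of_real (- x)" "x \<ge> 0" shows "Re z = 0"
proof -
  have "(Re z)\<^sup>2 - (Im z)\<^sup>2 = - x" "Re z * Im z = 0"
    using assms(1) by (auto simp: complex_eq_iff Re_power2 Im_power2)
  then show ?thesis using assms(2) by (auto simp: power2_eq_square) (smt (verit) mult_eq_0_iff not_real_square_gt_zero)
qed

text \<open>The mode \<open>k = 3\<close> gives a nonnegative, the mode \<open>k = 1\<close> a nonpositive value of the Hessian, so it is not definite.\<close>

theorem linearly_stable_3:
  assumes c: "c > 0" and \<epsilon>: "\<epsilon> \<ge> 0" and R: "R 1 \<ge> 0" and P: "P 1 < 0"
  shows "linearly_stable \<Lambda> X"
  unfolding linearly_stable_def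
proof (rule exI[of _ "axis_vec \<xi>\<^sub>0"], intro conjI ballI)
  show "angular_velocity \<Lambda> X (axis_vec \<xi>\<^sub>0)" by (rule angular_velocity_rings)
  have s4p: "s^4 > 0" using s_pos by simp
  have disc: "disc3 c \<ge> 0" using disc_value R P s4p
    by (smt (verit) divide_nonpos_pos mult_nonneg_nonpos2)
  have "P 3 * R 3 \<le> 0" using P_R_N N3 \<epsilon> G_0_neg by (simp add: mult_nonneg_nonpos)
  then have anti: "antisym3 c \<ge> 0" using antisym_value s4p by (smt (verit) divide_nonpos_pos)
  show "Re \<sigma> = 0" if "\<sigma> \<in> eigs" for \<sigma>
    using eigenvalues_subset_3[OF c that]
  proof (elim disjE)
    assume "(\<sigma> + \<i> * of_real (beta3 c))\<^sup>2 = of_real (- disc3 c)"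
    from Re_zero_of_square[OF this disc] show ?thesis by simp
  next
    assume "(\<sigma> - \<i> * of_real (beta3 c))\<^sup>2 = of_real (- disc3 c)"
    from Re_zero_of_square[OF this disc] show ?thesis by simp
  next
    assume "\<sigma>\<^sup>2 = of_real (- antisym3 c)"
    from Re_zero_of_square[OF this anti] show ?thesis .
  next
    assume "\<sigma>\<^sup>2 = of_real (- (nu3 c)\<^sup>2)"
    from Re_zero_of_square[OF this] show ?thesis by simp
  qed
  show "\<not> definite_on S (slice_hessian \<Lambda> X (axis_vec \<xi>\<^sub>0))"
  proof
    assume def: "definite_on S (slice_hessian \<Lambda> X (axis_vec \<xi>\<^sub>0))"
    have k1: "1 \<le> (1::nat)" "1 \<le> N" "1 \<noteq> N - 1" and k3: "1 \<le> (3::nat)" "3 \<le> N" "3 \<noteq> N - 1" using N3 by auto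
    define e f where "e = mode 3 1 0 0 0" and "f = mode 1 0 0 1 0"
    have eS: "e \<in> S - {0}" "f \<in> S - {0}"
      unfolding e_def f_def using mode_in_slice[OF k3] mode_in_slice[OF k1] mode_nonzero by auto
    have "slice_hessian \<Lambda> X (axis_vec \<xi>\<^sub>0) e e = P 3 / s\<^sup>2 * (\<Sum>i\<in>UNIV. (wave 3 1 0 i)\<^sup>2)"
      unfolding e_def mode_operator[OF k3(2) symplectic_slice_tangent[OF mode_in_slice[OF k3]]]
      by (simp add: mode_wave symplectic_form_frames wave_def sum_distrib_left power2_eq_square beta_values mult_ac)
    also have "\<dots> \<ge> 0" using \<epsilon> P_R_N N3 by (intro mult_nonneg_nonneg sum_nonneg) auto
    finally have ee: "slice_hessian \<Lambda> X (axis_vec \<xi>\<^sub>0) e e \<ge> 0" .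
    have "slice_hessian \<Lambda> X (axis_vec \<xi>\<^sub>0) f f = - (R 1 / s\<^sup>2) * (\<Sum>i\<in>UNIV. (wave 1 1 0 i)\<^sup>2)"
      unfolding f_def mode_operator[OF k1(2) symplectic_slice_tangent[OF mode_in_slice[OF k1]]]
      by (simp add: mode_wave symplectic_form_frames wave_def sum_distrib_left power2_eq_square mult_ac)
    moreover have "R 1 / s\<^sup>2 * (\<Sum>i\<in>UNIV. (wave 1 1 0 i)\<^sup>2) \<ge> 0" using R by (intro mult_nonneg_nonneg sum_nonneg) auto
    ultimately have ff: "slice_hessian \<Lambda> X (axis_vec \<xi>\<^sub>0) f f \<le> 0" by simp
    from def show False unfolding definite_on_def
    proof
      assume "\<forall>v\<in>S - {0}. 0 < slice_hessian \<Lambda> X (axis_vec \<xi>\<^sub>0) v v"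
      from bspec[OF this eS(2)] ff show False by linarith
    next
      assume "\<forall>v\<in>S - {0}. slice_hessian \<Lambda> X (axis_vec \<xi>\<^sub>0) v v < 0"
      from bspec[OF this eS(1)] ee show False by linarith
    qed
  qed
qed

end

section \<open>The threshold co-latitudes\<close>

text \<open>The Taylor polynomial of degree 10 with the remainder of order 12, in powers of \<open>x\<^sup>2\<close>.\<close>

lemma cos_Taylor_bound:
  fixes x :: real
  defines "z \<equiv> x\<^sup>2"
  shows "\<bar>cos x - (1 - z / 2 + z^2 / 24 - z^3 / 720 + z^4 / 40320 - z^5 / 3628800)\<bar> \<le> z^6 / 479001600"
proof -
  obtain t where t: "cos x = (\<Sum>m<12. cos_coeff m * x ^ m) + (cos (t + 1/2 * real 12 * pi) / fact 12) * x ^ 12"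
    using Maclaurin_cos_expansion[of x 12] by blast
  have s: "(\<Sum>m<12. cos_coeff m * x ^ m) = 1 - z / 2 + z^2 / 24 - z^3 / 720 + z^4 / 40320 - z^5 / 3628800"
    by (simp add: lessThan_nat_numeral lessThan_Suc cos_coeff_def fact_numeral z_def power_mult[symmetric])
  have "\<bar>(cos (t + 1/2 * real 12 * pi) / fact 12) * x ^ 12\<bar> = \<bar>cos (t + 1/2 * real 12 * pi)\<bar> * z^6 / fact 12"
    by (simp add: abs_mult z_def power_mult[symmetric])
  also have "\<dots> \<le> 1 * z^6 / fact 12"
    by (intro divide_right_mono mult_right_mono) (auto simp: z_def simp del: of_nat_numeral)
  also have "\<dots> = z^6 / 479001600" by (simp add: fact_numeral)
  finally show ?thesis unfolding t s by simp
qed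

text \<open>The lower bounds at the left ends and the upper bounds at the right ends of the intervals in which the three threshold
co-latitudes are located.\<close>

lemma cos_values:
  "cos 1.135 > (0.422::real)" "cos 1.145 < (0.4132::real)" "cos 1.3015 > (0.266::real)" "cos 1.3025 < (0.2651::real)"
  "cos 1.3145 > (0.2533::real)" "cos 1.3155 < (0.2528::real)"
proof -
  have l: "v < cos x" if "v + (x\<^sup>2)^6 / 479001600 < 1 - x\<^sup>2 / 2 + (x\<^sup>2)^2 / 24 - (x\<^sup>2)^3 / 720 + (x\<^sup>2)^4 / 40320 - (x\<^sup>2)^5 / 3628800" for v x :: real
    using cos_Taylor_bound[of x] that by linarith
  have u: "cos x < v" if "1 - x\<^sup>2 / 2 + (x\<^sup>2)^2 / 24 - (x\<^sup>2)^3 / 720 + (x\<^sup>2)^4 / 40320 - (x\<^sup>2)^5 / 3628800 + (x\<^sup>2)^6 / 479001600 < v" for v x :: real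
    using cos_Taylor_bound[of x] that by linarith
  show "cos 1.135 > (0.422::real)" "cos 1.3015 > (0.266::real)" "cos 1.3145 > (0.2533::real)"
    by (rule l; simp add: power_divide field_simps)+
  show "cos 1.145 < (0.4132::real)" "cos 1.3025 < (0.2651::real)" "cos 1.3155 < (0.2528::real)"
    by (rule u; simp add: power_divide field_simps)+
qed

text \<open>The squared cosine decreases on \<open>]0, \<pi> / 2]\<close>, so a condition that is monotone in it changes at one co-latitude.\<close>

lemma cos_threshold:
  fixes p :: "real \<Rightarrow> real"
  assumes mono: "\<And>u v. 0 \<le> u \<Longrightarrow> u < v \<Longrightarrow> v \<le> 1 \<Longrightarrow> p u < p v"
    and cont: "continuous_on UNIV p"
    and lohi: "0 < lo" "lo \<le> hi" "hi \<le> pi / 2" and a: "p ((cos hi)\<^sup>2) \<le> k" and b: "k \<le> p ((cos lo)\<^sup>2)"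
  obtains t where "lo \<le> t" "t \<le> hi" "p ((cos t)\<^sup>2) = k"
    "\<And>\<theta>. 0 < \<theta> \<Longrightarrow> \<theta> < t \<Longrightarrow> k < p ((cos \<theta>)\<^sup>2)" "\<And>\<theta>. t < \<theta> \<Longrightarrow> \<theta> \<le> pi / 2 \<Longrightarrow> p ((cos \<theta>)\<^sup>2) < k"
proof -
  have "continuous_on {lo..hi} (p \<circ> (\<lambda>t. (cos t)\<^sup>2))"
    by (rule continuous_on_compose) (auto intro!: continuous_intros continuous_on_subset[OF cont])
  then have "continuous_on {lo..hi} (\<lambda>t. p ((cos t)\<^sup>2))" by (simp add: o_def)
  from IVT2'[of "\<lambda>t. p ((cos t)\<^sup>2)", OF a b lohi(2) this]
  obtain t where t: "lo \<le> t" "t \<le> hi" "p ((cos t)\<^sup>2) = k" by blast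
  have dec: "p ((cos y)\<^sup>2) < p ((cos x)\<^sup>2)" if "0 < x" "x < y" "y \<le> pi / 2" for x y
  proof (rule mono)
    have "cos y < cos x" "0 \<le> cos y" using that by (auto intro!: cos_monotone_0_pi cos_ge_zero)
    then show "(cos y)\<^sup>2 < (cos x)\<^sup>2" by (intro power_strict_mono) auto
    show "(cos x)\<^sup>2 \<le> 1" by (simp add: abs_square_le_1)
  qed simp
  show thesis
  proof (rule that[OF t])
    fix \<theta>
    show "k < p ((cos \<theta>)\<^sup>2)" if "0 < \<theta>" "\<theta> < t" using dec[OF that] t lohi by simp
    show "p ((cos \<theta>)\<^sup>2) < k" if "t < \<theta>" "\<theta> \<le> pi / 2" using dec[OF _ that] t lohi by simp
  qed
qed

context staggered_rings
begin

lemma lyapunov_stable_2_if: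
  assumes "N = 2" "6 * (cos \<theta>)\<^sup>2 - ((cos \<theta>)\<^sup>2)\<^sup>2 < 1" shows "lyapunov_stable \<Lambda> X"
  using assms(2) by (intro lyapunov_stable_2[OF assms(1)]) (simp add: c_def power2_eq_square algebra_simps)

lemma linearly_unstable_2_if:
  assumes "N = 2" "1 < 6 * (cos \<theta>)\<^sup>2 - ((cos \<theta>)\<^sup>2)\<^sup>2" shows "linearly_unstable \<Lambda> X"
proof (rule linearly_unstable_eps_neg)
  have "(1 + c\<^sup>2)\<^sup>2 - 8 * c\<^sup>2 < 0" using assms(2) by (simp add: c_def power2_eq_square algebra_simps)
  moreover have "1 + c\<^sup>2 > 0" by (simp add: add_pos_nonneg)
  ultimately show "\<epsilon> < 0" unfolding eps_2[OF assms(1)] by (rule divide_neg_pos)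
qed

end

section \<open>The Hamiltonian-Hopf bifurcation\<close>

text \<open>The roots of \<open>(\<sigma> - \<i> * beta3 c)\<^sup>2 = - disc3 c\<close>, for \<open>\<kappa> = 1\<close> and \<open>\<kappa> = - 1\<close>. One of the two square roots always vanishes, and
their sum with the factor \<open>\<i>\<close> is a continuous square root of \<open>- disc3 c\<close> across its change of sign.\<close>

definition hopf_branch :: "real \<Rightarrow> real \<Rightarrow> complex" where
  "hopf_branch \<kappa> c = Complex (\<kappa> * sqrt (max 0 (- disc3 c))) (beta3 c + \<kappa> * sqrt (max 0 (disc3 c)))"

lemma hopf_branch_square:
  assumes "\<kappa> * \<kappa> = 1"
  shows "(hopf_branch \<kappa> c - \<i> * of_real (beta3 c))\<^sup>2 = of_real (- disc3 c)"
proof -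
  have "max 0 m - max 0 (- m) = m" "max 0 m * max 0 (- m) = 0" for m :: real by (auto simp: max_def)
  then have "sqrt (max 0 (- disc3 c)) * sqrt (max 0 (disc3 c)) = 0" "max 0 (- disc3 c) - max 0 (disc3 c) = - disc3 c"
    by (simp_all add: real_sqrt_mult[symmetric] mult.commute max_def)
  moreover have "\<kappa>\<^sup>2 = 1" using assms by (simp add: power2_eq_square)
  ultimately show ?thesis
    by (auto simp: hopf_branch_def complex_eq_iff Re_power2 Im_power2 power_mult_distrib)
qed

lemma hopf_branch_cases:
  assumes "(\<sigma> - \<i> * of_real (beta3 c))\<^sup>2 = of_real (- disc3 c)"
  shows "\<sigma> = hopf_branch 1 c \<or> \<sigma> = hopf_branch (- 1) c"
proof -
  have "hopf_branch (- 1) c - \<i> * of_real (beta3 c) = - (hopf_branch 1 c - \<i> * of_real (beta3 c))"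
    by (simp add: hopf_branch_def complex_eq_iff)
  moreover have "(\<sigma> - \<i> * of_real (beta3 c))\<^sup>2 = (hopf_branch 1 c - \<i> * of_real (beta3 c))\<^sup>2"
    unfolding assms by (rule hopf_branch_square[symmetric]) simp
  ultimately show ?thesis by (auto simp: power2_eq_iff)
qed

lemma hopf_branch_near:
  assumes "\<kappa> * \<kappa> = 1"
  shows "dist (\<i> * of_real w) (hopf_branch \<kappa> c) \<le> \<bar>beta3 c - w\<bar> + sqrt \<bar>disc3 c\<bar>"
proof -
  have k: "\<bar>\<kappa>\<bar> = 1" using assms by (metis abs_mult_self_eq abs_one abs_ge_zero real_sqrt_abs2 real_sqrt_one)
  have "dist (\<i> * of_real w) (hopf_branch \<kappa> c) = norm (hopf_branch \<kappa> c - \<i> * of_real w)"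
    by (simp add: dist_norm norm_minus_commute)
  also have "hopf_branch \<kappa> c - \<i> * of_real w = \<i> * of_real (beta3 c - w) + of_real \<kappa> * Complex (sqrt (max 0 (- disc3 c))) (sqrt (max 0 (disc3 c)))"
    by (simp add: hopf_branch_def complex_eq_iff)
  also have "norm \<dots> \<le> \<bar>beta3 c - w\<bar> + norm (Complex (sqrt (max 0 (- disc3 c))) (sqrt (max 0 (disc3 c))))"
    by (rule order_trans[OF norm_triangle_ineq]) (simp add: norm_mult k)
  also have "norm (Complex (sqrt (max 0 (- disc3 c))) (sqrt (max 0 (disc3 c)))) = sqrt \<bar>disc3 c\<bar>"
    by (simp add: complex_norm max_def abs_if)
  finally show ?thesis by simp
qed

context three_rings
begin

text \<open>The condition on \<open>d = c\<^sup>2\<close> is \<open>\<epsilon> \<ge> 0\<close>; it implies \<open>14 * d \<le> 1\<close>.\<close>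

lemma P_1_neg:
  assumes "14 * d + 3 * d\<^sup>2 \<le> 1" shows "P 1 < 0"
proof -
  have "d\<^sup>2 \<ge> 0" "d^3 \<ge> 0" by simp_all
  then have "25 * d - 3 - 45 * d\<^sup>2 - 9 * d^3 < 0" using assms by linarith
  moreover have "(1 + 3 * d)\<^sup>2 > 0" using d_pos(1) zero_less_power by blast
  ultimately show ?thesis unfolding PR_values by (rule divide_neg_pos)
qed

lemma R_1_sign:
  "9 * d^3 + 9 * d\<^sup>2 + 15 * d > 1 \<Longrightarrow> R 1 > 0" "9 * d^3 + 9 * d\<^sup>2 + 15 * d < 1 \<Longrightarrow> R 1 < 0" "9 * d^3 + 9 * d\<^sup>2 + 15 * d = 1 \<Longrightarrow> R 1 = 0"
proof -
  have q: "(1 + 3 * d)\<^sup>2 > 0" using d_pos(1) zero_less_power by blast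
  show "R 1 > 0" if "9 * d^3 + 9 * d\<^sup>2 + 15 * d > 1" unfolding PR_values using that by (intro divide_pos_pos[OF _ q]) linarith
  show "R 1 < 0" if "9 * d^3 + 9 * d\<^sup>2 + 15 * d < 1" unfolding PR_values using that by (intro divide_neg_pos[OF _ q]) linarith
  show "R 1 = 0" if "9 * d^3 + 9 * d\<^sup>2 + 15 * d = 1" unfolding PR_values using that by simp
qed

lemma linearly_unstable_3_low:
  assumes "14 * d + 3 * d\<^sup>2 > 1" shows "linearly_unstable \<Lambda> X"
proof (rule linearly_unstable_eps_neg)
  show "\<epsilon> < 0" unfolding eps_3 using assms by (intro divide_neg_pos[OF _ d_pos(1)]) linarith
qed

lemma linearly_stable_3_middle:
  assumes "c > 0" "14 * d + 3 * d\<^sup>2 \<le> 1" "9 * d^3 + 9 * d\<^sup>2 + 15 * d \<ge> 1" shows "linearly_stable \<Lambda> X"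
proof (rule linearly_stable_3[OF assms(1) _ _ P_1_neg[OF assms(2)]])
  show "\<epsilon> \<ge> 0" unfolding eps_3 using assms(2) d_pos(1) by (intro divide_nonneg_pos) linarith+
  show "R 1 \<ge> 0" using R_1_sign assms(3) by (metis less_eq_real_def)
qed

lemma linearly_unstable_3_high:
  assumes "14 * d + 3 * d\<^sup>2 \<le> 1" "9 * d^3 + 9 * d\<^sup>2 + 15 * d < 1" shows "linearly_unstable \<Lambda> X"
proof (rule linearly_unstable_mode)
  show "1 \<le> (1::nat)" "1 \<le> N" "1 \<noteq> N - 1" using N3 by auto
  show "P 1 * R 1 > 0" by (rule mult_neg_neg[OF P_1_neg[OF assms(1)] R_1_sign(2)[OF assms(2)]])
qed

lemma disc3_sign:
  assumes "14 * d + 3 * d\<^sup>2 \<le> 1"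
  shows "9 * d^3 + 9 * d\<^sup>2 + 15 * d > 1 \<Longrightarrow> disc3 c > 0" "9 * d^3 + 9 * d\<^sup>2 + 15 * d < 1 \<Longrightarrow> disc3 c < 0" "9 * d^3 + 9 * d\<^sup>2 + 15 * d = 1 \<Longrightarrow> disc3 c = 0"
proof -
  have s4p: "s^4 > 0" using s_pos by simp
  note P = P_1_neg[OF assms]
  show "disc3 c > 0" if "9 * d^3 + 9 * d\<^sup>2 + 15 * d > 1"
    using divide_neg_pos[OF mult_neg_pos[OF P R_1_sign(1)[OF that]] s4p] unfolding disc_value by simp
  show "disc3 c < 0" if "9 * d^3 + 9 * d\<^sup>2 + 15 * d < 1"
    using divide_pos_pos[OF mult_neg_neg[OF P R_1_sign(2)[OF that]] s4p] unfolding disc_value by simp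
  show "disc3 c = 0" if "9 * d^3 + 9 * d\<^sup>2 + 15 * d = 1"
    using disc_value unfolding R_1_sign(3)[OF that] by simp
qed

lemma hopf_branch_eigenvalue:
  assumes "14 * d + 3 * d\<^sup>2 \<le> 1" "\<kappa> * \<kappa> = 1"
  shows "hopf_branch \<kappa> c \<in> eigs" "- hopf_branch \<kappa> c \<in> eigs"
proof -
  have k: "1 \<le> (1::nat)" "1 \<le> N" "1 \<noteq> N - 1" using N3 by auto
  have P: "P 1 \<noteq> 0" using P_1_neg[OF assms(1)] by simp
  define \<tau> where "\<tau> = hopf_branch \<kappa> c - \<i> * of_real (beta3 c)"
  have t: "\<tau>\<^sup>2 = of_real (- disc3 c)" unfolding \<tau>_def by (rule hopf_branch_square[OF assms(2)])
  have t1: "\<tau>\<^sup>2 = of_real (P 1 * R 1 / s^4)" unfolding disc_value by (rule t)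
  have t2: "(- \<tau>)\<^sup>2 = of_real (P 1 * R 1 / s^4)" unfolding disc_value using t by simp
  have e: "\<tau> + \<i> * of_real (beta3 c) = hopf_branch \<kappa> c" "- \<tau> - \<i> * of_real (beta3 c) = - hopf_branch \<kappa> c" by (simp_all add: \<tau>_def)
  show "hopf_branch \<kappa> c \<in> eigs" using mode_eigenvalue(1)[OF k P t1] unfolding beta_values e .
  show "- hopf_branch \<kappa> c \<in> eigs" using mode_eigenvalue(2)[OF k P t2] unfolding beta_values e .
qed

text \<open>The eigenvalues of the modes other than \<open>k = 1\<close> lie on circles about \<open>0\<close> of radius \<open>sqrt \<bar>antisym3 c\<bar>\<close> and \<open>\<bar>nu3 c\<bar>\<close>, and the balls lie
between these two circles.\<close>

lemma eigenvalues_near_hopf: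
  assumes c: "c > 0" and P: "14 * d + 3 * d\<^sup>2 \<le> 1" and w: "0 < r" "r < w"
    and near: "\<bar>beta3 c - w\<bar> + sqrt \<bar>disc3 c\<bar> < r" and anti: "\<bar>antisym3 c\<bar> < (w - r)\<^sup>2" and nu: "nu3 c > w + r"
  shows "eigs \<inter> (ball (\<i> * of_real w) r \<union> ball (- \<i> * of_real w) r)
    = {hopf_branch 1 c, - hopf_branch 1 c, hopf_branch (- 1) c, - hopf_branch (- 1) c}"
proof (intro equalityI subsetI)
  fix \<sigma> assume s: "\<sigma> \<in> eigs \<inter> (ball (\<i> * of_real w) r \<union> ball (- \<i> * of_real w) r)"
  then have "norm (\<sigma> - \<i> * of_real w) < r \<or> norm (\<sigma> - - (\<i> * of_real w)) < r"
    by (auto simp: dist_norm norm_minus_commute)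
  moreover have "norm (\<i> * of_real w) = w" "norm (- (\<i> * of_real w)) = w" using w by (simp_all add: norm_mult)
  ultimately have "\<bar>norm \<sigma> - w\<bar> < r"
    using norm_triangle_ineq3[of \<sigma> "\<i> * of_real w"] norm_triangle_ineq3[of \<sigma> "- (\<i> * of_real w)"] by linarith
  then have n: "w - r < norm \<sigma>" "norm \<sigma> < w + r" by linarith+
  have "\<sigma> \<in> eigs" using s by blast
  from eigenvalues_subset_3[OF c this]
  show "\<sigma> \<in> {hopf_branch 1 c, - hopf_branch 1 c, hopf_branch (- 1) c, - hopf_branch (- 1) c}"
  proof (elim disjE)
    assume "(\<sigma> + \<i> * of_real (beta3 c))\<^sup>2 = of_real (- disc3 c)"
    moreover have "(\<sigma> + \<i> * of_real (beta3 c))\<^sup>2 = (- \<sigma> - \<i> * of_real (beta3 c))\<^sup>2" by algebra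
    ultimately have "- \<sigma> = hopf_branch 1 c \<or> - \<sigma> = hopf_branch (- 1) c" by (intro hopf_branch_cases) simp
    then have "\<sigma> = - hopf_branch 1 c \<or> \<sigma> = - hopf_branch (- 1) c" by (metis minus_minus)
    then show ?thesis by blast
  next
    assume "(\<sigma> - \<i> * of_real (beta3 c))\<^sup>2 = of_real (- disc3 c)"
    from hopf_branch_cases[OF this] show ?thesis by blast
  next
    assume "\<sigma>\<^sup>2 = of_real (- antisym3 c)"
    then have "(norm \<sigma>)\<^sup>2 = \<bar>antisym3 c\<bar>" by (metis norm_power norm_of_real abs_minus_cancel)
    moreover have "(w - r)\<^sup>2 < (norm \<sigma>)\<^sup>2" using n(1) w by (intro power_strict_mono) auto
    ultimately show ?thesis using anti by simp
  next
    assume "\<sigma>\<^sup>2 = of_real (- (nu3 c)\<^sup>2)"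
    then have "(norm \<sigma>)\<^sup>2 = \<bar>- (nu3 c)\<^sup>2\<bar>" by (metis norm_power norm_of_real)
    moreover have "(norm \<sigma>)\<^sup>2 < (nu3 c)\<^sup>2" using n(2) nu by (intro power_strict_mono) auto
    ultimately show ?thesis by simp
  qed
next
  fix \<sigma> assume "\<sigma> \<in> {hopf_branch 1 c, - hopf_branch 1 c, hopf_branch (- 1) c, - hopf_branch (- 1) c}"
  then obtain \<kappa> :: real where k: "\<kappa> * \<kappa> = 1" and s: "\<sigma> = hopf_branch \<kappa> c \<or> \<sigma> = - hopf_branch \<kappa> c"
    by (metis empty_iff insert_iff mult_1 mult_minus_left mult_minus_right minus_minus)
  have "dist (\<i> * of_real w) (hopf_branch \<kappa> c) < r" using hopf_branch_near[OF k, of w c] near by simp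
  moreover have "dist (- \<i> * of_real w) (- hopf_branch \<kappa> c) = dist (\<i> * of_real w) (hopf_branch \<kappa> c)"
    by (simp add: dist_norm norm_minus_commute)
  ultimately show "\<sigma> \<in> eigs \<inter> (ball (\<i> * of_real w) r \<union> ball (- \<i> * of_real w) r)"
    using s hopf_branch_eigenvalue[OF P k] by auto
qed

end

text \<open>At the bifurcation \<open>c\<close> is about \<open>0.25308\<close>, \<open>beta3\<close> about \<open>2.136\<close>, \<open>nu3\<close> about \<open>2.459\<close> and \<open>antisym3\<close> about \<open>0.45\<close>; so balls of
radius \<open>0.1\<close> about \<open>\<plusminus> \<i> * beta3\<close> contain only eigenvalues of the mode \<open>k = 1\<close>.\<close>

lemma hopf_frequencies:
  assumes c: "0.2528 \<le> c" "c \<le> 0.2533"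
  shows "2 < beta3 c" "beta3 c < 2.2" "2.35 < nu3 c" "\<bar>antisym3 c\<bar> < 1"
proof -
  define d where "d = c\<^sup>2"
  have "(0.2528::real)\<^sup>2 \<le> d" "d \<le> 0.2533\<^sup>2" unfolding d_def using c by (intro power_mono; simp)+
  then have d: "0.0639 \<le> d" "d \<le> 0.0642" by (simp_all add: power2_eq_square)
  then have "1.1917 \<le> 1 + 3 * d" "1 + 3 * d \<le> 1.1926" by simp_all
  then have "1.1917\<^sup>2 \<le> (1 + 3 * d)\<^sup>2" "(1 + 3 * d)\<^sup>2 \<le> 1.1926\<^sup>2" "1.1917^3 \<le> (1 + 3 * d)^3" using d by (intro power_mono; simp)+
  then have w: "1.42 \<le> (1 + 3 * d)\<^sup>2" "(1 + 3 * d)\<^sup>2 \<le> 1.4223" "1.69 \<le> (1 + 3 * d)^3"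
    by (simp_all add: power2_eq_square power3_eq_cube)
  have wp: "0 < (1 + 3 * d)\<^sup>2" by (rule less_le_trans[OF _ w(1)]) simp
  show "2 < beta3 c" "beta3 c < 2.2"
    unfolding beta3_def d_def[symmetric] using w c wp by (simp_all add: pos_less_divide_eq[OF wp] pos_divide_less_eq[OF wp])
  have den: "0 < (1 - d) * (1 + 3 * d)\<^sup>2" using d wp by (intro mult_pos_pos) auto
  have "(1 - d) * (1 + 3 * d)\<^sup>2 \<le> 0.9361 * 1.4223" using d w by (intro mult_mono) auto
  moreover have "16 * 0.2528 * 0.8074 \<le> 16 * c * (1 - 3 * d)" using c d by (intro mult_mono) auto
  ultimately show "2.35 < nu3 c"
    unfolding nu3_def d_def[symmetric] using den by (simp add: pos_less_divide_eq)
  have c4: "c^4 = d\<^sup>2" by (simp add: d_def)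
  have "d\<^sup>2 \<le> 0.0642\<^sup>2" using d by (intro power_mono) auto
  then have "d\<^sup>2 \<le> 0.0042" "0 \<le> d\<^sup>2" by (simp_all add: power2_eq_square)
  then have q1: "0 \<le> 1 - 14 * d - 3 * d\<^sup>2" using d by simp
  have "1 - 14 * d - 3 * d\<^sup>2 \<le> 1 - 14 * d" by simp
  also have "\<dots> \<le> 0.1054" using d by simp
  finally have q: "0 \<le> 1 - 14 * d - 3 * d\<^sup>2" "1 - 14 * d - 3 * d\<^sup>2 \<le> 0.1054" using q1 by simp_all
  have "9 * (1 - d) * (1 - 14 * d - 3 * d\<^sup>2) \<le> 9 * 1 * 0.1054" using d q by (intro mult_mono) auto
  then have "antisym3 c < 1" "0 \<le> antisym3 c"
    unfolding antisym3_def d_def[symmetric] c4 using w q d by (auto simp: pos_divide_less_eq intro!: divide_nonneg_pos mult_nonneg_nonneg)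
  then show "\<bar>antisym3 c\<bar> < 1" by simp
qed

lemma continuous_frequencies:
  assumes "(cos q)\<^sup>2 \<noteq> 1"
  shows "isCont (\<lambda>q. beta3 (cos q)) q" "isCont (\<lambda>q. disc3 (cos q)) q" "isCont (\<lambda>q. antisym3 (cos q)) q" "isCont (\<lambda>q. nu3 (cos q)) q"
proof -
  have "1 + 3 * (cos q)\<^sup>2 > 0" by (simp add: add_pos_nonneg)
  then show "isCont (\<lambda>q. beta3 (cos q)) q" "isCont (\<lambda>q. disc3 (cos q)) q" "isCont (\<lambda>q. antisym3 (cos q)) q" "isCont (\<lambda>q. nu3 (cos q)) q"
    unfolding beta3_def disc3_def antisym3_def nu3_def using assms by (auto intro!: continuous_intros)
qed

text \<open>At \<open>p\<close> the coefficient \<open>R 1\<close> vanishes, and so does \<open>disc3\<close>. Before \<open>p\<close> it is positive and the two branches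
are distinct and imaginary; after \<open>p\<close> it is negative and they have opposite nonzero real parts. The condition
\<open>beta3 > 0\<close> keeps the branches away from each other's negatives.\<close>

theorem hamiltonian_hopf_3:
  fixes \<iota> :: "'n::finite \<Rightarrow> nat"
  assumes \<iota>: "bij_betw \<iota> UNIV {1..CARD('n)}" and card: "CARD('n) = 3"
    and p: "0 < p" "p < pi / 2" and cp: "0.2528 \<le> cos p" "cos p \<le> 0.2533"
    and p1: "14 * (cos p)\<^sup>2 + 3 * ((cos p)\<^sup>2)\<^sup>2 < 1"
    and at_p: "9 * ((cos p)\<^sup>2)^3 + 9 * ((cos p)\<^sup>2)\<^sup>2 + 15 * (cos p)\<^sup>2 = 1"
    and before: "\<And>q. 0 < q \<Longrightarrow> q < p \<Longrightarrow> 1 < 9 * ((cos q)\<^sup>2)^3 + 9 * ((cos q)\<^sup>2)\<^sup>2 + 15 * (cos q)\<^sup>2"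
    and after: "\<And>q. p < q \<Longrightarrow> q \<le> pi / 2 \<Longrightarrow> 9 * ((cos q)\<^sup>2)^3 + 9 * ((cos q)\<^sup>2)\<^sup>2 + 15 * (cos q)\<^sup>2 < 1"
  shows "hamiltonian_hopf_bifurcation DNd_vorticity (DNd \<iota>) p"
proof -
  have rings: "three_rings \<iota> q 3" if "0 < q" "q < pi / 2" for q
    using that \<iota> card by unfold_locales auto
  have cos_eq: "staggered_rings.c q = cos q" if "0 < q" "q < pi / 2" for q
    using rings[OF that] by (simp add: three_rings_def staggered_rings.c_def[of \<iota> q 3])
  have cos1: "(cos q)\<^sup>2 \<noteq> 1" if "0 < q" "q < pi / 2" for q
    using sin_gt_zero[of q] that by (simp add: cos_squared_eq)
  note cont = continuous_frequencies[OF cos1]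
  define w where "w = beta3 (cos p)"
  note freq = hopf_frequencies[OF cp]
  have d0: "disc3 (cos p) = 0"
    using three_rings.disc3_sign(3)[OF rings[OF p]] p1 at_p unfolding cos_eq[OF p] by simp
  have nh: "(f \<longlongrightarrow> f p) (nhds p)" if "isCont f p" for f :: "real \<Rightarrow> real"
    using that by (simp add: isCont_def tendsto_at_iff_tendsto_nhds)
  have "((\<lambda>q. \<bar>beta3 (cos q) - w\<bar> + sqrt \<bar>disc3 (cos q)\<bar>) \<longlongrightarrow> \<bar>beta3 (cos p) - w\<bar> + sqrt \<bar>disc3 (cos p)\<bar>) (nhds p)"
    by (intro tendsto_intros nh[OF cont(1)[OF p]] nh[OF cont(2)[OF p]])
  then have e1: "\<forall>\<^sub>F q in nhds p. \<bar>beta3 (cos q) - w\<bar> + sqrt \<bar>disc3 (cos q)\<bar> < 0.1"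
    by (rule order_tendstoD(2)) (simp add: w_def d0)
  have "((\<lambda>q. \<bar>antisym3 (cos q)\<bar>) \<longlongrightarrow> \<bar>antisym3 (cos p)\<bar>) (nhds p)"
    by (intro tendsto_intros nh[OF cont(3)[OF p]])
  then have e2: "\<forall>\<^sub>F q in nhds p. \<bar>antisym3 (cos q)\<bar> < 1" by (rule order_tendstoD(2)) (rule freq)
  have e3: "\<forall>\<^sub>F q in nhds p. nu3 (cos q) > 2.35"
    by (rule order_tendstoD(1)[OF nh[OF cont(4)[OF p]]]) (rule freq)
  have "((\<lambda>q. 14 * (cos q)\<^sup>2 + 3 * ((cos q)\<^sup>2)\<^sup>2) \<longlongrightarrow> 14 * (cos p)\<^sup>2 + 3 * ((cos p)\<^sup>2)\<^sup>2) (nhds p)"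
    by (intro tendsto_intros filterlim_ident)
  then have e4: "\<forall>\<^sub>F q in nhds p. 14 * (cos q)\<^sup>2 + 3 * ((cos q)\<^sup>2)\<^sup>2 < 1" using p1 by (rule order_tendstoD(2))
  have e5: "\<forall>\<^sub>F q in nhds p. q \<in> {0<..<pi / 2}" using p by (intro eventually_nhds_in_open) auto
  from e1 e2 e3 e4 e5 have "\<forall>\<^sub>F q in nhds p. \<bar>beta3 (cos q) - w\<bar> + sqrt \<bar>disc3 (cos q)\<bar> < 0.1 \<and> \<bar>antisym3 (cos q)\<bar> < 1
    \<and> nu3 (cos q) > 2.35 \<and> 14 * (cos q)\<^sup>2 + 3 * ((cos q)\<^sup>2)\<^sup>2 < 1 \<and> 0 < q \<and> q < pi / 2"
    by eventually_elim auto
  then obtain \<delta> where \<delta>: "\<delta> > 0" and near: "\<And>q. dist q p < \<delta> \<Longrightarrow> \<bar>beta3 (cos q) - w\<bar> + sqrt \<bar>disc3 (cos q)\<bar> < 0.1 \<and> \<bar>antisym3 (cos q)\<bar> < 1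
    \<and> nu3 (cos q) > 2.35 \<and> 14 * (cos q)\<^sup>2 + 3 * ((cos q)\<^sup>2)\<^sup>2 < 1 \<and> 0 < q \<and> q < pi / 2"
    unfolding eventually_nhds_metric by blast
  have near: "\<bar>beta3 (cos q) - w\<bar> + sqrt \<bar>disc3 (cos q)\<bar> < 0.1" "\<bar>antisym3 (cos q)\<bar> < 1" "nu3 (cos q) > 2.35"
    "14 * (cos q)\<^sup>2 + 3 * ((cos q)\<^sup>2)\<^sup>2 \<le> 1" "0 < q" "q < pi / 2" if "q \<in> {p - \<delta><..<p + \<delta>}" for q
  proof -
    have "dist q p < \<delta>" using that by (auto simp: dist_real_def)
    note n = near[OF this]
    show "\<bar>beta3 (cos q) - w\<bar> + sqrt \<bar>disc3 (cos q)\<bar> < 0.1" "\<bar>antisym3 (cos q)\<bar> < 1" "nu3 (cos q) > 2.35" "0 < q" "q < pi / 2"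
      using n by blast+
    show "14 * (cos q)\<^sup>2 + 3 * ((cos q)\<^sup>2)\<^sup>2 \<le> 1" using n by linarith
  qed
  have w: "2 < w" "w < 2.2" using freq by (simp_all add: w_def)
  define \<xi> :: "real \<Rightarrow> real^3" where "\<xi> q = vector [0, 0, staggered_rings.\<xi>\<^sub>0 q 3]" for q
  have eig: "angular_velocity DNd_vorticity (DNd \<iota> q) (\<xi> q) \<and>
     slice_eigenvalues DNd_vorticity (DNd \<iota> q) (\<xi> q) \<inter> (ball (\<i> * of_real w) 0.1 \<union> ball (- \<i> * of_real w) 0.1)
     = {hopf_branch 1 (cos q), - hopf_branch 1 (cos q), hopf_branch (- 1) (cos q), - hopf_branch (- 1) (cos q)}"
    if q: "q \<in> {p - \<delta><..<p + \<delta>}" for q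
  proof -
    interpret three_rings \<iota> q 3 by (rule rings) (use near(5,6)[OF q] in auto)
    have "1.9\<^sup>2 < (w - 0.1)\<^sup>2" using w by (intro power_strict_mono) auto
    then have "\<bar>antisym3 (cos q)\<bar> < (w - 0.1)\<^sup>2" using near(2)[OF q] by (simp add: power2_eq_square)
    moreover have "cos q > 0" using near(5,6)[OF q] by (intro cos_gt_zero) auto
    ultimately show ?thesis
      using angular_velocity_rings eigenvalues_near_hopf[of "0.1" w] near(1,3,4)[OF q] w
      unfolding \<xi>_def cos_eq[OF near(5,6)[OF q]] by simp
  qed
  have pos: "cos q > 0" "beta3 (cos q) > 0" if q: "q \<in> {p - \<delta><..<p + \<delta>}" for q
  proof -
    show "cos q > 0" using near(5,6)[OF q] by (intro cos_gt_zero) auto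
    moreover have "0 < 1 + 3 * (cos q)\<^sup>2" by (simp add: add_pos_nonneg)
    ultimately show "beta3 (cos q) > 0" unfolding beta3_def by (intro divide_pos_pos zero_less_power) simp_all
  qed
  have ctb: "continuous_on {p - \<delta><..<p + \<delta>} (\<lambda>q. hopf_branch \<kappa> (cos q))" for \<kappa>
  proof -
    have "continuous_on {p - \<delta><..<p + \<delta>} (\<lambda>q. beta3 (cos q))" "continuous_on {p - \<delta><..<p + \<delta>} (\<lambda>q. disc3 (cos q))"
      using cont near(5,6) by (auto intro!: continuous_at_imp_continuous_on)
    then show ?thesis unfolding hopf_branch_def Complex_eq by (intro continuous_intros)
  qed
  \<comment> \<open>Larger cosines: \<open>R 1 > 0\<close>.\<close>
  have bef: "Re (hopf_branch \<kappa> (cos q)) = 0 \<and> hopf_branch 1 (cos q) \<noteq> hopf_branch (- 1) (cos q) \<and> hopf_branch 1 (cos q) \<noteq> - hopf_branch (- 1) (cos q)"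
    if q: "q \<in> {p - \<delta><..<p}" for \<kappa> q
  proof -
    have q': "q \<in> {p - \<delta><..<p + \<delta>}" using q \<delta> by auto
    have "disc3 (cos q) > 0"
      using three_rings.disc3_sign(1)[OF rings[OF near(5,6)[OF q']]] near(4)[OF q'] before[of q] near(5)[OF q'] q unfolding cos_eq[OF near(5,6)[OF q']] by simp
    then show ?thesis using pos(2)[OF q'] by (auto simp: hopf_branch_def max_def complex_eq_iff)
  qed
  \<comment> \<open>Smaller cosines: \<open>R 1 < 0\<close>.\<close>
  have aft: "(\<kappa> \<noteq> 0 \<longrightarrow> Re (hopf_branch \<kappa> (cos q)) \<noteq> 0) \<and> hopf_branch 1 (cos q) \<noteq> hopf_branch (- 1) (cos q) \<and> hopf_branch 1 (cos q) \<noteq> - hopf_branch (- 1) (cos q)"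
    if q: "q \<in> {p<..<p + \<delta>}" for \<kappa> q
  proof -
    have q': "q \<in> {p - \<delta><..<p + \<delta>}" using q \<delta> by auto
    have "disc3 (cos q) < 0"
      using three_rings.disc3_sign(2)[OF rings[OF near(5,6)[OF q']]] near(4)[OF q'] after[of q] near(6)[OF q'] q unfolding cos_eq[OF near(5,6)[OF q']] by simp
    then show ?thesis using pos(2)[OF q'] by (auto simp: hopf_branch_def max_def complex_eq_iff)
  qed
  have at_p: "hopf_branch \<kappa> (cos p) = \<i> * of_real w" for \<kappa>
    by (simp add: hopf_branch_def d0 w_def complex_eq_iff)
  show ?thesis
    unfolding hamiltonian_hopf_bifurcation_def
  proof (intro exI conjI ballI)
    show "w > 0" "(0.1::real) > 0" "\<delta> > 0" using w \<delta> by simp_all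
    show "continuous_on {p - \<delta><..<p + \<delta>} (\<lambda>q. hopf_branch 1 (cos q))" "continuous_on {p - \<delta><..<p + \<delta>} (\<lambda>q. hopf_branch (- 1) (cos q))"
      by (rule ctb)+
  qed (use eig bef aft at_p in \<open>auto\<close>)
qed

section \<open>The stability theorem\<close>

theorem theorem4p6:
  fixes \<iota> :: "'n::finite \<Rightarrow> nat"
  assumes N: "CARD('n) \<ge> 2"
    and \<iota>: "bij_betw \<iota> UNIV {1..CARD('n)}"
  shows "(\<forall>\<theta>\<in>{0<..pi/2}. relative_equilibrium DNd_vorticity (DNd \<iota> \<theta>)) \<and>
    fixed_equilibrium DNd_vorticity (DNd \<iota> (pi/2)) \<and>
    (CARD('n) = 2 \<longrightarrow>
      (\<exists>\<theta>\<^sub>1. \<bar>\<theta>\<^sub>1 - 1.14\<bar> \<le> 0.005 \<and>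
        (\<forall>\<theta>\<in>{\<theta>\<^sub>1<..pi/2}. lyapunov_stable DNd_vorticity (DNd \<iota> \<theta>)) \<and>
        (\<forall>\<theta>\<in>{0<..<\<theta>\<^sub>1}. linearly_unstable DNd_vorticity (DNd \<iota> \<theta>)))) \<and>
    (CARD('n) = 3 \<longrightarrow>
      (\<exists>\<theta>\<^sub>1 \<theta>\<^sub>2. \<bar>\<theta>\<^sub>1 - 1.302\<bar> \<le> 0.0005 \<and> \<bar>\<theta>\<^sub>2 - 1.315\<bar> \<le> 0.0005 \<and>
        (\<forall>\<theta>\<in>{\<theta>\<^sub>1..\<theta>\<^sub>2}. linearly_stable DNd_vorticity (DNd \<iota> \<theta>)) \<and>
        (\<forall>\<theta>\<in>{0<..pi/2} - {\<theta>\<^sub>1..\<theta>\<^sub>2}. linearly_unstable DNd_vorticity (DNd \<iota> \<theta>)) \<and>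
        hamiltonian_hopf_bifurcation DNd_vorticity (DNd \<iota>) \<theta>\<^sub>2)) \<and>
    (CARD('n) \<ge> 4 \<longrightarrow>
      (\<forall>\<theta>\<in>{0<..pi/2}. linearly_unstable DNd_vorticity (DNd \<iota> \<theta>))) \<and>
    (CARD('n) \<ge> 3 \<longrightarrow> linearly_unstable DNd_vorticity (DNd \<iota> (pi/2))) \<and>
    (CARD('n) = 2 \<longrightarrow> lyapunov_stable DNd_vorticity (DNd \<iota> (pi/2)))"
proof -
  have rings: "staggered_rings \<iota> \<theta> (CARD('n))" if "\<theta> \<in> {0<..pi/2}" for \<theta>
    using that N \<iota> by unfold_locales auto
  have rings3: "three_rings \<iota> \<theta> (CARD('n))" if "\<theta> \<in> {0<..pi/2}" "CARD('n) = 3" for \<theta>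
    using rings[OF that(1)] that(2) by (simp add: three_rings_def three_rings_axioms_def)
  have cos_eq: "staggered_rings.c \<theta> = cos \<theta>" if "\<theta> \<in> {0<..pi/2}" for \<theta>
    by (rule staggered_rings.c_def[OF rings[OF that]])
  have equator: "pi / 2 \<in> {0<..pi / 2}" by simp
  have pi_bound: "1.57 < pi / 2" using pi_approx by simp
  have two: "\<exists>\<theta>\<^sub>1. \<bar>\<theta>\<^sub>1 - 1.14\<bar> \<le> 0.005 \<and>
        (\<forall>\<theta>\<in>{\<theta>\<^sub>1<..pi/2}. lyapunov_stable DNd_vorticity (DNd \<iota> \<theta>)) \<and>
        (\<forall>\<theta>\<in>{0<..<\<theta>\<^sub>1}. linearly_unstable DNd_vorticity (DNd \<iota> \<theta>))" if card: "CARD('n) = 2"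
  proof -
    \<comment> \<open>The condition \<open>p (c\<^sup>2) < 1\<close> is \<open>\<epsilon> > 0\<close> and also the hypothesis of \<open>lyapunov_stable_2\<close>.\<close>
    define p :: "real \<Rightarrow> real" where "p d = 6 * d - d\<^sup>2" for d
    have m: "p u < p v" if "0 \<le> u" "u < v" "v \<le> 1" for u v
    proof -
      have "0 < (v - u) * (6 - u - v)" using that by (intro mult_pos_pos) auto
      then show ?thesis by (simp add: p_def power2_eq_square algebra_simps)
    qed
    have a: "p ((cos 1.145)\<^sup>2) \<le> 1"
    proof -
      have "0 \<le> cos (1.145::real)" using pi_bound by (intro cos_ge_zero) auto
      then have "(cos 1.145)\<^sup>2 < (0.4132::real)\<^sup>2" using cos_values(2) by (intro power_strict_mono) auto
      from m[OF _ this] show ?thesis by (simp add: p_def power2_eq_square)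
    qed
    have b: "1 \<le> p ((cos 1.135)\<^sup>2)"
    proof -
      have "(0.422::real)\<^sup>2 < (cos 1.135)\<^sup>2" using cos_values(1) by (intro power_strict_mono) auto
      from m[OF _ this] have "p (0.422\<^sup>2) < p ((cos 1.135)\<^sup>2)" by (simp add: abs_square_le_1)
      moreover have "1 \<le> p (0.422\<^sup>2)" by (simp add: p_def power2_eq_square)
      ultimately show ?thesis by linarith
    qed
    have ct: "continuous_on UNIV p" unfolding p_def by (intro continuous_intros)
    obtain t where t: "1.135 \<le> t" "t \<le> 1.145"
      "\<And>\<theta>. 0 < \<theta> \<Longrightarrow> \<theta> < t \<Longrightarrow> 1 < p ((cos \<theta>)\<^sup>2)" "\<And>\<theta>. t < \<theta> \<Longrightarrow> \<theta> \<le> pi / 2 \<Longrightarrow> p ((cos \<theta>)\<^sup>2) < 1"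
      by (rule cos_threshold[of p "1.135" "1.145" 1, OF m ct _ _ _ a b]) (use pi_bound in auto)
    show ?thesis
    proof (intro exI[of _ t] conjI ballI)
      show "\<bar>t - 1.14\<bar> \<le> 0.005" using t(1,2) by (simp add: abs_if)
      show "lyapunov_stable DNd_vorticity (DNd \<iota> \<theta>)" if "\<theta> \<in> {t<..pi/2}" for \<theta>
        using staggered_rings.lyapunov_stable_2_if[OF rings card] t(1) t(4)[of \<theta>] that by (auto simp: p_def)
      show "linearly_unstable DNd_vorticity (DNd \<iota> \<theta>)" if "\<theta> \<in> {0<..<t}" for \<theta>
        using staggered_rings.linearly_unstable_2_if[OF rings card] t(2) t(3)[of \<theta>] that pi_bound by (auto simp: p_def)
    qed
  qed
  have three: "\<exists>\<theta>\<^sub>1 \<theta>\<^sub>2. \<bar>\<theta>\<^sub>1 - 1.302\<bar> \<le> 0.0005 \<and> \<bar>\<theta>\<^sub>2 - 1.315\<bar> \<le> 0.0005 \<and>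
        (\<forall>\<theta>\<in>{\<theta>\<^sub>1..\<theta>\<^sub>2}. linearly_stable DNd_vorticity (DNd \<iota> \<theta>)) \<and>
        (\<forall>\<theta>\<in>{0<..pi/2} - {\<theta>\<^sub>1..\<theta>\<^sub>2}. linearly_unstable DNd_vorticity (DNd \<iota> \<theta>)) \<and>
        hamiltonian_hopf_bifurcation DNd_vorticity (DNd \<iota>) \<theta>\<^sub>2" if card: "CARD('n) = 3"
  proof -
    \<comment> \<open>In terms of \<open>c\<^sup>2\<close>, \<open>p1 \<le> 1\<close> is \<open>\<epsilon> \<ge> 0\<close> and \<open>p2 \<ge> 1\<close> is \<open>R 1 \<ge> 0\<close>.\<close>
    define p1 p2 :: "real \<Rightarrow> real" where "p1 d = 14 * d + 3 * d\<^sup>2" and "p2 d = 9 * d^3 + 9 * d\<^sup>2 + 15 * d" for d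
    have m: "p1 u < p1 v" "p2 u < p2 v" if "0 \<le> u" "u < v" "v \<le> 1" for u v
    proof -
      have "u\<^sup>2 \<le> v\<^sup>2" "u^3 \<le> v^3" using that by (auto intro!: power_mono)
      then show "p1 u < p1 v" "p2 u < p2 v" using that(2) unfolding p1_def p2_def by linarith+
    qed
    have cp: "0 \<le> cos x" if "0 \<le> x" "x < 1.57" for x :: real using pi_bound that by (intro cos_ge_zero) auto
    have sq: "(cos x)\<^sup>2 < v\<^sup>2" if "0 \<le> x" "x < 1.57" "cos x < v" for x v :: real
      using cp[OF that(1,2)] that(3) by (intro power_strict_mono) auto
    have sq': "v\<^sup>2 < (cos x)\<^sup>2" if "0 \<le> v" "v < cos x" for x v :: real
      using that by (intro power_strict_mono) auto
    have le1: "(cos x)\<^sup>2 \<le> 1" for x :: real by (simp add: abs_square_le_1)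
    have a1: "p1 ((cos 1.3025)\<^sup>2) \<le> 1"
      using m(1)[OF _ sq[OF _ _ cos_values(4)]] by (simp add: p1_def power2_eq_square)
    have b1: "1 \<le> p1 ((cos 1.3015)\<^sup>2)"
      using m(1)[OF _ sq'[OF _ cos_values(3)] le1] by (simp add: p1_def power2_eq_square)
    have a2: "p2 ((cos 1.3155)\<^sup>2) \<le> 1"
      using m(2)[OF _ sq[OF _ _ cos_values(6)]] by (simp add: p2_def power2_eq_square power3_eq_cube)
    have b2: "1 \<le> p2 ((cos 1.3145)\<^sup>2)"
      using m(2)[OF _ sq'[OF _ cos_values(5)] le1] by (simp add: p2_def power2_eq_square power3_eq_cube)
    have ct: "continuous_on UNIV p1" "continuous_on UNIV p2" unfolding p1_def p2_def by (intro continuous_intros)+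
    obtain t1 where t1: "1.3015 \<le> t1" "t1 \<le> 1.3025" "p1 ((cos t1)\<^sup>2) = 1"
      "\<And>\<theta>. 0 < \<theta> \<Longrightarrow> \<theta> < t1 \<Longrightarrow> 1 < p1 ((cos \<theta>)\<^sup>2)" "\<And>\<theta>. t1 < \<theta> \<Longrightarrow> \<theta> \<le> pi / 2 \<Longrightarrow> p1 ((cos \<theta>)\<^sup>2) < 1"
      by (rule cos_threshold[of p1 "1.3015" "1.3025" 1, OF m(1) ct(1) _ _ _ a1 b1]) (use pi_bound in auto)
    obtain t2 where t2: "1.3145 \<le> t2" "t2 \<le> 1.3155" "p2 ((cos t2)\<^sup>2) = 1"
      "\<And>\<theta>. 0 < \<theta> \<Longrightarrow> \<theta> < t2 \<Longrightarrow> 1 < p2 ((cos \<theta>)\<^sup>2)" "\<And>\<theta>. t2 < \<theta> \<Longrightarrow> \<theta> \<le> pi / 2 \<Longrightarrow> p2 ((cos \<theta>)\<^sup>2) < 1"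
      by (rule cos_threshold[of p2 "1.3145" "1.3155" 1, OF m(2) ct(2) _ _ _ a2 b2]) (use pi_bound in auto)
    have cos_t2: "0.2528 \<le> cos t2" "cos t2 \<le> 0.2533"
    proof -
      have nn: "0 \<le> cos t2" using t2(1,2) by (intro cp) auto
      show "0.2528 \<le> cos t2"
      proof (rule ccontr)
        assume "\<not> ?thesis"
        then have "(cos t2)\<^sup>2 < 0.2528\<^sup>2" using nn by (intro power_strict_mono) auto
        from m(2)[OF _ this] t2(3) show False by (simp add: p2_def power2_eq_square power3_eq_cube)
      qed
      show "cos t2 \<le> 0.2533"
      proof (rule ccontr)
        assume "\<not> ?thesis"
        then have "0.2533\<^sup>2 < (cos t2)\<^sup>2" by (intro power_strict_mono) auto
        from m(2)[OF _ this le1] t2(3) show False by (simp add: p2_def power2_eq_square power3_eq_cube)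
      qed
    qed
    show ?thesis
    proof (rule exI[of _ t1], rule exI[of _ t2], intro conjI ballI)
      show "\<bar>t1 - 1.302\<bar> \<le> 0.0005" "\<bar>t2 - 1.315\<bar> \<le> 0.0005" using t1(1,2) t2(1,2) by (simp_all add: abs_if)
      show "linearly_stable DNd_vorticity (DNd \<iota> \<theta>)" if \<theta>: "\<theta> \<in> {t1..t2}" for \<theta>
      proof -
        have range: "\<theta> \<in> {0<..pi/2}" "\<theta> < pi / 2" using \<theta> t1(1) t2(2) pi_bound by auto
        have "p1 ((cos \<theta>)\<^sup>2) \<le> 1" using t1(3) t1(5)[of \<theta>] \<theta> range by (cases "\<theta> = t1") auto
        moreover have "1 \<le> p2 ((cos \<theta>)\<^sup>2)" using t2(3) t2(4)[of \<theta>] \<theta> range by (cases "\<theta> = t2") auto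
        moreover have "cos \<theta> > 0" using range by (intro cos_gt_zero) auto
        ultimately show ?thesis
          using three_rings.linearly_stable_3_middle[OF rings3[OF range(1) card]] unfolding cos_eq[OF range(1)] p1_def p2_def by blast
      qed
      show "linearly_unstable DNd_vorticity (DNd \<iota> \<theta>)" if \<theta>: "\<theta> \<in> {0<..pi/2} - {t1..t2}" for \<theta>
      proof -
        have range: "\<theta> \<in> {0<..pi/2}" "0 < \<theta>" using \<theta> by auto
        show ?thesis
        proof (cases "\<theta> < t1")
          case True
          then have "1 < p1 ((cos \<theta>)\<^sup>2)" using t1(4)[of \<theta>] range by simp
          then show ?thesis
            using three_rings.linearly_unstable_3_low[OF rings3[OF range(1) card]] unfolding cos_eq[OF range(1)] p1_def by blast
        next
          case False
          then have "t1 < \<theta>" "t2 < \<theta>" using \<theta> t1(2) t2(1) by auto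
          then have "p1 ((cos \<theta>)\<^sup>2) \<le> 1" "p2 ((cos \<theta>)\<^sup>2) < 1" using t1(5)[of \<theta>] t2(5)[of \<theta>] range by auto
          then show ?thesis
            using three_rings.linearly_unstable_3_high[OF rings3[OF range(1) card]] unfolding cos_eq[OF range(1)] p1_def p2_def by blast
        qed
      qed
      have "t1 < t2" "0 < t2" "t2 < pi / 2" using t1(2) t2(1,2) pi_bound by auto
      then show "hamiltonian_hopf_bifurcation DNd_vorticity (DNd \<iota>) t2"
        using t1(5)[of t2] t2(3,4,5) unfolding p1_def p2_def by (intro hamiltonian_hopf_3[OF \<iota> card _ _ cos_t2]) auto
    qed
  qed
  have relative: "relative_equilibrium DNd_vorticity (DNd \<iota> \<theta>)" if "\<theta> \<in> {0<..pi/2}" for \<theta>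
    by (rule staggered_rings.relative_equilibrium_rings[OF rings[OF that]])
  have fixed: "fixed_equilibrium DNd_vorticity (DNd \<iota> (pi/2))"
    by (rule staggered_rings.fixed_equilibrium_rings[OF rings[OF equator]]) (simp add: cos_eq[OF equator])
  have four: "linearly_unstable DNd_vorticity (DNd \<iota> \<theta>)" if "CARD('n) \<ge> 4" "\<theta> \<in> {0<..pi/2}" for \<theta>
    by (rule staggered_rings.linearly_unstable_ge_4[OF rings[OF that(2)] that(1)])
  have equator_unstable: "linearly_unstable DNd_vorticity (DNd \<iota> (pi/2))" if "CARD('n) \<ge> 3"
  proof (cases "CARD('n) = 3")
    case True
    show ?thesis
      by (rule three_rings.linearly_unstable_3_high[OF rings3[OF equator True]]) (simp_all add: cos_eq[OF equator])
  next
    case False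
    then show ?thesis using that four equator by auto
  qed
  have equator_stable: "lyapunov_stable DNd_vorticity (DNd \<iota> (pi/2))" if "CARD('n) = 2"
    by (rule staggered_rings.lyapunov_stable_2_if[OF rings[OF equator] that]) simp
  show ?thesis
    using relative fixed two three four equator_unstable equator_stable by blast
qed

end
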